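(* Let $I=(-1,1)$ and let $b,f$ be analytic on $[-1,1]$ with $b(x)\ge \underline b>0$ on $[-1,1]$ for some constant $\underline b$, and assume that there are positive constants $C_f,K_f,C_b,K_b$ such that for all $n\in\mathbb N_0$: $\|f^{(n)}\|_{L^\infty(I)}\le C_fK_f^n n!$ and $\|b^{(n)}\|_{L^\infty(I)}\le C_bK_b^n n!$. For $\varepsilon\in(0,1]$ let $u_\varepsilon\in H^1_0(I)$ be the solution of $$\int_{-1}^1\{\varepsilon^2u_\varepsilon'v'+b\,u_\varepsilon v\}\,dx=\int_{-1}^1 fv\,dx\qquad\text{for all }v\in H^1_0(I).$$ Then there exists $\tilde\kappa_0>0$ (depending only on $b$ and $f$) such that for every $\kappa\in(0,\tilde\kappa_0)$ there exist positive constants $C,\beta$ independent of $\varepsilon$ and $p$, such that for every $p\in\mathbb N$ and every $\varepsilon\in(0,1]$ there exists a ReLU NN $\Phi^{FEM,\kappa,p}_\varepsilon$ with $$\varepsilon^{1/2}\|u_\varepsilon'-\mathrm R(\Phi^{FEM,\kappa,p}_\varepsilon)'\|_{L^2(I)}+\|u_\varepsilon-\mathrm R(\Phi^{FEM,\kappa,p}_\varepsilon)\|_{L^2(I)}\le Ce^{-\beta p},$$ $$\|u_\varepsilon-\mathrm R(\Phi^{FEM,\kappa,p}_\varepsilon)\|_{L^\infty(I)}\le Ce^{-\beta p},$$ and $\mathrm R(\Phi^{FEM,\kappa,p}_\varepsilon)(\pm1)=0$. For a constant $\tilde C=\tilde C(\beta)>0$ depending only on $\beta$, the network depth and size satisfy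 $$L(\Phi^{FEM,\kappa,p}_\varepsilon)\le\tilde Cp(1+\log_2(p)),\qquad M(\Phi^{FEM,\kappa,p}_\varepsilon)\le\tilde Cp^2.$$ The weights and biases in the hidden layers are independent of $u_\varepsilon$ and depend only on $\kappa,p,\varepsilon$ and $\beta$.
   Context: Neural networks (NNs): for $d,L\in\mathbb N$, a NN with input dimension $d$ and $L$ layers is a finite sequence $\Phi=((A_1,b_1),\dots,(A_L,b_L))$ with $N_0=d$, $N_1,\dots,N_L\in\mathbb N$, $A_\ell\in\mathbb R^{N_\ell\times N_{\ell-1}}$, $b_\ell\in\mathbb R^{N_\ell}$. For an activation $\varrho:\mathbb R\to\mathbb R$ (applied componentwise) its realization is $\mathrm R(\Phi):\mathbb R^d\to\mathbb R^{N_L}$, $x\mapsto x_L$, where $x_0=x$, $x_\ell=\varrho(A_\ell x_{\ell-1}+b_\ell)$ for $\ell=1,\dots,L-1$, and $x_L=A_Lx_{L-1}+b_L$. Layers $1,\dots,L-1$ are the hidden layers, layer $L$ is the output layer. The depth is $L(\Phi)=L$ and the size is $M(\Phi)=\sum_{\ell=1}^L(\|A_\ell\|_0+\|b_\ell\|_0)$, where $\|\cdot\|_0$ counts nonzero entries. A ReLU NN uses only the activation $\rho(x)=\max\{0,x\}$. *)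

theory Defs
  imports
    "HOL-Probability.Essential_Supremum"
    "Jordan_Normal_Form.Matrix"
begin

section \<open>Neural networks\<close>

text \<open>A network is the list of its layers \<open>(A, b)\<close>; the last entry is the output layer, so that
  \<^term>\<open>butlast \<Phi>\<close> are the hidden layers.\<close>

type_synonym network = "(real mat \<times> real Matrix.vec) list"

fun layers_fit :: "nat \<Rightarrow> network \<Rightarrow> bool" where
  "layers_fit d [] \<longleftrightarrow> True"
| "layers_fit d ((A, b) # \<Phi>) \<longleftrightarrow>
     0 < dim_row A \<and> dim_col A = d \<and> dim_vec b = dim_row A \<and> layers_fit (dim_row A) \<Phi>"

definition neural_network :: "nat \<Rightarrow> nat \<Rightarrow> network \<Rightarrow> bool" where
  "neural_network d m \<Phi> \<longleftrightarrow>
     0 < d \<and> \<Phi> \<noteq> [] \<and> layers_fit d \<Phi> \<and> dim_row (fst (last \<Phi>)) = m"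

fun realization :: "(real \<Rightarrow> real) \<Rightarrow> network \<Rightarrow> real Matrix.vec \<Rightarrow> real Matrix.vec" where
  "realization \<rho> [] x = x"
| "realization \<rho> [(A, b)] x = A *\<^sub>v x + b"
| "realization \<rho> ((A, b) # l # \<Phi>) x = realization \<rho> (l # \<Phi>) (map_vec \<rho> (A *\<^sub>v x + b))"

definition relu :: "real \<Rightarrow> real" where
  "relu x = max 0 x"

text \<open>The realization of a ReLU network with input and output dimension 1, as a function on the
  reals.\<close>

definition relu_fun :: "network \<Rightarrow> real \<Rightarrow> real" where
  "relu_fun \<Phi> x = vec_index (realization relu \<Phi> (Matrix.vec 1 (\<lambda>_. x))) 0"

definition depth :: "network \<Rightarrow> nat" where
  "depth \<Phi> = length \<Phi>"

definition nnz_mat :: "real mat \<Rightarrow> nat" where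
  "nnz_mat A = card {(i, j). i < dim_row A \<and> j < dim_col A \<and> A $$ (i, j) \<noteq> 0}"

definition nnz_vec :: "real Matrix.vec \<Rightarrow> nat" where
  "nnz_vec b = card {i. i < dim_vec b \<and> vec_index b i \<noteq> 0}"

definition network_size :: "network \<Rightarrow> nat" where
  "network_size \<Phi> = (\<Sum>(A, b)\<leftarrow>\<Phi>. nnz_mat A + nnz_vec b)"


section \<open>Real analytic functions\<close>

text \<open>The expansion is only required to represent \<open>f\<close> at points of \<open>S\<close>. On a nondegenerate
  compact interval this says that the restriction of \<open>f\<close> extends to an analytic function on a
  neighbourhood of the interval; the values of \<open>f\<close> outside \<open>S\<close> are irrelevant.\<close>

definition real_analytic_on :: "(real \<Rightarrow> real) \<Rightarrow> real set \<Rightarrow> bool" where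
  "real_analytic_on f S \<longleftrightarrow>
     (\<forall>x\<in>S. \<exists>r>0. \<exists>a. \<forall>y\<in>S. \<bar>y - x\<bar> < r \<longrightarrow> (\<lambda>n. a n * (y - x) ^ n) sums f y)"


section \<open>Lebesgue and Sobolev spaces on an open set\<close>

definition L2_space :: "real set \<Rightarrow> (real \<Rightarrow> real) set" where
  "L2_space I = {g. g \<in> borel_measurable (lebesgue_on I) \<and> integrable (lebesgue_on I) (\<lambda>x. (g x)\<^sup>2)}"

text \<open>Only meaningful for functions in \<^term>\<open>L2_space I\<close>.\<close>

definition L2_norm :: "real set \<Rightarrow> (real \<Rightarrow> real) \<Rightarrow> real" where
  "L2_norm I g = sqrt (LINT x|lebesgue_on I. (g x)\<^sup>2)"

definition Linf_norm :: "real set \<Rightarrow> (real \<Rightarrow> real) \<Rightarrow> ereal" where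
  "Linf_norm I g = esssup (lebesgue_on I) (\<lambda>x. ereal \<bar>g x\<bar>)"

definition test_functions :: "real set \<Rightarrow> (real \<Rightarrow> real) set" where
  "test_functions I =
     {\<phi>. (\<forall>n. (deriv ^^ n) \<phi> differentiable_on UNIV) \<and>
         compact (closure {x. \<phi> x \<noteq> 0}) \<and> closure {x. \<phi> x \<noteq> 0} \<subseteq> I}"

definition locally_integrable_on :: "(real \<Rightarrow> real) \<Rightarrow> real set \<Rightarrow> bool" where
  "locally_integrable_on g I \<longleftrightarrow> (\<forall>K. compact K \<and> K \<subseteq> I \<longrightarrow> integrable (lebesgue_on K) g)"

definition has_weak_deriv :: "real set \<Rightarrow> (real \<Rightarrow> real) \<Rightarrow> (real \<Rightarrow> real) \<Rightarrow> bool" where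
  "has_weak_deriv I u g \<longleftrightarrow>
     locally_integrable_on u I \<and> locally_integrable_on g I \<and>
     (\<forall>\<phi>\<in>test_functions I.
        (LINT x|lebesgue_on I. u x * deriv \<phi> x) = - (LINT x|lebesgue_on I. g x * \<phi> x))"

text \<open>A representative of the weak derivative, which is unique up to null sets if it exists.\<close>

definition weak_deriv :: "real set \<Rightarrow> (real \<Rightarrow> real) \<Rightarrow> real \<Rightarrow> real" where
  "weak_deriv I u = (SOME g. has_weak_deriv I u g)"

definition H1_space :: "real set \<Rightarrow> (real \<Rightarrow> real) set" where
  "H1_space I = {u \<in> L2_space I. \<exists>g\<in>L2_space I. has_weak_deriv I u g}"

definition H1_norm :: "real set \<Rightarrow> (real \<Rightarrow> real) \<Rightarrow> real" where
  "H1_norm I u = sqrt ((L2_norm I u)\<^sup>2 + (L2_norm I (weak_deriv I u))\<^sup>2)"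

text \<open>The closure of the test functions in \<open>H\<^sup>1\<close>.\<close>

definition H10_space :: "real set \<Rightarrow> (real \<Rightarrow> real) set" where
  "H10_space I =
     {u \<in> H1_space I. \<forall>\<delta>>0. \<exists>\<phi>\<in>test_functions I. H1_norm I (\<lambda>x. u x - \<phi> x) < \<delta>}"


section \<open>The reaction-diffusion problem\<close>

definition weak_solution ::
  "real \<Rightarrow> (real \<Rightarrow> real) \<Rightarrow> (real \<Rightarrow> real) \<Rightarrow> (real \<Rightarrow> real) \<Rightarrow> bool" where
  "weak_solution \<epsilon> b f u \<longleftrightarrow>
     (let I = {-1<..<1} in
      u \<in> H10_space I \<and>
      (\<forall>v\<in>H10_space I.
         (LINT x|lebesgue_on I. \<epsilon>\<^sup>2 * weak_deriv I u x * weak_deriv I v x + b x * u x * v x) =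
         (LINT x|lebesgue_on I. f x * v x)))"

end

theory Submission
  imports Defs "HOL-Computational_Algebra.Polynomial"
begin

text \<open>A weak solution has a classical representative \<open>u\<close>, because \<open>\<epsilon>\<^sup>2 u'\<close> is a primitive of \<open>b u - f\<close> almost
  everywhere. The maximum principle and the differential equation give
  \<open>\<bar>u\<^sup>(\<^sup>n\<^sup>)\<bar> \<le> A K\<^sup>n (n + 1 / \<epsilon>)\<^sup>n\<close>, so on elements of radius \<open>r \<le> min (1 / q) (p \<epsilon>)\<close> with \<open>q\<close> large the Taylor
  polynomial of degree \<open>N\<close> at the midpoint has an error of order \<open>exp (q p - N)\<close>, and \<open>N \<ge> 2 q p\<close> suffices.
  If \<open>q p \<epsilon> \<le> 1\<close>, the elements between the two layers of width \<open>p \<epsilon>\<close> may be larger than \<open>p \<epsilon>\<close>. There \<open>u\<close> is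
  replaced by the outer expansion \<open>\<Sum>j<p. \<epsilon>\<^sup>2\<^sup>j w\<^sub>j\<close> with \<open>w\<^sub>0 = f / b\<close> and \<open>w\<^sub>j\<^sub>+\<^sub>1 = w\<^sub>j'' / b\<close>, which is analytic
  uniformly in \<open>\<epsilon>\<close>. A barrier argument and integration by parts show that the remainder is exponentially
  small in \<open>p\<close> outside the layers, in the maximum norm and in energy.

  The hidden layers of the network compute approximate monomials of the local coordinates of all elements.
  The sawtooth construction approximates the square with accuracy \<open>2\<^sup>-\<^sup>m\<close> in \<open>m\<close> layers, and \<open>l\<close> rounds of
  polarised squaring reach degree \<open>2\<^sup>l\<close>. Only the Taylor coefficients in the output layer depend on \<open>u\<close>. The mesh
  needs no further parameter, so that \<open>\<kappa>\<close> plays no role, and the choice \<open>\<beta> = 1 / q\<close> lets the hidden layers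
  recover \<open>q\<close> from \<open>\<beta>\<close>.\<close>

section \<open>Iterated derivatives\<close>

text \<open>The obstacle is uniformity in \<epsilon>. The derivative bound resolves u by Taylor
  polynomials of degree O(p) only on elements of length O(p \<epsilon>), whereas a size of order p^2
  leaves room for a fixed number of elements: each carries about p monomials, and these are squared
  through about p sawtooth steps. On longer elements u must be replaced by something smoother, and
  the remainder need only be small there, not resolved.

  All local errors are differences within an element. Every local coordinate is constant outside its
  element, so the summands of the other elements drop out of such differences, and the network may
  be a plain sum over elements. Additive errors then accumulate along the fixed number of elements,
  and a multiple of one approximate linear monomial plus a constant restores both boundary values
  within the output layer.

  An error of slope \<theta> / r contributes \<theta>^2 / r to the squared norm of the derivative.
  All radii are at least \<epsilon> / (2 q), so the factor \<epsilon> of the energy norm compensates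
  for this.\<close>

definition ndiff :: "real set \<Rightarrow> nat \<Rightarrow> (real \<Rightarrow> real) \<Rightarrow> bool" where
  "ndiff S n f \<longleftrightarrow> (\<forall>m<n. \<forall>x\<in>S. (deriv ^^ m) f differentiable (at x))"

lemma ndiff_0 [simp]: "ndiff S 0 f"
  by (simp add: ndiff_def)

lemma ndiff_Suc: "ndiff S (Suc n) f \<longleftrightarrow> (\<forall>x\<in>S. f differentiable (at x)) \<and> ndiff S n (deriv f)"
proof -
  have "(\<forall>m<Suc n. P m) \<longleftrightarrow> P 0 \<and> (\<forall>m<n. P (Suc m))" for P :: "nat \<Rightarrow> bool"
    by (metis less_Suc_eq_0_disj)
  then show ?thesis
    unfolding ndiff_def by (simp add: funpow_Suc_right del: funpow.simps)
qed

lemma ndiff_mono: "ndiff S n f \<Longrightarrow> m \<le> n \<Longrightarrow> ndiff S m f"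
  by (auto simp: ndiff_def)

lemma deriv_cong_open:
  fixes f g :: "real \<Rightarrow> real"
  assumes "open S" "\<And>x. x \<in> S \<Longrightarrow> f x = g x" "x \<in> S"
  shows "deriv f x = deriv g x" "f differentiable (at x) \<longleftrightarrow> g differentiable (at x)"
proof -
  have e: "eventually (\<lambda>y. f y = g y) (nhds x)"
    using assms by (auto simp: eventually_nhds)
  show "deriv f x = deriv g x"
    using e by (intro deriv_cong_ev) auto
  show "f differentiable (at x) \<longleftrightarrow> g differentiable (at x)"
    by (simp add: real_differentiable_def DERIV_cong_ev[OF refl e refl])
qed

lemma deriv_n_cong:
  fixes f g :: "real \<Rightarrow> real"
  assumes "open S" "\<And>x. x \<in> S \<Longrightarrow> f x = g x"
  shows "x \<in> S \<Longrightarrow> (deriv ^^ n) f x = (deriv ^^ n) g x"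
proof (induction n arbitrary: x)
  case (Suc n)
  show ?case
    using deriv_cong_open(1)[OF assms(1) Suc.IH Suc.prems] by simp
qed (simp add: assms)

lemma ndiff_cong:
  assumes "open S" "\<And>x. x \<in> S \<Longrightarrow> f x = g x"
  shows "ndiff S n f \<longleftrightarrow> ndiff S n g"
proof -
  have "(deriv ^^ m) f differentiable (at x) \<longleftrightarrow> (deriv ^^ m) g differentiable (at x)" if "x \<in> S" for x m
    by (rule deriv_cong_open(2)[OF assms(1) _ that]) (rule deriv_n_cong[OF assms])
  then show ?thesis by (auto simp: ndiff_def)
qed

text \<open>The working rule for the closure properties below: an induction on n needs the
  derivative in closed form on an open set only, because iterated derivatives are local.\<close>

lemma ndiff_SucI:
  assumes "open S" "\<And>x. x \<in> S \<Longrightarrow> (f has_real_derivative f' x) (at x)" "ndiff S n f'"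
  shows "ndiff S (Suc n) f"
proof -
  have "ndiff S n (deriv f) \<longleftrightarrow> ndiff S n f'"
    using assms(2) by (intro ndiff_cong[OF assms(1)]) (auto intro: DERIV_imp_deriv)
  then show ?thesis
    using assms by (auto simp: ndiff_Suc real_differentiable_def)
qed

lemma ndiff_deriv: "ndiff S (Suc n) f \<Longrightarrow> ndiff S n (deriv f)"
  by (simp add: ndiff_Suc)

lemma ndiff_DERIV:
  assumes "ndiff S n f" "m < n" "x \<in> S"
  shows "((deriv ^^ m) f has_real_derivative (deriv ^^ Suc m) f x) (at x)"
  using assms by (simp add: ndiff_def DERIV_deriv_iff_real_differentiable)

lemma ndiff_DERIV0:
  assumes "ndiff S (Suc n) f" "x \<in> S"
  shows "(f has_real_derivative deriv f x) (at x)"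
  using ndiff_DERIV[OF assms(1), of 0 x] assms(2) by simp

lemma ndiff_const [simp]: "open S \<Longrightarrow> ndiff S n (\<lambda>_. c)"
proof (induction n arbitrary: c)
  case (Suc n)
  show ?case by (rule ndiff_SucI[where f' = "\<lambda>_. 0"]) (use Suc in auto)
qed simp

lemma ndiff_add:
  assumes S: "open S"
  shows "ndiff S n f \<Longrightarrow> ndiff S n g \<Longrightarrow> ndiff S n (\<lambda>x. f x + g x)"
proof (induction n arbitrary: f g)
  case (Suc n)
  show ?case
    by (rule ndiff_SucI[OF S, where f' = "\<lambda>x. deriv f x + deriv g x"])
      (auto intro!: Suc.IH ndiff_deriv Suc.prems derivative_eq_intros ndiff_DERIV0)
qed simp

lemma ndiff_mult:
  assumes S: "open S"
  shows "ndiff S n f \<Longrightarrow> ndiff S n g \<Longrightarrow> ndiff S n (\<lambda>x. f x * g x)"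
proof (induction n arbitrary: f g)
  case (Suc n)
  have "ndiff S n (\<lambda>x. deriv f x * g x)" "ndiff S n (\<lambda>x. f x * deriv g x)"
    using Suc by (auto intro!: Suc.IH ndiff_deriv intro: ndiff_mono[of _ "Suc n"])
  then show ?case
    by (intro ndiff_SucI[OF S, where f' = "\<lambda>x. deriv f x * g x + f x * deriv g x"])
      (auto intro!: ndiff_add[OF S] derivative_eq_intros ndiff_DERIV0[OF Suc.prems(1)] ndiff_DERIV0[OF Suc.prems(2)])
qed simp

lemma ndiff_cmult: "open S \<Longrightarrow> ndiff S n f \<Longrightarrow> ndiff S n (\<lambda>x. c * f x)" for c :: real
  by (rule ndiff_mult) auto

lemma ndiff_uminus: "open S \<Longrightarrow> ndiff S n f \<Longrightarrow> ndiff S n (\<lambda>x. - f x)" for f :: "real \<Rightarrow> real"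
  using ndiff_cmult[of S n f "-1"] by simp

lemma ndiff_diff: "open S \<Longrightarrow> ndiff S n f \<Longrightarrow> ndiff S n g \<Longrightarrow> ndiff S n (\<lambda>x. f x - g x)"
  using ndiff_add[of S n f "\<lambda>x. - g x"] ndiff_uminus[of S n g] by simp

lemma ndiff_sum: "open S \<Longrightarrow> (\<And>i. i \<in> A \<Longrightarrow> ndiff S n (f i)) \<Longrightarrow> ndiff S n (\<lambda>x. \<Sum>i\<in>A. f i x)"
  by (induction A rule: infinite_finite_induct) (auto intro: ndiff_add)

lemma ndiff_exp:
  assumes S: "open S"
  shows "ndiff S n f \<Longrightarrow> ndiff S n (\<lambda>x. exp (f x))"
proof (induction n)
  case (Suc n)
  have "ndiff S n (\<lambda>x. exp (f x))"
    using Suc.IH ndiff_mono[OF Suc.prems] by simp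
  then show ?case
    by (intro ndiff_SucI[OF S, where f' = "\<lambda>x. deriv f x * exp (f x)"])
      (auto intro!: ndiff_mult[OF S] ndiff_deriv[OF Suc.prems] derivative_eq_intros ndiff_DERIV0[OF Suc.prems])
qed simp

lemma ndiff_inverse:
  assumes S: "open S" and nz: "\<And>x. x \<in> S \<Longrightarrow> f x \<noteq> 0"
  shows "ndiff S n f \<Longrightarrow> ndiff S n (\<lambda>x. 1 / f x)"
proof (induction n)
  case (Suc n)
  have "ndiff S n (\<lambda>x. 1 / f x)"
    using Suc.IH ndiff_mono[OF Suc.prems] by simp
  then show ?case
  proof (intro ndiff_SucI[OF S, where f' = "\<lambda>x. - (deriv f x * ((1 / f x) * (1 / f x)))"])
    fix x assume x: "x \<in> S"
    show "((\<lambda>x. 1 / f x) has_real_derivative - (deriv f x * ((1 / f x) * (1 / f x)))) (at x)"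
      using nz[OF x] by (auto intro!: derivative_eq_intros ndiff_DERIV0[OF Suc.prems x] simp: field_simps)
  qed (intro ndiff_uminus[OF S] ndiff_mult[OF S] ndiff_deriv[OF Suc.prems])
qed simp

lemma ndiff_compose_affine:
  "ndiff UNIV n f \<Longrightarrow> ndiff UNIV n (\<lambda>x. f (c * x + d))"
proof (induction n arbitrary: f)
  case (Suc n)
  have "((\<lambda>x. f (c * x + d)) has_real_derivative c * deriv f (c * x + d)) (at x)" for x
    by (rule DERIV_cong, rule DERIV_chain'[OF _ ndiff_DERIV0[OF Suc.prems]])
      (auto intro!: derivative_eq_intros)
  then show ?case
    by (intro ndiff_SucI[where f' = "\<lambda>x. c * deriv f (c * x + d)"])
      (auto intro!: ndiff_cmult Suc.IH ndiff_deriv Suc.prems)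
qed simp

lemma deriv_n_Leibniz:
  assumes S: "open S" and x: "x \<in> S"
  shows "ndiff S n f \<Longrightarrow> ndiff S n g \<Longrightarrow> (deriv ^^ n) (\<lambda>x. f x * g x) x =
    (\<Sum>k\<le>n. real (n choose k) * (deriv ^^ k) f x * (deriv ^^ (n - k)) g x)"
  using x
proof (induction n arbitrary: x)
  case (Suc n)
  let ?T = "\<lambda>f g k y. real (n choose k) * (deriv ^^ k) f y * (deriv ^^ (n - k)) g y"
  have IH: "y \<in> S \<Longrightarrow> (deriv ^^ n) (\<lambda>x. f x * g x) y = (\<Sum>k\<le>n. ?T f g k y)" for y
    using Suc.IH Suc.prems by (meson ndiff_mono le_SucI order_refl)
  have "(deriv ^^ Suc n) (\<lambda>x. f x * g x) x = deriv (\<lambda>y. \<Sum>k\<le>n. ?T f g k y) x"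
    using deriv_cong_open(1)[OF S IH \<open>x \<in> S\<close>] by simp
  also have "\<dots> = (\<Sum>k\<le>n. real (n choose k) * ((deriv ^^ Suc k) f x * (deriv ^^ (n - k)) g x
      + (deriv ^^ k) f x * (deriv ^^ Suc (n - k)) g x))"
  proof (rule DERIV_imp_deriv, rule DERIV_sum)
    fix k assume k: "k \<in> {..n}"
    have "((deriv ^^ k) f has_real_derivative (deriv ^^ Suc k) f x) (at x)"
      "((deriv ^^ (n - k)) g has_real_derivative (deriv ^^ Suc (n - k)) g x) (at x)"
      using k by (auto intro!: ndiff_DERIV[OF Suc.prems(1)] ndiff_DERIV[OF Suc.prems(2)] Suc.prems simp del: funpow.simps)
    note d = DERIV_cmult[OF DERIV_mult[OF this], of "real (n choose k)"]
    show "(?T f g k has_real_derivative real (n choose k) * ((deriv ^^ Suc k) f x * (deriv ^^ (n - k)) g x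
      + (deriv ^^ k) f x * (deriv ^^ Suc (n - k)) g x)) (at x)"
      unfolding mult.assoc by (rule DERIV_cong[OF d]) (simp add: mult.commute add.commute del: funpow.simps)
  qed
  also have "\<dots> = (\<Sum>k\<le>n. real (n choose k) * (deriv ^^ Suc k) f x * (deriv ^^ (n - k)) g x)
     + (\<Sum>k\<le>n. real (n choose k) * (deriv ^^ k) f x * (deriv ^^ (Suc n - k)) g x)"
    unfolding sum.distrib[symmetric]
    by (rule sum.cong) (auto simp: Suc_diff_le distrib_left mult.assoc simp del: funpow.simps)
  \<comment> \<open>A zero term with k = n + 1 is appended and the term k = 0 split off, so that
    Pascal's rule can merge this sum with the first one.\<close>
  also have "(\<Sum>k\<le>n. real (n choose k) * (deriv ^^ k) f x * (deriv ^^ (Suc n - k)) g x) =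
     f x * (deriv ^^ Suc n) g x + (\<Sum>k\<le>n. real (n choose Suc k) * (deriv ^^ Suc k) f x * (deriv ^^ (n - k)) g x)"
  proof -
    have "(\<Sum>k\<le>n. real (n choose k) * (deriv ^^ k) f x * (deriv ^^ (Suc n - k)) g x) =
      (\<Sum>k\<le>Suc n. real (n choose k) * (deriv ^^ k) f x * (deriv ^^ (Suc n - k)) g x)"
      by (simp del: funpow.simps)
    also have "\<dots> = f x * (deriv ^^ Suc n) g x + (\<Sum>k\<le>n. real (n choose Suc k) * (deriv ^^ Suc k) f x * (deriv ^^ (n - k)) g x)"
      by (subst sum.atMost_Suc_shift) (simp del: funpow.simps(2))
    finally show ?thesis .
  qed
  also have "(\<Sum>k\<le>n. real (n choose k) * (deriv ^^ Suc k) f x * (deriv ^^ (n - k)) g x) + (f x * (deriv ^^ Suc n) g x + (\<Sum>k\<le>n. real (n choose Suc k) * (deriv ^^ Suc k) f x * (deriv ^^ (n - k)) g x))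
    = f x * (deriv ^^ Suc n) g x + (\<Sum>k\<le>n. real (Suc n choose Suc k) * (deriv ^^ Suc k) f x * (deriv ^^ (n - k)) g x)"
  proof -
    have "(\<Sum>k\<le>n. real (Suc n choose Suc k) * (deriv ^^ Suc k) f x * (deriv ^^ (n - k)) g x) =
      (\<Sum>k\<le>n. real (n choose k) * (deriv ^^ Suc k) f x * (deriv ^^ (n - k)) g x) +
      (\<Sum>k\<le>n. real (n choose Suc k) * (deriv ^^ Suc k) f x * (deriv ^^ (n - k)) g x)"
      unfolding sum.distrib[symmetric] by (rule sum.cong) (auto simp: distrib_right simp del: funpow.simps)
    then show ?thesis by linarith
  qed
  also have "\<dots> = (\<Sum>k\<le>Suc n. real (Suc n choose k) * (deriv ^^ k) f x * (deriv ^^ (Suc n - k)) g x)"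
    by (subst sum.atMost_Suc_shift) (simp del: funpow.simps(2) binomial_Suc_Suc)
  finally show ?case .
qed simp

section \<open>Smooth cut-off functions\<close>

text \<open>The family P(1/x) exp(-1/x), extended by zero, is closed under differentiation. This is
  why a polynomial factor is carried: smoothness at 0 reduces to a single derivative
  formula.\<close>

definition exp_poly :: "real poly \<Rightarrow> real \<Rightarrow> real" where
  "exp_poly P x = (if 0 < x then poly P (1 / x) * exp (- (1 / x)) else 0)"

lemma exp_poly_limit: "((\<lambda>x. poly P (1 / x) * exp (- (1 / x))) \<longlongrightarrow> 0) (at_right (0::real))"
proof -
  have "((\<lambda>y::real. y ^ k * exp (- y)) \<longlongrightarrow> 0) at_top" for k
    using tendsto_power_div_exp_0[of k] by (simp add: exp_minus divide_inverse)
  then have "((\<lambda>y. \<Sum>i\<le>degree P. coeff P i * (y ^ i * exp (- y))) \<longlongrightarrow> (\<Sum>i\<le>degree P. coeff P i * 0)) at_top"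
    by (intro tendsto_intros)
  then have "((\<lambda>y. poly P y * exp (- y)) \<longlongrightarrow> 0) at_top"
    by (simp add: poly_altdef sum_distrib_right mult.assoc)
  moreover have "filterlim (\<lambda>x::real. 1 / x) at_top (at_right 0)"
    using filterlim_inverse_at_top_right by (simp add: inverse_eq_divide)
  ultimately show ?thesis
    by (rule filterlim_compose)
qed

lemma exp_poly_DERIV:
  "(exp_poly P has_real_derivative exp_poly ([:0, 0, 1:] * (P - pderiv P)) x) (at x)"
proof -
  consider "x < 0" | "x = 0" | "x > 0" by linarith
  then show ?thesis
  proof cases
    case 1
    have "((\<lambda>_. 0) has_real_derivative 0) (at x)" by simp
    moreover have "eventually (\<lambda>y. 0 = exp_poly P y) (nhds x)"
      using 1 eventually_nhds_in_open[of "{..<0}" x] by (auto simp: exp_poly_def elim!: eventually_mono)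
    ultimately show ?thesis
      using 1 DERIV_cong_ev[OF refl _ refl, of "\<lambda>_. 0" "exp_poly P" x 0] by (simp add: exp_poly_def)
  next
    case 3
    have "((\<lambda>x. poly P (1 / x) * exp (- (1 / x))) has_real_derivative
       exp_poly ([:0, 0, 1:] * (P - pderiv P)) x) (at x)"
    proof -
      have i: "((\<lambda>x. 1 / x) has_real_derivative - (1 / x\<^sup>2)) (at x)"
        using 3 by (auto intro!: derivative_eq_intros simp: power2_eq_square)
      show ?thesis
        by (rule DERIV_cong[OF DERIV_mult[OF DERIV_chain2[OF poly_DERIV i] DERIV_chain2[OF DERIV_exp DERIV_minus[OF i]]]])
          (use 3 in \<open>simp add: exp_poly_def power2_eq_square algebra_simps\<close>)
    qed
    moreover have "eventually (\<lambda>y. poly P (1 / y) * exp (- (1 / y)) = exp_poly P y) (nhds x)"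
      using 3 eventually_nhds_in_open[of "{0<..}" x] by (auto simp: exp_poly_def elim!: eventually_mono)
    ultimately show ?thesis
      by (simp only: DERIV_cong_ev[OF refl _ refl])
  next
    case 2
    have "((\<lambda>y. (exp_poly P y - exp_poly P 0) / (y - 0)) \<longlongrightarrow> 0) (at 0)"
    proof -
      have "((\<lambda>y. (exp_poly P y - exp_poly P 0) / (y - 0)) \<longlongrightarrow> 0) (at_left 0)"
        by (rule tendsto_eventually) (auto simp: exp_poly_def eventually_at_filter)
      moreover have "((\<lambda>y. (exp_poly P y - exp_poly P 0) / (y - 0)) \<longlongrightarrow> 0) (at_right 0)"
        \<comment> \<open>The difference quotient from the right is again of this form, with P
          multiplied by the variable.\<close>
        using exp_poly_limit[of "[:0,1:] * P"]
        by (rule Lim_transform_eventually) (auto simp: exp_poly_def eventually_at_filter)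
      ultimately show ?thesis
        by (simp add: filterlim_at_split)
    qed
    then show ?thesis
      using 2 by (simp add: has_field_derivative_iff exp_poly_def)
  qed
qed

lemma ndiff_exp_poly: "ndiff UNIV n (exp_poly P)"
proof (induction n arbitrary: P)
  case (Suc n)
  show ?case by (rule ndiff_SucI[OF open_UNIV exp_poly_DERIV Suc])
qed simp

definition bump :: "real \<Rightarrow> real \<Rightarrow> real \<Rightarrow> real" where
  "bump a b x = exp_poly 1 (x - a) * exp_poly 1 (b - x)"

lemma bump_nonneg: "bump a b x \<ge> 0"
  by (simp add: bump_def exp_poly_def)

lemma bump_pos_iff: "bump a b x \<noteq> 0 \<longleftrightarrow> a < x \<and> x < b"
  by (simp add: bump_def exp_poly_def)

lemma ndiff_bump: "ndiff UNIV n (bump a b)"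
proof -
  have "ndiff UNIV n (\<lambda>x. exp_poly 1 (1 * x + (- a)) * exp_poly 1 ((-1) * x + b))"
    by (rule ndiff_mult[OF open_UNIV ndiff_compose_affine ndiff_compose_affine]; rule ndiff_exp_poly)
  moreover have "bump a b = (\<lambda>x. exp_poly 1 (1 * x + (- a)) * exp_poly 1 ((-1) * x + b))"
    by (rule ext) (simp add: bump_def)
  ultimately show ?thesis by simp
qed

text \<open>Smooth functions with values in [0, 1] that increase to the indicator of the open
  interval and vanish outside it. Only the limit matters, so no plateau is built.\<close>

definition cutoff :: "real \<Rightarrow> real \<Rightarrow> nat \<Rightarrow> real \<Rightarrow> real" where
  "cutoff a b n x = 1 - exp (- (real n * bump a b x))"

lemma ndiff_cutoff: "ndiff UNIV k (cutoff a b n)"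
  unfolding cutoff_def[abs_def]
  by (rule ndiff_diff[OF open_UNIV ndiff_const[OF open_UNIV] ndiff_exp[OF open_UNIV
        ndiff_uminus[OF open_UNIV ndiff_cmult[OF open_UNIV ndiff_bump]]]])

lemma cutoff_bounds: "0 \<le> cutoff a b n x" "cutoff a b n x \<le> 1"
  using bump_nonneg[of a b x] by (auto simp: cutoff_def)

lemma cutoff_outside: "\<not> (a < x \<and> x < b) \<Longrightarrow> cutoff a b n x = 0"
  using bump_pos_iff[of a b x] by (auto simp: cutoff_def)

lemma cutoff_limit: "(\<lambda>n. cutoff a b n x) \<longlonglongrightarrow> indicator {a<..<b} x"
proof (cases "a < x \<and> x < b")
  case True
  then have "bump a b x > 0" using bump_pos_iff[of a b x] bump_nonneg[of a b x] by linarith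
  then have "filterlim (\<lambda>n. real n * bump a b x) at_top sequentially"
    using filterlim_at_top_mult_tendsto_pos[OF tendsto_const _ filterlim_real_sequentially] by blast
  then have "(\<lambda>n. exp (- (real n * bump a b x))) \<longlonglongrightarrow> 0"
    using filterlim_compose[OF exp_at_bot filterlim_compose[OF filterlim_uminus_at_bot_at_top]] by blast
  from tendsto_diff[OF tendsto_const[of 1] this] show ?thesis using True by (simp add: cutoff_def)
next
  case False
  then show ?thesis by (simp add: cutoff_outside)
qed

lemma test_functionsI:
  assumes "\<And>n. ndiff UNIV n \<phi>" "\<And>x. x \<notin> {a..b} \<Longrightarrow> \<phi> x = 0" "{a..b} \<subseteq> I"
  shows "\<phi> \<in> test_functions I"
proof -
  have "{x. \<phi> x \<noteq> 0} \<subseteq> {a..b}" using assms(2) by blast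
  then have "closure {x. \<phi> x \<noteq> 0} \<subseteq> {a..b}" by (rule closure_minimal) auto
  moreover have "compact (closure {x. \<phi> x \<noteq> 0})"
    using calculation by (meson bounded_closed_interval bounded_subset closed_closure compact_eq_bounded_closed)
  moreover have "(deriv ^^ n) \<phi> differentiable_on UNIV" for n
    using assms(1)[of "Suc n"] by (auto simp: ndiff_def differentiable_on_def)
  ultimately show ?thesis using assms(3) unfolding test_functions_def by auto
qed

lemma test_functionsD_ndiff: "\<phi> \<in> test_functions I \<Longrightarrow> ndiff UNIV n \<phi>"
  by (auto simp: test_functions_def ndiff_def differentiable_on_def)

lemma test_functions_support:
  assumes "\<phi> \<in> test_functions {a<..<b}" "a < b"
  obtains c d where "a < c" "c < d" "d < b" "\<And>x. x \<notin> {c..d} \<Longrightarrow> \<phi> x = 0"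
proof -
  let ?K = "closure {x. \<phi> x \<noteq> 0}"
  have K: "compact ?K" "?K \<subseteq> {a<..<b}" using assms by (auto simp: test_functions_def)
  show ?thesis
  proof (cases "?K = {}")
    case True
    then have "{x. \<phi> x \<noteq> 0} = {}" using closure_subset by blast
    then have "\<phi> x = 0" for x by blast
    then show ?thesis using that[of "a + (b-a)/3" "a + 2*(b-a)/3"] assms(2) by (simp add: field_simps)
  next
    case False
    obtain m M where m: "m \<in> ?K" "\<And>x. x \<in> ?K \<Longrightarrow> m \<le> x" and M: "M \<in> ?K" "\<And>x. x \<in> ?K \<Longrightarrow> x \<le> M"
      using compact_attains_inf[OF K(1) False] compact_attains_sup[OF K(1) False] by blast
    have "m \<in> {a<..<b}" "M \<in> {a<..<b}" using K(2) m(1) M(1) by blast+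
    then have "a < m" "M < b" "m \<le> M" using m(2)[OF M(1)] by auto
    show ?thesis
    \<comment> \<open>The right end is moved beyond M to get the strict inequality
      \<open>c < d\<close> without showing that m and M differ.\<close>
    proof (rule that[of "m" "(M + b) / 2"])
      fix x assume "x \<notin> {m..(M + b)/2}"
      then have "x < m \<or> M < x" using \<open>M < b\<close> by auto
      then have "x \<notin> ?K" using m(2) M(2) by (meson not_le)
      then show "\<phi> x = 0" using closure_subset[of "{x. \<phi> x \<noteq> 0}"] by blast
    qed (use \<open>a < m\<close> \<open>M < b\<close> \<open>m \<le> M\<close> in auto)
  qed
qed

section \<open>Uniqueness of weak derivatives\<close>

text \<open>Open intervals form an intersection-stable generator of the Borel sets, so the vanishing
  of the integrals extends to all Borel sets; \<open>tot\<close> is what complements require. A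
  function all of whose set integrals vanish is zero almost everywhere.\<close>

lemma AE_zero_if_interval_integrals_zero:
  fixes h :: "real \<Rightarrow> real"
  assumes h: "integrable lborel h" and tot: "(LINT x|lborel. h x) = 0"
    and int: "\<And>a b. a < b \<Longrightarrow> (LINT x|lborel. indicator {a<..<b} x * h x) = 0"
  shows "AE x in lborel. h x = 0"
proof (rule sigma_finite_measure.density_zero[OF sigma_finite_lborel h])
  have I: "integrable lborel (\<lambda>x. indicator A x * h x)" if "A \<in> sets borel" for A
    using integrable_mult_indicator[of A lborel h] that h by simp
  let ?G = "range (\<lambda>(a, b). {a<..<b::real})"
  have st: "Int_stable ?G"
  proof (rule Int_stableI)
    fix A B assume "A \<in> ?G" "B \<in> ?G"
    then obtain a b c d where "A = {a<..<b}" "B = {c<..<d}" by auto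
    then have "A \<inter> B = {max a c<..<min b d}" by auto
    then show "A \<inter> B \<in> ?G" by auto
  qed
  have sub: "?G \<subseteq> Pow UNIV" by simp
  have gen: "sets (borel :: real measure) = sigma_sets UNIV ?G"
  proof -
    have "sets (borel :: real measure) = sigma_sets UNIV (range (\<lambda>(a, b). box a b :: real set))"
      by (subst borel_eq_box) simp
    then show ?thesis by simp
  qed
  fix A :: "real set" assume "A \<in> sets lborel"
  then have "A \<in> sigma_sets UNIV ?G" using gen by simp
  then have "(LINT x|lborel. indicator A x * h x) = 0"
  proof (induction rule: sigma_sets_induct_disjoint[OF st sub, consumes 1, case_names basic empty compl union])
    case (basic A)
    then obtain a b where A: "A = {a<..<b}" by auto
    show ?case
    proof (cases "a < b")
      case True
      then show ?thesis using int A by simp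
    next
      case False
      then have "A = {}" using A by auto
      then show ?thesis by simp
    qed
  next
    case empty
    then show ?case by simp
  next
    case (compl A)
    have "A \<in> sets borel" using compl(1) gen by simp
    have "(LINT x|lborel. indicator (UNIV - A) x * h x) = (LINT x|lborel. h x - indicator A x * h x)"
      by (rule Bochner_Integration.integral_cong) (auto simp: indicator_def)
    also have "\<dots> = 0"
      using compl tot h I[OF \<open>A \<in> sets borel\<close>] by (simp add: Bochner_Integration.integral_diff)
    finally show ?case .
  next
    case (union A)
    have A: "A i \<in> sets borel" for i using union(2) gen by blast
    have "set_integrable lborel (\<Union>i. A i) h"
      using A I[of "\<Union>i. A i"] by (simp add: set_integrable_def)
    from lebesgue_integral_countable_add[of A lborel h, OF _ _ this]
    have "(LINT x:(\<Union>i. A i)|lborel. h x) = (\<Sum>i. LINT x:A i|lborel. h x)"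
      using A union(1) by (auto simp: disjoint_family_on_def)
    also have "\<dots> = 0" using union(3) by (simp add: set_lebesgue_integral_def)
    finally show ?case by (simp add: set_lebesgue_integral_def)
  qed
  then show "(LINT x:A|lborel. h x) = 0" by (simp add: set_lebesgue_integral_def)
qed

section \<open>Local integrability and pairing with compactly supported functions\<close>

lemma locally_integrable_onD:
  "locally_integrable_on g {l<..<r} \<Longrightarrow> l < c \<Longrightarrow> d < r \<Longrightarrow> integrable lebesgue (\<lambda>x. indicator {c..d} x * g x)"
  using integrable_restrict_space[of "{c..d}" lebesgue g] spec[of _ "{c..d}"]
  by (simp add: locally_integrable_on_def subset_eq)

lemma integrable_lebesgue_on_iff:
  "S \<in> sets lebesgue \<Longrightarrow> integrable (lebesgue_on S) f \<longleftrightarrow> integrable lebesgue (\<lambda>x. indicator S x * f x)" for f :: "real \<Rightarrow> real"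
  using integrable_restrict_space[of S lebesgue f] by simp

lemma integral_lebesgue_on_eq:
  "S \<in> sets lebesgue \<Longrightarrow> integral\<^sup>L (lebesgue_on S) f = integral\<^sup>L lebesgue (\<lambda>x. indicator S x * f x)" for f :: "real \<Rightarrow> real"
  using integral_restrict_space[of S lebesgue f] by simp

lemma continuous_measurable_lebesgue: "continuous_on UNIV \<psi> \<Longrightarrow> \<psi> \<in> borel_measurable lebesgue" for \<psi> :: "real \<Rightarrow> real"
  by (intro measurable_completion) (simp add: borel_measurable_continuous_onI)

text \<open>On the compact set that carries \<psi>, g is integrable and \<psi> is bounded. Integrals
  over the interval thereby become integrals over the whole line, where they are easier to
  manipulate.\<close>

lemma integrable_times_compact_support:
  fixes g \<psi> :: "real \<Rightarrow> real"
  assumes g: "locally_integrable_on g {l<..<r}" and \<psi>: "continuous_on UNIV \<psi>"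
    and cd: "l < c" "d < r" "\<And>x. x \<notin> {c..d} \<Longrightarrow> \<psi> x = 0"
  shows "integrable lebesgue (\<lambda>x. g x * \<psi> x)"
    and "integrable (lebesgue_on {l<..<r}) (\<lambda>x. g x * \<psi> x)"
    and "(LINT x|lebesgue_on {l<..<r}. g x * \<psi> x) = (LINT x|lebesgue. g x * \<psi> x)"
proof -
  have "bounded (\<psi> ` {c..d})"
    by (intro compact_imp_bounded compact_continuous_image continuous_on_subset[OF \<psi>]) auto
  then obtain B where B: "\<And>x. x \<in> {c..d} \<Longrightarrow> \<bar>\<psi> x\<bar> \<le> B"
    unfolding bounded_iff by (metis imageI real_norm_def)
  have gi: "integrable lebesgue (\<lambda>x. indicator {c..d} x * g x)"
    by (rule locally_integrable_onD[OF g cd(1,2)])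
  have eq: "(\<lambda>x. (indicator {c..d} x * g x) * \<psi> x) = (\<lambda>x. g x * \<psi> x)"
    using cd(3) by (auto simp: indicator_def fun_eq_iff)
  have "integrable lebesgue (\<lambda>x. (indicator {c..d} x * g x) * \<psi> x)"
  proof (rule Bochner_Integration.integrable_bound[of _ "\<lambda>x. B * (indicator {c..d} x * g x)"])
    show "(\<lambda>x. indicator {c..d} x * g x * \<psi> x) \<in> borel_measurable lebesgue"
      by (rule borel_measurable_times[OF borel_measurable_integrable[OF gi] continuous_measurable_lebesgue[OF \<psi>]])
    show "AE x in lebesgue. norm (indicator {c..d} x * g x * \<psi> x) \<le> norm (B * (indicator {c..d} x * g x))"
    proof (rule AE_I2)
      fix x
      show "norm (indicator {c..d} x * g x * \<psi> x) \<le> norm (B * (indicator {c..d} x * g x))"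
        using B[of x] mult_right_mono[of "\<bar>\<psi> x\<bar>" "\<bar>B\<bar>" "\<bar>g x\<bar>"]
        by (cases "x \<in> {c..d}") (auto simp: abs_mult mult.commute)
    qed
  qed (use gi in auto)
  then show i: "integrable lebesgue (\<lambda>x. g x * \<psi> x)" unfolding eq .
  have "(\<lambda>x. indicator {l<..<r} x * (g x * \<psi> x)) = (\<lambda>x. g x * \<psi> x)"
    using cd(1,2) by (intro ext) (auto simp: indicator_def intro!: cd(3))
  with i show "integrable (lebesgue_on {l<..<r}) (\<lambda>x. g x * \<psi> x)"
    "(LINT x|lebesgue_on {l<..<r}. g x * \<psi> x) = (LINT x|lebesgue. g x * \<psi> x)"
    by (simp_all add: integrable_lebesgue_on_iff integral_lebesgue_on_eq)
qed

lemma ndiff_continuous: "ndiff UNIV (Suc n) f \<Longrightarrow> continuous_on UNIV f"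
  by (auto simp: ndiff_Suc intro!: differentiable_imp_continuous_on simp: differentiable_on_def)

lemma test_functionsD:
  assumes "\<phi> \<in> test_functions I"
  shows "continuous_on UNIV \<phi>" "continuous_on UNIV (deriv \<phi>)" "(\<phi> has_real_derivative deriv \<phi> x) (at x)"
  using test_functionsD_ndiff[OF assms, of 2]
  by (auto simp: numeral_2_eq_2 intro: ndiff_continuous ndiff_deriv ndiff_DERIV0)

lemma cutoff_test: "l < a \<Longrightarrow> b < r \<Longrightarrow> cutoff a b n \<in> test_functions {l<..<r}"
  by (rule test_functionsI[where a = a and b = b]) (auto intro: ndiff_cutoff cutoff_outside)

text \<open>Cut-off functions are test functions and converge to indicators, so dominated
  convergence with majorant |h| turns the hypothesis into vanishing integrals over
  intervals.\<close>

lemma AE_zero_on_subinterval: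
  assumes h: "locally_integrable_on h {l<..<r}"
    and z: "\<And>\<phi>. \<phi> \<in> test_functions {l<..<r} \<Longrightarrow> (LINT x|lebesgue_on {l<..<r}. h x * \<phi> x) = 0"
    and cd: "l < c" "d < r"
  shows "AE x in lebesgue. x \<in> {c..d} \<longrightarrow> h x = 0"
proof -
  let ?h = "\<lambda>x. indicator {c..d} x * h x"
  have hi: "integrable lebesgue ?h" by (rule locally_integrable_onD[OF h cd])
  note hm' = borel_measurable_integrable[OF hi]
  have zero: "(LINT x|lebesgue. indicator {a<..<b} x * ?h x) = 0" for a b
  proof -
    \<comment> \<open>The interval is clipped to [c, d], since a cut-off must be supported inside
      (l, r). For the truncated function nothing changes apart from the two points c and d.\<close>
    define a' b' where "a' = max a c" and "b' = min b d"
    have ab: "l < a'" "b' < r" using cd by (auto simp: a'_def b'_def)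
    have "(LINT x|lebesgue. cutoff a' b' n x * ?h x) = 0" for n
    proof -
      have "(LINT x|lebesgue. cutoff a' b' n x * ?h x) = (LINT x|lebesgue. h x * cutoff a' b' n x)"
        by (rule Bochner_Integration.integral_cong)
          (auto simp: indicator_def a'_def b'_def intro!: cutoff_outside)
      also have "\<dots> = (LINT x|lebesgue_on {l<..<r}. h x * cutoff a' b' n x)"
        by (rule integrable_times_compact_support(3)[OF h ndiff_continuous[OF ndiff_cutoff] ab, symmetric])
          (rule cutoff_outside, auto)
      also have "\<dots> = 0" by (rule z[OF cutoff_test[OF ab]])
      finally show ?thesis .
    qed
    moreover have "(\<lambda>n. LINT x|lebesgue. cutoff a' b' n x * ?h x) \<longlonglongrightarrow> (LINT x|lebesgue. indicator {a'<..<b'} x * ?h x)"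
    proof (rule integral_dominated_convergence[where w = "\<lambda>x. \<bar>?h x\<bar>"])
      show "(\<lambda>x. indicator {a'<..<b'} x * ?h x) \<in> borel_measurable lebesgue"
        by (rule borel_measurable_times[OF borel_measurable_indicator hm']) auto
      show "(\<lambda>x. cutoff a' b' n x * ?h x) \<in> borel_measurable lebesgue" for n
        by (rule borel_measurable_times[OF continuous_measurable_lebesgue[OF ndiff_continuous[OF ndiff_cutoff]] hm'])
      show "integrable lebesgue (\<lambda>x. \<bar>?h x\<bar>)" using hi by auto
      show "AE x in lebesgue. (\<lambda>n. cutoff a' b' n x * ?h x) \<longlonglongrightarrow> indicator {a'<..<b'} x * ?h x"
        by (intro AE_I2 tendsto_intros cutoff_limit)
      show "AE x in lebesgue. norm (cutoff a' b' n x * ?h x) \<le> \<bar>?h x\<bar>" for n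
      proof (rule AE_I2)
        fix x
        show "norm (cutoff a' b' n x * ?h x) \<le> \<bar>?h x\<bar>"
          using mult_right_mono[of "\<bar>cutoff a' b' n x\<bar>" 1 "\<bar>?h x\<bar>"] cutoff_bounds[of a' b' n x]
          unfolding real_norm_def abs_mult[of "cutoff a' b' n x"] by simp
      qed
    qed
    ultimately have "(LINT x|lebesgue. indicator {a'<..<b'} x * ?h x) = 0"
      using LIMSEQ_unique[OF _ tendsto_const] by force
    moreover have "(LINT x|lebesgue. indicator {a'<..<b'} x * ?h x) = (LINT x|lebesgue. indicator {a<..<b} x * ?h x)"
    proof (rule integral_cong_AE)
      have "AE x in lebesgue. x \<notin> {c, d}"
        by (rule AE_not_in) (auto intro: null_sets_completionI)
      then show "AE x in lebesgue. indicator {a'<..<b'} x * ?h x = indicator {a<..<b} x * ?h x"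
        by eventually_elim (auto simp: indicator_def a'_def b'_def)
    qed (rule borel_measurable_times[OF borel_measurable_indicator hm'], simp)+
    ultimately show ?thesis by simp
  qed
  \<comment> \<open>The interval criterion lives on \<open>lborel\<close>, so h is replaced by a
    Borel representative and the result is carried back through the completion.\<close>
  obtain h0 where h0: "h0 \<in> borel_measurable lborel" "AE x in lborel. ?h x = h0 x"
    using completion_ex_borel_measurable_real[of ?h lborel] hi by auto
  have ae: "AE x in lebesgue. ?h x = h0 x" using h0(2) by (rule AE_completion)
  have hm: "h0 \<in> borel_measurable lebesgue" using h0(1) by (rule measurable_completion)
  have "integrable lebesgue h0"
    using hi integrable_cong_AE[OF hm' hm ae] by simp
  then have int0: "integrable lborel h0" using integrable_completion[OF h0(1)] by simp
  have zero0: "(LINT x|lborel. indicator {a<..<b} x * h0 x) = 0" for a b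
  proof -
    have "(LINT x|lborel. indicator {a<..<b} x * h0 x) = (LINT x|lebesgue. indicator {a<..<b} x * h0 x)"
      using h0(1) by (intro integral_completion[symmetric]) auto
    also have "\<dots> = (LINT x|lebesgue. indicator {a<..<b} x * ?h x)"
    proof (rule integral_cong_AE)
      show "(\<lambda>x. indicator {a<..<b} x * h0 x) \<in> borel_measurable lebesgue"
        by (rule borel_measurable_times[OF borel_measurable_indicator hm]) simp
      show "(\<lambda>x. indicator {a<..<b} x * ?h x) \<in> borel_measurable lebesgue"
        by (rule borel_measurable_times[OF borel_measurable_indicator hm']) simp
    qed (use ae in eventually_elim, simp)
    finally show ?thesis using zero by simp
  qed
  have "AE x in lborel. h0 x = 0"
  proof (rule AE_zero_if_interval_integrals_zero[OF int0])
    have "(LINT x|lborel. h0 x) = (LINT x|lebesgue. h0 x)"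
      by (rule integral_completion[symmetric, OF h0(1)])
    also have "\<dots> = (LINT x|lebesgue. ?h x)"
      by (rule integral_cong_AE[OF hm hm']) (use ae in eventually_elim, simp)
    also have "\<dots> = (LINT x|lebesgue. indicator {c - 1<..<d + 1} x * ?h x)"
      by (rule Bochner_Integration.integral_cong) (auto simp: indicator_def)
    finally show "(LINT x|lborel. h0 x) = 0" using zero by simp
  qed (rule zero0)
  then have "AE x in lebesgue. h0 x = 0" by (rule AE_completion)
  with ae show ?thesis by eventually_elim (auto simp: indicator_def)
qed

text \<open>The open interval is exhausted by countably many compact ones.\<close>

theorem fundamental_lemma_variations:
  assumes h: "locally_integrable_on h {l<..<r}"
    and z: "\<And>\<phi>. \<phi> \<in> test_functions {l<..<r} \<Longrightarrow> (LINT x|lebesgue_on {l<..<r}. h x * \<phi> x) = 0"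
  shows "AE x in lebesgue_on {l<..<r}. h x = 0"
proof -
  have "AE x in lebesgue. \<forall>n. x \<in> {l + 1 / Suc n..r - 1 / Suc n} \<longrightarrow> h x = 0"
    unfolding AE_all_countable
  proof
    fix n
    have "l < l + 1 / Suc n" "r - 1 / Suc n < r" by simp_all
    then show "AE x in lebesgue. x \<in> {l + 1 / Suc n..r - 1 / Suc n} \<longrightarrow> h x = 0"
      using AE_zero_on_subinterval[OF h z] by blast
  qed
  then have "AE x in lebesgue. x \<in> {l<..<r} \<longrightarrow> h x = 0"
  proof eventually_elim
    case (elim x)
    show ?case
    proof
      assume "x \<in> {l<..<r}"
      then obtain n where "inverse (real (Suc n)) < min (x - l) (r - x)"
        using reals_Archimedean[of "min (x - l) (r - x)"] by (meson diff_gt_0_iff_gt greaterThanLessThan_iff min_less_iff_conj)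
      then have "x \<in> {l + 1 / Suc n..r - 1 / Suc n}" by (simp add: inverse_eq_divide)
      with elim show "h x = 0" by blast
    qed
  qed
  then show ?thesis by (simp add: AE_restrict_space_iff)
qed

text \<open>Since the function also vanishes at c and d, the boundary terms of an integration by
  parts over [c, d] disappear.\<close>

lemma test_functions_support':
  assumes "\<phi> \<in> test_functions {l<..<r}" "l < r"
  obtains c d where "l < c" "c < d" "d < r" "\<And>x. x \<le> c \<Longrightarrow> \<phi> x = 0" "\<And>x. d \<le> x \<Longrightarrow> \<phi> x = 0"
proof -
  obtain c d where cd: "l < c" "c < d" "d < r" "\<And>x. x \<notin> {c..d} \<Longrightarrow> \<phi> x = 0"
    using test_functions_support[OF assms] by blast
  show ?thesis
    by (rule that[of "(l + c) / 2" "(d + r) / 2"]) (use cd(1-3) in \<open>simp_all add: cd(4)\<close>)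
qed

lemma test_functions_deriv_support:
  fixes \<phi> :: "real \<Rightarrow> real"
  assumes "\<And>x. x \<le> c \<Longrightarrow> \<phi> x = 0" "\<And>x. d \<le> x \<Longrightarrow> \<phi> x = 0" "x < c \<or> d < x"
  shows "deriv \<phi> x = 0"
proof -
  have "deriv \<phi> x = deriv (\<lambda>_. 0) x"
    by (rule deriv_cong_open(1)[where S = "{..<c} \<union> {d<..}"]) (use assms in auto)
  then show ?thesis by simp
qed

lemma locally_integrable_on_diff:
  "locally_integrable_on f I \<Longrightarrow> locally_integrable_on g I \<Longrightarrow> locally_integrable_on (\<lambda>x. f x - g x) I"
  by (auto simp: locally_integrable_on_def)

lemma locally_integrable_on_cmult:
  "locally_integrable_on f I \<Longrightarrow> locally_integrable_on (\<lambda>x. c * f x) I"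
  by (auto simp: locally_integrable_on_def)

lemma locally_integrable_on_integrable:
  assumes "integrable (lebesgue_on I) f" "I \<in> sets lebesgue"
  shows "locally_integrable_on f I"
  unfolding locally_integrable_on_def
proof safe
  fix K :: "real set" assume K: "compact K" "K \<subseteq> I"
  have Ks: "K \<in> sets lebesgue" using K(1) by (simp add: compact_imp_closed)
  have "integrable lebesgue (\<lambda>x. indicator K x * (indicator I x * f x))"
    using integrable_mult_indicator[OF Ks, of "\<lambda>x. indicator I x * f x"] assms by (simp add: integrable_lebesgue_on_iff)
  moreover have "(\<lambda>x. indicator K x * (indicator I x * f x)) = (\<lambda>x. indicator K x * f x)"
    using K(2) by (auto simp: indicator_def fun_eq_iff)
  ultimately show "integrable (lebesgue_on K) f" using Ks by (simp add: integrable_lebesgue_on_iff)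
qed

lemma locally_integrable_on_continuous:
  assumes "continuous_on I f"
  shows "locally_integrable_on f I"
  unfolding locally_integrable_on_def
proof safe
  fix K :: "real set" assume K: "compact K" "K \<subseteq> I"
  have i: "integrable lborel (\<lambda>x. indicator K x *\<^sub>R f x)"
    by (rule borel_integrable_compact[OF K(1) continuous_on_subset[OF assms K(2)]])
  then have "integrable lebesgue (\<lambda>x. indicator K x *\<^sub>R f x)"
    by (subst integrable_completion) auto
  then show "integrable (lebesgue_on K) f"
    using K(1) by (simp add: integrable_lebesgue_on_iff compact_imp_closed)
qed

text \<open>Local integrability gives measurability on compact subintervals only; the truncations to
  an exhausting sequence of them eventually equal g at every point.\<close>

lemma locally_integrable_on_measurable:
  assumes "locally_integrable_on g {l<..<r}"
  shows "g \<in> borel_measurable (lebesgue_on {l<..<r})"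
proof -
  let ?s = "\<lambda>n x. indicator {l + 1 / Suc n..r - 1 / Suc n} x * g x"
  have "?s n \<in> borel_measurable lebesgue" for n
    by (rule borel_measurable_integrable[OF locally_integrable_onD[OF assms]]) auto
  then have m: "?s n \<in> borel_measurable (lebesgue_on {l<..<r})" for n
    by (rule measurable_restrict_space1)
  have "(\<lambda>n. ?s n x) \<longlonglongrightarrow> g x" if x: "x \<in> space (lebesgue_on {l<..<r})" for x
  proof -
    have "\<forall>\<^sub>F n in sequentially. 1 / real (Suc n) < min (x - l) (r - x)"
      using x by (intro order_tendstoD[OF LIMSEQ_Suc[OF lim_1_over_n]]) auto
    then have "\<forall>\<^sub>F n in sequentially. ?s n x = g x"
      by eventually_elim (auto simp: indicator_def)
    then show ?thesis by (rule tendsto_eventually)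
  qed
  then show ?thesis by (rule borel_measurable_LIMSEQ_metric[OF m])
qed

text \<open>The difference of two candidates annihilates all test functions. As
  \<open>weak_deriv\<close> is an arbitrary choice, every computation with it rests on this
  uniqueness.\<close>

lemma has_weak_deriv_unique:
  assumes "has_weak_deriv {l<..<r} u g" "has_weak_deriv {l<..<r} u g'" and lr: "l < r"
  shows "AE x in lebesgue_on {l<..<r}. g x = g' x"
proof -
  have li: "locally_integrable_on g {l<..<r}" "locally_integrable_on g' {l<..<r}"
    using assms by (auto simp: has_weak_deriv_def)
  have "AE x in lebesgue_on {l<..<r}. g x - g' x = 0"
  proof (rule fundamental_lemma_variations[OF locally_integrable_on_diff[OF li]])
    fix \<phi> assume \<phi>: "\<phi> \<in> test_functions {l<..<r}"
    obtain c d where cd: "l < c" "d < r" "\<And>x. x \<notin> {c..d} \<Longrightarrow> \<phi> x = 0"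
      using test_functions_support[OF \<phi> lr] by metis
    note i = integrable_times_compact_support(2)[OF _ test_functionsD(1)[OF \<phi>] cd]
    have "(LINT x|lebesgue_on {l<..<r}. (g x - g' x) * \<phi> x) =
      (LINT x|lebesgue_on {l<..<r}. g x * \<phi> x) - (LINT x|lebesgue_on {l<..<r}. g' x * \<phi> x)"
      using i[OF li(1)] i[OF li(2)] by (simp add: left_diff_distrib)
    also have "\<dots> = 0"
      using assms \<phi> unfolding has_weak_deriv_def by fastforce
    finally show "(LINT x|lebesgue_on {l<..<r}. (g x - g' x) * \<phi> x) = 0" .
  qed
  then show ?thesis by eventually_elim simp
qed

lemma has_weak_deriv_weak_deriv:
  assumes "has_weak_deriv {l<..<r} u g" "l < r"
  shows "has_weak_deriv {l<..<r} u (weak_deriv {l<..<r} u)"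
    and "AE x in lebesgue_on {l<..<r}. weak_deriv {l<..<r} u x = g x"
proof -
  show *: "has_weak_deriv {l<..<r} u (weak_deriv {l<..<r} u)"
    unfolding weak_deriv_def by (rule someI[of "has_weak_deriv {l<..<r} u", OF assms(1)])
  show "AE x in lebesgue_on {l<..<r}. weak_deriv {l<..<r} u x = g x"
    by (rule has_weak_deriv_unique[OF * assms])
qed

lemma integral_compact_support:
  fixes f :: "real \<Rightarrow> real"
  assumes "integrable lebesgue f" "\<And>x. x \<notin> {c..d} \<Longrightarrow> f x = 0"
  shows "integral\<^sup>L lebesgue f = integral {c..d} f" "f integrable_on {c..d}"
proof -
  have "f integrable_on UNIV" "integral\<^sup>L lebesgue f = integral UNIV f"
    using assms(1) integrable_on_lebesgue_on[of UNIV f] lebesgue_integral_eq_integral[of UNIV f]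
    by (auto simp: lebesgue_on_UNIV_eq)
  moreover have "f = (\<lambda>x. if x \<in> {c..d} then f x else 0)" using assms(2) by auto
  ultimately show "integral\<^sup>L lebesgue f = integral {c..d} f" "f integrable_on {c..d}"
    by (metis integral_restrict_UNIV, metis integrable_restrict_UNIV)
qed

text \<open>Finitely many points without derivative do not disturb the fundamental theorem of
  calculus for a continuous function. The exceptional set is there for the breakpoints of a ReLU
  network.\<close>

lemma has_weak_deriv_piecewise:
  assumes F: "continuous_on {l<..<r} F" and S: "finite S" and lr: "l < r"
    and d: "\<And>x. x \<in> {l<..<r} - S \<Longrightarrow> (F has_real_derivative F' x) (at x)"
    and F': "locally_integrable_on F' {l<..<r}"
  shows "has_weak_deriv {l<..<r} F F'"
  unfolding has_weak_deriv_def
proof (intro conjI ballI)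
  show lF: "locally_integrable_on F {l<..<r}" by (rule locally_integrable_on_continuous[OF F])
  fix \<phi> assume \<phi>: "\<phi> \<in> test_functions {l<..<r}"
  obtain c d where cd: "l < c" "c < d" "d < r" "\<And>x. x \<le> c \<Longrightarrow> \<phi> x = 0" "\<And>x. d \<le> x \<Longrightarrow> \<phi> x = 0"
    using test_functions_support'[OF \<phi> lr] by metis
  have s0: "\<phi> x = 0" if "x \<notin> {c..d}" for x
  proof -
    have "x \<le> c \<or> d \<le> x" using that by auto
    then show ?thesis using cd(4,5) by blast
  qed
  have s1: "deriv \<phi> x = 0" if "x \<notin> {c..d}" for x
    using that by (intro test_functions_deriv_support[OF cd(4,5)]) (auto simp: not_le)
  have i0: "integrable lebesgue (\<lambda>x. F' x * \<phi> x)"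
    "(LINT x|lebesgue_on {l<..<r}. F' x * \<phi> x) = (LINT x|lebesgue. F' x * \<phi> x)"
    using integrable_times_compact_support[OF F' test_functionsD(1)[OF \<phi>] cd(1,3)] s0 by blast+
  have i1: "integrable lebesgue (\<lambda>x. F x * deriv \<phi> x)"
    "(LINT x|lebesgue_on {l<..<r}. F x * deriv \<phi> x) = (LINT x|lebesgue. F x * deriv \<phi> x)"
    using integrable_times_compact_support[OF lF test_functionsD(2)[OF \<phi>] cd(1,3)] s1 by blast+
  have j0: "(LINT x|lebesgue. F' x * \<phi> x) = integral {c..d} (\<lambda>x. F' x * \<phi> x)" "(\<lambda>x. F' x * \<phi> x) integrable_on {c..d}"
    by (rule integral_compact_support[OF i0(1)], simp add: s0)+
  have j1: "(LINT x|lebesgue. F x * deriv \<phi> x) = integral {c..d} (\<lambda>x. F x * deriv \<phi> x)" "(\<lambda>x. F x * deriv \<phi> x) integrable_on {c..d}"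
    by (rule integral_compact_support[OF i1(1)], simp add: s1)+
  have "((\<lambda>x. F' x * \<phi> x + F x * deriv \<phi> x) has_integral F d * \<phi> d - F c * \<phi> c) {c..d}"
  proof (rule fundamental_theorem_of_calculus_interior_strong[OF S])
    show "continuous_on {c..d} (\<lambda>x. F x * \<phi> x)"
      using cd(1-3) by (intro continuous_on_mult continuous_on_subset[OF F] continuous_on_subset[OF test_functionsD(1)[OF \<phi>]]) auto
    fix x assume "x \<in> {c<..<d} - S"
    then have "x \<in> {l<..<r} - S" using cd(1-3) by auto
    from DERIV_mult[OF d[OF this] test_functionsD(3)[OF \<phi>]]
    show "((\<lambda>x. F x * \<phi> x) has_vector_derivative F' x * \<phi> x + F x * deriv \<phi> x) (at x)"
      by (simp add: has_real_derivative_iff_has_vector_derivative mult.commute)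
  qed (use cd(2) in simp)
  moreover have "((\<lambda>x. F' x * \<phi> x + F x * deriv \<phi> x) has_integral
     (integral {c..d} (\<lambda>x. F' x * \<phi> x) + integral {c..d} (\<lambda>x. F x * deriv \<phi> x))) {c..d}"
    by (intro has_integral_add integrable_integral j0 j1)
  ultimately have "integral {c..d} (\<lambda>x. F' x * \<phi> x) + integral {c..d} (\<lambda>x. F x * deriv \<phi> x) = 0"
    using cd(4)[of c] cd(5)[of d] by (simp add: has_integral_iff)
  then show "(LINT x|lebesgue_on {l<..<r}. F x * deriv \<phi> x) = - (LINT x|lebesgue_on {l<..<r}. F' x * \<phi> x)"
    by (simp add: i0 i1 j0 j1)
qed (rule F')

text \<open>A primitive of a compactly supported function is constant on either side of the support.
  Zero mean makes the two constants equal, and subtracting the common value gives compact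
  support.\<close>

lemma test_functions_antideriv:
  assumes \<psi>: "\<psi> \<in> test_functions {l<..<r}" and lr: "l < r"
    and z: "(LINT x|lebesgue_on {l<..<r}. \<psi> x) = 0"
  obtains \<phi> where "\<phi> \<in> test_functions {l<..<r}" "deriv \<phi> = \<psi>"
proof -
  obtain c d where cd: "l < c" "c < d" "d < r" "\<And>x. x \<le> c \<Longrightarrow> \<psi> x = 0" "\<And>x. d \<le> x \<Longrightarrow> \<psi> x = 0"
    using test_functions_support'[OF \<psi> lr] by metis
  have cont: "continuous_on UNIV \<psi>" by (rule test_functionsD(1)[OF \<psi>])
  have "\<exists>F. \<forall>x. - \<infinity> < ereal x \<longrightarrow> ereal x < \<infinity> \<longrightarrow> (F has_vector_derivative \<psi> x) (at x)"
    using cont by (intro einterval_antiderivative) (auto simp: continuous_on_eq_continuous_at)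
  then obtain F where F: "\<And>x. (F has_vector_derivative \<psi> x) (at x)" by auto
  have ftc: "(\<psi> has_integral F b - F a) {a..b}" if "a \<le> b" for a b
    using that F by (intro fundamental_theorem_of_calculus) (auto intro: has_vector_derivative_at_within)
  have const: "F b = F a" if "a \<le> b" "\<And>x. x \<in> {a..b} \<Longrightarrow> \<psi> x = 0" for a b
  proof -
    have "(\<psi> has_integral 0) {a..b}" by (rule has_integral_is_0) (rule that(2))
    from has_integral_unique[OF ftc[OF that(1)] this] show ?thesis by simp
  qed
  have s: "\<psi> x = 0" if "x \<notin> {c..d}" for x
  proof -
    have "x \<le> c \<or> d \<le> x" using that by auto
    then show ?thesis using cd(4,5) by blast
  qed
  have one: "locally_integrable_on (\<lambda>_. 1) {l<..<r}" by (rule locally_integrable_on_continuous) simp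
  have "(LINT x|lebesgue_on {l<..<r}. 1 * \<psi> x) = (LINT x|lebesgue. 1 * \<psi> x)" "integrable lebesgue (\<lambda>x. 1 * \<psi> x)"
    using integrable_times_compact_support[OF one cont cd(1,3)] s by blast+
  then have "(LINT x|lebesgue. \<psi> x) = 0" "integrable lebesgue \<psi>"
    using z by simp_all
  then have "integral {c..d} \<psi> = 0"
    using integral_compact_support(1)[of \<psi> c d, OF _ s] by metis
  then have Fd: "F d = F c"
    using integral_unique[OF ftc[of c d]] cd(2) by simp
  define \<phi> where "\<phi> x = F x - F c" for x
  have D: "(\<phi> has_real_derivative \<psi> x) (at x)" for x
    unfolding \<phi>_def using F[of x] by (auto simp: has_real_derivative_iff_has_vector_derivative intro!: derivative_eq_intros)
  show ?thesis
  proof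
    show "\<phi> \<in> test_functions {l<..<r}"
    proof (rule test_functionsI[where a = c and b = d])
      fix n show "ndiff UNIV n \<phi>"
        by (rule ndiff_mono[OF ndiff_SucI[OF open_UNIV D test_functionsD_ndiff[OF \<psi>, of n]]]) simp
    next
      fix x assume "x \<notin> {c..d}"
      then consider "x \<le> c" | "d \<le> x" by fastforce
      then have "F x = F c"
      proof cases
        case 1
        show ?thesis by (rule const[OF 1, symmetric]) (rule cd(4), simp)
      next
        case 2
        have "F x = F d" by (rule const[OF 2]) (rule cd(5), simp)
        then show ?thesis using Fd by (rule trans)
      qed
      then show "\<phi> x = 0" by (simp add: \<phi>_def)
    qed (use cd(1,3) in auto)
    show "deriv \<phi> = \<psi>" using DERIV_imp_deriv[OF D] by auto
  qed
qed

lemma test_functions_lincomb: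
  assumes "\<phi> \<in> test_functions {l<..<r}" "\<psi> \<in> test_functions {l<..<r}" "l < r"
  shows "(\<lambda>x. \<phi> x - k * \<psi> x) \<in> test_functions {l<..<r}"
proof -
  obtain c d where 1: "l < c" "c < d" "d < r" "\<And>x. x \<notin> {c..d} \<Longrightarrow> \<phi> x = 0"
    using test_functions_support[OF assms(1,3)] by metis
  obtain c' d' where 2: "l < c'" "c' < d'" "d' < r" "\<And>x. x \<notin> {c'..d'} \<Longrightarrow> \<psi> x = 0"
    using test_functions_support[OF assms(2,3)] by metis
  show ?thesis
  proof (rule test_functionsI[where a = "min c c'" and b = "max d d'"])
    show "ndiff UNIV n (\<lambda>x. \<phi> x - k * \<psi> x)" for n
      using test_functionsD_ndiff[OF assms(1), of n] test_functionsD_ndiff[OF assms(2), of n]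
      by (simp add: ndiff_diff ndiff_cmult)
    show "\<phi> x - k * \<psi> x = 0" if "x \<notin> {min c c'..max d d'}" for x
    proof -
      have "x \<notin> {c..d}" "x \<notin> {c'..d'}" using that by auto
      then show ?thesis using 1(4) 2(4) by simp
    qed
    show "{min c c'..max d d'} \<subseteq> {l<..<r}" using 1(1,3) 2(1,3) by auto
  qed
qed

text \<open>Subtracting a suitable multiple of a fixed \<eta> with nonzero integral gives any test
  function zero mean and hence makes it the derivative of a test function. The fundamental lemma
  then applies to h - c.\<close>

theorem du_Bois_Reymond:
  assumes h: "locally_integrable_on h {l<..<r}" and lr: "l < r"
    and z: "\<And>\<phi>. \<phi> \<in> test_functions {l<..<r} \<Longrightarrow> (LINT x|lebesgue_on {l<..<r}. h x * deriv \<phi> x) = 0"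
  shows "\<exists>c. AE x in lebesgue_on {l<..<r}. h x = c"
proof -
  let ?L = "lebesgue_on {l<..<r}"
  have one: "locally_integrable_on (\<lambda>_. 1) {l<..<r}" by (rule locally_integrable_on_continuous) simp
  have int: "integrable ?L (\<lambda>x. g x * \<phi> x)" if "locally_integrable_on g {l<..<r}" "\<phi> \<in> test_functions {l<..<r}" for g \<phi>
  proof -
    obtain c d where cd: "l < c" "c < d" "d < r" and z: "\<And>x. x \<notin> {c..d} \<Longrightarrow> \<phi> x = 0"
      using test_functions_support[OF \<open>\<phi> \<in> test_functions {l<..<r}\<close> lr] by metis
    show ?thesis
      by (rule integrable_times_compact_support(2)[OF that(1) test_functionsD(1)[OF that(2)] cd(1,3)]) (rule z)
  qed
  \<comment> \<open>Otherwise the constant 1 would vanish almost everywhere.\<close>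
  have "\<exists>\<eta>\<in>test_functions {l<..<r}. (LINT x|?L. \<eta> x) \<noteq> 0"
  proof (rule ccontr)
    assume "\<not> ?thesis"
    then have "AE x in ?L. (1::real) = 0"
      by (intro fundamental_lemma_variations[OF one]) auto
    then have "AE x in ?L. False" by simp
    then have "emeasure ?L (space ?L) = 0"
      by (subst (asm) AE_iff_measurable[OF sets.top]) auto
    then show False using lr by (simp add: emeasure_restrict_space)
  qed
  then obtain \<eta> where \<eta>: "\<eta> \<in> test_functions {l<..<r}" "(LINT x|?L. \<eta> x) \<noteq> 0" by blast
  \<comment> \<open>The value is forced: it makes h - c orthogonal to \<eta>.\<close>
  define c where "c = (LINT x|?L. h x * \<eta> x) / (LINT x|?L. \<eta> x)"
  have "AE x in ?L. h x - c * 1 = 0"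
  proof (rule fundamental_lemma_variations[OF locally_integrable_on_diff[OF h locally_integrable_on_cmult[OF one]]])
    fix \<psi> assume \<psi>: "\<psi> \<in> test_functions {l<..<r}"
    define k where "k = (LINT x|?L. \<psi> x) / (LINT x|?L. \<eta> x)"
    have \<psi>': "(\<lambda>x. \<psi> x - k * \<eta> x) \<in> test_functions {l<..<r}" by (rule test_functions_lincomb[OF \<psi> \<eta>(1) lr])
    note i = int[OF one \<psi>] int[OF one \<eta>(1)] int[OF h \<psi>] int[OF h \<eta>(1)]
    have "(LINT x|?L. \<psi> x - k * \<eta> x) = 0"
      using i(1,2) \<eta>(2) by (simp add: k_def)
    then obtain \<phi> where \<phi>: "\<phi> \<in> test_functions {l<..<r}" "deriv \<phi> = (\<lambda>x. \<psi> x - k * \<eta> x)"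
      using test_functions_antideriv[OF \<psi>' lr] by blast
    have "0 = (LINT x|?L. h x * (\<psi> x - k * \<eta> x))" using z[OF \<phi>(1)] \<phi>(2) by simp
    also have "\<dots> = (LINT x|?L. h x * \<psi> x - k * (h x * \<eta> x))" by (simp add: algebra_simps)
    also have "\<dots> = (LINT x|?L. h x * \<psi> x) - k * (LINT x|?L. h x * \<eta> x)" using i(3,4) by simp
    also have "\<dots> = (LINT x|?L. h x * \<psi> x) - c * (LINT x|?L. \<psi> x)" by (simp add: k_def c_def)
    also have "\<dots> = (LINT x|?L. h x * \<psi> x - c * \<psi> x)" using i(1,3) by simp
    finally show "(LINT x|?L. (h x - c * 1) * \<psi> x) = 0" by (simp add: left_diff_distrib)
  qed
  then have "AE x in ?L. h x = c" by eventually_elim simp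
  then show ?thesis ..
qed

section \<open>Weak solutions are classical\<close>

text \<open>|u| \<le> 1 + u^2, and the interval has finite measure.\<close>

lemma L2_space_integrable:
  assumes "u \<in> L2_space {l<..<r}"
  shows "integrable (lebesgue_on {l<..<r}) u"
proof (rule Bochner_Integration.integrable_bound[of _ "\<lambda>x. 1 + (u x)\<^sup>2"])
  have "finite_measure (lebesgue_on {l<..<r})" by (rule finite_measure_lebesgue_on) simp
  then have "integrable (lebesgue_on {l<..<r}) (\<lambda>_. 1::real)"
    by (rule finite_measure.integrable_const)
  then show "integrable (lebesgue_on {l<..<r}) (\<lambda>x. 1 + (u x)\<^sup>2)"
    using assms by (auto simp: L2_space_def)
  show "u \<in> borel_measurable (lebesgue_on {l<..<r})" using assms by (simp add: L2_space_def)
  show "AE x in lebesgue_on {l<..<r}. norm (u x) \<le> norm (1 + (u x)\<^sup>2)"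
  proof (rule AE_I2)
    fix x
    have "\<bar>u x\<bar> \<le> 1 + (u x)\<^sup>2"
      using zero_le_power2[of "\<bar>u x\<bar> - 1"] by (simp add: power2_diff) 
    then show "norm (u x) \<le> norm (1 + (u x)\<^sup>2)" by simp
  qed
qed

lemma L2_space_diff:
  assumes "u \<in> L2_space I" "v \<in> L2_space I"
  shows "(\<lambda>x. u x - v x) \<in> L2_space I"
proof -
  have m: "(\<lambda>x. u x - v x) \<in> borel_measurable (lebesgue_on I)" using assms by (auto simp: L2_space_def)
  have "integrable (lebesgue_on I) (\<lambda>x. (u x - v x)\<^sup>2)"
  proof (rule Bochner_Integration.integrable_bound[of _ "\<lambda>x. 2 * (u x)\<^sup>2 + 2 * (v x)\<^sup>2"])
    show "AE x in lebesgue_on I. norm ((u x - v x)\<^sup>2) \<le> norm (2 * (u x)\<^sup>2 + 2 * (v x)\<^sup>2)"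
    proof (rule AE_I2)
      fix x show "norm ((u x - v x)\<^sup>2) \<le> norm (2 * (u x)\<^sup>2 + 2 * (v x)\<^sup>2)"
      proof -
        have "(u x - v x)\<^sup>2 \<le> 2 * (u x)\<^sup>2 + 2 * (v x)\<^sup>2"
          using zero_le_power2[of "u x + v x"] by (simp add: power2_diff power2_sum)
        then show ?thesis by simp
      qed
    qed
  qed (use assms m in \<open>auto simp: L2_space_def\<close>)
  with m show ?thesis by (simp add: L2_space_def)
qed

lemma L2_space_bounded:
  assumes "u \<in> borel_measurable (lebesgue_on {l<..<r})" "\<And>x. x \<in> {l<..<r} \<Longrightarrow> \<bar>u x\<bar> \<le> B"
  shows "u \<in> L2_space {l<..<r}"
proof -
  have "finite_measure (lebesgue_on {l<..<r})" by (rule finite_measure_lebesgue_on) simp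
  then have c: "integrable (lebesgue_on {l<..<r}) (\<lambda>_. B\<^sup>2)"
    by (rule finite_measure.integrable_const)
  have "integrable (lebesgue_on {l<..<r}) (\<lambda>x. (u x)\<^sup>2)"
  proof (rule Bochner_Integration.integrable_bound[OF c])
    show "AE x in lebesgue_on {l<..<r}. norm ((u x)\<^sup>2) \<le> norm (B\<^sup>2)"
    proof (rule AE_I2)
      fix x assume "x \<in> space (lebesgue_on {l<..<r})"
      then have "\<bar>u x\<bar> \<le> \<bar>B\<bar>" using assms(2)[of x] by auto
      then show "norm ((u x)\<^sup>2) \<le> norm (B\<^sup>2)" by (simp add: abs_le_square_iff)
    qed
  qed (use assms(1) in auto)
  then show ?thesis using assms(1) by (simp add: L2_space_def)
qed

text \<open>Young's inequality with weight \<delta> takes the place of the Cauchy-Schwarz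
  inequality; the interval has length 2.\<close>

lemma integral_abs_le_of_L2_norm:
  assumes h: "h \<in> L2_space {-1<..<1}" and n: "L2_norm {-1<..<1} h \<le> \<delta>" and d: "0 < \<delta>"
  shows "(LINT x|lebesgue_on {-1<..<1}. \<bar>h x\<bar>) \<le> 2 * \<delta>"
proof -
  let ?L = "lebesgue_on {-1<..<1::real}"
  have fin: "finite_measure ?L" by (rule finite_measure_lebesgue_on) simp
  have ci: "integrable ?L (\<lambda>x. \<delta> / 2)" by (rule finite_measure.integrable_const[OF fin])
  have sq: "integrable ?L (\<lambda>x. (h x)\<^sup>2)" using h by (simp add: L2_space_def)
  have "(LINT x|?L. (h x)\<^sup>2) \<le> \<delta>\<^sup>2"
    using n d real_sqrt_le_iff[of "LINT x|?L. (h x)\<^sup>2" "\<delta>\<^sup>2"] by (simp add: L2_norm_def)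
  have "(LINT x|?L. \<bar>h x\<bar>) \<le> (LINT x|?L. \<delta> / 2 + (h x)\<^sup>2 / (2 * \<delta>))"
  proof (rule integral_mono)
    show "integrable ?L (\<lambda>x. \<bar>h x\<bar>)" using L2_space_integrable[OF h] by auto
    show "integrable ?L (\<lambda>x. \<delta> / 2 + (h x)\<^sup>2 / (2 * \<delta>))"
      by (intro Bochner_Integration.integrable_add ci) (use sq in auto)
    fix x
    show "\<bar>h x\<bar> \<le> \<delta> / 2 + (h x)\<^sup>2 / (2 * \<delta>)"
      using zero_le_power2[of "\<bar>h x\<bar> - \<delta>"] d by (simp add: power2_diff field_simps power2_eq_square)
  qed
  also have "\<dots> = (LINT x|?L. \<delta> / 2) + (LINT x|?L. (h x)\<^sup>2) / (2 * \<delta>)"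
    by (subst Bochner_Integration.integral_add) (use sq ci in auto)
  also have "(LINT x|?L. \<delta> / 2) = \<delta>"
    by (simp add: measure_restrict_space)
  also have "\<delta> + (LINT x|?L. (h x)\<^sup>2) / (2 * \<delta>) \<le> \<delta> + \<delta>\<^sup>2 / (2 * \<delta>)"
    using \<open>_ \<le> \<delta>\<^sup>2\<close> d by (intro add_left_mono divide_right_mono) auto
  also have "\<dots> \<le> 2 * \<delta>" using d by (simp add: power2_eq_square)
  finally show ?thesis .
qed

lemma has_weak_deriv_diff:
  assumes u: "has_weak_deriv {l<..<r} u g" and v: "has_weak_deriv {l<..<r} v h" and lr: "l < r"
  shows "has_weak_deriv {l<..<r} (\<lambda>x. u x - v x) (\<lambda>x. g x - h x)"
  unfolding has_weak_deriv_def
proof (intro conjI ballI)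
  have li: "locally_integrable_on u {l<..<r}" "locally_integrable_on v {l<..<r}"
      "locally_integrable_on g {l<..<r}" "locally_integrable_on h {l<..<r}"
    using u v by (auto simp: has_weak_deriv_def)
  then show "locally_integrable_on (\<lambda>x. u x - v x) {l<..<r}" "locally_integrable_on (\<lambda>x. g x - h x) {l<..<r}"
    by (auto intro: locally_integrable_on_diff)
  fix \<phi> assume \<phi>: "\<phi> \<in> test_functions {l<..<r}"
  obtain c d where cd: "l < c" "c < d" "d < r" and z: "\<And>x. x \<le> c \<Longrightarrow> \<phi> x = 0" "\<And>x. d \<le> x \<Longrightarrow> \<phi> x = 0"
    by (rule test_functions_support'[OF \<phi> lr]) blast
  have s: "\<phi> x = 0" if "x \<notin> {c..d}" for x
  proof -
    have "x \<le> c \<or> d \<le> x" using that by auto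
    then show ?thesis using z by blast
  qed
  have s': "deriv \<phi> x = 0" if "x \<notin> {c..d}" for x
    using that by (intro test_functions_deriv_support[OF z]) (auto simp: not_le)
  have i: "integrable (lebesgue_on {l<..<r}) (\<lambda>x. w x * \<phi> x)" if "locally_integrable_on w {l<..<r}" for w
    by (rule integrable_times_compact_support(2)[OF that test_functionsD(1)[OF \<phi>] cd(1,3)]) (rule s)
  have i': "integrable (lebesgue_on {l<..<r}) (\<lambda>x. w x * deriv \<phi> x)" if "locally_integrable_on w {l<..<r}" for w
    by (rule integrable_times_compact_support(2)[OF that test_functionsD(2)[OF \<phi>] cd(1,3)]) (rule s')
  have "(LINT x|lebesgue_on {l<..<r}. u x * deriv \<phi> x) = - (LINT x|lebesgue_on {l<..<r}. g x * \<phi> x)"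
    "(LINT x|lebesgue_on {l<..<r}. v x * deriv \<phi> x) = - (LINT x|lebesgue_on {l<..<r}. h x * \<phi> x)"
    using u v \<phi> by (auto simp: has_weak_deriv_def)
  then show "(LINT x|lebesgue_on {l<..<r}. (u x - v x) * deriv \<phi> x) = - (LINT x|lebesgue_on {l<..<r}. (g x - h x) * \<phi> x)"
    using i[OF li(3)] i[OF li(4)] i'[OF li(1)] i'[OF li(2)] by (simp add: left_diff_distrib)
qed

lemma continuous_borel_measurable_lebesgue_on: "continuous_on UNIV f \<Longrightarrow> f \<in> borel_measurable (lebesgue_on S)" for f :: "real \<Rightarrow> real"
  by (intro measurable_restrict_space1 continuous_measurable_lebesgue)

lemma bounded_of_compact_support:
  fixes \<psi> :: "real \<Rightarrow> real"
  assumes "continuous_on UNIV \<psi>" "\<And>x. x \<notin> {c..d} \<Longrightarrow> \<psi> x = 0"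
  obtains B where "\<And>x. \<bar>\<psi> x\<bar> \<le> B"
proof -
  have "bounded (\<psi> ` {c..d})"
    by (intro compact_imp_bounded compact_continuous_image continuous_on_subset[OF assms(1)]) auto
  then obtain B where B: "\<forall>y\<in>\<psi> ` {c..d}. \<bar>y\<bar> \<le> B" unfolding bounded_iff by auto
  have "\<bar>\<psi> x\<bar> \<le> max B 0" for x
    using B assms(2)[of x] by (cases "x \<in> {c..d}") (auto simp: le_max_iff_disj)
  then show ?thesis by (rule that)
qed

lemma test_functions_H1:
  assumes \<phi>: "\<phi> \<in> test_functions {l<..<r}" and lr: "l < r"
  shows "has_weak_deriv {l<..<r} \<phi> (deriv \<phi>)" "\<phi> \<in> L2_space {l<..<r}" "deriv \<phi> \<in> L2_space {l<..<r}"
proof -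
  show "has_weak_deriv {l<..<r} \<phi> (deriv \<phi>)"
  proof (rule has_weak_deriv_piecewise[where S = "{}"])
    show "continuous_on {l<..<r} \<phi>" using test_functionsD(1)[OF \<phi>] continuous_on_subset by blast
    show "locally_integrable_on (deriv \<phi>) {l<..<r}"
      by (rule locally_integrable_on_continuous) (use test_functionsD(2)[OF \<phi>] continuous_on_subset in blast)
  qed (use lr test_functionsD(3)[OF \<phi>] in auto)
  obtain c d where cd: "l < c" "c < d" "d < r" and z: "\<And>x. x \<le> c \<Longrightarrow> \<phi> x = 0" "\<And>x. d \<le> x \<Longrightarrow> \<phi> x = 0"
    by (rule test_functions_support'[OF \<phi> lr]) blast
  have s: "\<phi> x = 0" if "x \<notin> {c..d}" for x
  proof -
    have "x \<le> c \<or> d \<le> x" using that by auto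
    then show ?thesis using z by blast
  qed
  have s': "deriv \<phi> x = 0" if "x \<notin> {c..d}" for x
    using that by (intro test_functions_deriv_support[OF z]) (auto simp: not_le)
  obtain B where "\<And>x. \<bar>\<phi> x\<bar> \<le> B" by (rule bounded_of_compact_support[OF test_functionsD(1)[OF \<phi>] s]) blast+
  then show "\<phi> \<in> L2_space {l<..<r}"
    by (intro L2_space_bounded[of _ _ _ B] continuous_borel_measurable_lebesgue_on test_functionsD(1)[OF \<phi>])
  obtain B' where "\<And>x. \<bar>deriv \<phi> x\<bar> \<le> B'" by (rule bounded_of_compact_support[OF test_functionsD(2)[OF \<phi>] s']) blast+
  then show "deriv \<phi> \<in> L2_space {l<..<r}"
    by (intro L2_space_bounded[of _ _ _ B'] continuous_borel_measurable_lebesgue_on test_functionsD(2)[OF \<phi>])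
qed

lemma has_weak_deriv_zero: "has_weak_deriv I (\<lambda>_. 0) (\<lambda>_. 0)"
  by (auto simp: has_weak_deriv_def locally_integrable_on_def)

lemma test_functions_H10:
  assumes \<phi>: "\<phi> \<in> test_functions {l<..<r}" and lr: "l < r"
  shows "\<phi> \<in> H10_space {l<..<r}"
proof -
  have "AE x in lebesgue_on {l<..<r}. weak_deriv {l<..<r} (\<lambda>_. 0) x = 0"
    by (rule has_weak_deriv_weak_deriv(2)[OF has_weak_deriv_zero lr])
  then have "(LINT x|lebesgue_on {l<..<r}. (weak_deriv {l<..<r} (\<lambda>_. 0) x)\<^sup>2) = 0"
    by (intro integral_eq_zero_AE) (auto elim: eventually_mono)
  then have "H1_norm {l<..<r} (\<lambda>x. \<phi> x - \<phi> x) = 0"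
    by (simp add: H1_norm_def L2_norm_def)
  then show ?thesis
    using test_functions_H1[OF assms] \<phi> unfolding H10_space_def H1_space_def by force
qed

lemma L2_norm_le_H1_norm: "L2_norm I u \<le> H1_norm I u" "L2_norm I (weak_deriv I u) \<le> H1_norm I u"
  by (auto simp: H1_norm_def intro!: real_le_rsqrt)

lemma L2_norm_cong_AE:
  assumes "AE x in lebesgue_on I. f x = g x" "f \<in> borel_measurable (lebesgue_on I)" "g \<in> borel_measurable (lebesgue_on I)"
  shows "L2_norm I f = L2_norm I g"
  unfolding L2_norm_def
  by (intro arg_cong[of _ _ sqrt] integral_cong_AE) (use assms in \<open>auto elim: eventually_mono\<close>)

text \<open>Let U be the primitive of the weak derivative g that vanishes at -1. If a test function
  \<phi> is close to u in the H^1 norm, its derivative is close to g in the mean, so \<phi> is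
  uniformly close to U and close to u in the mean. Hence u = U almost everywhere, and the value 0 of
  \<phi> at 1 passes to U.\<close>

lemma H10_representative:
  assumes u: "u \<in> H10_space {-1<..<1}"
  obtains g where "g \<in> L2_space {-1<..<1}" "has_weak_deriv {-1<..<1} u g"
    "AE x in lebesgue_on {-1<..<1}. u x = integral {-1..x} g" "integral {-1..1} g = 0"
    "g integrable_on {-1..1}"
proof -
  let ?I = "{-1<..<1::real}" let ?L = "lebesgue_on ?I"
  obtain g where uL: "u \<in> L2_space ?I" and g: "g \<in> L2_space ?I" "has_weak_deriv ?I u g"
    using u by (auto simp: H10_space_def H1_space_def)
  have gint: "integrable ?L g" by (rule L2_space_integrable[OF g(1)])
  have gi: "g integrable_on {-1..1}"
    using integrable_on_lebesgue_on[OF gint] integrable_on_Icc_iff_Ioo by auto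
  define U where "U x = integral {-1..x} g" for x
  have Ucont: "continuous_on {-1..1} U"
    unfolding U_def by (rule indefinite_integral_continuous_1[OF gi])
  have approx: "\<exists>\<phi>. (LINT x|?L. \<bar>u x - \<phi> x\<bar>) \<le> 2 * \<delta> \<and> (\<forall>x\<in>{-1..1}. \<bar>U x - \<phi> x\<bar> \<le> 2 * \<delta>) \<and> \<phi> 1 = 0
      \<and> continuous_on UNIV \<phi> \<and> integrable ?L (\<lambda>x. \<bar>u x - \<phi> x\<bar>)"
    if d: "\<delta> > 0" for \<delta>
  proof -
    obtain \<phi> where \<phi>: "\<phi> \<in> test_functions ?I" "H1_norm ?I (\<lambda>x. u x - \<phi> x) < \<delta>"
      using u d by (auto simp: H10_space_def)
    note T = test_functions_H1[OF \<phi>(1), simplified]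
    have wd: "has_weak_deriv ?I (\<lambda>x. u x - \<phi> x) (\<lambda>x. g x - deriv \<phi> x)"
      by (rule has_weak_deriv_diff[OF g(2) T(1)]) simp
    have uphi: "(\<lambda>x. u x - \<phi> x) \<in> L2_space ?I" by (rule L2_space_diff[OF uL T(2)])
    have gphi: "(\<lambda>x. g x - deriv \<phi> x) \<in> L2_space ?I" by (rule L2_space_diff[OF g(1) T(3)])
    have wm: "weak_deriv ?I (\<lambda>x. u x - \<phi> x) \<in> borel_measurable ?L"
      using has_weak_deriv_weak_deriv(1)[OF wd] by (intro locally_integrable_on_measurable) (auto simp: has_weak_deriv_def)
    \<comment> \<open>The H^1 norm is defined through an arbitrary representative of the weak
      derivative; uniqueness transfers it to the concrete one.\<close>
    have "L2_norm ?I (weak_deriv ?I (\<lambda>x. u x - \<phi> x)) = L2_norm ?I (\<lambda>x. g x - deriv \<phi> x)"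
      by (rule L2_norm_cong_AE[OF has_weak_deriv_weak_deriv(2)[OF wd] wm]) (use gphi in \<open>auto simp: L2_space_def\<close>)
    then have "L2_norm ?I (\<lambda>x. g x - deriv \<phi> x) \<le> \<delta>"
      using L2_norm_le_H1_norm(2)[of ?I "\<lambda>x. u x - \<phi> x"] \<phi>(2) by simp
    note 1 = integral_abs_le_of_L2_norm[OF gphi this d]
    have "L2_norm ?I (\<lambda>x. u x - \<phi> x) \<le> \<delta>"
      using L2_norm_le_H1_norm(1)[of ?I "\<lambda>x. u x - \<phi> x"] \<phi>(2) by simp
    note 2 = integral_abs_le_of_L2_norm[OF uphi this d]
    obtain c e where cd: "-1 < c" "c < e" "e < 1" and z: "\<And>x. x \<le> c \<Longrightarrow> \<phi> x = 0" "\<And>x. e \<le> x \<Longrightarrow> \<phi> x = 0"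
      by (rule test_functions_support'[OF \<phi>(1)]) (simp, blast)
    have p1: "\<phi> 1 = 0" by (rule z(2)) (use cd in simp)
    have pm1: "\<phi> (-1) = 0" by (rule z(1)) (use cd in simp)
    have absint: "integrable ?L (\<lambda>x. \<bar>g x - deriv \<phi> x\<bar>)" using L2_space_integrable[OF gphi] by auto
    have hi: "((\<lambda>x. \<bar>g x - deriv \<phi> x\<bar>) has_integral (LINT x|?L. \<bar>g x - deriv \<phi> x\<bar>)) {-1..1}"
      using has_integral_integral_lebesgue_on[OF absint] has_integral_Icc_iff_Ioo by auto
    have Uphi: "\<bar>U x - \<phi> x\<bar> \<le> 2 * \<delta>" if x: "x \<in> {-1..1}" for x
    proof -
      have sub: "{-1..x} \<subseteq> {-1..1}" using x by auto
      have "(deriv \<phi> has_integral (\<phi> x - \<phi> (-1))) {-1..x}"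
        using x test_functionsD(3)[OF \<phi>(1)] by (intro fundamental_theorem_of_calculus)
          (auto simp: has_real_derivative_iff_has_vector_derivative intro: has_vector_derivative_at_within)
      moreover have gx: "(g has_integral U x) {-1..x}"
        unfolding U_def using integrable_on_subinterval[OF gi sub] by (rule integrable_integral)
      ultimately have h: "((\<lambda>t. g t - deriv \<phi> t) has_integral (U x - \<phi> x)) {-1..x}"
        using pm1 has_integral_diff[of g "U x" "{-1..x}" "deriv \<phi>" "\<phi> x - \<phi> (-1)"] by simp
      have ai: "(\<lambda>t. \<bar>g t - deriv \<phi> t\<bar>) integrable_on {-1..x}"
        by (rule integrable_on_subinterval[OF has_integral_integrable[OF hi] sub])
      have "\<bar>U x - \<phi> x\<bar> \<le> integral {-1..x} (\<lambda>t. \<bar>g t - deriv \<phi> t\<bar>)"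
        using integral_norm_bound_integral[OF has_integral_integrable[OF h] ai] integral_unique[OF h] by simp
      also have "\<dots> \<le> integral {-1..1} (\<lambda>t. \<bar>g t - deriv \<phi> t\<bar>)"
        by (rule integral_subset_le[OF sub ai has_integral_integrable[OF hi]]) simp
      also have "\<dots> \<le> 2 * \<delta>" using 1 integral_unique[OF hi] by simp
      finally show ?thesis .
    qed
    show ?thesis
      using 2 Uphi p1 test_functionsD(1)[OF \<phi>(1)] L2_space_integrable[OF uphi] by (intro exI[of _ \<phi>]) auto
  qed
  have U1: "U 1 = 0"
  proof (rule ccontr)
    assume "U 1 \<noteq> 0"
    then obtain \<phi> where "\<forall>x\<in>{-1..1}. \<bar>U x - \<phi> x\<bar> \<le> 2 * (\<bar>U 1\<bar> / 4)" "\<phi> 1 = 0"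
      using approx[of "\<bar>U 1\<bar> / 4"] by auto
    from bspec[OF this(1), of 1] this(2) have "\<bar>U 1 - 0\<bar> \<le> \<bar>U 1\<bar> / 2" by simp
    with \<open>U 1 \<noteq> 0\<close> show False by simp
  qed
  have Um: "U \<in> borel_measurable ?L"
  proof -
    have "U \<in> borel_measurable (lebesgue_on {-1..1})"
      by (rule borel_measurable_integrable)
        (use locally_integrable_on_continuous[OF Ucont] in \<open>auto simp: locally_integrable_on_def\<close>)
    then show ?thesis by (rule measurable_restrict_mono) auto
  qed
  have Ubd: "\<exists>B. \<forall>x\<in>{-1..1}. \<bar>U x\<bar> \<le> B"
  proof -
    have "bounded (U ` {-1..1})" by (intro compact_imp_bounded compact_continuous_image Ucont) simp
    then show ?thesis by (auto simp: bounded_iff)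
  qed
  have UL: "U \<in> L2_space ?I"
  proof -
    obtain B where "\<forall>x\<in>{-1..1}. \<bar>U x\<bar> \<le> B" using Ubd by blast
    then show ?thesis by (intro L2_space_bounded[OF Um, of B]) auto
  qed
  have uU: "integrable ?L (\<lambda>x. \<bar>u x - U x\<bar>)"
    using L2_space_integrable[OF L2_space_diff[OF uL UL]] by auto
  have le: "(LINT x|?L. \<bar>u x - U x\<bar>) \<le> 6 * \<delta>" if d: "\<delta> > 0" for \<delta>
  proof -
    obtain \<phi> where \<phi>: "(LINT x|?L. \<bar>u x - \<phi> x\<bar>) \<le> 2 * \<delta>" "\<forall>x\<in>{-1..1}. \<bar>U x - \<phi> x\<bar> \<le> 2 * \<delta>"
        "integrable ?L (\<lambda>x. \<bar>u x - \<phi> x\<bar>)"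
      using approx[OF d] by blast
    have fin: "finite_measure ?L" by (rule finite_measure_lebesgue_on) simp
    have ci: "integrable ?L (\<lambda>x. 2 * \<delta>)" by (rule finite_measure.integrable_const[OF fin])
    have "(LINT x|?L. \<bar>u x - U x\<bar>) \<le> (LINT x|?L. \<bar>u x - \<phi> x\<bar> + 2 * \<delta>)"
    proof (rule integral_mono[OF uU])
      show "integrable ?L (\<lambda>x. \<bar>u x - \<phi> x\<bar> + 2 * \<delta>)" using \<phi>(3) ci by auto
      fix x assume "x \<in> space ?L"
      then have "x \<in> {-1..1}" by simp
      then have "\<bar>U x - \<phi> x\<bar> \<le> 2 * \<delta>" using \<phi>(2) by blast
      then show "\<bar>u x - U x\<bar> \<le> \<bar>u x - \<phi> x\<bar> + 2 * \<delta>" by linarith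
    qed
    also have "\<dots> = (LINT x|?L. \<bar>u x - \<phi> x\<bar>) + (LINT x|?L. 2 * \<delta>)" using \<phi>(3) ci by simp
    also have "(LINT x|?L. 2 * \<delta>) = 4 * \<delta>" by (simp add: measure_restrict_space)
    finally show ?thesis using \<phi>(1) by linarith
  qed
  have "(LINT x|?L. \<bar>u x - U x\<bar>) \<le> 0"
  proof (rule ccontr)
    assume "\<not> ?thesis"
    then show False using le[of "(LINT x|?L. \<bar>u x - U x\<bar>) / 12"] by simp
  qed
  then have "(LINT x|?L. \<bar>u x - U x\<bar>) = 0" by (intro antisym) auto
  then have "AE x in ?L. \<bar>u x - U x\<bar> = 0"
    using integral_nonneg_eq_0_iff_AE[OF uU] by simp
  then have "AE x in ?L. u x = U x" by eventually_elim simp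
  then show ?thesis using that[OF g] U1 gi unfolding U_def by blast
qed

lemma integral_has_real_derivative_interior:
  fixes f :: "real \<Rightarrow> real"
  assumes "f integrable_on {a..b}" "continuous_on {a<..<b} f" "x \<in> {a<..<b}"
  shows "((\<lambda>x. integral {a..x} f) has_real_derivative f x) (at x)"
proof -
  have x: "x \<in> interior {a..b}" using assms(3) by (simp add: interior_atLeastAtMost_real)
  have "continuous (at x) f"
    using assms(2,3) by (auto simp: continuous_on_eq_continuous_at)
  then have "continuous (at x within {a..b} - {}) f"
    by (rule continuous_at_imp_continuous_at_within)
  from integral_has_vector_derivative_continuous_at[OF assms(1) _ _ this]
  have "((\<lambda>x. integral {a..x} f) has_vector_derivative f x) (at x within {a..b})"
    using assms(3) by auto
  then show ?thesis
    using at_within_interior[OF x] by (simp add: has_real_derivative_iff_has_vector_derivative)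
qed

lemma AE_lebesgue_on_negligible:
  fixes l r :: real
  assumes "AE x in lebesgue_on {l<..<r}. P x"
  obtains N where "negligible N" "\<And>x. x \<in> {l..r} - N \<Longrightarrow> P x"
proof -
  have "AE x in lebesgue. x \<in> {l<..<r} \<longrightarrow> P x"
    using assms by (subst (asm) AE_restrict_space_iff) (auto intro: sets_completionI_sets)
  then obtain N where N: "N \<in> null_sets lebesgue" "{x \<in> space lebesgue. \<not> (x \<in> {l<..<r} \<longrightarrow> P x)} \<subseteq> N"
    unfolding eventually_ae_filter by blast
  have "negligible (N \<union> {l, r})"
    using N(1) by (simp add: negligible_iff_null_sets null_sets.Un)
  moreover have "P x" if "x \<in> {l..r} - (N \<union> {l, r})" for x
  proof -
    have "x \<in> {l<..<r}" "x \<notin> N" using that by (auto simp: less_le)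
    then show ?thesis using N(2) by auto
  qed
  ultimately show ?thesis by (rule that)
qed

text \<open>With k a primitive of b U - f, testing with \<phi> and integrating by parts shows that
  \<epsilon>^2 g - k is orthogonal to all derivatives of test functions. It is therefore constant,
  which makes g continuous up to a null set and U twice differentiable.\<close>

theorem weak_solution_classical:
  assumes ws: "weak_solution \<epsilon> b f u" and e: "0 < \<epsilon>"
    and b: "continuous_on {-1<..<1} b" "\<And>x. x \<in> {-1<..<1} \<Longrightarrow> \<bar>b x\<bar> \<le> Bb"
    and f: "continuous_on {-1<..<1} f" "\<And>x. x \<in> {-1<..<1} \<Longrightarrow> \<bar>f x\<bar> \<le> Bf"
  obtains U U' where "continuous_on {-1..1} U" "U (-1) = 0" "U 1 = 0"
    "\<And>x. x \<in> {-1<..<1} \<Longrightarrow> (U has_real_derivative U' x) (at x)"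
    "\<And>x. x \<in> {-1<..<1} \<Longrightarrow> (U' has_real_derivative (b x * U x - f x) / \<epsilon>\<^sup>2) (at x)"
    "AE x in lebesgue_on {-1<..<1}. u x = U x"
    "AE x in lebesgue_on {-1<..<1}. weak_deriv {-1<..<1} u x = U' x"
    "u \<in> borel_measurable (lebesgue_on {-1<..<1})"
proof -
  let ?I = "{-1<..<1::real}" let ?L = "lebesgue_on ?I"
  have uH: "u \<in> H10_space ?I" using ws by (simp add: weak_solution_def Let_def)
  obtain g where g: "g \<in> L2_space ?I" "has_weak_deriv ?I u g"
    "AE x in ?L. u x = integral {-1..x} g" "integral {-1..1} g = 0" "g integrable_on {-1..1}"
    by (rule H10_representative[OF uH])
  define U where "U x = integral {-1..x} g" for x
  have uU: "AE x in ?L. u x = U x" using g(3) by (simp add: U_def)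
  have Ucont: "continuous_on {-1..1} U"
    unfolding U_def by (rule indefinite_integral_continuous_1[OF g(5)])
  then have UcontI: "continuous_on ?I U" by (rule continuous_on_subset) auto
  have "bounded (U ` {-1..1})" by (intro compact_imp_bounded compact_continuous_image Ucont) simp
  then obtain BU where BU: "\<forall>x\<in>{-1..1}. \<bar>U x\<bar> \<le> BU" by (auto simp: bounded_iff)
  have meas: "w \<in> borel_measurable ?L" if "continuous_on ?I w" for w :: "real \<Rightarrow> real"
    by (rule locally_integrable_on_measurable[OF locally_integrable_on_continuous[OF that]])
  note gw = has_weak_deriv_weak_deriv[OF g(2), simplified]
  define R where "R x = b x * U x - f x" for x
  have Rcont: "continuous_on ?I R"
    unfolding R_def by (intro continuous_intros b f UcontI)
  have Rbd: "\<bar>R x\<bar> \<le> Bb * BU + Bf" if x: "x \<in> ?I" for x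
  proof -
    have "\<bar>b x * U x\<bar> \<le> Bb * BU"
      unfolding abs_mult using b(2)[OF x] BU x by (intro mult_mono) auto
    then show ?thesis using f(2)[OF x] unfolding R_def by linarith
  qed
  have Rint: "integrable ?L R"
    by (rule L2_space_integrable[OF L2_space_bounded[OF meas[OF Rcont] Rbd]])
  have Ri: "R integrable_on {-1..1}"
    using integrable_on_lebesgue_on[OF Rint] integrable_on_Icc_iff_Ioo by auto
  define k where "k x = integral {-1..x} R" for x
  have kcont: "continuous_on {-1..1} k"
    unfolding k_def by (rule indefinite_integral_continuous_1[OF Ri])
  then have kcontI: "continuous_on ?I k" by (rule continuous_on_subset) auto
  have kd: "(k has_real_derivative R x) (at x)" if "x \<in> ?I" for x
    unfolding k_def by (rule integral_has_real_derivative_interior[OF Ri Rcont that])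
  have kw: "has_weak_deriv ?I k R"
    by (rule has_weak_deriv_piecewise[where S = "{}"])
      (use kcontI kd locally_integrable_on_continuous[OF Rcont] in auto)
  have gli: "locally_integrable_on g ?I" using g(2) by (simp add: has_weak_deriv_def)
  have h: "locally_integrable_on (\<lambda>x. \<epsilon>\<^sup>2 * g x - k x) ?I"
    by (intro locally_integrable_on_diff locally_integrable_on_cmult gli locally_integrable_on_continuous kcontI)
  have "\<exists>c. AE x in ?L. \<epsilon>\<^sup>2 * g x - k x = c"
  proof (rule du_Bois_Reymond[OF h])
    fix \<phi> assume \<phi>: "\<phi> \<in> test_functions ?I"
    obtain c d where cd: "-1 < c" "c < d" "d < 1" and z: "\<And>x. x \<le> c \<Longrightarrow> \<phi> x = 0" "\<And>x. d \<le> x \<Longrightarrow> \<phi> x = 0"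
      by (rule test_functions_support'[OF \<phi>]) (simp, blast)
    have s: "\<phi> x = 0" if "x \<notin> {c..d}" for x
    proof -
      have "x \<le> c \<or> d \<le> x" using that by auto
      then show ?thesis using z by blast
    qed
    have s': "deriv \<phi> x = 0" if "x \<notin> {c..d}" for x
      using that by (intro test_functions_deriv_support[OF z]) (auto simp: not_le)
    have i: "integrable ?L (\<lambda>x. w x * \<phi> x)" if "locally_integrable_on w ?I" for w
      by (rule integrable_times_compact_support(2)[OF that test_functionsD(1)[OF \<phi>] cd(1,3)]) (rule s)
    have i': "integrable ?L (\<lambda>x. w x * deriv \<phi> x)" if "locally_integrable_on w ?I" for w
      by (rule integrable_times_compact_support(2)[OF that test_functionsD(2)[OF \<phi>] cd(1,3)]) (rule s')
    note T = test_functions_H1[OF \<phi>, simplified]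
    note Tw = has_weak_deriv_weak_deriv[OF T(1), simplified]
    have lis: "locally_integrable_on (\<lambda>x. b x * U x) ?I" "locally_integrable_on f ?I"
       "locally_integrable_on k ?I" "locally_integrable_on R ?I"
      by (intro locally_integrable_on_continuous continuous_intros b f UcontI kcontI Rcont)+
    have "(LINT x|?L. \<epsilon>\<^sup>2 * weak_deriv ?I u x * weak_deriv ?I \<phi> x + b x * u x * \<phi> x) = (LINT x|?L. f x * \<phi> x)"
      using ws test_functions_H10[OF \<phi>] by (simp add: weak_solution_def Let_def)
    moreover have "(LINT x|?L. \<epsilon>\<^sup>2 * weak_deriv ?I u x * weak_deriv ?I \<phi> x + b x * u x * \<phi> x) =
      (LINT x|?L. \<epsilon>\<^sup>2 * (g x * deriv \<phi> x) + b x * U x * \<phi> x)"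
    proof (rule integral_cong_AE)
      have m: "weak_deriv ?I u \<in> borel_measurable ?L" "weak_deriv ?I \<phi> \<in> borel_measurable ?L"
        "u \<in> borel_measurable ?L" "g \<in> borel_measurable ?L"
        using gw(1) Tw(1) g(2) by (auto intro!: locally_integrable_on_measurable simp: has_weak_deriv_def)
      have m': "b \<in> borel_measurable ?L" "U \<in> borel_measurable ?L" "\<phi> \<in> borel_measurable ?L" "deriv \<phi> \<in> borel_measurable ?L"
        using test_functionsD(1,2)[OF \<phi>] continuous_on_subset by (auto intro!: meas b UcontI)
      show "(\<lambda>x. \<epsilon>\<^sup>2 * weak_deriv ?I u x * weak_deriv ?I \<phi> x + b x * u x * \<phi> x) \<in> borel_measurable ?L"
        "(\<lambda>x. \<epsilon>\<^sup>2 * (g x * deriv \<phi> x) + b x * U x * \<phi> x) \<in> borel_measurable ?L"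
        by (intro borel_measurable_add borel_measurable_times borel_measurable_const m m')+
      show "AE x in ?L. \<epsilon>\<^sup>2 * weak_deriv ?I u x * weak_deriv ?I \<phi> x + b x * u x * \<phi> x =
        \<epsilon>\<^sup>2 * (g x * deriv \<phi> x) + b x * U x * \<phi> x"
        using gw(2) Tw(2) uU by eventually_elim simp
    qed
    moreover have "\<dots> = \<epsilon>\<^sup>2 * (LINT x|?L. g x * deriv \<phi> x) + (LINT x|?L. b x * U x * \<phi> x)"
      using i[OF lis(1)] i'[OF gli] by simp
    moreover have "(LINT x|?L. R x * \<phi> x) = (LINT x|?L. b x * U x * \<phi> x) - (LINT x|?L. f x * \<phi> x)"
      unfolding R_def left_diff_distrib using i[OF lis(1)] i[OF lis(2)] by simp
    moreover have "(LINT x|?L. k x * deriv \<phi> x) = - (LINT x|?L. R x * \<phi> x)"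
      using kw \<phi> by (simp add: has_weak_deriv_def)
    ultimately have "\<epsilon>\<^sup>2 * (LINT x|?L. g x * deriv \<phi> x) - (LINT x|?L. k x * deriv \<phi> x) = 0" by simp
    then show "(LINT x|?L. (\<epsilon>\<^sup>2 * g x - k x) * deriv \<phi> x) = 0"
      using i'[OF gli] i'[OF lis(3)] by (simp add: left_diff_distrib mult.assoc)
  qed simp
  then obtain c where c: "AE x in ?L. \<epsilon>\<^sup>2 * g x - k x = c" ..
  \<comment> \<open>The continuous representative of g. Its integral is still U, so that U is
    differentiable at every interior point and not only almost everywhere.\<close>
  define U' where "U' x = (k x + c) / \<epsilon>\<^sup>2" for x
  have gU': "AE x in ?L. g x = U' x"
    using c by eventually_elim (use e in \<open>simp add: U'_def field_simps\<close>)
  have U'cont: "continuous_on {-1..1} U'"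
    unfolding U'_def using e by (intro continuous_intros kcont) auto
  have U'i: "U' integrable_on {-1..1}" by (rule integrable_continuous_real[OF U'cont])
  obtain N where N: "negligible N" "\<And>x. x \<in> {-1..1} - N \<Longrightarrow> g x = U' x"
    using AE_lebesgue_on_negligible[OF gU'] by blast
  have UU': "U x = integral {-1..x} U'" if "x \<in> {-1..1}" for x
    unfolding U_def by (rule integral_spike[OF N(1)]) (use that N(2) in auto)
  show ?thesis
  proof (rule that[OF Ucont])
    show "U (-1) = 0" by (simp add: U_def)
    show "U 1 = 0" using g(4) by (simp add: U_def)
    show "(U has_real_derivative U' x) (at x)" if x: "x \<in> ?I" for x
    proof -
      have "((\<lambda>x. integral {-1..x} U') has_real_derivative U' x) (at x)"
        by (rule integral_has_real_derivative_interior[OF U'i continuous_on_subset[OF U'cont] x]) auto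
      moreover have ev: "\<forall>\<^sub>F y in nhds x. integral {-1..y} U' = U y"
        using eventually_nhds_in_open[of ?I x] x by (auto simp: UU' elim!: eventually_mono)
      ultimately show ?thesis using DERIV_cong_ev[OF refl ev refl] by simp
    qed
    show "(U' has_real_derivative (b x * U x - f x) / \<epsilon>\<^sup>2) (at x)" if x: "x \<in> ?I" for x
      unfolding U'_def R_def[symmetric] by (intro DERIV_cdivide) (auto intro!: derivative_eq_intros kd x)
    show "AE x in ?L. u x = U x" by (rule uU)
    show "AE x in ?L. weak_deriv ?I u x = U' x" using gw(2) gU' by eventually_elim simp
    show "u \<in> borel_measurable ?L"
      using g(2) by (intro locally_integrable_on_measurable) (simp add: has_weak_deriv_def)
  qed
qed

section \<open>Analytic functions on the interval\<close>

lemma ndiff_localI: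
  assumes "\<And>x. x \<in> S \<Longrightarrow> \<exists>T. x \<in> T \<and> ndiff T n f"
  shows "ndiff S n f"
  using assms unfolding ndiff_def by blast

lemma ndiff_power_series:
  assumes "\<And>z. norm z < r \<Longrightarrow> summable (\<lambda>n. a n * z ^ n)"
  shows "ndiff (ball x0 r) k (\<lambda>y. \<Sum>n. a n * (y - x0) ^ n :: real)"
  using assms
proof (induction k arbitrary: a)
  case (Suc k)
  show ?case
  proof (rule ndiff_SucI[OF open_ball])
    show "ndiff (ball x0 r) k (\<lambda>y. \<Sum>n. diffs a n * (y - x0) ^ n)"
    proof (rule Suc.IH)
      fix z :: real assume "norm z < r"
      then show "summable (\<lambda>n. diffs a n * z ^ n)"
        using termdiff_converges[of z r a] Suc.prems by blast
    qed
    fix y assume "y \<in> ball x0 r"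
    then have "norm (y - x0) < r" by (simp add: dist_norm norm_minus_commute)
    from termdiffs_strong'[OF Suc.prems this]
    have "((\<lambda>z. \<Sum>n. a n * z ^ n) has_real_derivative (\<Sum>n. diffs a n * (y - x0) ^ n)) (at (y - x0))" .
    note * = this
    have "((\<lambda>y. y - x0) has_real_derivative 1) (at y)" by (auto intro!: derivative_eq_intros)
    from DERIV_chain2[where f = "\<lambda>z. \<Sum>n. a n * z ^ n" and g = "\<lambda>y. y - x0" and x = y, OF * this]
    show "((\<lambda>y. \<Sum>n. a n * (y - x0) ^ n) has_real_derivative (\<Sum>n. diffs a n * (y - x0) ^ n)) (at y)"
      by simp
  qed
qed simp

lemma real_analytic_on_ndiff:
  assumes "real_analytic_on f {l..r}"
  shows "ndiff {l<..<r} k f"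
proof (rule ndiff_localI)
  fix x assume x: "x \<in> {l<..<r}"
  then have "x \<in> {l..r}" by simp
  then obtain d where d: "d > 0" and "\<exists>a. \<forall>y\<in>{l..r}. \<bar>y - x\<bar> < d \<longrightarrow> (\<lambda>n. a n * (y - x) ^ n) sums f y"
    using assms unfolding real_analytic_on_def by blast
  then obtain a where a: "\<And>y. y \<in> {l..r} \<Longrightarrow> \<bar>y - x\<bar> < d \<Longrightarrow> (\<lambda>n. a n * (y - x) ^ n) sums f y"
    by blast
  \<comment> \<open>The expansion represents f only at points of [l, r], so the ball is shrunk to
    stay inside.\<close>
  define e where "e = min d (min (x - l) (r - x))"
  have e: "e > 0" using d x by (simp add: e_def)
  have s: "(\<lambda>n. a n * (y - x) ^ n) sums f y" if "\<bar>y - x\<bar> < e" for y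
    by (rule a) (use that x in \<open>auto simp: e_def abs_less_iff\<close>)
  have "summable (\<lambda>n. a n * z ^ n)" if "norm z < e" for z
    using s[of "z + x"] that by (auto simp: sums_iff)
  then have "ndiff (ball x e) k (\<lambda>y. \<Sum>n. a n * (y - x) ^ n)" by (rule ndiff_power_series)
  moreover have "f y = (\<Sum>n. a n * (y - x) ^ n)" if "y \<in> ball x e" for y
    using s[of y] that by (simp add: dist_norm sums_iff abs_minus_commute)
  ultimately have "ndiff (ball x e) k f"
    using ndiff_cong[OF open_ball, of x e f "\<lambda>y. \<Sum>n. a n * (y - x) ^ n"] by blast
  then show "\<exists>T. x \<in> T \<and> ndiff T k f" using e by (intro exI[of _ "ball x e"]) simp
qed

lemma ndiff_continuous_on:
  assumes "ndiff S (Suc n) f" "m \<le> n"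
  shows "continuous_on S ((deriv ^^ m) f)"
proof (rule continuous_at_imp_continuous_on, rule ballI)
  fix x assume "x \<in> S"
  then show "isCont ((deriv ^^ m) f) x"
    using assms by (intro DERIV_isCont[OF ndiff_DERIV[OF assms(1)]]) auto
qed

text \<open>The set where |g| > C is open and negligible, hence empty.\<close>

lemma Linf_norm_le_pointwise:
  assumes g: "continuous_on {l<..<r} g" and le: "Linf_norm {l<..<r} g \<le> ereal C" and x: "x \<in> {l<..<r}"
  shows "\<bar>g x\<bar> \<le> C"
proof (rule ccontr)
  assume c: "\<not> \<bar>g x\<bar> \<le> C"
  have "AE x in lebesgue_on {l<..<r}. ereal \<bar>g x\<bar> \<le> Linf_norm {l<..<r} g"
    unfolding Linf_norm_def by (rule esssup_AE)
  then have "AE x in lebesgue_on {l<..<r}. \<bar>g x\<bar> \<le> C"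
    by eventually_elim (use le order_trans ereal_less_eq(3) in blast)
  then obtain N where N: "negligible N" "\<And>x. x \<in> {l..r} - N \<Longrightarrow> \<bar>g x\<bar> \<le> C"
    using AE_lebesgue_on_negligible by blast
  let ?O = "{l<..<r} \<inter> (\<lambda>x. \<bar>g x\<bar>) -` {C<..}"
  have "open ?O"
    by (rule continuous_open_preimage) (use g in \<open>auto intro: continuous_intros\<close>)
  moreover have "x \<in> ?O" using x c by auto
  moreover have "?O \<subseteq> N"
  proof
    fix y assume y: "y \<in> ?O"
    show "y \<in> N"
    proof (rule ccontr)
      assume "y \<notin> N"
      then have "\<bar>g y\<bar> \<le> C" using y by (intro N(2)) auto
      then show False using y by simp
    qed
  qed
  ultimately show False
    using open_not_negligible[of ?O] negligible_subset[OF N(1)] by blast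
qed

section \<open>Maximum principle\<close>

text \<open>If D < 0, then Z' is negative just to the right of its zero x, and the mean value
  theorem puts Z below its minimum there.\<close>

lemma second_derivative_at_min:
  fixes Z :: "real \<Rightarrow> real"
  assumes x: "x \<in> {a<..<c}" and m: "\<And>y. y \<in> {a<..<c} \<Longrightarrow> Z x \<le> Z y"
    and d: "\<And>y. y \<in> {a<..<c} \<Longrightarrow> (Z has_real_derivative Z' y) (at y)"
    and d2: "(Z' has_real_derivative D) (at x)"
  shows "0 \<le> D"
proof (rule ccontr)
  assume "\<not> 0 \<le> D"
  then have D: "D < 0" by simp
  have Z'0: "Z' x = 0"
  proof (rule DERIV_local_min[OF d[OF x], of "min (x - a) (c - x)"])
    show "0 < min (x - a) (c - x)" using x by simp
    show "\<forall>y. \<bar>x - y\<bar> < min (x - a) (c - x) \<longrightarrow> Z x \<le> Z y"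
    proof (intro allI impI m)
      fix y assume "\<bar>x - y\<bar> < min (x - a) (c - x)"
      then show "y \<in> {a<..<c}" by (simp add: abs_less_iff)
    qed
  qed
  obtain e where e: "e > 0" "\<And>h. 0 < h \<Longrightarrow> h < e \<Longrightarrow> Z' (x + h) < Z' x"
    using DERIV_neg_dec_right[OF d2 D] by auto
  define q where "q = min e (c - x)"
  have q: "0 < q" "q \<le> e" "q \<le> c - x" using x e(1) by (auto simp: q_def)
  define y where "y = x + q / 2"
  have y: "x < y" "y < c" "y < x + e" using q by (auto simp: y_def field_simps)
  obtain z where z: "x < z" "z < y" "Z y - Z x = (y - x) * Z' z"
  proof -
    have "(Z has_real_derivative Z' t) (at t)" if "x \<le> t" "t \<le> y" for t
      using that x y by (intro d) simp
    from MVT2[OF y(1) this] show ?thesis using that by blast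
  qed
  have "Z' z < 0" using e(2)[of "z - x"] z y Z'0 by simp
  then have "Z y < Z x" using z(3) y(1) mult_pos_neg[of "y - x" "Z' z"] by simp
  then show False using m[of y] x y by simp
qed

text \<open>At a negative interior minimum the left side of \<open>L\<close> is nonnegative and the
  right side negative.\<close>

lemma max_principle:
  fixes Z :: "real \<Rightarrow> real"
  assumes cont: "continuous_on {a..c} Z" and Za: "0 \<le> Z a" and Zc: "0 \<le> Z c"
    and d: "\<And>x. x \<in> {a<..<c} \<Longrightarrow> (Z has_real_derivative Z' x) (at x)"
    and d2: "\<And>x. x \<in> {a<..<c} \<Longrightarrow> (Z' has_real_derivative Z'' x) (at x)"
    and b: "\<And>x. x \<in> {a<..<c} \<Longrightarrow> 0 < b x"
    and L: "\<And>x. x \<in> {a<..<c} \<Longrightarrow> \<epsilon>\<^sup>2 * Z'' x \<le> b x * Z x"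
    and x: "x \<in> {a..c}"
  shows "0 \<le> Z x"
proof (rule ccontr)
  assume n: "\<not> 0 \<le> Z x"
  obtain m where m: "m \<in> {a..c}" "\<And>y. y \<in> {a..c} \<Longrightarrow> Z m \<le> Z y"
    using continuous_attains_inf[of "{a..c}" Z] cont x by auto
  have Zm: "Z m < 0" using m(2)[OF x] n by simp
  have "m \<noteq> a" "m \<noteq> c" using Zm Za Zc by (metis not_less)+
  then have mi: "m \<in> {a<..<c}" using m(1) by (simp add: less_le)
  have "0 \<le> Z'' m"
    by (rule second_derivative_at_min[OF mi _ d d2[OF mi]]) (rule m(2), auto)
  then have "0 \<le> \<epsilon>\<^sup>2 * Z'' m" by simp
  moreover have "b m * Z m < 0" using b[OF mi] Zm by (rule mult_pos_neg)
  ultimately show False using L[OF mi] by simp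
qed

section \<open>Majorants for iterated derivatives\<close>

abbreviation (input) J :: "real set" where "J \<equiv> {-1<..<1}"

text \<open>The shift m counts derivatives already taken: differentiation raises the shift and
  leaves the geometric rate K as it is. The p-fold iteration in the outer expansion depends on
  this.\<close>

definition deriv_bound :: "(real \<Rightarrow> real) \<Rightarrow> real \<Rightarrow> real \<Rightarrow> nat \<Rightarrow> bool" where
  "deriv_bound f A K m \<longleftrightarrow> (\<forall>n. ndiff J n f) \<and> (\<forall>n. \<forall>x\<in>J. \<bar>(deriv ^^ n) f x\<bar> \<le> A * K ^ n * fact (n + m))"

lemma deriv_boundD:
  assumes "deriv_bound f A K m"
  shows "ndiff J n f" "x \<in> J \<Longrightarrow> \<bar>(deriv ^^ n) f x\<bar> \<le> A * K ^ n * fact (n + m)"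
  using assms by (auto simp: deriv_bound_def)

lemma deriv_bound_nonneg:
  assumes "deriv_bound f A K m"
  shows "0 \<le> A"
proof -
  have "\<bar>f 0\<bar> \<le> A * fact m" using deriv_boundD(2)[OF assms, of 0 0] by simp
  then have "0 \<le> A * fact m" using abs_ge_zero[of "f 0"] by linarith
  then show ?thesis using fact_gt_zero[of m, where 'a = real] by (simp add: zero_le_mult_iff)
qed

lemma deriv_bound_mono:
  assumes "deriv_bound f A K m" "A \<le> A'" "K \<le> K'" "0 \<le> K"
  shows "deriv_bound f A' K' m"
  unfolding deriv_bound_def
proof (intro conjI allI ballI)
  fix n x assume "x \<in> J"
  have "\<bar>(deriv ^^ n) f x\<bar> \<le> A * K ^ n * fact (n + m)" by (rule deriv_boundD(2)[OF assms(1) \<open>x \<in> J\<close>])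
  also have "\<dots> \<le> A' * K' ^ n * fact (n + m)"
    using assms deriv_bound_nonneg[OF assms(1)] by (intro mult_right_mono mult_mono power_mono) auto
  finally show "\<bar>(deriv ^^ n) f x\<bar> \<le> A' * K' ^ n * fact (n + m)" .
qed (rule deriv_boundD(1)[OF assms(1)])

lemma fact_fact_le: "fact (j + k) * fact (j + m) \<le> (fact (j + k + m) * fact j :: real)"
proof (induction k)
  case (Suc k)
  have "fact (j + Suc k) * fact (j + m) = (real (j + k) + 1) * (fact (j + k) * fact (j + m) :: real)"
    by simp
  also have "\<dots> \<le> (real (j + k + m) + 1) * (fact (j + k + m) * fact j)"
    by (rule mult_mono[OF _ Suc]) auto
  also have "\<dots> = fact (j + Suc k + m) * fact j" by simp
  finally show ?case .
qed (simp add: mult.commute)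

text \<open>Through this inequality the Leibniz rule keeps the shift m of one factor when the other
  factor has shift 0.\<close>

lemma binomial_fact_fact_le:
  assumes "k \<le> n"
  shows "real (n choose k) * fact k * fact (n - k + m) \<le> fact (n + m)"
proof -
  have "real (n choose k) * fact k * fact (n - k) = fact n"
  proof -
    have "real (fact k * fact (n - k) * (n choose k)) = real (fact n)"
      by (simp only: binomial_fact_lemma[OF assms])
    then show ?thesis by (simp add: mult_ac)
  qed
  then have "real (n choose k) * fact k * fact (n - k + m) * fact (n - k) = fact n * fact (n - k + m)"
    by (simp add: mult_ac)
  also have "\<dots> \<le> fact (n + m) * fact (n - k)"
    using fact_fact_le[of "n - k" k m] assms by simp
  finally show ?thesis by (rule mult_right_le_imp_le) simp
qed

lemma sum_power_le:
  fixes L K :: real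
  assumes "0 \<le> L" "2 * L \<le> K"
  shows "(\<Sum>k\<le>n. L ^ k * K ^ (n - k)) \<le> 2 * K ^ n"
proof -
  have K: "0 \<le> K" using assms by simp
  have "(\<Sum>k\<le>n. L ^ k * K ^ (n - k)) \<le> (\<Sum>k\<le>n. (1 / 2) ^ k * K ^ n)"
  proof (rule sum_mono)
    fix k assume k: "k \<in> {..n}"
    have "L ^ k \<le> (1 / 2 * K) ^ k" using assms by (intro power_mono) auto
    then have "L ^ k * K ^ (n - k) \<le> (1 / 2 * K) ^ k * K ^ (n - k)" using K by (intro mult_right_mono) auto
    also have "\<dots> = (1 / 2) ^ k * K ^ n"
      using k by (simp only: power_mult_distrib mult.assoc power_add[symmetric]) simp
    finally show "L ^ k * K ^ (n - k) \<le> (1 / 2) ^ k * K ^ n" .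
  qed
  also have "\<dots> = (\<Sum>k\<le>n. (1 / 2) ^ k) * K ^ n" by (simp add: sum_distrib_right)
  also have "\<dots> \<le> 2 * K ^ n"
  proof (rule mult_right_mono)
    have "(\<Sum>k\<le>n. (1 / 2 :: real) ^ k) = 2 - (1/2) ^ n"
      by (induction n) auto
    then show "(\<Sum>k\<le>n. (1 / 2 :: real) ^ k) \<le> 2" by simp
  qed (use K in simp)
  finally show ?thesis .
qed

text \<open>The rate of c is at most half of K, so the Leibniz sum is dominated by a geometric
  series: K and m survive, and the product costs only the factor 2.\<close>

lemma deriv_bound_mult:
  assumes c: "deriv_bound c C L 0" and g: "deriv_bound g A K m" and LK: "0 \<le> L" "2 * L \<le> K"
  shows "deriv_bound (\<lambda>x. c x * g x) (2 * C * A) K m"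
  unfolding deriv_bound_def
proof (intro conjI allI ballI)
  show "ndiff J n (\<lambda>x. c x * g x)" for n
    by (intro ndiff_mult deriv_boundD(1)[OF c] deriv_boundD(1)[OF g]) simp
  have CA: "0 \<le> C" "0 \<le> A" by (rule deriv_bound_nonneg[OF c], rule deriv_bound_nonneg[OF g])
  have K: "0 \<le> K" using LK by simp
  fix n x assume x: "x \<in> J"
  have "\<bar>(deriv ^^ n) (\<lambda>x. c x * g x) x\<bar> = \<bar>\<Sum>k\<le>n. real (n choose k) * (deriv ^^ k) c x * (deriv ^^ (n - k)) g x\<bar>"
    by (subst deriv_n_Leibniz[OF _ x deriv_boundD(1)[OF c] deriv_boundD(1)[OF g]]) simp_all
  also have "\<dots> \<le> (\<Sum>k\<le>n. \<bar>real (n choose k) * (deriv ^^ k) c x * (deriv ^^ (n - k)) g x\<bar>)"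
    by (rule sum_abs)
  also have "\<dots> \<le> (\<Sum>k\<le>n. C * A * fact (n + m) * (L ^ k * K ^ (n - k)))"
  proof (rule sum_mono)
    fix k assume "k \<in> {..n}"
    then have k: "k \<le> n" by simp
    have "\<bar>real (n choose k) * (deriv ^^ k) c x * (deriv ^^ (n - k)) g x\<bar> =
      real (n choose k) * \<bar>(deriv ^^ k) c x\<bar> * \<bar>(deriv ^^ (n - k)) g x\<bar>" by (simp add: abs_mult)
    also have "\<dots> \<le> real (n choose k) * (C * L ^ k * fact k) * (A * K ^ (n - k) * fact (n - k + m))"
      using deriv_boundD(2)[OF c x, of k] deriv_boundD(2)[OF g x, of "n - k"] CA K LK
      by (intro mult_mono mult_left_mono) auto
    also have "\<dots> = (C * A * (L ^ k * K ^ (n - k))) * (real (n choose k) * fact k * fact (n - k + m))"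
      by (simp add: mult_ac)
    also have "\<dots> \<le> (C * A * (L ^ k * K ^ (n - k))) * fact (n + m)"
      using CA K LK binomial_fact_fact_le[OF k] by (intro mult_left_mono) auto
    finally show "\<bar>real (n choose k) * (deriv ^^ k) c x * (deriv ^^ (n - k)) g x\<bar> \<le> C * A * fact (n + m) * (L ^ k * K ^ (n - k))"
      by (simp add: mult_ac)
  qed
  also have "\<dots> = C * A * fact (n + m) * (\<Sum>k\<le>n. L ^ k * K ^ (n - k))" by (simp add: sum_distrib_left)
  also have "\<dots> \<le> C * A * fact (n + m) * (2 * K ^ n)"
    using CA sum_power_le[OF LK] by (intro mult_left_mono) auto
  finally show "\<bar>(deriv ^^ n) (\<lambda>x. c x * g x) x\<bar> \<le> 2 * C * A * K ^ n * fact (n + m)" by (simp add: mult_ac)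
qed

lemma deriv_n_deriv: "(deriv ^^ n) (deriv f) = (deriv ^^ Suc n) f"
  by (simp only: funpow_Suc_right o_def)

lemma deriv_bound_deriv:
  assumes "deriv_bound f A K m"
  shows "deriv_bound (deriv f) (A * K) K (Suc m)"
  unfolding deriv_bound_def deriv_n_deriv
proof (intro conjI allI ballI)
  show "ndiff J n (deriv f)" for n by (rule ndiff_deriv[OF deriv_boundD(1)[OF assms]])
  fix n x assume "x \<in> J"
  from deriv_boundD(2)[OF assms this, of "Suc n"]
  show "\<bar>(deriv ^^ Suc n) f x\<bar> \<le> A * K * K ^ n * fact (n + Suc m)"
    by (simp add: mult.assoc del: funpow.simps fact_Suc)
qed

text \<open>For n > 0 the n-th derivative of b times 1 / b vanishes. Solving for the top derivative
  of 1 / b gives a recursion, and the choice of K absorbs its Leibniz sum.\<close>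

lemma deriv_bound_inverse:
  assumes b: "deriv_bound b C L 0" and b0: "0 < b0" "\<And>x. x \<in> J \<Longrightarrow> b0 \<le> b x" and L: "0 \<le> L"
    and K: "2 * (1 + C / b0) * L \<le> K"
  shows "deriv_bound (\<lambda>x. 1 / b x) (1 / b0) K 0"
proof -
  have C: "0 \<le> C" using deriv_bound_nonneg[OF b] .
  have "0 \<le> 2 * (1 + C / b0) * L" using L C b0(1) by (intro mult_nonneg_nonneg) auto
  then have K0: "0 \<le> K" using K by linarith
  have nz: "b x \<noteq> 0" if "x \<in> J" for x using b0 that by force
  have nd: "ndiff J n (\<lambda>x. 1 / b x)" for n
    by (rule ndiff_inverse[OF _ nz deriv_boundD(1)[OF b]]) auto
  have "\<bar>(deriv ^^ n) (\<lambda>x. 1 / b x) x\<bar> \<le> 1 / b0 * K ^ n * fact n" if x: "x \<in> J" for n x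
  proof (induction n rule: less_induct)
    case (less n)
    show ?case
    proof (cases n)
      case 0
      have "1 / b x \<le> 1 / b0" using b0 x by (intro divide_left_mono) (auto intro: less_le_trans mult_pos_pos)
      moreover have "0 \<le> 1 / b x" using b0 x less_le_trans[of 0 b0 "b x"] by simp
      ultimately show ?thesis using 0 by simp
    next
      case (Suc n')
      let ?c = "\<lambda>x. 1 / b x"
      have "(deriv ^^ n) (\<lambda>x. b x * ?c x) x = (deriv ^^ n) (\<lambda>_. 1) x"
        by (rule deriv_n_cong[OF _ _ x]) (use nz in auto)
      moreover have "(deriv ^^ n) (\<lambda>_. 1 :: real) x = 0"
      proof -
        have "(deriv ^^ k) (\<lambda>_. 0 :: real) = (\<lambda>_. 0)" for k by (induction k) auto
        then show ?thesis unfolding Suc by (simp add: funpow_Suc_right del: funpow.simps)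
      qed
      moreover have "(deriv ^^ n) (\<lambda>x. b x * ?c x) x = (\<Sum>k\<le>n. real (n choose k) * (deriv ^^ k) b x * (deriv ^^ (n - k)) ?c x)"
        by (rule deriv_n_Leibniz[OF _ x deriv_boundD(1)[OF b] nd]) simp
      ultimately have "(\<Sum>k\<le>n. real (n choose k) * (deriv ^^ k) b x * (deriv ^^ (n - k)) ?c x) = 0" by simp
      then have "b x * (deriv ^^ n) ?c x = - (\<Sum>k\<le>n'. real (n choose Suc k) * (deriv ^^ Suc k) b x * (deriv ^^ (n' - k)) ?c x)"
        unfolding Suc sum.atMost_Suc_shift by simp
      then have "\<bar>b x * (deriv ^^ n) ?c x\<bar> = \<bar>\<Sum>k\<le>n'. real (n choose Suc k) * (deriv ^^ Suc k) b x * (deriv ^^ (n' - k)) ?c x\<bar>"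
        by simp
      also have "\<dots> \<le> (\<Sum>k\<le>n'. \<bar>real (n choose Suc k) * (deriv ^^ Suc k) b x * (deriv ^^ (n' - k)) ?c x\<bar>)"
        by (rule sum_abs)
      also have "\<dots> \<le> (\<Sum>k\<le>n'. C * L / b0 * fact n * (L ^ k * K ^ (n' - k)))"
      proof (rule sum_mono)
        fix k assume "k \<in> {..n'}"
        then have k: "k \<le> n'" by simp
        have kn: "Suc k \<le> n" "n - Suc k = n' - k" "n' - k < n" using k Suc by auto
        have "\<bar>real (n choose Suc k) * (deriv ^^ Suc k) b x * (deriv ^^ (n' - k)) ?c x\<bar> =
          real (n choose Suc k) * \<bar>(deriv ^^ Suc k) b x\<bar> * \<bar>(deriv ^^ (n' - k)) ?c x\<bar>" by (simp add: abs_mult del: funpow.simps)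
        also have "\<dots> \<le> real (n choose Suc k) * (C * L ^ Suc k * fact (Suc k)) * (1 / b0 * K ^ (n' - k) * fact (n' - k))"
          using deriv_boundD(2)[OF b x, of "Suc k"] less.IH[OF kn(3)] C K0 L b0(1)
          by (intro mult_mono mult_left_mono) (auto simp del: funpow.simps fact_Suc)
        also have "\<dots> = (C * L / b0 * (L ^ k * K ^ (n' - k))) * (real (n choose Suc k) * fact (Suc k) * fact (n' - k))"
          by (simp add: mult_ac del: fact_Suc)
        also have "\<dots> \<le> (C * L / b0 * (L ^ k * K ^ (n' - k))) * fact n"
          using C K0 L b0(1) binomial_fact_fact_le[OF kn(1), of 0] kn(2) by (intro mult_left_mono) auto
        finally show "\<bar>real (n choose Suc k) * (deriv ^^ Suc k) b x * (deriv ^^ (n' - k)) ?c x\<bar> \<le> C * L / b0 * fact n * (L ^ k * K ^ (n' - k))"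
          by (simp only: mult_ac)
      qed
      also have "\<dots> = C * L / b0 * fact n * (\<Sum>k\<le>n'. L ^ k * K ^ (n' - k))" by (simp add: sum_distrib_left)
      also have "\<dots> \<le> C * L / b0 * fact n * (2 * K ^ n')"
      proof (intro mult_left_mono sum_power_le L)
        have "0 \<le> C / b0 * L" using C b0 L by simp
        moreover have "2 * (1 + C / b0) * L = 2 * L + 2 * (C / b0 * L)" by (simp add: algebra_simps)
        ultimately show "2 * L \<le> K" using K by linarith
      qed (use C L b0 in auto)
      also have "\<dots> = (2 * (C / b0) * L) * K ^ n' * fact n" by simp
      also have "\<dots> \<le> K * K ^ n' * fact n"
        using K L K0 by (intro mult_right_mono) (auto simp: algebra_simps)
      finally have *: "\<bar>b x * (deriv ^^ n) ?c x\<bar> \<le> K ^ n * fact n" by (simp add: Suc)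
      have "b0 * \<bar>(deriv ^^ n) ?c x\<bar> \<le> \<bar>b x * (deriv ^^ n) ?c x\<bar>"
        unfolding abs_mult using b0(2)[OF x] by (intro mult_right_mono) auto
      with * have "b0 * \<bar>(deriv ^^ n) ?c x\<bar> \<le> K ^ n * fact n" by linarith
      then show ?thesis using b0(1) by (simp add: field_simps)
    qed
  qed
  then show ?thesis using nd by (simp add: deriv_bound_def)
qed

section \<open>Regularity of the solution\<close>

locale reaction_diffusion =
  fixes b f :: "real \<Rightarrow> real" and b0 C L :: real
  assumes b0: "0 < b0" "\<And>x. x \<in> J \<Longrightarrow> b0 \<le> b x"
    and bC: "deriv_bound b C L 0" and fC: "deriv_bound f C L 0" and L: "1 \<le> L" and C: "1 \<le> C"
begin

definition A :: real where "A = C / b0 + 1"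

text \<open>A sum that dominates every rate needed later: four times the rate of 1 / b, which also
  covers 8 L for the Leibniz sums, and 4 A + C A + C from the bound on the first derivative.\<close>

definition K :: real where "K = 8 * (1 + C / b0) * L + 4 * A + C * A + C"

lemma A: "1 \<le> A" "C \<le> A * b0" "0 < A"
  using b0 C by (auto simp: A_def field_simps)

lemma CA: "0 \<le> C * A" "0 \<le> C / b0" "C \<le> C * A"
  using A C b0 by auto

lemma K: "1 \<le> K" "8 * L \<le> K" "2 * (1 + C / b0) * L \<le> K" "4 * A + C * A + C \<le> K"
proof -
  have 1: "0 \<le> C / b0 * L" using b0 C L by simp
  have 2: "K = 8 * L + 8 * (C / b0 * L) + 4 * A + C * A + C"
    by (simp add: K_def algebra_simps)
  show "1 \<le> K" "8 * L \<le> K" "4 * A + C * A + C \<le> K"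
    using 1 2 A(1) CA L C by linarith+
  have "2 * (1 + C / b0) * L = 2 * L + 2 * (C / b0 * L)" by (simp add: algebra_simps)
  then show "2 * (1 + C / b0) * L \<le> K" using 1 2 A(1) CA L C by linarith
qed

lemma b_pos: "x \<in> J \<Longrightarrow> 0 < b x" using b0 less_le_trans by blast

lemma b_le: "x \<in> J \<Longrightarrow> \<bar>b x\<bar> \<le> C" and f_le: "x \<in> J \<Longrightarrow> \<bar>f x\<bar> \<le> C"
  using deriv_boundD(2)[OF bC, of x 0] deriv_boundD(2)[OF fC, of x 0] by simp_all

end

locale classical_solution = reaction_diffusion +
  fixes \<epsilon> :: real and U U' :: "real \<Rightarrow> real"
  assumes eps: "0 < \<epsilon>" "\<epsilon> \<le> 1"
    and U_cont: "continuous_on {-1..1} U" and U_bc: "U (-1) = 0" "U 1 = 0"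
    and U_deriv: "\<And>x. x \<in> J \<Longrightarrow> (U has_real_derivative U' x) (at x)"
    and U'_deriv: "\<And>x. x \<in> J \<Longrightarrow> (U' has_real_derivative (b x * U x - f x) / \<epsilon>\<^sup>2) (at x)"
begin

lemma U_bound: "x \<in> {-1..1} \<Longrightarrow> \<bar>U x\<bar> \<le> A"
proof -
  assume x: "x \<in> {-1..1}"
  \<comment> \<open>The constant barrier works because b times C / b0 is at least C \<ge> |f|; the
    sign s treats the upper and the lower bound together.\<close>
  have "0 \<le> C / b0 + s * U x" if s: "s = 1 \<or> s = -1" for s
  proof (rule max_principle[where a = "-1" and c = 1 and b = b and \<epsilon> = \<epsilon> and Z = "\<lambda>x. C / b0 + s * U x"
        and Z' = "\<lambda>x. s * U' x" and Z'' = "\<lambda>x. s * ((b x * U x - f x) / \<epsilon>\<^sup>2)"])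
    show "continuous_on {-1..1} (\<lambda>x. C / b0 + s * U x)" by (intro continuous_intros U_cont)
    show "0 \<le> C / b0 + s * U (-1)" "0 \<le> C / b0 + s * U 1" using U_bc b0 C by auto
    fix x assume x: "x \<in> J"
    show "((\<lambda>x. C / b0 + s * U x) has_real_derivative s * U' x) (at x)"
      by (auto intro!: derivative_eq_intros U_deriv[OF x])
    show "((\<lambda>x. s * U' x) has_real_derivative s * ((b x * U x - f x) / \<epsilon>\<^sup>2)) (at x)"
      by (rule DERIV_cmult[OF U'_deriv[OF x]])
    show "0 < b x" by (rule b_pos[OF x])
    have "b0 * (C / b0) \<le> b x * (C / b0)" using b0 C x by (intro mult_right_mono) auto
    then have "C \<le> b x * (C / b0)" using b0 by simp
    have "- (s * f x) \<le> C" using s f_le[OF x] by auto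
    show "\<epsilon>\<^sup>2 * (s * ((b x * U x - f x) / \<epsilon>\<^sup>2)) \<le> b x * (C / b0 + s * U x)"
    proof -
      have "\<epsilon>\<^sup>2 * (s * ((b x * U x - f x) / \<epsilon>\<^sup>2)) = b x * (s * U x) - s * f x"
      proof -
        have "\<epsilon>\<^sup>2 * (s * ((b x * U x - f x) / \<epsilon>\<^sup>2)) = s * (b x * U x - f x)" using eps by simp
        then show ?thesis by (simp add: algebra_simps)
      qed
      moreover have "b x * (C / b0 + s * U x) = b x * (C / b0) + b x * (s * U x)" by (rule distrib_left)
      ultimately show ?thesis using \<open>C \<le> b x * (C / b0)\<close> \<open>- (s * f x) \<le> C\<close> by linarith
    qed
  qed (rule x)
  from this[of 1] this[of "-1"] show ?thesis by (simp add: A_def)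
qed

lemma U''_bound: "x \<in> J \<Longrightarrow> \<bar>(b x * U x - f x) / \<epsilon>\<^sup>2\<bar> \<le> (C * A + C) / \<epsilon>\<^sup>2"
proof -
  assume x: "x \<in> J"
  have "\<bar>b x * U x\<bar> \<le> C * A"
    unfolding abs_mult using b_le[OF x] U_bound[of x] x C A by (intro mult_mono) auto
  then have "\<bar>b x * U x - f x\<bar> \<le> C * A + C" using f_le[OF x] by linarith
  then show ?thesis using eps by (simp add: divide_right_mono)
qed

text \<open>Interpolation between U and its second derivative: on an interval of length \<epsilon> /
  2 containing x the mean value theorem gives a point where U' is at most 4 A / \<epsilon>, and from
  there U' changes by at most \<epsilon> times a bound of order 1 / \<epsilon>^2.\<close>

lemma U'_bound: "x \<in> J \<Longrightarrow> \<bar>U' x\<bar> \<le> K / \<epsilon>"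
proof -
  assume x: "x \<in> J"
  \<comment> \<open>The interval extends to the right or to the left of x, whichever side has room
    inside (-1, 1).\<close>
  have "\<exists>l. -1 < l \<and> l \<le> x \<and> x \<le> l + \<epsilon> / 2 \<and> l + \<epsilon> / 2 < 1"
  proof (cases "x \<le> 0")
    case True
    then show ?thesis using x eps by (intro exI[of _ x]) auto
  next
    case False
    then show ?thesis using x eps by (intro exI[of _ "x - \<epsilon> / 2"]) auto
  qed
  then obtain l where l: "-1 < l" "l \<le> x" "x \<le> l + \<epsilon> / 2" "l + \<epsilon> / 2 < 1" by blast
  define h where "h = l + \<epsilon> / 2"
  have lh: "l < h" "h - l = \<epsilon> / 2" using eps by (simp_all add: h_def)
  have inJ: "t \<in> J" if "l \<le> t" "t \<le> h" for t using that l by (simp add: h_def)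
  obtain z where z: "l < z" "z < h" "U h - U l = (h - l) * U' z"
  proof -
    have "(U has_real_derivative U' t) (at t)" if "l \<le> t" "t \<le> h" for t
      by (rule U_deriv[OF inJ[OF that]])
    from MVT2[OF lh(1) this] show ?thesis using that by blast
  qed
  have "\<bar>U h - U l\<bar> \<le> 2 * A" using U_bound[of h] U_bound[of l] inJ[of l] inJ[of h] lh by auto
  then have "\<epsilon> / 2 * \<bar>U' z\<bar> \<le> 2 * A" using z(3) lh(2) eps by (simp add: abs_mult)
  then have 1: "\<bar>U' z\<bar> \<le> 4 * A / \<epsilon>" using eps by (simp add: field_simps)
  have "\<bar>U' x - U' z\<bar> \<le> (C * A + C) / \<epsilon>\<^sup>2 * \<bar>x - z\<bar>"
  proof -
    have "norm (U' x - U' z) \<le> (C * A + C) / \<epsilon>\<^sup>2 * norm (x - z)"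
    proof (rule field_differentiable_bound[of "{l..h}"])
      fix t assume t: "t \<in> {l..h}"
      then have tJ: "t \<in> J" by (intro inJ) auto
      show "(U' has_field_derivative (b t * U t - f t) / \<epsilon>\<^sup>2) (at t within {l..h})"
        by (rule has_field_derivative_at_within[OF U'_deriv[OF tJ]])
      show "norm ((b t * U t - f t) / \<epsilon>\<^sup>2) \<le> (C * A + C) / \<epsilon>\<^sup>2" using U''_bound[OF tJ] by simp
    qed (use z l h_def in auto)
    then show ?thesis by simp
  qed
  also have "\<dots> \<le> (C * A + C) / \<epsilon>\<^sup>2 * \<epsilon>"
    using z l lh eps CA C by (intro mult_left_mono) (auto simp: h_def)
  also have "\<dots> = (C * A + C) / \<epsilon>" using eps by (simp add: power2_eq_square)
  finally have "\<bar>U' x - U' z\<bar> \<le> (C * A + C) / \<epsilon>" .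
  with 1 have "\<bar>U' x\<bar> \<le> 4 * A / \<epsilon> + (C * A + C) / \<epsilon>" by linarith
  also have "\<dots> = (4 * A + C * A + C) / \<epsilon>" by (simp add: add_divide_distrib)
  also have "\<dots> \<le> K / \<epsilon>" using K(4) eps by (intro divide_right_mono) auto
  finally show ?thesis .
qed

lemma deriv_U: "x \<in> J \<Longrightarrow> deriv U x = U' x"
  by (rule DERIV_imp_deriv[OF U_deriv])

text \<open>Bootstrapping: each use of the equation gains two derivatives.\<close>

lemma ndiff_U: "ndiff J n U"
proof -
  have "ndiff J (2 * k) U" for k
  proof (induction k)
    case (Suc k)
    have "ndiff J (2 * k) (\<lambda>x. 1 / \<epsilon>\<^sup>2 * (b x * U x - f x))"
      by (intro ndiff_cmult ndiff_diff ndiff_mult deriv_boundD(1)[OF bC] deriv_boundD(1)[OF fC] Suc) auto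
    then have "ndiff J (Suc (2 * k)) U'"
      by (rule ndiff_SucI[rotated 2]) (use U'_deriv in auto)
    then have "ndiff J (Suc (Suc (2 * k))) U"
      by (rule ndiff_SucI[rotated 2]) (use U_deriv in auto)
    then show ?case by simp
  qed simp
  then show ?thesis by (rule ndiff_mono[of _ "2 * n"]) simp
qed

lemma deriv_n_U:
  assumes x: "x \<in> J"
  shows "(deriv ^^ Suc (Suc n)) U x = ((deriv ^^ n) (\<lambda>x. b x * U x) x - (deriv ^^ n) f x) / \<epsilon>\<^sup>2"
  using x
proof (induction n arbitrary: x)
  case 0
  have "deriv (deriv U) x = deriv U' x"
    by (rule deriv_cong_open(1)[OF _ deriv_U 0]) auto
  also have "\<dots> = (b x * U x - f x) / \<epsilon>\<^sup>2" by (rule DERIV_imp_deriv[OF U'_deriv[OF 0]])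
  finally show ?case by simp
next
  case (Suc n)
  have bU: "ndiff J (Suc n) (\<lambda>x. b x * U x)"
    by (intro ndiff_mult deriv_boundD(1)[OF bC] ndiff_U) simp
  have "(deriv ^^ Suc (Suc (Suc n))) U x = deriv (\<lambda>x. ((deriv ^^ n) (\<lambda>x. b x * U x) x - (deriv ^^ n) f x) / \<epsilon>\<^sup>2) x"
    using deriv_cong_open(1)[of J, OF _ Suc.IH Suc.prems] by simp
  also have "\<dots> = ((deriv ^^ Suc n) (\<lambda>x. b x * U x) x - (deriv ^^ Suc n) f x) / \<epsilon>\<^sup>2"
    by (intro DERIV_imp_deriv DERIV_cdivide DERIV_diff ndiff_DERIV[OF bU _ Suc.prems]
        ndiff_DERIV[OF deriv_boundD(1)[OF fC, of "Suc n"] _ Suc.prems]) auto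
  finally show ?case .
qed

text \<open>The growth (n + 1 / \<epsilon>)^n covers the layer regime n < 1 / \<epsilon>, where a
  derivative costs about 1 / \<epsilon>, and the analytic regime beyond it. The induction goes down
  two orders through the equation, and the price 1 / \<epsilon>^2 is at most (n + 1 /
  \<epsilon>)^2.\<close>

lemma deriv_n_U_bound: "x \<in> J \<Longrightarrow> \<bar>(deriv ^^ n) U x\<bar> \<le> A * K ^ n * (real n + 1 / \<epsilon>) ^ n"
proof (induction n arbitrary: x rule: less_induct)
  case (less n)
  define E where "E = 1 / \<epsilon>"
  have E: "1 \<le> E" using eps by (simp add: E_def)
  consider "n = 0" | "n = 1" | m where "n = Suc (Suc m)"
    by (cases n; cases "n - 1") auto
  then show ?case
  proof cases
    case 1
    then show ?thesis using U_bound[of x] less.prems by simp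
  next
    case 2
    have "\<bar>U' x\<bar> \<le> K * E" using U'_bound[OF less.prems] by (simp add: E_def)
    also have "\<dots> \<le> K * (1 + E)" using K(1) E by simp
    also have "\<dots> \<le> A * (K * (1 + E))" using K(1) E A(1) mult_right_mono[of 1 A "K * (1 + E)"] by simp
    finally show ?thesis using 2 deriv_U[OF less.prems] by (simp add: E_def mult.assoc)
  next
    case 3
    let ?X = "real m + E"
    have X: "0 \<le> ?X" using E by simp
    have LK: "0 \<le> L" "2 * L \<le> K" "0 \<le> K" "L \<le> K" using L K by auto
    have "\<bar>(deriv ^^ m) (\<lambda>x. b x * U x) x\<bar> = \<bar>\<Sum>k\<le>m. real (m choose k) * (deriv ^^ k) b x * (deriv ^^ (m - k)) U x\<bar>"
      by (subst deriv_n_Leibniz[OF _ less.prems deriv_boundD(1)[OF bC] ndiff_U]) simp_all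
    also have "\<dots> \<le> (\<Sum>k\<le>m. \<bar>real (m choose k) * (deriv ^^ k) b x * (deriv ^^ (m - k)) U x\<bar>)"
      by (rule sum_abs)
    also have "\<dots> \<le> (\<Sum>k\<le>m. C * A * ?X ^ m * (L ^ k * K ^ (m - k)))"
    proof (rule sum_mono)
      fix k assume "k \<in> {..m}"
      then have k: "k \<le> m" by simp
      have "\<bar>(deriv ^^ (m - k)) U x\<bar> \<le> A * K ^ (m - k) * (real (m - k) + E) ^ (m - k)"
        unfolding E_def by (rule less.IH) (use 3 less.prems in auto)
      also have "\<dots> \<le> A * K ^ (m - k) * ?X ^ (m - k)"
        using A LK E by (intro mult_left_mono power_mono) auto
      finally have u: "\<bar>(deriv ^^ (m - k)) U x\<bar> \<le> A * K ^ (m - k) * ?X ^ (m - k)" .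
      \<comment> \<open>The factorial from b is absorbed by the binomial coefficient, so that the
        powers of \<open>?X\<close> add up to m for every k.\<close>
      have "real ((m choose k) * fact k) \<le> real (m ^ k)"
        using binomial_fact_pow of_nat_le_iff by blast
      also have "\<dots> \<le> ?X ^ k" using E by (simp add: power_mono)
      finally have bf: "real (m choose k) * fact k \<le> ?X ^ k" by (simp only: of_nat_mult of_nat_fact)
      have "\<bar>real (m choose k) * (deriv ^^ k) b x * (deriv ^^ (m - k)) U x\<bar> =
        real (m choose k) * \<bar>(deriv ^^ k) b x\<bar> * \<bar>(deriv ^^ (m - k)) U x\<bar>" by (simp add: abs_mult)
      also have "\<dots> \<le> real (m choose k) * (C * L ^ k * fact k) * (A * K ^ (m - k) * ?X ^ (m - k))"
        using deriv_boundD(2)[OF bC less.prems, of k] u C LK by (intro mult_mono mult_left_mono) auto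
      also have "\<dots> = (C * A * (L ^ k * K ^ (m - k)) * ?X ^ (m - k)) * (real (m choose k) * fact k)"
        by (simp add: mult_ac)
      also have "\<dots> \<le> (C * A * (L ^ k * K ^ (m - k)) * ?X ^ (m - k)) * ?X ^ k"
        using C A LK X bf by (intro mult_left_mono) auto
      also have "\<dots> = C * A * (L ^ k * K ^ (m - k)) * (?X ^ (m - k) * ?X ^ k)" by (simp only: mult_ac)
      also have "?X ^ (m - k) * ?X ^ k = ?X ^ m" using k by (simp add: power_add[symmetric])
      finally show "\<bar>real (m choose k) * (deriv ^^ k) b x * (deriv ^^ (m - k)) U x\<bar> \<le> C * A * ?X ^ m * (L ^ k * K ^ (m - k))"
        by (simp only: mult_ac)
    qed
    also have "\<dots> = C * A * ?X ^ m * (\<Sum>k\<le>m. L ^ k * K ^ (m - k))" by (simp add: sum_distrib_left)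
    also have "\<dots> \<le> C * A * ?X ^ m * (2 * K ^ m)"
      using C A X sum_power_le[OF LK(1,2)] by (intro mult_left_mono) auto
    finally have 1: "\<bar>(deriv ^^ m) (\<lambda>x. b x * U x) x\<bar> \<le> 2 * C * A * (K ^ m * ?X ^ m)" by (simp only: mult_ac)
    have "\<bar>(deriv ^^ m) f x\<bar> \<le> C * L ^ m * fact m" using deriv_boundD(2)[OF fC less.prems, of m] by simp
    also have "\<dots> \<le> C * K ^ m * ?X ^ m"
    proof (intro mult_mono power_mono)
      have "fact m \<le> real m ^ m" using fact_le_power[of m, where 'a = real] by simp
      also have "\<dots> \<le> ?X ^ m" using E by (intro power_mono) auto
      finally show "fact m \<le> ?X ^ m" .
    qed (use C LK in auto)
    finally have 2: "\<bar>(deriv ^^ m) f x\<bar> \<le> C * (K ^ m * ?X ^ m)" by (simp only: mult_ac)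
    have "\<bar>(deriv ^^ n) U x\<bar> = \<bar>(deriv ^^ m) (\<lambda>x. b x * U x) x - (deriv ^^ m) f x\<bar> * E\<^sup>2"
      unfolding 3 deriv_n_U[OF less.prems] using eps by (simp add: E_def power_divide)
    also have "\<dots> \<le> ((2 * C * A + C) * (K ^ m * ?X ^ m)) * E\<^sup>2"
    proof (rule mult_right_mono)
      have "\<bar>(deriv ^^ m) (\<lambda>x. b x * U x) x - (deriv ^^ m) f x\<bar> \<le> 2 * C * A * (K ^ m * ?X ^ m) + C * (K ^ m * ?X ^ m)"
        using 1 2 by linarith
      also have "\<dots> = (2 * C * A + C) * (K ^ m * ?X ^ m)" by (simp add: algebra_simps)
      finally show "\<bar>(deriv ^^ m) (\<lambda>x. b x * U x) x - (deriv ^^ m) f x\<bar> \<le> (2 * C * A + C) * (K ^ m * ?X ^ m)" .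
    qed simp
    also have "\<dots> \<le> ((A * K\<^sup>2) * (K ^ m * (real n + E) ^ m)) * (real n + E)\<^sup>2"
    proof (intro mult_mono power_mono)
      \<comment> \<open>The two additional orders supply K^2, and both 3 and C are at most
        K.\<close>
      have "2 * C * A + C \<le> 3 * (C * A)" using CA by simp
      also have "\<dots> \<le> K * (K * A)"
      proof -
        have "8 \<le> K" using K(2) L by linarith
        moreover have "C \<le> K" using K(4) A CA by linarith
        ultimately have "3 * (C * A) \<le> K * (K * A)"
          using A C by (intro mult_mono) auto
        then show ?thesis .
      qed
      finally show "2 * C * A + C \<le> A * K\<^sup>2" by (simp add: power2_eq_square mult_ac)
    qed (use 3 E A LK in auto)
    also have "\<dots> = A * K ^ n * (real n + E) ^ n"
      unfolding 3 by (simp add: power2_eq_square mult_ac)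
    finally show ?thesis by (simp add: E_def)
  qed
qed

end

section \<open>The outer expansion\<close>

context reaction_diffusion begin

primrec outer :: "nat \<Rightarrow> real \<Rightarrow> real" where
  "outer 0 = (\<lambda>x. 1 / b x * f x)"
| "outer (Suc j) = (\<lambda>x. 1 / b x * deriv (deriv (outer j)) x)"

definition \<Gamma> :: real where "\<Gamma> = 2 / b0 * K\<^sup>2"

definition A0 :: real where "A0 = 2 / b0 * C"

lemma \<Gamma>_pos: "0 < \<Gamma>" and A0_pos: "0 < A0"
  using b0 K(1) C by (simp_all add: \<Gamma>_def A0_def)

text \<open>Every step divides by b and takes two derivatives: the product costs 2 / b0, the
  derivatives cost K^2 and a factorial shift by 2. The rate K does not grow with j, since it is at
  least twice the rate M of 1 / b.\<close>

lemma deriv_bound_outer: "deriv_bound (outer j) (A0 * \<Gamma> ^ j) K (2 * j)"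
proof -
  define M where "M = 2 * (1 + C / b0) * L"
  have M: "deriv_bound (\<lambda>x. 1 / b x) (1 / b0) M 0"
    using bC b0 L M_def by (intro deriv_bound_inverse) auto
  have "K = 4 * M + (4 * A + C * A + C)" by (simp add: K_def M_def)
  moreover have M0: "0 \<le> M" using CA L by (simp add: M_def)
  ultimately have MK: "2 * M \<le> K" "0 \<le> M" using A(1) CA C by linarith+
  show ?thesis
  proof (induction j)
    case 0
    have "deriv_bound f C K 0"
      by (rule deriv_bound_mono[OF fC]) (use K L in auto)
    from deriv_bound_mult[OF M this MK(2,1)] show ?case
      by (simp add: A0_def)
  next
    case (Suc j)
    have "deriv_bound (deriv (deriv (outer j))) (A0 * \<Gamma> ^ j * K * K) K (Suc (Suc (2 * j)))"
      by (intro deriv_bound_deriv Suc)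
    from deriv_bound_mult[OF M this MK(2,1)] show ?case
      by (simp add: \<Gamma>_def power2_eq_square mult_ac)
  qed
qed

definition outer_sum :: "real \<Rightarrow> nat \<Rightarrow> real \<Rightarrow> real" where
  "outer_sum \<epsilon> M x = (\<Sum>j<M. \<epsilon> ^ (2 * j) * outer j x)"

lemma ndiff_outer: "ndiff J n (outer j)"
  by (rule deriv_boundD(1)[OF deriv_bound_outer])

lemma ndiff_outer_sum: "ndiff J n (outer_sum \<epsilon> M)"
  unfolding outer_sum_def[abs_def] by (intro ndiff_sum ndiff_cmult ndiff_outer) auto

lemma deriv_n_outer_sum:
  assumes "x \<in> J"
  shows "(deriv ^^ n) (outer_sum \<epsilon> M) x = (\<Sum>j<M. \<epsilon> ^ (2 * j) * (deriv ^^ n) (outer j) x)"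
  using assms
proof (induction n arbitrary: x)
  case (Suc n)
  have "(deriv ^^ Suc n) (outer_sum \<epsilon> M) x = deriv (\<lambda>x. \<Sum>j<M. \<epsilon> ^ (2 * j) * (deriv ^^ n) (outer j) x) x"
    using deriv_cong_open(1)[of J, OF _ Suc.IH Suc.prems] by simp
  also have "\<dots> = (\<Sum>j<M. \<epsilon> ^ (2 * j) * (deriv ^^ Suc n) (outer j) x)"
    by (intro DERIV_imp_deriv DERIV_sum DERIV_cmult ndiff_DERIV[OF ndiff_outer[of "Suc n"] _ Suc.prems]) auto
  finally show ?case .
qed (simp add: outer_sum_def)

lemma fact_le_pow: "m \<le> M \<Longrightarrow> fact m \<le> real M ^ m"
proof -
  assume m: "m \<le> M"
  have "fact m \<le> real m ^ m" using fact_le_power[of m, where 'a = real] by simp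
  also have "\<dots> \<le> real M ^ m" using m by (intro power_mono) auto
  finally show ?thesis .
qed

lemma fact_add_le: "fact (n + m) \<le> (2 ^ (n + m) * fact n * fact m :: real)"
proof -
  have "(n + m) choose n \<le> 2 ^ (n + m)" by (rule binomial_le_pow2)
  then have "real ((n + m) choose n) \<le> real (2 ^ (n + m))" by (rule of_nat_mono)
  moreover have "fact n * fact m * real ((n + m) choose n) = fact (n + m)"
    using binomial_fact_lemma[of n "n + m"]
    by (metis (mono_tags) add_diff_cancel_left' le_add1 of_nat_fact of_nat_mult)
  ultimately show ?thesis
    using mult_left_mono[of "real ((n + m) choose n)" "2 ^ (n + m)" "fact n * fact m"] by (simp add: mult_ac)
qed

text \<open>(n + 2 j)! is split into 2^(n + 2 j) n! (2 j)!, and (2 j)! \<le> (4 M^2)^j because j <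
  M. The terms are then geometric with ratio 16 \<open>\<Gamma>\<close> (\<epsilon> M)^2, well below
  1 / 2, and the splitting doubles the rate. The factor 128 is dictated by
  \<open>outer_residual_bound\<close>.\<close>

lemma deriv_bound_outer_sum:
  assumes e: "0 \<le> \<epsilon>" and small: "128 * \<Gamma> * (\<epsilon> * real M)\<^sup>2 \<le> 1"
  shows "deriv_bound (outer_sum \<epsilon> M) (2 * A0) (2 * K) 0"
  unfolding deriv_bound_def
proof (intro conjI allI ballI ndiff_outer_sum)
  fix n x assume x: "x \<in> J"
  have K0: "0 \<le> K" using K by simp
  have "\<bar>(deriv ^^ n) (outer_sum \<epsilon> M) x\<bar> \<le> (\<Sum>j<M. \<bar>\<epsilon> ^ (2 * j) * (deriv ^^ n) (outer j) x\<bar>)"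
    unfolding deriv_n_outer_sum[OF x] by (rule sum_abs)
  also have "\<dots> \<le> (\<Sum>j<M. A0 * (2 * K) ^ n * fact n * (1 / 2) ^ j)"
  proof (rule sum_mono)
    fix j assume "j \<in> {..<M}"
    then have j: "j < M" by simp
    have "fact (2 * j) \<le> real (2 * M) ^ (2 * j)" by (rule fact_le_pow) (use j in simp)
    then have f2: "fact (2 * j) \<le> (4 * (real M)\<^sup>2) ^ j" by (simp add: power_mult power_mult_distrib)
    have "\<bar>\<epsilon> ^ (2 * j) * (deriv ^^ n) (outer j) x\<bar> = (\<epsilon>\<^sup>2) ^ j * \<bar>(deriv ^^ n) (outer j) x\<bar>"
      using e by (simp add: abs_mult power_mult)
    also have "\<dots> \<le> (\<epsilon>\<^sup>2) ^ j * (A0 * \<Gamma> ^ j * K ^ n * fact (n + 2 * j))"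
      by (rule mult_left_mono[OF deriv_boundD(2)[OF deriv_bound_outer x]]) simp
    also have "\<dots> \<le> (\<epsilon>\<^sup>2) ^ j * (A0 * \<Gamma> ^ j * K ^ n * (2 ^ (n + 2 * j) * fact n * (4 * (real M)\<^sup>2) ^ j))"
    proof (intro mult_left_mono)
      have "fact (n + 2 * j) \<le> (2 ^ (n + 2 * j) * fact n * fact (2 * j) :: real)" by (rule fact_add_le)
      also have "\<dots> \<le> 2 ^ (n + 2 * j) * fact n * (4 * (real M)\<^sup>2) ^ j" using f2 by (intro mult_left_mono) auto
      finally show "fact (n + 2 * j) \<le> 2 ^ (n + 2 * j) * fact n * (4 * (real M)\<^sup>2) ^ j" .
    qed (use A0_pos \<Gamma>_pos K0 in auto)
    also have "\<dots> = A0 * (2 * K) ^ n * fact n * (16 * \<Gamma> * (\<epsilon> * real M)\<^sup>2) ^ j"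
    proof -
      have "(2::real) ^ (2 * j) = 4 ^ j" by (simp add: power_mult)
      then have "(2::real) ^ (n + 2 * j) = 2 ^ n * 4 ^ j" by (simp add: power_add)
      moreover have "(16::real) ^ j = 4 ^ j * 4 ^ j" by (simp add: power_mult_distrib[symmetric])
      ultimately show ?thesis by (simp add: power_mult_distrib)
    qed
    also have "\<dots> \<le> A0 * (2 * K) ^ n * fact n * (1 / 2) ^ j"
      using small A0_pos K0 \<Gamma>_pos by (intro mult_left_mono power_mono) auto
    finally show "\<bar>\<epsilon> ^ (2 * j) * (deriv ^^ n) (outer j) x\<bar> \<le> A0 * (2 * K) ^ n * fact n * (1 / 2) ^ j" .
  qed
  also have "\<dots> = A0 * (2 * K) ^ n * fact n * (\<Sum>j<M. (1 / 2) ^ j)" by (simp add: sum_distrib_left)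
  also have "\<dots> \<le> A0 * (2 * K) ^ n * fact n * 2"
  proof (rule mult_left_mono)
    have "(\<Sum>j<M. (1 / 2 :: real) ^ j) = 2 - 2 * (1/2) ^ M" by (induction M) auto
    then show "(\<Sum>j<M. (1 / 2 :: real) ^ j) \<le> 2" by simp
  qed (use A0_pos K0 in simp)
  finally show "\<bar>(deriv ^^ n) (outer_sum \<epsilon> M) x\<bar> \<le> 2 * A0 * (2 * K) ^ n * fact (n + 0)" by (simp add: mult_ac)
qed

definition outer_residual :: "real \<Rightarrow> nat \<Rightarrow> real \<Rightarrow> real" where
  "outer_residual \<epsilon> M x = \<epsilon> ^ (2 * M) * deriv (deriv (outer (M - 1))) x"

text \<open>The recursion telescopes and leaves only the second derivative of the last
  coefficient.\<close>

lemma outer_sum_equation: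
  assumes x: "x \<in> J" and M: "0 < M"
  shows "\<epsilon>\<^sup>2 * deriv (deriv (outer_sum \<epsilon> M)) x = b x * outer_sum \<epsilon> M x - f x + outer_residual \<epsilon> M x"
proof -
  obtain m where m: "M = Suc m" using M by (cases M) auto
  have bz: "b x \<noteq> 0" using b_pos[OF x] by simp
  have "deriv (deriv (outer_sum \<epsilon> M)) x = (\<Sum>j<M. \<epsilon> ^ (2 * j) * deriv (deriv (outer j)) x)"
    using deriv_n_outer_sum[OF x, of 2] by (simp add: numeral_2_eq_2)
  then have 1: "\<epsilon>\<^sup>2 * deriv (deriv (outer_sum \<epsilon> M)) x = (\<Sum>j<M. \<epsilon> ^ (2 * Suc j) * deriv (deriv (outer j)) x)"
    by (simp add: sum_distrib_left power2_eq_square mult.assoc)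
  have "b x * outer_sum \<epsilon> M x = (\<Sum>j<Suc m. \<epsilon> ^ (2 * j) * (b x * outer j x))"
    by (simp add: outer_sum_def m sum_distrib_left mult_ac del: sum.lessThan_Suc)
  also have "\<dots> = b x * outer 0 x + (\<Sum>j<m. \<epsilon> ^ (2 * Suc j) * (b x * outer (Suc j) x))"
    by (subst sum.lessThan_Suc_shift) simp
  also have "\<dots> = f x + (\<Sum>j<m. \<epsilon> ^ (2 * Suc j) * deriv (deriv (outer j)) x)" using bz by simp
  finally show ?thesis unfolding 1 by (simp add: m outer_residual_def)
qed

text \<open>With 4 \<open>\<Gamma>\<close> (\<epsilon> M)^2 \<le> 1 / 32 the factorial growth is
  beaten: M^2 / 32^(M - 1) is at most 4^M / 32^(M - 1) = 32 / 8^M. One factor \<epsilon>^2 is kept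
  apart, because the energy estimate divides the residual by it.\<close>

lemma outer_residual_bound:
  assumes e: "0 \<le> \<epsilon>" and small: "128 * \<Gamma> * (\<epsilon> * real M)\<^sup>2 \<le> 1" and M: "0 < M" and x: "x \<in> J"
  shows "\<bar>outer_residual \<epsilon> M x\<bar> \<le> \<epsilon>\<^sup>2 * (128 * A0 * K\<^sup>2) * exp (- real M)"
proof -
  obtain m where m: "M = Suc m" using M by (cases M) auto
  have K0: "0 \<le> K" using K by simp
  have "deriv_bound (deriv (deriv (outer m))) (A0 * \<Gamma> ^ m * K * K) K (Suc (Suc (2 * m)))"
    by (intro deriv_bound_deriv deriv_bound_outer)
  from deriv_boundD(2)[OF this x, of 0]
  have "\<bar>deriv (deriv (outer m)) x\<bar> \<le> A0 * K\<^sup>2 * \<Gamma> ^ m * fact (2 * M)"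
    by (simp add: m power2_eq_square mult_ac del: fact_Suc)
  also have "\<dots> \<le> A0 * K\<^sup>2 * \<Gamma> ^ m * (4 * (real M)\<^sup>2) ^ M"
  proof (rule mult_left_mono)
    have "fact (2 * M) \<le> real (2 * M) ^ (2 * M)" by (rule fact_le_pow) simp
    then show "fact (2 * M) \<le> (4 * (real M)\<^sup>2) ^ M" by (simp add: power_mult power_mult_distrib)
  qed (use A0_pos \<Gamma>_pos in simp)
  finally have d: "\<bar>deriv (deriv (outer m)) x\<bar> \<le> A0 * K\<^sup>2 * \<Gamma> ^ m * (4 * (real M)\<^sup>2) ^ M" .
  have "\<bar>outer_residual \<epsilon> M x\<bar> = (\<epsilon>\<^sup>2) ^ M * \<bar>deriv (deriv (outer m)) x\<bar>"
    unfolding outer_residual_def abs_mult power_mult using m e by (simp del: power_Suc)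
  also have "\<dots> \<le> (\<epsilon>\<^sup>2) ^ M * (A0 * K\<^sup>2 * \<Gamma> ^ m * (4 * (real M)\<^sup>2) ^ M)"
    by (rule mult_left_mono[OF d]) simp
  also have "\<dots> = \<epsilon>\<^sup>2 * (4 * A0 * K\<^sup>2) * ((real M)\<^sup>2 * (4 * \<Gamma> * (\<epsilon> * real M)\<^sup>2) ^ m)"
    by (simp add: m power_mult_distrib mult_ac)
  also have "\<dots> \<le> \<epsilon>\<^sup>2 * (4 * A0 * K\<^sup>2) * (32 * exp (- real M))"
  proof (rule mult_left_mono)
    have "(4 * \<Gamma> * (\<epsilon> * real M)\<^sup>2) ^ m \<le> (1 / 32) ^ m"
      using small \<Gamma>_pos by (intro power_mono) auto
    then have "(real M)\<^sup>2 * (4 * \<Gamma> * (\<epsilon> * real M)\<^sup>2) ^ m \<le> (real M)\<^sup>2 * (1 / 32) ^ m"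
      by (rule mult_left_mono) simp
    also have "\<dots> \<le> 4 ^ M * (1 / 32) ^ m"
    proof (rule mult_right_mono)
      have "real M < real (2 ^ M)" using less_exp[of M] by (simp only: of_nat_less_iff)
      then have "(real M)\<^sup>2 \<le> (2 ^ M)\<^sup>2" by (intro power_mono) auto
      also have "\<dots> = (2\<^sup>2) ^ M" by (simp only: power_mult[symmetric] mult.commute)
      also have "\<dots> = 4 ^ M" by simp
      finally show "(real M)\<^sup>2 \<le> 4 ^ M" .
    qed simp
    also have "\<dots> = 32 * (1 / 8) ^ M" unfolding m power_Suc by (simp add: power_mult_distrib[symmetric])
    also have "\<dots> \<le> 32 * exp (-1) ^ M"
    proof (intro mult_left_mono power_mono)
      have "exp (1::real) \<le> 8" using exp_le by linarith
      then show "1 / 8 \<le> exp (-1 :: real)" by (simp add: exp_minus field_simps)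
    qed auto
    also have "exp (-1 :: real) ^ M = exp (- real M)" by (simp add: exp_of_nat_mult[symmetric])
    finally show "(real M)\<^sup>2 * (4 * \<Gamma> * (\<epsilon> * real M)\<^sup>2) ^ m \<le> 32 * exp (- real M)" .
  qed (use A0_pos in simp)
  finally show ?thesis by simp
qed

end

section \<open>The remainder away from the boundary\<close>

context reaction_diffusion begin

definition \<sigma> :: real where "\<sigma> = sqrt b0"

text \<open>The function exp(-\<sigma> d / \<epsilon>) of the distance d is a supersolution for
  \<open>\<sigma>\<close> = sqrt b0, and the barrier acts over a distance p \<epsilon> / 2; hence
  \<sigma> / 2. The cap 1 comes from the factor exp(-p) of the residual.\<close>

definition rate :: real where "rate = min 1 (\<sigma> / 2)"

definition Cr :: real where "Cr = 128 * A0 * K\<^sup>2"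

definition Cz :: real where "Cz = Cr / b0 + 2 * (A + 2 * A0)"

definition CE :: real where "CE = Cz * (2 * K + 8 * A0 * K + 2 * Cr)"

lemma \<sigma>: "0 < \<sigma>" "\<sigma>\<^sup>2 = b0"
  using b0 by (simp_all add: \<sigma>_def)

lemma rate: "0 < rate" "rate \<le> 1" "rate \<le> \<sigma> / 2"
  using \<sigma> by (auto simp: rate_def)

lemma consts_pos: "0 < Cr" "0 < Cz" "0 < CE"
proof -
  show 1: "0 < Cr" using A0_pos K(1) by (simp add: Cr_def)
  then show 2: "0 < Cz" using A0_pos A b0 by (simp add: Cz_def add_pos_pos)
  have "0 < 2 * K + 8 * A0 * K + 2 * Cr" using 1 A0_pos K(1) by (intro add_pos_pos mult_pos_pos) auto
  with 2 show "0 < CE" unfolding CE_def by (rule mult_pos_pos)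
qed

end

lemma (in reaction_diffusion) outer_sum_bounds:
  assumes "0 \<le> \<epsilon>" "128 * \<Gamma> * (\<epsilon> * real M)\<^sup>2 \<le> 1" "x \<in> J"
  shows "\<bar>outer_sum \<epsilon> M x\<bar> \<le> 2 * A0" "\<bar>deriv (outer_sum \<epsilon> M) x\<bar> \<le> 4 * A0 * K"
  using deriv_boundD(2)[OF deriv_bound_outer_sum[OF assms(1,2)] assms(3), of 0]
    deriv_boundD(2)[OF deriv_bound_outer_sum[OF assms(1,2)] assms(3), of 1] by (simp_all add: mult_ac)

context classical_solution begin

context
  fixes p :: nat
  assumes p: "0 < p" and p_small: "real p * \<epsilon> \<le> 1 / 2" "128 * \<Gamma> * (\<epsilon> * real p)\<^sup>2 \<le> 1"
begin

definition rem :: "real \<Rightarrow> real" where "rem x = U x - outer_sum \<epsilon> p x"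

definition rem' :: "real \<Rightarrow> real" where "rem' x = U' x - deriv (outer_sum \<epsilon> p) x"

lemma rem_deriv: "x \<in> J \<Longrightarrow> (rem has_real_derivative rem' x) (at x)"
  unfolding rem_def[abs_def] rem'_def
  by (intro DERIV_diff U_deriv ndiff_DERIV0[OF ndiff_outer_sum])

lemma rem'_deriv:
  assumes x: "x \<in> J"
  shows "(rem' has_real_derivative (b x * rem x - outer_residual \<epsilon> p x) / \<epsilon>\<^sup>2) (at x)"
proof -
  have "(rem' has_real_derivative (b x * U x - f x) / \<epsilon>\<^sup>2 - deriv (deriv (outer_sum \<epsilon> p)) x) (at x)"
    unfolding rem'_def[abs_def]
    by (intro DERIV_diff U'_deriv x ndiff_DERIV0[OF ndiff_deriv[OF ndiff_outer_sum]])
  moreover have "deriv (deriv (outer_sum \<epsilon> p)) x = (b x * outer_sum \<epsilon> p x - f x + outer_residual \<epsilon> p x) / \<epsilon>\<^sup>2"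
    using outer_sum_equation[OF x p, of \<epsilon>] eps by (simp add: field_simps)
  ultimately show ?thesis
    by (elim DERIV_cong) (simp add: rem_def diff_divide_distrib add_divide_distrib right_diff_distrib)
qed

lemma residual_bound: "x \<in> J \<Longrightarrow> \<bar>outer_residual \<epsilon> p x\<bar> \<le> \<epsilon>\<^sup>2 * (Cr * exp (- real p))"
  using outer_residual_bound[OF _ p_small(2) p] eps by (simp add: Cr_def mult.assoc)

lemma rem_bound_crude: "x \<in> J \<Longrightarrow> \<bar>rem x\<bar> \<le> A + 2 * A0"
  using U_bound[of x] outer_sum_bounds(1)[OF _ p_small(2), of x] eps by (auto simp: rem_def)

text \<open>The barrier has two parts: the constant \<rho> / b0 absorbs the residual, and two
  exponentials of amplitude D dominate the remainder at a and c, where only the crude bound is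
  available.\<close>

lemma rem_bound:
  assumes x: "x \<in> {-1 + p * \<epsilon>..1 - p * \<epsilon>}"
  shows "\<bar>rem x\<bar> \<le> Cz * exp (- rate * p)"
proof -
  define t where "t = p * \<epsilon>"
  \<comment> \<open>The comparison starts inside the layers, since the outer expansion is controlled
    on the open interval only; the other half of the layer width p \<epsilon> is left for the
    decay.\<close>
  define a where "a = -1 + t / 2"
  define c where "c = 1 - t / 2"
  define D where "D = A + 2 * A0"
  define \<rho> where "\<rho> = Cr * exp (- real p)"
  have pe: "0 < t" "t \<le> 1 / 2" using p eps p_small(1) by (auto simp: t_def)
  have "-1 + t \<le> x" "x \<le> 1 - t" using x by (simp_all add: t_def)
  then have xac: "x \<in> {a..c}" "t / 2 \<le> x - a" "t / 2 \<le> c - x" using pe by (auto simp: a_def c_def)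
  have acJ: "{a..c} \<subseteq> J" using pe by (auto simp: a_def c_def)
  have D0: "0 < D" using A A0_pos by (simp add: D_def)
  have \<rho>0: "0 < \<rho>" using consts_pos by (simp add: \<rho>_def)
  have main: "0 \<le> \<rho> / b0 + D * (exp (- (\<sigma> / \<epsilon> * (x - a))) + exp (- (\<sigma> / \<epsilon> * (c - x)))) + s * rem x"
    if s: "s = 1 \<or> s = -1" for s
  proof (rule max_principle[where a = a and c = c and b = b and \<epsilon> = \<epsilon> and
        Z = "\<lambda>x. \<rho> / b0 + D * (exp (- (\<sigma> / \<epsilon> * (x - a))) + exp (- (\<sigma> / \<epsilon> * (c - x)))) + s * rem x"
      and Z' = "\<lambda>x. D * (- (\<sigma> / \<epsilon>) * exp (- (\<sigma> / \<epsilon> * (x - a))) + (\<sigma> / \<epsilon>) * exp (- (\<sigma> / \<epsilon> * (c - x)))) + s * rem' x"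
      and Z'' = "\<lambda>x. D * ((\<sigma> / \<epsilon>)\<^sup>2 * exp (- (\<sigma> / \<epsilon> * (x - a))) + (\<sigma> / \<epsilon>)\<^sup>2 * exp (- (\<sigma> / \<epsilon> * (c - x)))) + s * ((b x * rem x - outer_residual \<epsilon> p x) / \<epsilon>\<^sup>2)"])
    have rc: "continuous_on {a..c} rem"
      by (intro continuous_at_imp_continuous_on ballI DERIV_isCont[OF rem_deriv]) (use acJ in auto)
    show "continuous_on {a..c} (\<lambda>x. \<rho> / b0 + D * (exp (- (\<sigma> / \<epsilon> * (x - a))) + exp (- (\<sigma> / \<epsilon> * (c - x)))) + s * rem x)"
      by (intro continuous_intros rc)
    have ac: "a \<in> J" "c \<in> J" using pe by (auto simp: a_def c_def)
    have sr: "- D \<le> s * rem y" if "y \<in> J" for y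
      using rem_bound_crude[OF that] s by (auto simp: D_def)
    have "0 \<le> \<rho> / b0" using \<rho>0 b0 by simp
    moreover have "D \<le> D * (exp (- (\<sigma> / \<epsilon> * (a - a))) + exp (- (\<sigma> / \<epsilon> * (c - a))))"
      using D0 by simp
    ultimately show "0 \<le> \<rho> / b0 + D * (exp (- (\<sigma> / \<epsilon> * (a - a))) + exp (- (\<sigma> / \<epsilon> * (c - a)))) + s * rem a"
      using sr[OF ac(1)] by linarith
    have "0 \<le> \<rho> / b0" using \<rho>0 b0 by simp
    moreover have "D \<le> D * (exp (- (\<sigma> / \<epsilon> * (c - a))) + exp (- (\<sigma> / \<epsilon> * (c - c))))"
      using D0 by simp
    ultimately show "0 \<le> \<rho> / b0 + D * (exp (- (\<sigma> / \<epsilon> * (c - a))) + exp (- (\<sigma> / \<epsilon> * (c - c)))) + s * rem c"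
      using sr[OF ac(2)] by linarith
  next
    fix y assume "y \<in> {a<..<c}"
    then have y: "y \<in> J" by (intro subsetD[OF acJ]) auto
    show "((\<lambda>x. \<rho> / b0 + D * (exp (- (\<sigma> / \<epsilon> * (x - a))) + exp (- (\<sigma> / \<epsilon> * (c - x)))) + s * rem x) has_real_derivative
      D * (- (\<sigma> / \<epsilon>) * exp (- (\<sigma> / \<epsilon> * (y - a))) + (\<sigma> / \<epsilon>) * exp (- (\<sigma> / \<epsilon> * (c - y)))) + s * rem' y) (at y)"
      by (rule derivative_eq_intros rem_deriv[OF y] refl)+ (simp add: algebra_simps)
    show "((\<lambda>x. D * (- (\<sigma> / \<epsilon>) * exp (- (\<sigma> / \<epsilon> * (x - a))) + (\<sigma> / \<epsilon>) * exp (- (\<sigma> / \<epsilon> * (c - x)))) + s * rem' x) has_real_derivative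
      D * ((\<sigma> / \<epsilon>)\<^sup>2 * exp (- (\<sigma> / \<epsilon> * (y - a))) + (\<sigma> / \<epsilon>)\<^sup>2 * exp (- (\<sigma> / \<epsilon> * (c - y)))) + s * ((b y * rem y - outer_residual \<epsilon> p y) / \<epsilon>\<^sup>2)) (at y)"
      by (rule derivative_eq_intros rem'_deriv[OF y] refl)+ (simp add: algebra_simps power2_eq_square)
    show "0 < b y" by (rule b_pos[OF y])
    define S where "S = exp (- (\<sigma> / \<epsilon> * (y - a))) + exp (- (\<sigma> / \<epsilon> * (c - y)))"
    have S0: "0 \<le> S" by (simp add: S_def)
    have "\<epsilon>\<^sup>2 * (D * ((\<sigma> / \<epsilon>)\<^sup>2 * exp (- (\<sigma> / \<epsilon> * (y - a))) + (\<sigma> / \<epsilon>)\<^sup>2 * exp (- (\<sigma> / \<epsilon> * (c - y)))) + s * ((b y * rem y - outer_residual \<epsilon> p y) / \<epsilon>\<^sup>2))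
      = (\<epsilon>\<^sup>2 * (\<sigma> / \<epsilon>)\<^sup>2) * (D * S) + s * (\<epsilon>\<^sup>2 * ((b y * rem y - outer_residual \<epsilon> p y) / \<epsilon>\<^sup>2))"
      unfolding S_def by (simp only: distrib_left mult_ac)
    also have "\<dots> = b0 * (D * S) + s * (b y * rem y - outer_residual \<epsilon> p y)"
      using eps \<sigma>(2) by (simp add: power_divide)
    also have "\<dots> \<le> b y * (\<rho> / b0 + D * S + s * rem y)"
    proof -
      have 1: "b0 * (D * S) \<le> b y * (D * S)" using b0(2)[OF y] D0 S0 by (intro mult_right_mono) auto
      have "b0 * (\<rho> / b0) \<le> b y * (\<rho> / b0)" using b0(1) b0(2)[OF y] \<rho>0 by (intro mult_right_mono) auto
      then have 2: "\<rho> \<le> b y * (\<rho> / b0)" using b0(1) by simp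
      have "\<epsilon>\<^sup>2 * \<rho> \<le> \<rho>" using eps \<rho>0 by (simp add: power_le_one)
      then have "\<bar>outer_residual \<epsilon> p y\<bar> \<le> \<rho>" using residual_bound[OF y] by (simp add: \<rho>_def)
      then have 3: "- (s * outer_residual \<epsilon> p y) \<le> \<rho>" using s by auto
      have "s * (b y * rem y - outer_residual \<epsilon> p y) = b y * (s * rem y) - s * outer_residual \<epsilon> p y"
        by (simp add: algebra_simps)
      moreover have "b y * (\<rho> / b0 + D * S + s * rem y) = b y * (\<rho> / b0) + b y * (D * S) + b y * (s * rem y)"
        by (simp only: distrib_left)
      moreover have "b0 * (D * S) + (b y * (s * rem y) - s * outer_residual \<epsilon> p y) \<le>
        b y * (D * S) + (b y * (s * rem y) + b y * (\<rho> / b0))"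
        using add_mono[OF 1 add_mono[OF order_refl[of "b y * (s * rem y)"] order_trans[OF 3 2]]] by simp
      ultimately show ?thesis by (simp only: add_ac)
    qed
    finally show "\<epsilon>\<^sup>2 * (D * ((\<sigma> / \<epsilon>)\<^sup>2 * exp (- (\<sigma> / \<epsilon> * (y - a))) + (\<sigma> / \<epsilon>)\<^sup>2 * exp (- (\<sigma> / \<epsilon> * (c - y)))) + s * ((b y * rem y - outer_residual \<epsilon> p y) / \<epsilon>\<^sup>2))
      \<le> b y * (\<rho> / b0 + D * (exp (- (\<sigma> / \<epsilon> * (y - a))) + exp (- (\<sigma> / \<epsilon> * (c - y)))) + s * rem y)"
      by (simp only: S_def)
  qed (rule xac)
  have ex: "exp (- (\<sigma> / \<epsilon> * d)) \<le> exp (- rate * p)" if d: "t / 2 \<le> d" for d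
  proof -
    have "rate * p \<le> \<sigma> / 2 * p" using rate(3) by (intro mult_right_mono) auto
    also have "\<dots> = \<sigma> / \<epsilon> * (t / 2)" using eps by (simp add: t_def)
    also have "\<dots> \<le> \<sigma> / \<epsilon> * d" using d \<sigma>(1) eps by (intro mult_left_mono) auto
    finally show ?thesis by simp
  qed
  have "\<bar>rem x\<bar> \<le> \<rho> / b0 + D * (exp (- (\<sigma> / \<epsilon> * (x - a))) + exp (- (\<sigma> / \<epsilon> * (c - x))))"
    using main[of 1] main[of "-1"] by (simp add: abs_le_iff)
  also have "\<dots> \<le> Cr * exp (- rate * p) / b0 + D * (exp (- rate * p) + exp (- rate * p))"
  proof (intro add_mono mult_left_mono ex xac(2,3))
    have "rate * p \<le> 1 * real p" using rate(2) by (intro mult_right_mono) auto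
    then show "\<rho> / b0 \<le> Cr * exp (- rate * p) / b0"
      unfolding \<rho>_def using consts_pos(1) b0(1) by (intro divide_right_mono mult_left_mono) auto
  qed (use D0 in simp)
  also have "\<dots> = Cz * exp (- rate * p)" by (simp add: Cz_def D_def algebra_simps)
  finally show ?thesis .
qed

text \<open>The derivative of \<open>rem\<close> times \<open>rem'\<close> is integrated. The term
  with b has the good sign, the residual divided by \<epsilon>^2 is bounded by \<open>Cr\<close>,
  and the boundary terms are a small \<open>rem\<close> times a \<open>rem'\<close> of order 1 /
  \<epsilon>, which the factor \<epsilon> compensates.\<close>

lemma rem'_energy:
  shows "(\<lambda>x. (rem' x)\<^sup>2) integrable_on {-1 + p * \<epsilon>..1 - p * \<epsilon>}"
    and "\<epsilon> * integral {-1 + p * \<epsilon>..1 - p * \<epsilon>} (\<lambda>x. (rem' x)\<^sup>2) \<le> CE * exp (- rate * p)"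
proof -
  define t where "t = p * \<epsilon>"
  define a where "a = -1 + t"
  define c where "c = 1 - t"
  define \<zeta> where "\<zeta> = Cz * exp (- rate * p)"
  have pe: "0 < t" "t \<le> 1 / 2" using p eps p_small(1) by (auto simp: t_def)
  have ac: "a \<le> c" using pe by (simp add: a_def c_def)
  have acJ: "{a..c} \<subseteq> J" using pe by (auto simp: a_def c_def)
  have \<zeta>: "\<bar>rem x\<bar> \<le> \<zeta>" if "x \<in> {a..c}" for x
    unfolding \<zeta>_def by (rule rem_bound) (use that in \<open>simp add: a_def c_def t_def\<close>)
  have \<zeta>0: "0 < \<zeta>" using consts_pos by (simp add: \<zeta>_def)
  have "continuous_on {a..c} rem'"
    by (intro continuous_at_imp_continuous_on ballI DERIV_isCont[OF rem'_deriv]) (use acJ in auto)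
  then have "continuous_on {a..c} (\<lambda>x. (rem' x)\<^sup>2)" by (intro continuous_intros)
  then show i: "(\<lambda>x. (rem' x)\<^sup>2) integrable_on {-1 + p * \<epsilon>..1 - p * \<epsilon>}"
    unfolding a_def c_def t_def by (rule integrable_continuous_real)
  let ?H' = "\<lambda>x. rem' x * rem' x + (b x * rem x - outer_residual \<epsilon> p x) / \<epsilon>\<^sup>2 * rem x"
  have H: "(?H' has_integral (rem c * rem' c - rem a * rem' a)) {a..c}"
  proof (rule fundamental_theorem_of_calculus[OF ac])
    fix x assume "x \<in> {a..c}"
    then have x: "x \<in> J" using acJ by auto
    have "((\<lambda>x. rem x * rem' x) has_real_derivative ?H' x) (at x)"
      by (rule DERIV_mult[OF rem_deriv[OF x] rem'_deriv[OF x]])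
    then show "((\<lambda>x. rem x * rem' x) has_vector_derivative ?H' x) (at x within {a..c})"
      by (simp add: has_real_derivative_iff_has_vector_derivative has_vector_derivative_at_within)
  qed
  \<comment> \<open>The constant makes up for the residual term of unknown sign, so that the
    integrands can be compared pointwise.\<close>
  have I1: "((\<lambda>x. ?H' x + \<zeta> * Cr) has_integral (rem c * rem' c - rem a * rem' a + (c - a) * (\<zeta> * Cr))) {a..c}"
    using has_integral_add[OF H has_integral_const_real[of "\<zeta> * Cr" a c]] ac by simp
  have I2: "((\<lambda>x. (rem' x)\<^sup>2) has_integral integral {a..c} (\<lambda>x. (rem' x)\<^sup>2)) {a..c}"
    using i unfolding a_def c_def t_def by (rule integrable_integral)
  have I: "integral {a..c} (\<lambda>x. (rem' x)\<^sup>2) \<le> rem c * rem' c - rem a * rem' a + (c - a) * (\<zeta> * Cr)"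
  proof (rule has_integral_le[OF I2 I1])
    fix x assume x: "x \<in> {a..c}"
    then have xJ: "x \<in> J" using acJ by blast
    have e1: "(b x * rem x - outer_residual \<epsilon> p x) / \<epsilon>\<^sup>2 * rem x = b x * (rem x)\<^sup>2 / \<epsilon>\<^sup>2 - outer_residual \<epsilon> p x / \<epsilon>\<^sup>2 * rem x"
      by (simp add: diff_divide_distrib power2_eq_square left_diff_distrib)
    have e2: "0 \<le> b x * (rem x)\<^sup>2 / \<epsilon>\<^sup>2" using b_pos[OF xJ] by simp
    have e3: "\<bar>outer_residual \<epsilon> p x / \<epsilon>\<^sup>2 * rem x\<bar> \<le> Cr * \<zeta>"
      unfolding abs_mult
    proof (intro mult_mono \<zeta>[OF x])
      have "\<bar>outer_residual \<epsilon> p x\<bar> / \<epsilon>\<^sup>2 \<le> Cr * exp (- real p)"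
        using residual_bound[OF xJ] eps by (simp add: field_simps)
      also have "\<dots> \<le> Cr * 1" using consts_pos(1) by (intro mult_left_mono) auto
      finally show "\<bar>outer_residual \<epsilon> p x / \<epsilon>\<^sup>2\<bar> \<le> Cr" by (simp add: abs_divide)
    qed (use consts_pos in auto)
    show "(rem' x)\<^sup>2 \<le> ?H' x + \<zeta> * Cr"
      unfolding e1 power2_eq_square[of "rem' x"] using e2 abs_le_D1[OF e3] unfolding mult.commute[of \<zeta> Cr] by linarith
  qed
  have r': "\<bar>rem' x\<bar> \<le> K / \<epsilon> + 4 * A0 * K / \<epsilon>" if "x \<in> {a..c}" for x
  proof -
    have xJ: "x \<in> J" using that acJ by auto
    have "4 * A0 * K \<le> 4 * A0 * K / \<epsilon>" using eps A0_pos K(1) by (simp add: field_simps mult_le_cancel_left1)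
    then show ?thesis
      using U'_bound[OF xJ] outer_sum_bounds(2)[OF _ p_small(2) xJ] eps unfolding rem'_def by linarith
  qed
  have HH: "\<bar>rem x * rem' x\<bar> \<le> \<zeta> * (K / \<epsilon> + 4 * A0 * K / \<epsilon>)" if "x \<in> {a..c}" for x
    unfolding abs_mult using \<zeta>[OF that] r'[OF that] \<zeta>0 by (intro mult_mono) auto
  have "(c - a) * (\<zeta> * Cr) \<le> 2 * (\<zeta> * Cr)"
    using pe \<zeta>0 consts_pos by (intro mult_right_mono) (auto simp: a_def c_def)
  then have "integral {a..c} (\<lambda>x. (rem' x)\<^sup>2) \<le> 2 * (\<zeta> * (K / \<epsilon> + 4 * A0 * K / \<epsilon>)) + 2 * (\<zeta> * Cr)"
    using I abs_le_D2[OF HH[of a]] abs_le_D1[OF HH[of c]] ac by (simp add: mult.commute)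
  then have "\<epsilon> * integral {a..c} (\<lambda>x. (rem' x)\<^sup>2) \<le> \<epsilon> * (2 * (\<zeta> * (K / \<epsilon> + 4 * A0 * K / \<epsilon>)) + 2 * (\<zeta> * Cr))"
    using eps by (intro mult_left_mono) auto
  also have "\<dots> = \<zeta> * (2 * K + 8 * A0 * K) + \<epsilon> * (2 * (\<zeta> * Cr))"
    using eps by (simp add: field_simps)
  also have "\<dots> \<le> \<zeta> * (2 * K + 8 * A0 * K) + 1 * (2 * (\<zeta> * Cr))"
    using eps \<zeta>0 consts_pos by (intro add_left_mono mult_right_mono) auto
  also have "\<dots> = CE * exp (- rate * p)" by (simp add: CE_def \<zeta>_def algebra_simps)
  finally show "\<epsilon> * integral {-1 + p * \<epsilon>..1 - p * \<epsilon>} (\<lambda>x. (rem' x)\<^sup>2) \<le> CE * exp (- rate * p)"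
    by (simp add: a_def c_def t_def)
qed

end

end

section \<open>Piecewise affine functions\<close>

text \<open>Affinity on the closed interval encodes continuity at the breakpoints, and quantifying
  over gaps avoids enumerating them. The property is carried through the layers because it yields
  continuity and a derivative off a finite set.\<close>

definition pw_affine :: "(real \<Rightarrow> real) \<Rightarrow> bool" where
  "pw_affine F \<longleftrightarrow> (\<exists>S. finite S \<and>
     (\<forall>a b. a < b \<longrightarrow> {a<..<b} \<inter> S = {} \<longrightarrow> (\<exists>s c. \<forall>x\<in>{a..b}. F x = s * x + c)))"

lemma pw_affine_const: "pw_affine (\<lambda>_. c)"
  unfolding pw_affine_def by (rule exI[of _ "{}"]) (auto intro: exI[of _ 0])

lemma pw_affine_ident: "pw_affine (\<lambda>x. x)"
proof -
  have "\<forall>x\<in>{a..b}. x = 1 * x + 0" for a b :: real by simp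
  then show ?thesis unfolding pw_affine_def by blast
qed

lemma pw_affine_cmult:
  assumes "pw_affine F"
  shows "pw_affine (\<lambda>x. k * F x)"
proof -
  obtain S where S: "finite S" "\<And>a b. a < b \<Longrightarrow> {a<..<b} \<inter> S = {} \<Longrightarrow> \<exists>s c. \<forall>x\<in>{a..b}. F x = s * x + c"
    using assms unfolding pw_affine_def by blast
  have "\<exists>s c. \<forall>x\<in>{a..b}. k * F x = s * x + c" if ab: "a < b" "{a<..<b} \<inter> S = {}" for a b
  proof -
    obtain s c where "\<forall>x\<in>{a..b}. F x = s * x + c" using S(2)[OF ab] by blast
    then have "\<forall>x\<in>{a..b}. k * F x = (k * s) * x + k * c" by (simp add: algebra_simps)
    then show ?thesis by blast
  qed
  then show ?thesis unfolding pw_affine_def using S(1) by blast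
qed

lemma pw_affine_add:
  assumes "pw_affine F" "pw_affine G"
  shows "pw_affine (\<lambda>x. F x + G x)"
proof -
  obtain S where S: "finite S" "\<And>a b. a < b \<Longrightarrow> {a<..<b} \<inter> S = {} \<Longrightarrow> \<exists>s c. \<forall>x\<in>{a..b}. F x = s * x + c"
    using assms(1) unfolding pw_affine_def by blast
  obtain T where T: "finite T" "\<And>a b. a < b \<Longrightarrow> {a<..<b} \<inter> T = {} \<Longrightarrow> \<exists>s c. \<forall>x\<in>{a..b}. G x = s * x + c"
    using assms(2) unfolding pw_affine_def by blast
  have "\<exists>s c. \<forall>x\<in>{a..b}. F x + G x = s * x + c" if ab: "a < b" "{a<..<b} \<inter> (S \<union> T) = {}" for a b
  proof -
    have e: "{a<..<b} \<inter> S = {}" "{a<..<b} \<inter> T = {}" using ab(2) by auto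
    obtain s c where "\<forall>x\<in>{a..b}. F x = s * x + c" using S(2)[OF ab(1) e(1)] by blast
    moreover obtain s' c' where "\<forall>x\<in>{a..b}. G x = s' * x + c'" using T(2)[OF ab(1) e(2)] by blast
    ultimately have "\<forall>x\<in>{a..b}. F x + G x = (s + s') * x + (c + c')" by (simp add: algebra_simps)
    then show ?thesis by blast
  qed
  then show ?thesis unfolding pw_affine_def using S(1) T(1) by (intro exI[of _ "S \<union> T"]) blast
qed

lemma pw_affine_sum: "(\<And>i. i \<in> A \<Longrightarrow> pw_affine (F i)) \<Longrightarrow> pw_affine (\<lambda>x. \<Sum>i\<in>A. F i x)"
  by (induction A rule: infinite_finite_induct) (auto intro: pw_affine_add pw_affine_const)

text \<open>The rectifier adds the isolated zeros as breakpoints. There is at most one of them in each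
  gap between old breakpoints, and the gap of \<open>x\<close> is identified by the set of old breakpoints below \<open>x\<close>.\<close>

lemma pw_affine_relu:
  assumes "pw_affine F"
  shows "pw_affine (\<lambda>x. relu (F x))"
proof -
  obtain S where S: "finite S" "\<And>a b. a < b \<Longrightarrow> {a<..<b} \<inter> S = {} \<Longrightarrow> \<exists>s c. \<forall>x\<in>{a..b}. F x = s * x + c"
    using assms unfolding pw_affine_def by blast
  define Z where "Z = {x. x \<notin> S \<and> F x = 0 \<and> \<not> (\<exists>e>0. \<forall>y\<in>{x..x+e}. F y = 0)}"
  have inj: "inj_on (\<lambda>x. S \<inter> {..<x}) Z"
  proof (rule linorder_inj_onI')
    fix x y assume xy: "x \<in> Z" "y \<in> Z" "x < y"
    show "S \<inter> {..<x} \<noteq> S \<inter> {..<y}"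
    proof
      assume eq: "S \<inter> {..<x} = S \<inter> {..<y}"
      have "{x<..<y} \<inter> S = {}"
      proof (rule ccontr)
        assume "{x<..<y} \<inter> S \<noteq> {}"
        then obtain t where t: "x < t" "t < y" "t \<in> S" by auto
        then have "t \<in> S \<inter> {..<y}" by simp
        then have "t \<in> S \<inter> {..<x}" using eq by blast
        then show False using t(1) by simp
      qed
      then obtain s c where sc: "\<forall>t\<in>{x..y}. F t = s * t + c" using S(2)[OF xy(3)] by blast
      have "F x = 0" "F y = 0" using xy by (auto simp: Z_def)
      then have "s * x + c = 0" "s * y + c = 0" using sc xy(3) by auto
      then have "s * y - s * x = 0" by linarith
      then have "s * (y - x) = 0" by (simp only: right_diff_distrib)
      then have "s = 0" "c = 0" using xy(3) \<open>s * x + c = 0\<close> by auto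
      then have "\<forall>t\<in>{x..x + (y - x)}. F t = 0" using sc by simp
      moreover have "0 < y - x" using xy(3) by simp
      ultimately have "\<exists>e>0. \<forall>t\<in>{x..x + e}. F t = 0" by blast
      then show False using xy(1) unfolding Z_def by blast
    qed
  qed
  have "finite ((\<lambda>x. S \<inter> {..<x}) ` Z)"
    by (rule finite_subset[of _ "Pow S"]) (use S(1) in auto)
  then have Zf: "finite Z" using inj by (rule finite_imageD)
  have "\<exists>s c. \<forall>x\<in>{a..b}. relu (F x) = s * x + c" if ab: "a < b" "{a<..<b} \<inter> (S \<union> Z) = {}" for a b
  proof -
    have e: "{a<..<b} \<inter> S = {}" using ab(2) by auto
    obtain s c where sc: "\<And>x. x \<in> {a..b} \<Longrightarrow> F x = s * x + c" using S(2)[OF ab(1) e] by blast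
    have sign: "(\<forall>x\<in>{a..b}. 0 \<le> F x) \<or> (\<forall>x\<in>{a..b}. F x \<le> 0)"
    proof (cases "s = 0")
      case True
      then show ?thesis using sc by (cases "0 \<le> c") auto
    next
      case s: False
      define z where "z = - c / s"
      have F: "F x = s * (x - z)" if "x \<in> {a..b}" for x using sc[OF that] s by (simp add: z_def field_simps)
      have "z \<notin> {a<..<b}"
      proof
        assume z: "z \<in> {a<..<b}"
        then have "z \<notin> S" "z \<notin> Z" using ab(2) by auto
        moreover have "F z = 0" using F[of z] z by simp
        ultimately obtain e where e: "e > 0" "\<forall>y\<in>{z..z+e}. F y = 0" unfolding Z_def by auto
        define y where "y = z + min e (b - z)"
        have "y \<in> {z..z+e}" "y \<in> {a..b}" "y > z" using e(1) z by (auto simp: y_def)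
        then show False using e(2) F[of y] s by auto
      qed
      then consider "z \<le> a" | "b \<le> z" by fastforce
      then show ?thesis
      proof cases
        case 1
        then have "0 \<le> x - z" if "x \<in> {a..b}" for x using that by auto
        then show ?thesis using F s by (cases "0 < s") (auto simp: zero_le_mult_iff mult_le_0_iff)
      next
        case 2
        then have "x - z \<le> 0" if "x \<in> {a..b}" for x using that by auto
        then show ?thesis using F s by (cases "0 < s") (auto simp: zero_le_mult_iff mult_le_0_iff)
      qed
    qed
    then show ?thesis
    proof
      assume "\<forall>x\<in>{a..b}. 0 \<le> F x"
      then have "\<forall>x\<in>{a..b}. relu (F x) = s * x + c" using sc by (simp add: relu_def max_def)
      then show ?thesis by blast
    next
      assume "\<forall>x\<in>{a..b}. F x \<le> 0"
      then have "\<forall>x\<in>{a..b}. relu (F x) = 0 * x + 0" by (simp add: relu_def)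
      then show ?thesis by blast
    qed
  qed
  then show ?thesis unfolding pw_affine_def using S(1) Zf by (intro exI[of _ "S \<union> Z"]) blast
qed

lemma pw_affine_derivative:
  assumes "pw_affine F"
  obtains S where "finite S" "\<And>x. x \<notin> S \<Longrightarrow> (F has_real_derivative deriv F x) (at x)"
proof -
  obtain S where S: "finite S" "\<And>a b. a < b \<Longrightarrow> {a<..<b} \<inter> S = {} \<Longrightarrow> \<exists>s c. \<forall>x\<in>{a..b}. F x = s * x + c"
    using assms unfolding pw_affine_def by blast
  have "(F has_real_derivative deriv F x) (at x)" if x: "x \<notin> S" for x
  proof -
    have "open (- S)" using S(1) by (simp add: finite_imp_closed open_Compl)
    then obtain e where e: "e > 0" "ball x e \<subseteq> - S" using x open_contains_ball by blast
    have "{x - e<..<x + e} \<inter> S = {}" using e(2) by (auto simp: ball_eq_greaterThanLessThan)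
    then obtain s c where sc: "\<forall>y\<in>{x - e..x + e}. F y = s * y + c" using S(2)[of "x - e" "x + e"] e(1) by auto
    have ev: "\<forall>\<^sub>F y in nhds x. s * y + c = F y"
      using eventually_nhds_in_open[of "{x - e<..<x + e}" x] e(1) sc by (auto elim!: eventually_mono)
    have "((\<lambda>y. s * y + c) has_real_derivative s) (at x)" by (auto intro!: derivative_eq_intros)
    then have "(F has_real_derivative s) (at x)" using DERIV_cong_ev[OF refl ev refl] by simp
    then show ?thesis using DERIV_imp_deriv by force
  qed
  with S(1) show ?thesis by (rule that)
qed

section \<open>Building networks layer by layer\<close>

text \<open>Here the activation follows every layer, the last one included. A stack of hidden layers
  can thus be extended at its end, and the affine output layer is added only once, by
  \<open>realization_snoc\<close>.\<close>

fun hidden_state :: "network \<Rightarrow> real Matrix.vec \<Rightarrow> real Matrix.vec" where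
  "hidden_state [] x = x"
| "hidden_state ((A, b) # \<Phi>) x = hidden_state \<Phi> (map_vec relu (A *\<^sub>v x + b))"

fun out_dim :: "nat \<Rightarrow> network \<Rightarrow> nat" where
  "out_dim d [] = d"
| "out_dim d ((A, b) # \<Phi>) = out_dim (dim_row A) \<Phi>"

lemma realization_snoc: "realization relu (\<Phi> @ [(A, b)]) x = A *\<^sub>v hidden_state \<Phi> x + b"
proof (induction \<Phi> arbitrary: x)
  case (Cons l \<Phi>)
  obtain A' b' where l: "l = (A', b')" by (cases l)
  obtain l2 \<Phi>2 where l2: "\<Phi> @ [(A, b)] = l2 # \<Phi>2" by (cases "\<Phi> @ [(A, b)]") auto
  show ?case using Cons[of "map_vec relu (A' *\<^sub>v x + b')"] l l2 by simp
qed simp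

lemma hidden_state_snoc: "hidden_state (\<Phi> @ [(A, b)]) x = map_vec relu (A *\<^sub>v hidden_state \<Phi> x + b)"
  by (induction \<Phi> x rule: hidden_state.induct) auto

lemma out_dim_snoc: "out_dim d (\<Phi> @ [(A, b)]) = dim_row A"
  by (induction d \<Phi> rule: out_dim.induct) auto

lemma layers_fit_snoc:
  "layers_fit d (\<Phi> @ [(A, b)]) \<longleftrightarrow>
     layers_fit d \<Phi> \<and> 0 < dim_row A \<and> dim_col A = out_dim d \<Phi> \<and> dim_vec b = dim_row A"
  by (induction d \<Phi> rule: layers_fit.induct) auto

lemma network_size_snoc: "network_size (\<Phi> @ [(A, b)]) = network_size \<Phi> + (nnz_mat A + nnz_vec b)"
  by (simp add: network_size_def)

text \<open>One row of a weight matrix with its bias: r counts the nonzero weights, while the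
  constant d is accounted for by the + 1 in \<open>sparse_layer\<close>.\<close>

definition sparse_comb :: "nat \<Rightarrow> (real \<Rightarrow> real) list \<Rightarrow> (real \<Rightarrow> real) \<Rightarrow> bool" where
  "sparse_comb r gs h \<longleftrightarrow> (\<exists>c d. card {j. j < length gs \<and> c j \<noteq> 0} \<le> r \<and>
     (\<forall>x. h x = (\<Sum>j<length gs. c j * (gs ! j) x) + d))"

lemma sparse_comb_const: "sparse_comb r gs (\<lambda>_. d)"
  unfolding sparse_comb_def by (intro exI[of _ "\<lambda>_. 0"] exI[of _ d]) simp

lemma sparse_comb_mem:
  assumes "g \<in> set gs"
  shows "sparse_comb 1 gs g"
proof -
  obtain i where i: "i < length gs" "gs ! i = g" using assms by (auto simp: in_set_conv_nth)
  have "card {j. j < length gs \<and> (if j = i then 1 else 0 :: real) \<noteq> 0} \<le> card {i}"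
    by (rule card_mono) auto
  moreover have "g x = (\<Sum>j<length gs. (if j = i then 1 else 0) * (gs ! j) x)" for x
  proof -
    have "(\<Sum>j<length gs. (if j = i then 1 else 0) * (gs ! j) x) = (\<Sum>j<length gs. if j = i then (gs ! j) x else 0)"
      by (rule sum.cong) auto
    then show ?thesis using i by simp
  qed
  ultimately show ?thesis
    unfolding sparse_comb_def by (intro exI[of _ "\<lambda>j. if j = i then 1 else 0"] exI[of _ 0]) simp
qed

lemma sparse_comb_cmult:
  assumes "sparse_comb r gs h"
  shows "sparse_comb r gs (\<lambda>x. k * h x)"
proof -
  obtain c d where c: "card {j. j < length gs \<and> c j \<noteq> 0} \<le> r" "\<And>x. h x = (\<Sum>j<length gs. c j * (gs ! j) x) + d"
    using assms unfolding sparse_comb_def by blast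
  have "card {j. j < length gs \<and> k * c j \<noteq> 0} \<le> card {j. j < length gs \<and> c j \<noteq> 0}"
    by (rule card_mono) auto
  then show ?thesis
    unfolding sparse_comb_def using c
    by (intro exI[of _ "\<lambda>j. k * c j"] exI[of _ "k * d"]) (auto simp: distrib_left sum_distrib_left mult.assoc)
qed

lemma sparse_comb_add:
  assumes "sparse_comb r gs h" "sparse_comb r' gs h'"
  shows "sparse_comb (r + r') gs (\<lambda>x. h x + h' x)"
proof -
  obtain c d where c: "card {j. j < length gs \<and> c j \<noteq> 0} \<le> r" "\<And>x. h x = (\<Sum>j<length gs. c j * (gs ! j) x) + d"
    using assms(1) unfolding sparse_comb_def by blast
  obtain c' d' where c': "card {j. j < length gs \<and> c' j \<noteq> 0} \<le> r'" "\<And>x. h' x = (\<Sum>j<length gs. c' j * (gs ! j) x) + d'"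
    using assms(2) unfolding sparse_comb_def by blast
  have "card {j. j < length gs \<and> c j + c' j \<noteq> 0} \<le> card ({j. j < length gs \<and> c j \<noteq> 0} \<union> {j. j < length gs \<and> c' j \<noteq> 0})"
    by (rule card_mono) auto
  also have "\<dots> \<le> r + r'" by (rule order_trans[OF card_Un_le add_mono[OF c(1) c'(1)]])
  finally show ?thesis
    unfolding sparse_comb_def using c(2) c'(2)
    by (intro exI[of _ "\<lambda>j. c j + c' j"] exI[of _ "d + d'"]) (simp add: distrib_right sum.distrib)
qed

lemma sparse_comb_mono: "sparse_comb r gs h \<Longrightarrow> r \<le> r' \<Longrightarrow> sparse_comb r' gs h"
  unfolding sparse_comb_def by (blast intro: order_trans)

text \<open>In the output layer all neurons may occur, so sums of any length are brought back to the
  trivial count.\<close>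

lemma sparse_comb_length: "sparse_comb r gs h \<Longrightarrow> sparse_comb (length gs) gs h"
proof -
  have "card {j. j < length gs \<and> c j \<noteq> (0::real)} \<le> length gs" for c
    using card_mono[of "{..<length gs}" "{j. j < length gs \<and> c j \<noteq> 0}"] by auto
  then show "sparse_comb r gs h \<Longrightarrow> sparse_comb (length gs) gs h"
    unfolding sparse_comb_def by blast
qed

lemma sparse_comb_sum:
  "(\<And>i. i \<in> S \<Longrightarrow> sparse_comb (length gs) gs (h i)) \<Longrightarrow> sparse_comb (length gs) gs (\<lambda>x. \<Sum>i\<in>S. h i x)"
proof (induction S rule: infinite_finite_induct)
  case (insert a S)
  then have "sparse_comb (length gs + length gs) gs (\<lambda>x. h a x + (\<Sum>i\<in>S. h i x))"
    by (intro sparse_comb_add) auto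
  then show ?case using insert by (simp add: sparse_comb_length)
qed (auto intro: sparse_comb_const)

lemma sparse_comb_pw_affine:
  assumes "sparse_comb r gs h" "\<And>g. g \<in> set gs \<Longrightarrow> pw_affine g"
  shows "pw_affine h"
proof -
  obtain c d where "\<And>x. h x = (\<Sum>j<length gs. c j * (gs ! j) x) + d"
    using assms(1) unfolding sparse_comb_def by blast
  then have "h = (\<lambda>x. (\<Sum>j<length gs. c j * (gs ! j) x) + d)" by auto
  moreover have "pw_affine (\<lambda>x. (\<Sum>j<length gs. c j * (gs ! j) x) + d)"
    by (intro pw_affine_add pw_affine_sum pw_affine_const pw_affine_cmult assms(2)) auto
  ultimately show ?thesis by simp
qed

text \<open>\<open>gs\<close> lists the neurons of the last hidden layer as functions of the scalar
  input. Piecewise affinity is included because the output inherits its regularity from it.\<close>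

definition realizes :: "network \<Rightarrow> (real \<Rightarrow> real) list \<Rightarrow> bool" where
  "realizes \<Phi> gs \<longleftrightarrow> layers_fit 1 \<Phi> \<and> out_dim 1 \<Phi> = length gs \<and> (\<forall>g\<in>set gs. pw_affine g) \<and>
     (\<forall>x. hidden_state \<Phi> (Matrix.vec 1 (\<lambda>_. x)) = Matrix.vec (length gs) (\<lambda>i. (gs ! i) x))"

definition net :: "nat \<Rightarrow> nat \<Rightarrow> (real \<Rightarrow> real) list \<Rightarrow> bool" where
  "net d s gs \<longleftrightarrow> (\<exists>\<Phi>. realizes \<Phi> gs \<and> length \<Phi> = d \<and> network_size \<Phi> \<le> s)"

lemma net_init: "net 0 0 [\<lambda>x. x]"
  unfolding net_def realizes_def
  by (intro exI[of _ "[]"]) (auto simp: network_size_def pw_affine_ident)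

lemma sparse_layer:
  assumes "\<And>i. i < n \<Longrightarrow> sparse_comb r gs (h i)"
  obtains A b where "dim_row A = n" "dim_col A = length gs" "dim_vec b = n"
    "\<And>x. A *\<^sub>v Matrix.vec (length gs) (\<lambda>i. (gs ! i) x) + b = Matrix.vec n (\<lambda>i. h i x)"
    "nnz_mat A + nnz_vec b \<le> n * (r + 1)"
proof -
  have "\<forall>i. \<exists>c d. i < n \<longrightarrow> card {j. j < length gs \<and> c j \<noteq> 0} \<le> r \<and>
     (\<forall>x. h i x = (\<Sum>j<length gs. c j * (gs ! j) x) + d)"
    using assms unfolding sparse_comb_def by blast
  from choice[OF this] obtain c where "\<forall>i. \<exists>d. i < n \<longrightarrow> card {j. j < length gs \<and> c i j \<noteq> 0} \<le> r \<and>
     (\<forall>x. h i x = (\<Sum>j<length gs. c i j * (gs ! j) x) + d)" ..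
  from choice[OF this] obtain d where "\<forall>i. i < n \<longrightarrow> card {j. j < length gs \<and> c i j \<noteq> 0} \<le> r \<and>
     (\<forall>x. h i x = (\<Sum>j<length gs. c i j * (gs ! j) x) + d i)" ..
  then have cd: "\<And>i. i < n \<Longrightarrow> card {j. j < length gs \<and> c i j \<noteq> 0} \<le> r"
     "\<And>i x. i < n \<Longrightarrow> h i x = (\<Sum>j<length gs. c i j * (gs ! j) x) + d i"
    by blast+
  define A where "A = Matrix.mat n (length gs) (\<lambda>(i, j). c i j)"
  define b where "b = Matrix.vec n d"
  have "nnz_mat A = card (SIGMA i : {..<n}. {j. j < length gs \<and> c i j \<noteq> 0})"
    unfolding nnz_mat_def by (rule arg_cong[of _ _ card]) (auto simp: A_def)
  also have "\<dots> = (\<Sum>i<n. card {j. j < length gs \<and> c i j \<noteq> 0})"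
    by (rule card_SigmaI) auto
  also have "\<dots> \<le> (\<Sum>i<n. r)" by (rule sum_mono) (simp add: cd(1))
  finally have nA: "nnz_mat A \<le> n * r" by simp
  have "nnz_vec b \<le> card {..<n}" unfolding nnz_vec_def by (rule card_mono) (auto simp: b_def)
  then have nb: "nnz_vec b \<le> n" by simp
  show ?thesis
  proof (rule that[of A b])
    fix x
    show "A *\<^sub>v Matrix.vec (length gs) (\<lambda>i. (gs ! i) x) + b = Matrix.vec n (\<lambda>i. h i x)"
      by (rule eq_vecI) (auto simp: A_def b_def scalar_prod_def cd(2) lessThan_atLeast0)
  qed (use nA nb in \<open>auto simp: A_def b_def\<close>)
qed

lemma net_layer:
  assumes net: "net d s gs" and hs: "hs \<noteq> []"
    and h: "\<And>h. h \<in> set hs \<Longrightarrow> \<exists>h0. sparse_comb r gs h0 \<and> (\<forall>x. h x = relu (h0 x))"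
  shows "net (Suc d) (s + length hs * (r + 1)) hs"
proof -
  obtain \<Phi> where \<Phi>: "realizes \<Phi> gs" "length \<Phi> = d" "network_size \<Phi> \<le> s"
    using net unfolding net_def by blast
  have "\<forall>h\<in>set hs. \<exists>h0. sparse_comb r gs h0 \<and> (\<forall>x. h x = relu (h0 x))" using h by blast
  from bchoice[OF this] obtain h0 where h0: "\<And>h. h \<in> set hs \<Longrightarrow> sparse_comb r gs (h0 h) \<and> (\<forall>x. h x = relu (h0 h x))"
    by blast
  obtain A b where Ab: "dim_row A = length hs" "dim_col A = length gs" "dim_vec b = length hs"
    "\<And>x. A *\<^sub>v Matrix.vec (length gs) (\<lambda>i. (gs ! i) x) + b = Matrix.vec (length hs) (\<lambda>i. h0 (hs ! i) x)"
    "nnz_mat A + nnz_vec b \<le> length hs * (r + 1)"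
  proof (rule sparse_layer[of "length hs" r gs "\<lambda>i. h0 (hs ! i)"])
    fix i assume "i < length hs"
    then show "sparse_comb r gs (h0 (hs ! i))" using h0[OF nth_mem] by blast
  qed blast
  have "realizes (\<Phi> @ [(A, b)]) hs"
    unfolding realizes_def
  proof (intro conjI allI ballI)
    show "layers_fit 1 (\<Phi> @ [(A, b)])" "out_dim 1 (\<Phi> @ [(A, b)]) = length hs"
      using \<Phi>(1) Ab hs by (simp_all add: realizes_def layers_fit_snoc out_dim_snoc)
    fix g assume g: "g \<in> set hs"
    have "pw_affine g'" if "g' \<in> set gs" for g' using \<Phi>(1) that unfolding realizes_def by blast
    then have "pw_affine (\<lambda>x. relu (h0 g x))"
      by (rule pw_affine_relu[OF sparse_comb_pw_affine[OF conjunct1[OF h0[OF g]]]])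
    moreover have "g = (\<lambda>x. relu (h0 g x))"
      by (rule ext) (rule spec[OF conjunct2[OF h0[OF g]]])
    ultimately show "pw_affine g" by simp
  next
    fix x
    have "hidden_state (\<Phi> @ [(A, b)]) (Matrix.vec 1 (\<lambda>_. x)) = map_vec relu (Matrix.vec (length hs) (\<lambda>i. h0 (hs ! i) x))"
    proof -
      have "hidden_state \<Phi> (Matrix.vec 1 (\<lambda>_. x)) = Matrix.vec (length gs) (\<lambda>i. (gs ! i) x)"
        using \<Phi>(1) unfolding realizes_def by blast
      then show ?thesis by (simp only: hidden_state_snoc Ab(4))
    qed
    also have "\<dots> = Matrix.vec (length hs) (\<lambda>i. (hs ! i) x)"
    proof (rule eq_vecI)
      fix i assume "i < dim_vec (Matrix.vec (length hs) (\<lambda>i. (hs ! i) x))"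
      then have i: "i < length hs" by simp
      have "(hs ! i) x = relu (h0 (hs ! i) x)" using h0[OF nth_mem[OF i]] by blast
      then show "map_vec relu (Matrix.vec (length hs) (\<lambda>i. h0 (hs ! i) x)) $ i = Matrix.vec (length hs) (\<lambda>i. (hs ! i) x) $ i"
        using i by simp
    qed simp
    finally show "hidden_state (\<Phi> @ [(A, b)]) (Matrix.vec 1 (\<lambda>_. x)) = Matrix.vec (length hs) (\<lambda>i. (hs ! i) x)" .
  qed
  then show ?thesis
    unfolding net_def using \<Phi> Ab(5) by (intro exI[of _ "\<Phi> @ [(A, b)]"]) (simp add: network_size_snoc)
qed

lemma realizes_output:
  assumes \<Phi>: "realizes \<Phi> gs" and F: "sparse_comb (length gs) gs F"
  obtains l where "neural_network 1 1 (\<Phi> @ [l])" "relu_fun (\<Phi> @ [l]) = F"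
    "network_size (\<Phi> @ [l]) \<le> network_size \<Phi> + (length gs + 1)" "pw_affine F"
proof -
  obtain A b where Ab: "dim_row A = 1" "dim_col A = length gs" "dim_vec b = 1"
    "\<And>x. A *\<^sub>v Matrix.vec (length gs) (\<lambda>i. (gs ! i) x) + b = Matrix.vec 1 (\<lambda>i. F x)"
    "nnz_mat A + nnz_vec b \<le> 1 * (length gs + 1)"
    by (rule sparse_layer[of 1 "length gs" gs "\<lambda>_. F"]) (use F in auto)
  show ?thesis
  proof (rule that[of "(A, b)"])
    show "neural_network 1 1 (\<Phi> @ [(A, b)])"
      using \<Phi> Ab by (simp add: neural_network_def realizes_def layers_fit_snoc)
    show "relu_fun (\<Phi> @ [(A, b)]) = F"
    proof
      fix x
      have "hidden_state \<Phi> (Matrix.vec 1 (\<lambda>_. x)) = Matrix.vec (length gs) (\<lambda>i. (gs ! i) x)"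
        using \<Phi> unfolding realizes_def by blast
      then show "relu_fun (\<Phi> @ [(A, b)]) x = F x" by (simp add: relu_fun_def realization_snoc Ab(4))
    qed
    show "network_size (\<Phi> @ [(A, b)]) \<le> network_size \<Phi> + (length gs + 1)"
      using Ab(5) by (simp add: network_size_snoc)
    show "pw_affine F"
      by (rule sparse_comb_pw_affine[OF F]) (use \<Phi> in \<open>unfold realizes_def, blast\<close>)
  qed
qed

section \<open>Approximate squaring by sawtooth functions\<close>

text \<open>On [0, 1] this is the tent map, written with the single rectified value that a network
  has to provide next to t itself.\<close>

definition tent :: "real \<Rightarrow> real" where
  "tent t = 2 * t - 4 * relu (t - 1 / 2)"

lemma tent_bounds: "t \<in> {0..1} \<Longrightarrow> tent t \<in> {0..1}"
  by (auto simp: tent_def relu_def max_def)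

lemma tent_lipschitz: "\<bar>tent s - tent t\<bar> \<le> 2 * \<bar>s - t\<bar>"
  by (auto simp: tent_def relu_def max_def abs_if)

text \<open>A partial sum of a Takagi-type series with ratio 1 / 4, whose limit on [0, 1] is the
  parabola t - t^2.\<close>

definition saw_sum :: "nat \<Rightarrow> real \<Rightarrow> real" where
  "saw_sum m t = (\<Sum>j<m. (tent ^^ Suc j) t / 4 ^ Suc j)"

lemma tent_iter_bounds: "t \<in> {0..1} \<Longrightarrow> (tent ^^ k) t \<in> {0..1}"
proof (induction k)
  case (Suc k)
  then show ?case using tent_bounds[of "(tent ^^ k) t"] by simp
qed simp

lemma saw_sum_Suc: "saw_sum (Suc m) t = saw_sum m t + (tent ^^ Suc m) t / 4 ^ Suc m"
  by (simp add: saw_sum_def)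

lemma saw_sum_nonneg: "t \<in> {0..1} \<Longrightarrow> 0 \<le> saw_sum m t"
  unfolding saw_sum_def
proof (intro sum_nonneg divide_nonneg_nonneg)
  fix j assume "t \<in> {0..1}"
  from tent_iter_bounds[OF this, of "Suc j"] show "0 \<le> (tent ^^ Suc j) t" by simp
qed simp

lemma saw_sum_rec: "saw_sum (Suc m) t = tent t / 4 + saw_sum m (tent t) / 4"
proof -
  have "saw_sum (Suc m) t = tent t / 4 + (\<Sum>j<m. (tent ^^ Suc (Suc j)) t / 4 ^ Suc (Suc j))"
    unfolding saw_sum_def by (subst sum.lessThan_Suc_shift) simp
  also have "(\<Sum>j<m. (tent ^^ Suc (Suc j)) t / 4 ^ Suc (Suc j)) = saw_sum m (tent t) / 4"
    unfolding saw_sum_def sum_divide_distrib by (rule sum.cong) (simp_all add: funpow_swap1)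
  finally show ?thesis .
qed

definition saw_err :: "nat \<Rightarrow> real \<Rightarrow> real" where
  "saw_err m t = t - t\<^sup>2 - saw_sum m t"

text \<open>Self-similarity of the parabola under the tent map: \<open>4 t (1 - t) = T + T (1 - T)\<close> for \<open>T = tent t\<close>.\<close>

lemma saw_err_Suc: "saw_err (Suc m) t = saw_err m (tent t) / 4"
proof -
  have "t - t\<^sup>2 = tent t / 4 + (tent t - (tent t)\<^sup>2) / 4"
  proof (cases "t \<le> 1 / 2")
    case True
    then show ?thesis by (simp add: tent_def relu_def power2_eq_square field_simps)
  next
    case False
    then have "tent t = 2 - 2 * t" by (simp add: tent_def relu_def)
    then show ?thesis by (simp only: power2_eq_square) (simp add: field_simps)
  qed
  then show ?thesis by (simp add: saw_err_def saw_sum_rec field_simps)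
qed

lemma saw_err_bound: "t \<in> {0..1} \<Longrightarrow> \<bar>saw_err m t\<bar> \<le> (1 / 2) ^ m"
proof (induction m arbitrary: t)
  case 0
  have "0 \<le> t * (1 - t)" using 0 by simp
  moreover have "t * (1 - t) \<le> 1 * 1" using 0 by (intro mult_mono) auto
  ultimately show ?case by (simp add: saw_err_def saw_sum_def power2_eq_square algebra_simps)
next
  case (Suc m)
  show ?case using Suc.IH[OF tent_bounds[OF Suc.prems]] by (simp add: saw_err_Suc)
qed

text \<open>One step divides the error by 4 while the tent map doubles distances, so the slope of
  the error halves. The size of the error is stated with the same rate in
  \<open>saw_err_bound\<close>.\<close>

lemma saw_err_lipschitz: "s \<in> {0..1} \<Longrightarrow> t \<in> {0..1} \<Longrightarrow> \<bar>saw_err m s - saw_err m t\<bar> \<le> (1 / 2) ^ m * \<bar>s - t\<bar>"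
proof (induction m arbitrary: s t)
  case 0
  have "saw_err 0 s - saw_err 0 t = (1 - (s + t)) * (s - t)"
    by (simp add: saw_err_def saw_sum_def power2_eq_square algebra_simps)
  then have "\<bar>saw_err 0 s - saw_err 0 t\<bar> = \<bar>1 - (s + t)\<bar> * \<bar>s - t\<bar>" by (simp add: abs_mult)
  also have "\<dots> \<le> 1 * \<bar>s - t\<bar>" using 0 by (intro mult_right_mono) auto
  finally show ?case by simp
next
  case (Suc m)
  have "\<bar>saw_err (Suc m) s - saw_err (Suc m) t\<bar> = \<bar>saw_err m (tent s) - saw_err m (tent t)\<bar> / 4"
    by (simp add: saw_err_Suc diff_divide_distrib[symmetric])
  also have "\<dots> \<le> (1 / 2) ^ m * \<bar>tent s - tent t\<bar> / 4"
    using Suc.IH[OF tent_bounds[OF Suc.prems(1)] tent_bounds[OF Suc.prems(2)]] by simp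
  also have "\<dots> \<le> (1 / 2) ^ m * (2 * \<bar>s - t\<bar>) / 4"
    by (intro divide_right_mono mult_left_mono tent_lipschitz) auto
  finally show ?case by (simp add: mult.commute)
qed

text \<open>With t = (y + 2) / 4 one has y^2 = 4 - 16 (t - t^2). The range [-2, 2] leaves room for
  values of modulus 1 that carry an error of at most 1.\<close>

definition sq :: "nat \<Rightarrow> real \<Rightarrow> real" where
  "sq m y = 4 - 16 * saw_sum m ((y + 2) / 4)"

lemma sq_eq: "sq m y = y\<^sup>2 + 16 * saw_err m ((y + 2) / 4)"
  by (simp add: sq_def saw_err_def power2_eq_square field_simps)

definition \<eta> :: "nat \<Rightarrow> real" where "\<eta> m = 16 * (1 / 2) ^ m"

lemma \<eta>_pos: "0 < \<eta> m" by (simp add: \<eta>_def)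

lemma sq_error:
  assumes "\<bar>y\<bar> \<le> 2" "\<bar>z\<bar> \<le> 2"
  shows "\<bar>sq m y - y\<^sup>2\<bar> \<le> \<eta> m" "\<bar>(sq m y - y\<^sup>2) - (sq m z - z\<^sup>2)\<bar> \<le> \<eta> m * \<bar>y - z\<bar>"
proof -
  have y: "(y + 2) / 4 \<in> {0..1}" and z: "(z + 2) / 4 \<in> {0..1}" using assms by (auto simp: abs_le_iff)
  show "\<bar>sq m y - y\<^sup>2\<bar> \<le> \<eta> m" using saw_err_bound[OF y, of m] by (simp add: sq_eq \<eta>_def abs_mult)
  have "\<bar>(sq m y - y\<^sup>2) - (sq m z - z\<^sup>2)\<bar> = 16 * \<bar>saw_err m ((y + 2) / 4) - saw_err m ((z + 2) / 4)\<bar>"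
    by (simp add: sq_eq abs_mult right_diff_distrib[symmetric] del: right_diff_distrib_numeral)
  also have "\<dots> \<le> 16 * ((1 / 2) ^ m * \<bar>(y + 2) / 4 - (z + 2) / 4\<bar>)"
    by (intro mult_left_mono saw_err_lipschitz y z) auto
  also have "\<bar>(y + 2) / 4 - (z + 2) / 4\<bar> = \<bar>y - z\<bar> / 4"
    by (simp add: diff_divide_distrib[symmetric])
  also have "16 * ((1 / 2) ^ m * (\<bar>y - z\<bar> / 4)) \<le> \<eta> m * \<bar>y - z\<bar>"
    by (simp add: \<eta>_def)
  finally show "\<bar>(sq m y - y\<^sup>2) - (sq m z - z\<^sup>2)\<bar> \<le> \<eta> m * \<bar>y - z\<bar>" .
qed

section \<open>Approximate monomials\<close>

text \<open>A distance in W^(1,infinity) without derivatives: D bounds the difference as well as its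
  Lipschitz constant. The slope part is what the energy norm sees later.\<close>

definition near :: "real \<Rightarrow> (real \<Rightarrow> real) \<Rightarrow> (real \<Rightarrow> real) \<Rightarrow> bool" where
  "near D F G \<longleftrightarrow> (\<forall>s\<in>{-1..1}. \<forall>t\<in>{-1..1}. \<bar>F t - G t\<bar> \<le> D \<and> \<bar>(F s - G s) - (F t - G t)\<bar> \<le> D * \<bar>s - t\<bar>)"

definition unit_lipschitz :: "real \<Rightarrow> (real \<Rightarrow> real) \<Rightarrow> bool" where
  "unit_lipschitz n G \<longleftrightarrow> (\<forall>s\<in>{-1..1}. \<forall>t\<in>{-1..1}. \<bar>G t\<bar> \<le> 1 \<and> \<bar>G s - G t\<bar> \<le> n * \<bar>s - t\<bar>)"

lemma near_add:
  assumes "near D F G" "near D' F' G'"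
  shows "near (D + D') (\<lambda>t. F t + F' t) (\<lambda>t. G t + G' t)"
  unfolding near_def
proof (intro ballI conjI)
  fix s t :: real assume st: "s \<in> {-1..1}" "t \<in> {-1..1}"
  have "\<bar>F t - G t\<bar> \<le> D" "\<bar>F' t - G' t\<bar> \<le> D'" using assms st unfolding near_def by blast+
  then show "\<bar>F t + F' t - (G t + G' t)\<bar> \<le> D + D'" by linarith
  have "\<bar>(F s - G s) - (F t - G t)\<bar> \<le> D * \<bar>s - t\<bar>" "\<bar>(F' s - G' s) - (F' t - G' t)\<bar> \<le> D' * \<bar>s - t\<bar>"
    using assms st unfolding near_def by blast+
  then show "\<bar>F s + F' s - (G s + G' s) - (F t + F' t - (G t + G' t))\<bar> \<le> (D + D') * \<bar>s - t\<bar>"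
    unfolding distrib_right by linarith
qed

lemma near_cmult:
  assumes "near D F G"
  shows "near (\<bar>k\<bar> * D) (\<lambda>t. k * F t) (\<lambda>t. k * G t)"
  unfolding near_def
proof (intro ballI conjI)
  fix s t :: real assume st: "s \<in> {-1..1}" "t \<in> {-1..1}"
  have 1: "\<bar>F t - G t\<bar> \<le> D" and 2: "\<bar>(F s - G s) - (F t - G t)\<bar> \<le> D * \<bar>s - t\<bar>"
    using assms st unfolding near_def by blast+
  have "\<bar>k * F t - k * G t\<bar> = \<bar>k\<bar> * \<bar>F t - G t\<bar>" by (simp only: right_diff_distrib[symmetric] abs_mult)
  then show "\<bar>k * F t - k * G t\<bar> \<le> \<bar>k\<bar> * D" using 1 by (simp add: mult_left_mono)
  have "\<bar>k * F s - k * G s - (k * F t - k * G t)\<bar> = \<bar>k\<bar> * \<bar>(F s - G s) - (F t - G t)\<bar>"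
    by (simp only: right_diff_distrib[symmetric] abs_mult)
  then show "\<bar>k * F s - k * G s - (k * F t - k * G t)\<bar> \<le> \<bar>k\<bar> * D * \<bar>s - t\<bar>"
    using mult_left_mono[OF 2, of "\<bar>k\<bar>"] by (simp add: mult.assoc)
qed

lemma near_mono: "near D F G \<Longrightarrow> D \<le> D' \<Longrightarrow> near D' F G"
  unfolding near_def by (meson abs_ge_zero mult_right_mono order_trans)

lemma near_sum:
  assumes "\<And>k. k \<in> S \<Longrightarrow> near D (F k) (G k)" "finite S" "0 \<le> D"
  shows "near ((\<Sum>k\<in>S. \<bar>a k\<bar>) * D) (\<lambda>t. \<Sum>k\<in>S. a k * F k t) (\<lambda>t. \<Sum>k\<in>S. a k * G k t)"
  using assms(2,1)
proof (induction S rule: finite_induct)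
  case empty
  then show ?case by (simp add: near_def)
next
  case (insert k S)
  have 1: "near ((\<Sum>k\<in>S. \<bar>a k\<bar>) * D) (\<lambda>t. \<Sum>k\<in>S. a k * F k t) (\<lambda>t. \<Sum>k\<in>S. a k * G k t)"
    by (rule insert.IH) (simp add: insert.prems)
  have 2: "near (\<bar>a k\<bar> * D) (\<lambda>t. a k * F k t) (\<lambda>t. a k * G k t)"
    by (rule near_cmult[OF insert.prems]) simp
  from near_add[OF 2 1] show ?case using insert.hyps by (simp add: distrib_right)
qed

text \<open>The error splits into that of the approximate square and E (2 G + E) with E = F - G.
  Slopes of squares contain slopes of their arguments, hence the Lipschitz constant n, which for
  monomials is the degree.\<close>

lemma near_sq:
  assumes F: "near D F G" and G: "unit_lipschitz n G" and D: "0 \<le> D" "D \<le> 1" and n: "1 \<le> n"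
  shows "near ((n + 1) * \<eta> m + (2 * n + 4) * D) (\<lambda>t. sq m (F t)) (\<lambda>t. (G t)\<^sup>2)"
  unfolding near_def
proof (intro ballI conjI)
  fix s t :: real assume st: "s \<in> {-1..1}" "t \<in> {-1..1}"
  define E where "E t = F t - G t" for t
  define e where "e t = sq m (F t) - (F t)\<^sup>2" for t
  have Ft: "\<bar>E t\<bar> \<le> D" and Fs: "\<bar>E s\<bar> \<le> D" and Est: "\<bar>E s - E t\<bar> \<le> D * \<bar>s - t\<bar>"
    using F st unfolding near_def E_def by blast+
  have Gt: "\<bar>G t\<bar> \<le> 1" and Gs: "\<bar>G s\<bar> \<le> 1" and Gst: "\<bar>G s - G t\<bar> \<le> n * \<bar>s - t\<bar>"
    using G st unfolding unit_lipschitz_def by blast+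
  have F2: "\<bar>F t\<bar> \<le> 2" "\<bar>F s\<bar> \<le> 2" using Ft Fs Gt Gs D unfolding E_def by linarith+
  have eta: "0 \<le> \<eta> m" using \<eta>_pos[of m] by simp
  have eq: "sq m (F t) - (G t)\<^sup>2 = e t + E t * (2 * G t + E t)" for t
    by (simp add: e_def E_def power2_eq_square algebra_simps)
  have g2: "\<bar>2 * G t + E t\<bar> \<le> 3" "\<bar>2 * G s + E s\<bar> \<le> 3" using Gt Gs Ft Fs D by linarith+
  have "\<bar>E t * (2 * G t + E t)\<bar> \<le> D * 3"
    unfolding abs_mult using Ft g2(1) D by (intro mult_mono) auto
  moreover have "\<bar>e t\<bar> \<le> \<eta> m" unfolding e_def by (rule sq_error(1)[OF F2(1,1)])
  ultimately have "\<bar>sq m (F t) - (G t)\<^sup>2\<bar> \<le> \<eta> m + D * 3" unfolding eq by linarith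
  also have "\<dots> \<le> (n + 1) * \<eta> m + (2 * n + 4) * D"
  proof -
    have "1 * \<eta> m \<le> (n + 1) * \<eta> m" using n eta by (intro mult_right_mono) auto
    moreover have "3 * D \<le> (2 * n + 4) * D" using n D by (intro mult_right_mono) auto
    ultimately show ?thesis by simp
  qed
  finally show "\<bar>sq m (F t) - (G t)\<^sup>2\<bar> \<le> (n + 1) * \<eta> m + (2 * n + 4) * D" .
  have "\<bar>e s - e t\<bar> \<le> \<eta> m * \<bar>F s - F t\<bar>"
    unfolding e_def by (rule sq_error(2)[OF F2(2,1)])
  also have "\<dots> \<le> \<eta> m * ((n + 1) * \<bar>s - t\<bar>)"
  proof (rule mult_left_mono[OF _ eta])
    have "\<bar>F s - F t\<bar> \<le> \<bar>G s - G t\<bar> + \<bar>E s - E t\<bar>" unfolding E_def by linarith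
    also have "\<dots> \<le> n * \<bar>s - t\<bar> + D * \<bar>s - t\<bar>" using Gst Est by linarith
    also have "\<dots> \<le> n * \<bar>s - t\<bar> + 1 * \<bar>s - t\<bar>" using D by (intro add_left_mono mult_right_mono) auto
    finally show "\<bar>F s - F t\<bar> \<le> (n + 1) * \<bar>s - t\<bar>" by (simp add: distrib_right)
  qed
  finally have 1: "\<bar>e s - e t\<bar> \<le> (n + 1) * \<eta> m * \<bar>s - t\<bar>" by (simp add: mult_ac)
  have "E s * (2 * G s + E s) - E t * (2 * G t + E t) =
    (E s - E t) * (2 * G s + E s) + E t * (2 * (G s - G t) + (E s - E t))"
    by (simp add: algebra_simps)
  also have "\<bar>\<dots>\<bar> \<le> \<bar>(E s - E t) * (2 * G s + E s)\<bar> + \<bar>E t * (2 * (G s - G t) + (E s - E t))\<bar>"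
    by (rule abs_triangle_ineq)
  also have "\<dots> \<le> (D * \<bar>s - t\<bar>) * 3 + D * ((2 * n + 1) * \<bar>s - t\<bar>)"
    unfolding abs_mult
  proof (intro add_mono mult_mono Est g2 Ft)
    have "\<bar>2 * (G s - G t) + (E s - E t)\<bar> \<le> 2 * (n * \<bar>s - t\<bar>) + D * \<bar>s - t\<bar>"
    proof -
      have "\<bar>2 * (G s - G t) + (E s - E t)\<bar> \<le> 2 * \<bar>G s - G t\<bar> + \<bar>E s - E t\<bar>"
        using abs_triangle_ineq[of "2 * (G s - G t)" "E s - E t"] by (simp only: abs_mult abs_numeral)
      also have "\<dots> \<le> 2 * (n * \<bar>s - t\<bar>) + D * \<bar>s - t\<bar>"
        by (rule add_mono[OF mult_left_mono[OF Gst] Est]) simp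
      finally show ?thesis .
    qed
    also have "\<dots> \<le> 2 * (n * \<bar>s - t\<bar>) + 1 * \<bar>s - t\<bar>" using D by (intro add_left_mono mult_right_mono) auto
    finally show "\<bar>2 * (G s - G t) + (E s - E t)\<bar> \<le> (2 * n + 1) * \<bar>s - t\<bar>" by (simp add: distrib_right)
  qed (use D in auto)
  also have "\<dots> = (2 * n + 4) * D * \<bar>s - t\<bar>" by (simp add: algebra_simps)
  finally have 2: "\<bar>E s * (2 * G s + E s) - E t * (2 * G t + E t)\<bar> \<le> (2 * n + 4) * D * \<bar>s - t\<bar>" .
  show "\<bar>sq m (F s) - (G s)\<^sup>2 - (sq m (F t) - (G t)\<^sup>2)\<bar> \<le> ((n + 1) * \<eta> m + (2 * n + 4) * D) * \<bar>s - t\<bar>"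
    unfolding eq distrib_right[of _ _ "\<bar>s - t\<bar>"] using 1 2 by linarith
qed

text \<open>Each round doubles the degree: even powers are squares, odd ones are products of
  neighbouring powers, computed from x y = 2 ((x + y) / 2)^2 - x^2 / 2 - y^2 / 2. Taking the average
  keeps the argument within the range of \<open>sq\<close>.\<close>

fun mono_approx :: "nat \<Rightarrow> nat \<Rightarrow> nat \<Rightarrow> real \<Rightarrow> real" where
  "mono_approx m 0 k t = (if k = 0 then 1 else t)"
| "mono_approx m (Suc l) k t = (let P = mono_approx m l; i = k div 2 in
     if even k then sq m (P i t)
     else 2 * sq m ((P i t + P (i + 1) t) / 2) - sq m (P i t) / 2 - sq m (P (i + 1) t) / 2)"

lemma unit_lipschitz_power:
  assumes "k \<le> n"
  shows "unit_lipschitz (real n) (\<lambda>t. t ^ k)"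
  unfolding unit_lipschitz_def
proof (intro ballI conjI)
  fix s t :: real assume st: "s \<in> {-1..1}" "t \<in> {-1..1}"
  then have a: "\<bar>s\<bar> \<le> 1" "\<bar>t\<bar> \<le> 1" by auto
  show "\<bar>t ^ k\<bar> \<le> 1" using a by (simp add: power_abs power_le_one)
  have "\<bar>s ^ k - t ^ k\<bar> \<le> real k * \<bar>s - t\<bar>" using norm_power_diff[of s t k] a by simp
  also have "\<dots> \<le> real n * \<bar>s - t\<bar>" using assms by (intro mult_right_mono) auto
  finally show "\<bar>s ^ k - t ^ k\<bar> \<le> real n * \<bar>s - t\<bar>" .
qed

lemma unit_lipschitz_avg:
  assumes "unit_lipschitz n F" "unit_lipschitz n G"
  shows "unit_lipschitz n (\<lambda>t. (F t + G t) / 2)"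
  unfolding unit_lipschitz_def
proof (intro ballI conjI)
  fix s t :: real assume st: "s \<in> {-1..1}" "t \<in> {-1..1}"
  have "\<bar>F t\<bar> \<le> 1" "\<bar>G t\<bar> \<le> 1" and 1: "\<bar>F s - F t\<bar> \<le> n * \<bar>s - t\<bar>" "\<bar>G s - G t\<bar> \<le> n * \<bar>s - t\<bar>"
    using assms st unfolding unit_lipschitz_def by blast+
  then show "\<bar>(F t + G t) / 2\<bar> \<le> 1" by (simp add: abs_le_iff)
  have "\<bar>(F s + G s) / 2 - (F t + G t) / 2\<bar> \<le> (\<bar>F s - F t\<bar> + \<bar>G s - G t\<bar>) / 2"
    by (auto simp: abs_if field_simps)
  also have "\<dots> \<le> n * \<bar>s - t\<bar>" using add_mono[OF 1] by simp
  finally show "\<bar>(F s + G s) / 2 - (F t + G t) / 2\<bar> \<le> n * \<bar>s - t\<bar>" .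
qed

lemma bernoulli_30: "1 \<le> n \<Longrightarrow> 9 * real n + 15 \<le> 30 ^ n"
proof (induction n rule: dec_induct)
  case (step n)
  then show ?case by simp
qed simp

text \<open>An error D at degree n becomes at most (9 n + 15) D at degree 2 n; this contains a
  factor 3, the sum of the polarisation weights. For D = \<open>\<eta> m * 30 ^ n\<close> the growth
  factor is at most 30^n by \<open>bernoulli_30\<close>, so the form of the bound reproduces
  itself.\<close>

lemma mono_approx_near:
  assumes small: "\<eta> m * 30 ^ (2 ^ l) \<le> 1" and k: "k \<le> 2 ^ l"
  shows "near (\<eta> m * 30 ^ (2 ^ l)) (mono_approx m l k) (\<lambda>t. t ^ k)"
  using assms
proof (induction l arbitrary: k)
  case 0
  then have "k = 0 \<or> k = 1" by auto
  then show ?case using \<eta>_pos[of m] by (auto simp: near_def)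
next
  case (Suc l)
  define n :: nat where "n = 2 ^ l"
  have n: "1 \<le> n" by (simp add: n_def)
  have n2: "2 ^ Suc l = 2 * n" by (simp add: n_def)
  define D where "D = \<eta> m * 30 ^ n"
  have D': "D \<le> \<eta> m * 30 ^ (2 ^ Suc l)"
    unfolding D_def n2 using \<eta>_pos[of m] by (intro mult_left_mono power_increasing) auto
  have D: "0 \<le> D" using \<eta>_pos[of m] by (simp add: D_def)
  note D = D order_trans[OF D' Suc.prems(1)]
  have IH: "near D (mono_approx m l i) (\<lambda>t. t ^ i)" if "i \<le> n" for i
    unfolding D_def n_def by (rule Suc.IH) (use D(2) that in \<open>auto simp: D_def n_def\<close>)
  define D2 where "D2 = (real n + 1) * \<eta> m + (2 * real n + 4) * D"
  have D2le: "3 * D2 \<le> \<eta> m * 30 ^ (2 ^ Suc l)"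
  proof -
    have "\<eta> m * 1 \<le> \<eta> m * 30 ^ n" using \<eta>_pos[of m] by (intro mult_left_mono) auto
    then have "\<eta> m \<le> D" by (simp add: D_def)
    then have "(real n + 1) * \<eta> m \<le> (real n + 1) * D" by (intro mult_left_mono) auto
    then have "3 * D2 \<le> (9 * real n + 15) * D" by (simp add: D2_def algebra_simps)
    also have "\<dots> \<le> 30 ^ n * D" using bernoulli_30[OF n] D by (intro mult_right_mono) auto
    also have "\<dots> = \<eta> m * 30 ^ (2 ^ Suc l)" unfolding D_def n2 mult_2 power_add by (simp only: mult_ac)
    finally show ?thesis .
  qed
  have D20: "0 \<le> D2" using D \<eta>_pos[of m] by (auto simp: D2_def intro!: add_nonneg_nonneg mult_nonneg_nonneg)
  define i where "i = k div 2"
  show ?case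
  proof (cases "even k")
    case True
    then have k: "k = 2 * i" by (simp add: i_def)
    then have i: "i \<le> n" using Suc.prems(2) n2 by simp
    have "near D2 (\<lambda>t. sq m (mono_approx m l i t)) (\<lambda>t. (t ^ i)\<^sup>2)"
      unfolding D2_def by (rule near_sq[OF IH[OF i] unit_lipschitz_power[OF i] D]) (use n in simp)
    then have "near (\<eta> m * 30 ^ (2 ^ Suc l)) (\<lambda>t. sq m (mono_approx m l i t)) (\<lambda>t. (t ^ i)\<^sup>2)"
      by (rule near_mono) (use D2le D20 in linarith)
    moreover have "(\<lambda>t. sq m (mono_approx m l i t)) = mono_approx m (Suc l) k"
      using True by (auto simp: i_def Let_def)
    moreover have "(\<lambda>t::real. (t ^ i)\<^sup>2) = (\<lambda>t. t ^ k)"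
      by (simp add: k power_mult[symmetric] mult.commute)
    ultimately show ?thesis by (simp only:)
  next
    case False
    then have k: "k = 2 * i + 1" by (simp add: i_def odd_two_times_div_two_succ)
    then have i: "i \<le> n" "i + 1 \<le> n" using Suc.prems(2) n2 by simp_all
    let ?P = "mono_approx m l i" and ?Q = "mono_approx m l (i + 1)"
    have n1: "1 \<le> real n" using n by simp
    have sP: "near D2 (\<lambda>t. sq m (?P t)) (\<lambda>t. (t ^ i)\<^sup>2)"
      unfolding D2_def by (rule near_sq[OF IH[OF i(1)] unit_lipschitz_power[OF i(1)] D n1])
    have sQ: "near D2 (\<lambda>t. sq m (?Q t)) (\<lambda>t. (t ^ (i + 1))\<^sup>2)"
      unfolding D2_def by (rule near_sq[OF IH[OF i(2)] unit_lipschitz_power[OF i(2)] D n1])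
    have "near (\<bar>1 / 2\<bar> * (D + D)) (\<lambda>t. 1 / 2 * (?P t + ?Q t)) (\<lambda>t. 1 / 2 * (t ^ i + t ^ (i + 1)))"
      by (intro near_cmult near_add IH i)
    then have av: "near D (\<lambda>t. (?P t + ?Q t) / 2) (\<lambda>t. (t ^ i + t ^ (i + 1)) / 2)" by simp
    have sA: "near D2 (\<lambda>t. sq m ((?P t + ?Q t) / 2)) (\<lambda>t. ((t ^ i + t ^ (i + 1)) / 2)\<^sup>2)"
      unfolding D2_def
      by (rule near_sq[OF av unit_lipschitz_avg[OF unit_lipschitz_power[OF i(1)] unit_lipschitz_power[OF i(2)]] D n1])
    have "near (\<bar>2\<bar> * D2 + (\<bar>- 1 / 2\<bar> * D2 + \<bar>- 1 / 2\<bar> * D2))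
      (\<lambda>t. 2 * sq m ((?P t + ?Q t) / 2) + (- 1 / 2 * sq m (?P t) + - 1 / 2 * sq m (?Q t)))
      (\<lambda>t. 2 * ((t ^ i + t ^ (i + 1)) / 2)\<^sup>2 + (- 1 / 2 * (t ^ i)\<^sup>2 + - 1 / 2 * (t ^ (i + 1))\<^sup>2))"
      by (intro near_add near_cmult sP sQ sA)
    then have "near (\<eta> m * 30 ^ (2 ^ Suc l))
      (\<lambda>t. 2 * sq m ((?P t + ?Q t) / 2) + (- 1 / 2 * sq m (?P t) + - 1 / 2 * sq m (?Q t)))
      (\<lambda>t. 2 * ((t ^ i + t ^ (i + 1)) / 2)\<^sup>2 + (- 1 / 2 * (t ^ i)\<^sup>2 + - 1 / 2 * (t ^ (i + 1))\<^sup>2))"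
      by (rule near_mono) (use D2le D20 in simp)
    moreover have "(\<lambda>t. 2 * sq m ((?P t + ?Q t) / 2) + (- 1 / 2 * sq m (?P t) + - 1 / 2 * sq m (?Q t))) = mono_approx m (Suc l) k"
      using False by (auto simp: i_def Let_def)
    moreover have "(\<lambda>t::real. 2 * ((t ^ i + t ^ (i + 1)) / 2)\<^sup>2 + (- 1 / 2 * (t ^ i)\<^sup>2 + - 1 / 2 * (t ^ (i + 1))\<^sup>2)) = (\<lambda>t. t ^ k)"
    proof
      fix t :: real
      have "2 * ((x + y) / 2)\<^sup>2 + (- 1 / 2 * x\<^sup>2 + - 1 / 2 * y\<^sup>2) = x * y" for x y :: real
        by (simp add: power2_eq_square field_simps)
      then show "2 * ((t ^ i + t ^ (i + 1)) / 2)\<^sup>2 + (- 1 / 2 * (t ^ i)\<^sup>2 + - 1 / 2 * (t ^ (i + 1))\<^sup>2) = t ^ k"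
        by (simp only: k power_add[symmetric] mult_2 add.assoc)
    qed
    ultimately show ?thesis by (simp only:)
  qed
qed

lemma mono_approx_abs_le_2:
  assumes "\<eta> m * 30 ^ (2 ^ l) \<le> 1" "k \<le> 2 ^ l" "t \<in> {-1..1}"
  shows "\<bar>mono_approx m l k t\<bar> \<le> 2"
proof -
  have "\<bar>mono_approx m l k t - t ^ k\<bar> \<le> 1"
    using mono_approx_near[OF assms(1,2)] assms(1,3) unfolding near_def by force
  moreover have "\<bar>t ^ k\<bar> \<le> 1" using assms(3) by (simp add: power_abs power_le_one abs_le_iff)
  ultimately show ?thesis by linarith
qed

section \<open>Networks for the local monomials\<close>

text \<open>A tent iterate together with its rectified shift makes the next iterate an affine
  combination; the third entry accumulates the sum. All entries are nonnegative and so pass through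
  the activation unchanged.\<close>

definition saw_state :: "nat \<Rightarrow> (real \<Rightarrow> real) \<Rightarrow> (real \<Rightarrow> real) list" where
  "saw_state k y = (let \<tau> = \<lambda>x. (y x + 2) / 4 in
     [\<lambda>x. (tent ^^ k) (\<tau> x), \<lambda>x. relu ((tent ^^ k) (\<tau> x) - 1 / 2), \<lambda>x. saw_sum k (\<tau> x)])"

lemma relu_nonneg_eq: "0 \<le> x \<Longrightarrow> relu x = x"
  by (simp add: relu_def)

lemma saw_state_next:
  assumes h: "h \<in> set (saw_state (Suc k) y)" and y: "\<And>x. \<bar>y x\<bar> \<le> 2" and sub: "set (saw_state k y) \<subseteq> set gs"
  shows "\<exists>h0. sparse_comb 6 gs h0 \<and> (\<forall>x. h x = relu (h0 x))"
proof -
  define \<tau> where "\<tau> x = (y x + 2) / 4" for x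
  have \<tau>: "\<tau> x \<in> {0..1}" for x using y[of x] by (auto simp: \<tau>_def abs_le_iff)
  define g where "g x = (tent ^^ k) (\<tau> x)" for x
  define r where "r x = relu (g x - 1 / 2)" for x
  define a where "a x = saw_sum k (\<tau> x)" for x
  have "g \<in> set gs" "r \<in> set gs" "a \<in> set gs"
    using sub by (auto simp: saw_state_def Let_def \<tau>_def g_def[abs_def] r_def[abs_def] a_def[abs_def])
  note m = this[THEN sparse_comb_mem]
  have G: "(tent ^^ Suc k) (\<tau> x) = 2 * g x + (-4) * r x" for x
    by (simp add: g_def r_def tent_def)
  have A: "saw_sum (Suc k) (\<tau> x) = a x + (1 / 4 ^ Suc k) * (2 * g x + (-4) * r x)" for x
    unfolding saw_sum_Suc G a_def by simp
  have sG: "sparse_comb 2 gs (\<lambda>x. 2 * g x + (-4) * r x)"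
    using sparse_comb_add[OF sparse_comb_cmult[OF m(1), of 2] sparse_comb_cmult[OF m(2), of "-4"]] by (simp add: numeral_2_eq_2)
  have sA: "sparse_comb (1 + 2) gs (\<lambda>x. a x + (1 / 4 ^ Suc k) * (2 * g x + (-4) * r x))"
    by (rule sparse_comb_add[OF m(3) sparse_comb_cmult[OF sG]])
  have sR: "sparse_comb (2 + 0) gs (\<lambda>x. (2 * g x + (-4) * r x) + - 1 / 2)"
    by (rule sparse_comb_add[OF sG sparse_comb_const])
  consider "h = (\<lambda>x. (tent ^^ Suc k) (\<tau> x))" | "h = (\<lambda>x. relu ((tent ^^ Suc k) (\<tau> x) - 1 / 2))"
    | "h = (\<lambda>x. saw_sum (Suc k) (\<tau> x))"
    using h by (auto simp: saw_state_def Let_def \<tau>_def simp del: funpow.simps)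
  then show ?thesis
  proof cases
    case 1
    have "h x = relu (2 * g x + (-4) * r x)" for x
      using relu_nonneg_eq[of "(tent ^^ Suc k) (\<tau> x)"] tent_iter_bounds[OF \<tau>[of x], of "Suc k"] unfolding 1 G by simp
    then show ?thesis using sparse_comb_mono[OF sG, of 6] by (intro exI[of _ "\<lambda>x. 2 * g x + (-4) * r x"]) simp
  next
    case 2
    have "h x = relu ((2 * g x + (-4) * r x) + - 1 / 2)" for x unfolding 2 G by simp
    then show ?thesis using sparse_comb_mono[OF sR, of 6] by (intro exI[of _ "\<lambda>x. (2 * g x + (-4) * r x) + - 1 / 2"]) simp
  next
    case 3
    have "h x = relu (a x + (1 / 4 ^ Suc k) * (2 * g x + (-4) * r x))" for x
      using relu_nonneg_eq[OF saw_sum_nonneg[OF \<tau>[of x], of "Suc k"]] unfolding 3 A by simp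
    then show ?thesis using sparse_comb_mono[OF sA, of 6] by (intro exI[of _ "\<lambda>x. a x + (1 / 4 ^ Suc k) * (2 * g x + (-4) * r x)"]) simp
  qed
qed

lemma saw_state_start:
  assumes h: "h \<in> set (saw_state 0 y)" and y: "\<And>x. \<bar>y x\<bar> \<le> 2" and s: "sparse_comb 6 gs y"
  shows "\<exists>h0. sparse_comb 6 gs h0 \<and> (\<forall>x. h x = relu (h0 x))"
proof -
  have t: "sparse_comb 6 gs (\<lambda>x. 1 / 4 * y x + c)" for c
    using sparse_comb_add[OF sparse_comb_cmult[OF s, of "1 / 4"] sparse_comb_const[of 0 gs c]] by simp
  have "0 \<le> (y x + 2) / 4" for x using y[of x] by (simp add: abs_le_iff)
  then have r: "(y x + 2) / 4 = relu (1 / 4 * y x + 1 / 2)" for x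
    using relu_nonneg_eq[of "(y x + 2) / 4"] by (simp add: add_divide_distrib)
  consider "h = (\<lambda>x. (y x + 2) / 4)" | "h = (\<lambda>x. relu ((y x + 2) / 4 - 1 / 2))" | "h = (\<lambda>x. 0)"
    using h by (auto simp: saw_state_def Let_def saw_sum_def)
  then show ?thesis
  proof cases
    case 1
    then show ?thesis using t[of "1 / 2"] r by (intro exI[of _ "\<lambda>x. 1 / 4 * y x + 1 / 2"]) simp
  next
    case 2
    then show ?thesis using t[of 0] by (intro exI[of _ "\<lambda>x. 1 / 4 * y x + 0"]) (simp add: add_divide_distrib)
  next
    case 3
    then show ?thesis using sparse_comb_const[of 6 gs 0] by (intro exI[of _ "\<lambda>x. 0"]) (simp add: relu_def)
  qed
qed

lemma net_mono: "net d s gs \<Longrightarrow> s \<le> s' \<Longrightarrow> net d s' gs"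
  unfolding net_def by (blast intro: order_trans)

text \<open>The 21 is three neurons per argument with at most 6 weights and a bias each. The 6 is
  forced by the first layer, where an argument may be the average of two monomials with 3 weights
  each.\<close>

lemma net_squares:
  assumes net: "net d s gs" and ys: "ys \<noteq> []"
    and y: "\<And>y. y \<in> set ys \<Longrightarrow> sparse_comb 6 gs y" "\<And>y x. y \<in> set ys \<Longrightarrow> \<bar>y x\<bar> \<le> 2"
  shows "net (Suc k + d) (s + Suc k * (21 * length ys)) (concat (map (saw_state k) ys))"
proof (induction k)
  case 0
  have len: "length (concat (map (saw_state k) ys)) = 3 * length ys" for k
    by (induction ys) (auto simp: saw_state_def Let_def)
  have "net (Suc d) (s + length (concat (map (saw_state 0) ys)) * (6 + 1)) (concat (map (saw_state 0) ys))"
  proof (rule net_layer[OF net])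
    show "concat (map (saw_state 0) ys) \<noteq> []" using ys by (cases ys) (auto simp: saw_state_def Let_def)
    fix h assume "h \<in> set (concat (map (saw_state 0) ys))"
    then obtain y' where "y' \<in> set ys" "h \<in> set (saw_state 0 y')" by auto
    then show "\<exists>h0. sparse_comb 6 gs h0 \<and> (\<forall>x. h x = relu (h0 x))"
      using saw_state_start[of h y' gs] y by blast
  qed
  then show ?case by (simp add: len)
next
  case (Suc k)
  have len: "length (concat (map (saw_state k) ys)) = 3 * length ys" for k
    by (induction ys) (auto simp: saw_state_def Let_def)
  let ?gs = "concat (map (saw_state k) ys)"
  have "net (Suc (Suc k + d)) (s + Suc k * (21 * length ys) + length (concat (map (saw_state (Suc k)) ys)) * (6 + 1)) (concat (map (saw_state (Suc k)) ys))"
  proof (rule net_layer[OF Suc.IH])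
    show "concat (map (saw_state (Suc k)) ys) \<noteq> []" using ys by (cases ys) (auto simp: saw_state_def Let_def)
    fix h assume "h \<in> set (concat (map (saw_state (Suc k)) ys))"
    then obtain y' where y': "y' \<in> set ys" "h \<in> set (saw_state (Suc k) y')" by auto
    have "set (saw_state k y') \<subseteq> set ?gs" using y'(1) by auto
    then show "\<exists>h0. sparse_comb 6 ?gs h0 \<and> (\<forall>x. h x = relu (h0 x))"
      using saw_state_next[OF y'(2), of ?gs] y(2)[OF y'(1)] by blast
  qed
  then show ?case by (simp add: len algebra_simps)
qed

lemma sparse_comb_sq:
  assumes "y \<in> set ys"
  shows "sparse_comb 1 (concat (map (saw_state m) ys)) (\<lambda>x. sq m (y x))"
proof -
  let ?gs = "concat (map (saw_state m) ys)"
  have "(\<lambda>x. saw_sum m ((y x + 2) / 4)) \<in> set ?gs"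
    using assms by (auto simp: saw_state_def Let_def)
  from sparse_comb_add[OF sparse_comb_const[of 0 ?gs 4] sparse_comb_cmult[OF sparse_comb_mem[OF this], of "-16"]]
  show ?thesis by (simp add: sq_def)
qed

text \<open>The coordinate (x - c) / r clamped to [-1, 1]. Its constancy outside the element is what
  localises all its powers.\<close>

definition lcoord :: "real \<Rightarrow> real \<Rightarrow> real \<Rightarrow> real" where
  "lcoord c r x = -1 + relu ((x - (c - r)) / r) - relu ((x - (c + r)) / r)"

lemma lcoord_bounds: "0 < r \<Longrightarrow> lcoord c r x \<in> {-1..1}"
  by (auto simp: lcoord_def relu_def max_def field_simps)

lemma lcoord_inside: "0 < r \<Longrightarrow> x \<in> {c - r..c + r} \<Longrightarrow> lcoord c r x = (x - c) / r"
  by (auto simp: lcoord_def relu_def max_def field_simps)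

lemma lcoord_left: "0 < r \<Longrightarrow> x \<le> c - r \<Longrightarrow> lcoord c r x = -1"
  by (auto simp: lcoord_def relu_def max_def field_simps)

lemma lcoord_right: "0 < r \<Longrightarrow> c + r \<le> x \<Longrightarrow> lcoord c r x = 1"
  by (auto simp: lcoord_def relu_def max_def field_simps)

text \<open>With n = 2^l, a round squares the monomials up to degree n and the averages of
  neighbours, 2 n + 1 functions per element, in m + 1 layers. A monomial of the next level then
  combines at most three squares. The constant 67 closes the induction because 67 n + 21 (2 n + 1)
  is at most 67 times 2 n.\<close>

theorem net_monomials:
  fixes els :: "(real \<times> real) list"
  assumes els: "els \<noteq> []" "\<And>c r. (c, r) \<in> set els \<Longrightarrow> 0 < r"
    and small: "\<eta> m * 30 ^ (2 ^ l) \<le> 1"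
  shows "\<exists>gs. net (1 + l * Suc m) (67 * length els * Suc m * 2 ^ l) gs \<and> length gs \<le> 9 * length els * 2 ^ l \<and>
    (\<forall>c r k. (c, r) \<in> set els \<longrightarrow> k \<le> 2 ^ l \<longrightarrow> sparse_comb 3 gs (\<lambda>x. mono_approx m l k (lcoord c r x)))"
  using small
proof (induction l)
  case 0
  let ?gs = "concat (map (\<lambda>(c, r). [\<lambda>x. relu ((x - (c - r)) / r), \<lambda>x. relu ((x - (c + r)) / r)]) els)"
  have len: "length ?gs = 2 * length els" by (induction els) auto
  have "net (Suc 0) (0 + length ?gs * (1 + 1)) ?gs"
  proof (rule net_layer[OF net_init])
    show "?gs \<noteq> []" using els(1) by (cases els) auto
    fix h assume "h \<in> set ?gs"
    then obtain a r where h: "h = (\<lambda>x. relu ((x - a) / r))" by auto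
    have "sparse_comb (1 + 0) [\<lambda>x. x] (\<lambda>x. (1 / r) * x + - (a / r))"
      by (intro sparse_comb_add sparse_comb_const sparse_comb_cmult sparse_comb_mem) simp
    then have "sparse_comb 1 [\<lambda>x. x] (\<lambda>x. (x - a) / r)" by (simp add: diff_divide_distrib)
    then show "\<exists>h0. sparse_comb 1 [\<lambda>x. x] h0 \<and> (\<forall>x. h x = relu (h0 x))" using h by blast
  qed
  moreover have "sparse_comb 3 ?gs (\<lambda>x. mono_approx m 0 k (lcoord c r x))" if cr: "(c, r) \<in> set els" for c r k
  proof (cases "k = 0")
    case True
    then show ?thesis by (simp add: sparse_comb_const)
  next
    case False
    have "(\<lambda>x. relu ((x - (c - r)) / r)) \<in> set ?gs" "(\<lambda>x. relu ((x - (c + r)) / r)) \<in> set ?gs"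
      using cr by force+
    note mm = this[THEN sparse_comb_mem]
    have "sparse_comb (0 + (1 + 1)) ?gs (\<lambda>x. -1 + (relu ((x - (c - r)) / r) + (-1) * relu ((x - (c + r)) / r)))"
      by (intro sparse_comb_add sparse_comb_const sparse_comb_cmult mm)
    then have "sparse_comb 2 ?gs (lcoord c r)" by (simp add: lcoord_def[abs_def] add_diff_eq numeral_2_eq_2)
    from sparse_comb_mono[OF this, of 3] show ?thesis using False by simp
  qed
  ultimately show ?case
    using len by (intro exI[of _ ?gs]) (auto simp: net_def intro: order_trans)
next
  case (Suc l)
  define n :: nat where "n = 2 ^ l"
  define J where "J = length els"
  have n: "1 \<le> n" "2 ^ Suc l = 2 * n" by (simp_all add: n_def)
  have "\<eta> m * 30 ^ (2 ^ l) \<le> \<eta> m * 30 ^ (2 ^ Suc l)"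
    using \<eta>_pos[of m] by (intro mult_left_mono power_increasing) auto
  then have small: "\<eta> m * 30 ^ (2 ^ l) \<le> 1" using Suc.prems by linarith
  then obtain gs where gs: "net (1 + l * Suc m) (67 * J * Suc m * n) gs"
    and P: "\<And>c r k. (c, r) \<in> set els \<Longrightarrow> k \<le> n \<Longrightarrow> sparse_comb 3 gs (\<lambda>x. mono_approx m l k (lcoord c r x))"
    using Suc.IH unfolding J_def n_def by blast
  define y where "y k = (\<lambda>(c, r) x. mono_approx m l k (lcoord c r x))" for k
  define z where "z k = (\<lambda>(c, r) x. (mono_approx m l k (lcoord c r x) + mono_approx m l (k + 1) (lcoord c r x)) / 2)" for k
  define blk where "blk e = map (\<lambda>k. y k e) [0..<Suc n] @ map (\<lambda>k. z k e) [0..<n]" for e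
  have blk: "set (blk e) = (\<lambda>k. y k e) ` {..n} \<union> (\<lambda>k. z k e) ` {..<n}" for e
    unfolding blk_def set_append set_map set_upt by (simp only: atLeast0LessThan lessThan_Suc_atMost)
  define ys where "ys = concat (map blk els)"
  have lys: "length ys = J * (2 * n + 1)"
    unfolding ys_def J_def by (induction els) (auto simp: blk_def)
  have y_in: "y k e \<in> set ys" if "e \<in> set els" "k \<le> n" for k e
    unfolding ys_def set_concat set_map using that blk[of e] by blast
  have z_in: "z k e \<in> set ys" if "e \<in> set els" "k < n" for k e
    unfolding ys_def set_concat set_map using that blk[of e] by blast
  have mb: "\<bar>mono_approx m l k (lcoord c r x)\<bar> \<le> 2" if "(c, r) \<in> set els" "k \<le> n" for c r k x
    by (rule mono_approx_abs_le_2[OF small]) (use that lcoord_bounds els(2) n_def in auto)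
  have ycases: "\<exists>c r k. (c, r) \<in> set els \<and> (k \<le> n \<and> w = (\<lambda>x. mono_approx m l k (lcoord c r x)) \<or>
      k + 1 \<le> n \<and> w = (\<lambda>x. (mono_approx m l k (lcoord c r x) + mono_approx m l (k + 1) (lcoord c r x)) / 2))"
    if w_in: "w \<in> set ys" for w
  proof -
    obtain e' where "e' \<in> set els" "w \<in> set (blk e')"
      using w_in unfolding ys_def set_concat set_map by blast
    moreover obtain c r where "e' = (c, r)" by (rule prod.exhaust)
    ultimately have e: "(c, r) \<in> set els" and w: "w \<in> set (blk (c, r))" by simp_all
    from w consider k where "k \<le> n" "w = y k (c, r)" | k where "k + 1 \<le> n" "w = z k (c, r)"
      unfolding blk by (auto simp: Suc_le_eq)
    then show ?thesis
    proof cases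
      case (1 k)
      then show ?thesis using e by (intro exI[of _ c] exI[of _ r] exI[of _ k]) (simp add: y_def)
    next
      case (2 k)
      then show ?thesis using e by (intro exI[of _ c] exI[of _ r] exI[of _ k]) (simp add: z_def)
    qed
  qed
  have sq_net: "net (Suc m + (1 + l * Suc m)) (67 * J * Suc m * n + Suc m * (21 * length ys)) (concat (map (saw_state m) ys))"
  proof (rule net_squares[OF gs])
    have "els \<noteq> []" by (rule els(1))
    then show "ys \<noteq> []" using lys by (auto simp: J_def)
    fix w assume "w \<in> set ys"
    then obtain c r k where e: "(c, r) \<in> set els" and
      w: "k \<le> n \<and> w = (\<lambda>x. mono_approx m l k (lcoord c r x)) \<or>
      k + 1 \<le> n \<and> w = (\<lambda>x. (mono_approx m l k (lcoord c r x) + mono_approx m l (k + 1) (lcoord c r x)) / 2)"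
      using ycases by blast
    show "sparse_comb 6 gs w"
      using w
    proof
      assume "k \<le> n \<and> w = (\<lambda>x. mono_approx m l k (lcoord c r x))"
      then show ?thesis using sparse_comb_mono[OF P[OF e, of k], of 6] by simp
    next
      assume k: "k + 1 \<le> n \<and> w = (\<lambda>x. (mono_approx m l k (lcoord c r x) + mono_approx m l (k + 1) (lcoord c r x)) / 2)"
      have "sparse_comb (3 + 3) gs (\<lambda>x. 1 / 2 * (mono_approx m l k (lcoord c r x) + mono_approx m l (k + 1) (lcoord c r x)))"
        by (intro sparse_comb_cmult sparse_comb_add P[OF e]) (use k in auto)
      then show ?thesis using k by simp
    qed
    fix x
    show "\<bar>w x\<bar> \<le> 2"
      using w
    proof
      assume "k \<le> n \<and> w = (\<lambda>x. mono_approx m l k (lcoord c r x))"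
      then show ?thesis using mb[OF e, of k x] by simp
    next
      assume k: "k + 1 \<le> n \<and> w = (\<lambda>x. (mono_approx m l k (lcoord c r x) + mono_approx m l (k + 1) (lcoord c r x)) / 2)"
      then have "\<bar>mono_approx m l k (lcoord c r x)\<bar> \<le> 2" "\<bar>mono_approx m l (k + 1) (lcoord c r x)\<bar> \<le> 2"
        by (auto intro!: mb[OF e])
      moreover have "w x = (mono_approx m l k (lcoord c r x) + mono_approx m l (k + 1) (lcoord c r x)) / 2" using k by simp
      ultimately show ?thesis by (simp add: abs_le_iff)
    qed
  qed
  let ?gs = "concat (map (saw_state m) ys)"
  have len: "length ?gs = 3 * length ys"
    by (induction ys) (auto simp: saw_state_def Let_def)
  have "67 * J * Suc m * n + Suc m * (21 * length ys) \<le> 67 * J * Suc m * (2 * n)"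
  proof -
    have "21 * (2 * n + 1) \<le> 67 * n" using n(1) by simp
    then have "J * Suc m * (21 * (2 * n + 1)) \<le> J * Suc m * (67 * n)" by (rule mult_le_mono2)
    then show ?thesis unfolding lys by (simp add: algebra_simps)
  qed
  then have net': "net (1 + Suc l * Suc m) (67 * J * Suc m * (2 * n)) ?gs"
  proof -
    assume le: "67 * J * Suc m * n + Suc m * (21 * length ys) \<le> 67 * J * Suc m * (2 * n)"
    have "Suc m + (1 + l * Suc m) = 1 + Suc l * Suc m" by simp
    then show ?thesis using net_mono[OF sq_net le] by (simp only:)
  qed
  have "length ?gs \<le> 9 * J * (2 * n)"
  proof -
    have "3 * (2 * n + 1) \<le> 9 * (2 * n)" using n(1) by simp
    then have "J * (3 * (2 * n + 1)) \<le> J * (9 * (2 * n))" by (rule mult_le_mono2)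
    then show ?thesis unfolding len lys by (simp add: algebra_simps)
  qed
  moreover have "sparse_comb 3 ?gs (\<lambda>x. mono_approx m (Suc l) k (lcoord c r x))"
    if e: "(c, r) \<in> set els" and k: "k \<le> 2 * n" for c r k
  proof -
    define i where "i = k div 2"
    show ?thesis
    proof (cases "even k")
      case True
      then have "i \<le> n" using k by (auto simp: i_def)
      from sparse_comb_mono[OF sparse_comb_sq[OF y_in[OF e this]], of 3]
      show ?thesis using True by (simp add: i_def y_def Let_def)
    next
      case False
      then have i: "i < n" "i \<le> n" "i + 1 \<le> n" using k by (auto simp: i_def elim!: oddE)
      have "sparse_comb (1 + (1 + 1)) ?gs (\<lambda>x. 2 * sq m (z i (c, r) x) + ((- 1 / 2) * sq m (y i (c, r) x) + (- 1 / 2) * sq m (y (i + 1) (c, r) x)))"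
        by (intro sparse_comb_add sparse_comb_cmult sparse_comb_sq y_in z_in e i)
      moreover have "(\<lambda>x. 2 * sq m (z i (c, r) x) + ((- 1 / 2) * sq m (y i (c, r) x) + (- 1 / 2) * sq m (y (i + 1) (c, r) x))) =
         (\<lambda>x. mono_approx m (Suc l) k (lcoord c r x))"
        using False by (auto simp: i_def y_def z_def Let_def)
      ultimately show ?thesis by (simp add: numeral_3_eq_3)
    qed
  qed
  ultimately show ?case
    using net' unfolding J_def n(2) by blast
qed

section \<open>Meshes\<close>

text \<open>Elements are pairs of midpoint and radius that tile [a, b] from left to right.\<close>

fun chain :: "real \<Rightarrow> (real \<times> real) list \<Rightarrow> real \<Rightarrow> bool" where
  "chain a [] b \<longleftrightarrow> a = b"
| "chain a ((c, r) # es) b \<longleftrightarrow> 0 < r \<and> c - r = a \<and> chain (c + r) es b"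

lemma chain_append: "chain a es b \<Longrightarrow> chain b es' d \<Longrightarrow> chain a (es @ es') d"
  by (induction a es b rule: chain.induct) auto

lemma chain_element:
  assumes "chain a es b" "(c, r) \<in> set es"
  shows "0 < r" "a \<le> c - r" "c + r \<le> b"
proof -
  have le: "chain a es b \<Longrightarrow> a \<le> b" for a by (induction a es b rule: chain.induct) force+
  have "0 < r \<and> a \<le> c - r \<and> c + r \<le> b"
    using assms
  proof (induction a es b rule: chain.induct)
    case (2 a c' r' es b)
    have le: "chain x es b \<Longrightarrow> x \<le> b" for x by (induction x es b rule: chain.induct) force+
    show ?case
    proof (cases "(c, r) = (c', r')")
      case True
      then show ?thesis using 2(2) le[of "c' + r'"] by simp
    next
      case False
      then have "(c, r) \<in> set es" using 2(3) by auto
      then show ?thesis using 2(1,2) by force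
    qed
  qed simp
  then show "0 < r" "a \<le> c - r" "c + r \<le> b" by simp_all
qed

lemma chain_separated:
  assumes "chain a es b" "(c, r) \<in> set es" "(c', r') \<in> set es" "(c, r) \<noteq> (c', r')"
  shows "c + r \<le> c' - r' \<or> c' + r' \<le> c - r"
  using assms
proof (induction a es b rule: chain.induct)
  case (2 a d s es b)
  have ch: "chain (d + s) es b" and IH: "(c, r) \<in> set es \<Longrightarrow> (c', r') \<in> set es \<Longrightarrow> ?case"
    using 2 by auto
  have el: "d + s \<le> x - y" if "(x, y) \<in> set es" for x y using chain_element(2)[OF ch that] .
  consider "(c, r) \<in> set es" "(c', r') \<in> set es" | "(c, r) = (d, s)" "(c', r') \<in> set es" | "(c', r') = (d, s)" "(c, r) \<in> set es"
    using 2(3-5) by auto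
  then show ?case using IH el by cases auto
qed simp

lemma chain_cover:
  assumes "chain a es b" "x \<in> {a<..<b}"
  shows "\<exists>c r. (c, r) \<in> set es \<and> x \<in> {c - r..c + r}"
  using assms
proof (induction a es b rule: chain.induct)
  case (2 a c r es b)
  show ?case
  proof (cases "x \<le> c + r")
    case True
    then show ?thesis using 2 by (intro exI[of _ c] exI[of _ r]) auto
  next
    case False
    then have "x \<in> {c + r<..<b}" using 2(3) by auto
    then show ?thesis using 2 by auto
  qed
qed simp

definition uniform_mesh :: "real \<Rightarrow> real \<Rightarrow> nat \<Rightarrow> (real \<times> real) list" where
  "uniform_mesh a h n = map (\<lambda>i. (a + (2 * real i + 1) * h, h)) [0..<n]"

lemma chain_uniform_mesh: "0 < h \<Longrightarrow> chain a (uniform_mesh a h n) (a + 2 * real n * h)"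
proof (induction n)
  case (Suc n)
  have "chain (a + 2 * real n * h) [(a + (2 * real n + 1) * h, h)] (a + 2 * real (Suc n) * h)"
    using Suc.prems by (simp add: algebra_simps)
  from chain_append[OF Suc.IH[OF Suc.prems] this] show ?case by (simp add: uniform_mesh_def)
qed (simp add: uniform_mesh_def)

lemma oscillation_closure:
  fixes E :: "real \<Rightarrow> real"
  assumes E: "continuous_on {u..v} E" and uv: "u < v"
    and o: "\<And>x y. x \<in> {u<..<v} \<Longrightarrow> y \<in> {u<..<v} \<Longrightarrow> \<bar>E x - E y\<bar> \<le> k"
    and xy: "x \<in> {u..v}" "y \<in> {u..v}"
  shows "\<bar>E x - E y\<bar> \<le> k"
proof -
  have cl: "closure {u<..<v} = {u..v}" using uv by simp
  have 1: "\<bar>E z - E w\<bar> \<le> k" if "z \<in> {u..v}" "w \<in> {u<..<v}" for z w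
  proof (rule continuous_le_on_closure[of "{u<..<v}" "\<lambda>z. \<bar>E z - E w\<bar>"])
    show "continuous_on (closure {u<..<v}) (\<lambda>z. \<bar>E z - E w\<bar>)"
      unfolding cl by (intro continuous_intros E)
  qed (use that o cl in auto)
  show ?thesis
  proof (rule continuous_le_on_closure[of "{u<..<v}" "\<lambda>w. \<bar>E x - E w\<bar>"])
    show "continuous_on (closure {u<..<v}) (\<lambda>w. \<bar>E x - E w\<bar>)"
      unfolding cl by (intro continuous_intros E)
  qed (use xy 1 cl in auto)
qed

text \<open>Oscillations add up along the elements from the left end. Only interior points are
  compared in the hypothesis, since the local comparison functions differ from element to element;
  continuity supplies the nodes.\<close>

lemma chain_oscillation:
  fixes E :: "real \<Rightarrow> real"
  assumes "chain a es b" "continuous_on {a..b} E"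
    and "\<And>c r x y. (c, r) \<in> set es \<Longrightarrow> x \<in> {c - r<..<c + r} \<Longrightarrow> y \<in> {c - r<..<c + r} \<Longrightarrow> \<bar>E x - E y\<bar> \<le> k"
    and "x \<in> {a..b}" and "0 \<le> k"
  shows "\<bar>E x - E a\<bar> \<le> real (length es) * k"
  using assms
proof (induction a es b arbitrary: x rule: chain.induct)
  case (2 a c r es b)
  have r: "0 < r" "c - r = a" and ch: "chain (c + r) es b" using 2(2) by auto
  have cb: "c + r \<le> b" by (rule chain_element(3)[OF 2(2), of c r]) simp
  have cont: "continuous_on {c - r..c + r} E" by (rule continuous_on_subset[OF 2(3)]) (use r cb in auto)
  have first: "\<bar>E y - E a\<bar> \<le> k" if "y \<in> {c - r..c + r}" for y
  proof (rule oscillation_closure[OF cont])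
    show "\<bar>E x - E y\<bar> \<le> k" if "x \<in> {c - r<..<c + r}" "y \<in> {c - r<..<c + r}" for x y
      by (rule 2(4)[OF _ that]) simp
  qed (use r that in auto)
  show ?case
  proof (cases "x \<le> c + r")
    case True
    then have "\<bar>E x - E a\<bar> \<le> k" using 2(5) r by (intro first) auto
    also have "\<dots> \<le> real (length ((c, r) # es)) * k" using 2(6) by (simp add: distrib_right)
    finally show ?thesis .
  next
    case False
    have "\<bar>E x - E (c + r)\<bar> \<le> real (length es) * k"
    proof (rule 2(1)[OF ch])
      show "continuous_on {c + r..b} E" by (rule continuous_on_subset[OF 2(3)]) (use r in auto)
      show "\<bar>E x - E y\<bar> \<le> k" if "(c', r') \<in> set es" "x \<in> {c' - r'<..<c' + r'}" "y \<in> {c' - r'<..<c' + r'}" for c' r' x y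
        by (rule 2(4)[OF _ that(2,3)]) (simp add: that(1))
    qed (use False 2(5,6) in auto)
    moreover have "\<bar>E (c + r) - E a\<bar> \<le> k" using r by (intro first) auto
    ultimately show ?thesis by (simp add: distrib_right)
  qed
qed simp

section \<open>Local polynomial approximation\<close>

lemma exp_minus_two_le: "exp (- 2 * real k) \<le> (1 / 2) ^ k"
proof -
  have "exp (- 2 :: real) \<le> 1 / 2" using exp_ge_add_one_self[of 2] by (simp add: exp_minus field_simps)
  then have "exp (- 2 :: real) ^ k \<le> (1 / 2) ^ k" by (intro power_mono) auto
  then show ?thesis by (simp add: exp_of_nat_mult[symmetric] mult.commute)
qed

text \<open>Taylor's theorem is applied to V', whose error the energy norm needs. The remainder
  carries (N + 1)! / N! = N + 1, and one of the two factors exp(-N - 1) from the hypothesis absorbs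
  it. The decay of the coefficients keeps their absolute sum bounded, so that the monomials can be
  replaced by approximate ones.\<close>

lemma taylor_element:
  assumes nd: "\<And>n. ndiff J n V" and sub: "{c - r<..<c + r} \<subseteq> J" and r: "0 < r" and N: "0 < N"
    and bd: "\<And>k x. x \<in> {c - r<..<c + r} \<Longrightarrow> \<bar>(deriv ^^ k) V x\<bar> * r ^ k \<le> A * exp (- 2 * real k) * fact k"
  shows "\<exists>a. (\<forall>k. \<bar>a k\<bar> \<le> A * (1 / 2) ^ k) \<and> (\<forall>x\<in>{c - r<..<c + r}. \<forall>y\<in>{c - r<..<c + r}.
     \<bar>(V x - (\<Sum>k\<le>N. a k * ((x - c) / r) ^ k)) - (V y - (\<Sum>k\<le>N. a k * ((y - c) / r) ^ k))\<bar> \<le> A * exp (- real N) / r * \<bar>x - y\<bar>)"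
proof -
  define a where "a k = (deriv ^^ k) V c * r ^ k / fact k" for k
  have cI: "c \<in> {c - r<..<c + r}" using r by simp
  have A: "0 \<le> A" using order_trans[OF abs_ge_zero, of "V c" A] bd[OF cI, of 0] by simp
  have a: "\<bar>a k\<bar> \<le> A * (1 / 2) ^ k" for k
  proof -
    have "\<bar>a k\<bar> = \<bar>(deriv ^^ k) V c\<bar> * r ^ k / fact k" using r by (simp add: a_def abs_mult)
    also have "\<dots> \<le> A * exp (- 2 * real k) * fact k / fact k" by (rule divide_right_mono[OF bd[OF cI]]) simp
    also have "\<dots> \<le> A * (1 / 2) ^ k" using exp_minus_two_le[of k] A by (simp add: mult_left_mono)
    finally show ?thesis .
  qed
  let ?q = "\<lambda>x. \<Sum>k\<le>N. a k * ((x - c) / r) ^ k"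
  let ?q' = "\<lambda>x. \<Sum>k<N. (deriv ^^ Suc k) V c / fact k * (x - c) ^ k"
  have dq: "(?q has_real_derivative ?q' x) (at x)" for x
  proof -
    have "(?q has_real_derivative (\<Sum>k\<le>N. a k * (real k * ((x - c) / r) ^ (k - 1) * (1 / r)))) (at x)"
      by (rule DERIV_sum, rule DERIV_cmult) (rule derivative_eq_intros refl | use r in simp)+
    moreover have "(\<Sum>k\<le>N. a k * (real k * ((x - c) / r) ^ (k - 1) * (1 / r))) = ?q' x"
    proof -
      have "(\<Sum>k\<le>N. a k * (real k * ((x - c) / r) ^ (k - 1) * (1 / r)))
        = (\<Sum>k<N. a (Suc k) * (real (Suc k) * ((x - c) / r) ^ k * (1 / r)))"
        using N by (cases N) (simp_all only: sum.atMost_Suc_shift lessThan_Suc_atMost diff_Suc_1 of_nat_0 mult_zero_left mult_zero_right add_0_left)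
      also have "\<dots> = ?q' x"
      proof (rule sum.cong[OF refl])
        fix k
        show "a (Suc k) * (real (Suc k) * ((x - c) / r) ^ k * (1 / r)) = (deriv ^^ Suc k) V c / fact k * (x - c) ^ k"
          using r by (simp add: a_def power_divide field_simps del: funpow.simps of_nat_Suc)
      qed
      finally show ?thesis .
    qed
    ultimately show ?thesis by simp
  qed
  have dV: "(V has_real_derivative deriv V x) (at x)" if "x \<in> J" for x
    by (rule ndiff_DERIV0[OF nd that])
  have rem: "\<bar>deriv V x - ?q' x\<bar> \<le> A * exp (- real N) / r" if x: "x \<in> {c - r<..<c + r}" for x
  proof (cases "x = c")
    case True
    obtain n where n: "N = Suc n" using N by (cases N) auto
    have "?q' x = deriv V x"
      unfolding True n sum.lessThan_Suc_shift by simp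
    then show ?thesis using A r by simp
  next
    case False
    let ?lo = "min x c" and ?hi = "max x c"
    have inJ: "t \<in> {c - r<..<c + r}" if "?lo \<le> t" "t \<le> ?hi" for t
      using that x r by (auto simp: min_def max_def split: if_splits)
    have der: "\<forall>m t. m < N \<and> ?lo \<le> t \<and> t \<le> ?hi \<longrightarrow> DERIV ((deriv ^^ Suc m) V) t :> (deriv ^^ Suc (Suc m)) V t"
    proof (intro allI impI)
      fix m t assume h: "m < N \<and> ?lo \<le> t \<and> t \<le> ?hi"
      then have "t \<in> J" using inJ sub by blast
      then show "DERIV ((deriv ^^ Suc m) V) t :> (deriv ^^ Suc (Suc m)) V t"
        by (rule ndiff_DERIV[OF nd[of "Suc (Suc m)"] lessI])
    qed
    have "\<exists>t. (if x < c then x < t \<and> t < c else c < t \<and> t < x) \<and>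
        deriv V x = (\<Sum>m<N. (deriv ^^ Suc m) V c / fact m * (x - c) ^ m) + (deriv ^^ Suc N) V t / fact N * (x - c) ^ N"
      by (rule Taylor[OF N _ der]) (use False in auto)
    then obtain t where t: "if x < c then x < t \<and> t < c else c < t \<and> t < x"
      "deriv V x - ?q' x = (deriv ^^ Suc N) V t / fact N * (x - c) ^ N" by auto
    have tI: "t \<in> {c - r<..<c + r}" using t(1) by (intro inJ) (auto split: if_splits)
    have "\<bar>deriv V x - ?q' x\<bar> = \<bar>(deriv ^^ Suc N) V t\<bar> / fact N * \<bar>x - c\<bar> ^ N"
      unfolding t(2) by (simp add: abs_mult power_abs del: funpow.simps)
    also have "\<dots> \<le> \<bar>(deriv ^^ Suc N) V t\<bar> / fact N * r ^ N"
      using x by (intro mult_left_mono power_mono) (auto simp: abs_le_iff)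
    also have "\<dots> = \<bar>(deriv ^^ Suc N) V t\<bar> * r ^ Suc N / (fact N * r)" using r by (simp add: field_simps del: funpow.simps)
    also have "\<dots> \<le> A * exp (- 2 * real (Suc N)) * fact (Suc N) / (fact N * r)"
      by (rule divide_right_mono[OF bd[OF tI]]) (use r in simp)
    also have "\<dots> = A * (exp (- 2 * real (Suc N)) * real (Suc N)) / r" using r by (simp add: field_simps del: of_nat_Suc)
    also have "\<dots> \<le> A * exp (- real N) / r"
    proof (intro divide_right_mono mult_left_mono A)
      have "real (Suc N) \<le> exp (real (Suc N))" using exp_ge_add_one_self[of "real (Suc N)"] by linarith
      then have "exp (- 2 * real (Suc N)) * real (Suc N) \<le> exp (- 2 * real (Suc N)) * exp (real (Suc N))"
        by (intro mult_left_mono) auto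
      also have "\<dots> \<le> exp (- real N)" by (simp add: exp_add[symmetric])
      finally show "exp (- 2 * real (Suc N)) * real (Suc N) \<le> exp (- real N)" .
    qed (use r in simp)
    finally show ?thesis .
  qed
  have "\<bar>(V x - ?q x) - (V y - ?q y)\<bar> \<le> A * exp (- real N) / r * \<bar>x - y\<bar>"
    if xy: "x \<in> {c - r<..<c + r}" "y \<in> {c - r<..<c + r}" for x y
  proof -
    have "norm ((V x - ?q x) - (V y - ?q y)) \<le> A * exp (- real N) / r * norm (x - y)"
    proof (rule field_differentiable_bound[where S = "{c - r<..<c + r}" and f = "\<lambda>x. V x - ?q x"])
      fix z assume z: "z \<in> {c - r<..<c + r}"
      then have "z \<in> J" using sub by blast
      show "((\<lambda>x. V x - ?q x) has_field_derivative (deriv V z - ?q' z)) (at z within {c - r<..<c + r})"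
        by (rule has_field_derivative_at_within, rule DERIV_diff[OF dV[OF \<open>z \<in> J\<close>] dq])
      show "norm (deriv V z - ?q' z) \<le> A * exp (- real N) / r" using rem[OF z] by simp
    qed (use xy in auto)
    then show ?thesis by simp
  qed
  with a show ?thesis by blast
qed

definition local_sum :: "nat \<Rightarrow> nat \<Rightarrow> (real \<times> real) list \<Rightarrow> (real \<times> real \<Rightarrow> nat \<Rightarrow> real) \<Rightarrow> real \<Rightarrow> real" where
  "local_sum m l es a x = (\<Sum>(c, r)\<in>set es. \<Sum>k\<le>2 ^ l. a (c, r) k * mono_approx m l k (lcoord c r x))"

text \<open>Inside one element the local coordinates of all the others are saturated at -1 or 1, so
  their summands are constant and drop out of the difference.\<close>

lemma local_sum_diff:
  assumes ch: "chain u es v" and cr: "(c, r) \<in> set es"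
    and x: "x \<in> {c - r..c + r}" and y: "y \<in> {c - r..c + r}"
  shows "local_sum m l es a x - local_sum m l es a y =
    (\<Sum>k\<le>2 ^ l. a (c, r) k * mono_approx m l k ((x - c) / r)) - (\<Sum>k\<le>2 ^ l. a (c, r) k * mono_approx m l k ((y - c) / r))"
proof -
  have r: "0 < r" by (rule chain_element(1)[OF ch cr])
  let ?T = "\<lambda>e x. case e of (c, r) \<Rightarrow> \<Sum>k\<le>2 ^ l. a (c, r) k * mono_approx m l k (lcoord c r x)"
  have "local_sum m l es a x - local_sum m l es a y = (\<Sum>e\<in>set es. ?T e x - ?T e y)"
    by (simp only: local_sum_def sum_subtractf)
  also have "\<dots> = (\<Sum>e\<in>{(c, r)}. ?T e x - ?T e y)"
  proof (rule sum.mono_neutral_right)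
    show "\<forall>e\<in>set es - {(c, r)}. ?T e x - ?T e y = 0"
    proof
      fix e assume e: "e \<in> set es - {(c, r)}"
      obtain c' r' where e': "e = (c', r')" by (cases e)
      then have el: "(c', r') \<in> set es" "(c', r') \<noteq> (c, r)" using e by auto
      have r': "0 < r'" by (rule chain_element(1)[OF ch el(1)])
      from chain_separated[OF ch el(1) cr el(2)]
      have "lcoord c' r' x = lcoord c' r' y"
      proof
        assume "c' + r' \<le> c - r"
        then show ?thesis using x y by (simp add: lcoord_right[OF r'])
      next
        assume "c + r \<le> c' - r'"
        then show ?thesis using x y by (simp add: lcoord_left[OF r'])
      qed
      then show "?T e x - ?T e y = 0" using e' by simp
    qed
  qed (use cr in auto)
  also have "\<dots> = ?T (c, r) x - ?T (c, r) y" by simp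
  finally show ?thesis using lcoord_inside[OF r x] lcoord_inside[OF r y] by simp
qed

text \<open>The Lipschitz form of the local error bounds the derivative of the error wherever it exists, and
  avoids differentiating the network.\<close>

definition elementwise_near :: "(real \<times> real) list \<Rightarrow> real \<Rightarrow> (real \<times> real \<Rightarrow> real \<Rightarrow> real) \<Rightarrow> (real \<Rightarrow> real) \<Rightarrow> bool" where
  "elementwise_near es \<theta> V F \<longleftrightarrow> (\<forall>c r. (c, r) \<in> set es \<longrightarrow> (\<forall>x\<in>{c - r<..<c + r}. \<forall>y\<in>{c - r<..<c + r}.
     \<bar>(V (c, r) x - F x) - (V (c, r) y - F y)\<bar> \<le> \<theta> / r * \<bar>x - y\<bar>))"

lemma geometric_half: "(\<Sum>k\<le>n. (1 / 2 :: real) ^ k) \<le> 2"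
proof -
  have "(\<Sum>k\<le>n. (1 / 2 :: real) ^ k) = 2 - (1/2) ^ n" by (induction n) auto
  then show ?thesis by simp
qed

text \<open>The first term is the Taylor error. The second is the effect of the approximate
  monomials, bounded by the absolute sum of the coefficients, which is at most 2 A.\<close>

lemma local_sum_near:
  assumes ch: "chain (-1) es 1" and A: "0 \<le> A"
    and nd: "\<And>e n. e \<in> set es \<Longrightarrow> ndiff J n (V e)"
    and bd: "\<And>c r k x. (c, r) \<in> set es \<Longrightarrow> x \<in> {c - r<..<c + r} \<Longrightarrow>
      \<bar>(deriv ^^ k) (V (c, r)) x\<bar> * r ^ k \<le> A * exp (- 2 * real k) * fact k"
    and small: "\<eta> m * 30 ^ (2 ^ l) \<le> 1"
  shows "\<exists>a. elementwise_near es (A * exp (- real (2 ^ l)) + 2 * A * (\<eta> m * 30 ^ (2 ^ l))) V (local_sum m l es a)"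
proof -
  define N :: nat where "N = 2 ^ l"
  define D where "D = \<eta> m * 30 ^ N"
  have D0: "0 \<le> D" using \<eta>_pos[of m] by (simp add: D_def)
  have "\<exists>a. \<forall>c r. e = (c, r) \<longrightarrow> e \<in> set es \<longrightarrow> (\<forall>k. \<bar>a k\<bar> \<le> A * (1 / 2) ^ k) \<and> (\<forall>x\<in>{c - r<..<c + r}. \<forall>y\<in>{c - r<..<c + r}.
     \<bar>(V e x - (\<Sum>k\<le>N. a k * ((x - c) / r) ^ k)) - (V e y - (\<Sum>k\<le>N. a k * ((y - c) / r) ^ k))\<bar> \<le> A * exp (- real N) / r * \<bar>x - y\<bar>)" for e
  proof (cases "e \<in> set es")
    case True
    obtain c r where e: "e = (c, r)" by (cases e)
    then have cr: "(c, r) \<in> set es" using True by simp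
    note el = chain_element[OF ch cr]
    have "{c - r<..<c + r} \<subseteq> J" using el by auto
    from taylor_element[OF nd[OF cr] this el(1) _ bd[OF cr], of N] show ?thesis
      unfolding e using cr by (auto simp: N_def)
  qed auto
  from choice[OF allI[OF this]] obtain a where a: "\<forall>e. \<forall>c r. e = (c, r) \<longrightarrow> e \<in> set es \<longrightarrow> (\<forall>k. \<bar>a e k\<bar> \<le> A * (1 / 2) ^ k) \<and> (\<forall>x\<in>{c - r<..<c + r}. \<forall>y\<in>{c - r<..<c + r}.
     \<bar>(V e x - (\<Sum>k\<le>N. a e k * ((x - c) / r) ^ k)) - (V e y - (\<Sum>k\<le>N. a e k * ((y - c) / r) ^ k))\<bar> \<le> A * exp (- real N) / r * \<bar>x - y\<bar>)" ..
  have "elementwise_near es (A * exp (- real N) + 2 * A * D) V (local_sum m l es a)"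
    unfolding elementwise_near_def
  proof (intro allI impI ballI)
    fix c r x y assume cr: "(c, r) \<in> set es" and x: "x \<in> {c - r<..<c + r}" and y: "y \<in> {c - r<..<c + r}"
    have r: "0 < r" by (rule chain_element(1)[OF ch cr])
    let ?q = "\<lambda>t. \<Sum>k\<le>N. a (c, r) k * t ^ k"
    let ?g = "\<lambda>t. \<Sum>k\<le>N. a (c, r) k * mono_approx m l k t"
    let ?s = "(x - c) / r" and ?t = "(y - c) / r"
    have st: "?s \<in> {-1..1}" "?t \<in> {-1..1}" using x y r by (auto simp: field_simps)
    have ab: "\<bar>a (c, r) k\<bar> \<le> A * (1 / 2) ^ k" for k using a cr by blast
    have T: "\<bar>(V (c, r) x - ?q ?s) - (V (c, r) y - ?q ?t)\<bar> \<le> A * exp (- real N) / r * \<bar>x - y\<bar>"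
      using a cr x y by blast
    have nr: "near ((\<Sum>k\<le>N. \<bar>a (c, r) k\<bar>) * D) ?g ?q"
      by (rule near_sum) (use mono_approx_near[OF small] D0 in \<open>auto simp: D_def N_def\<close>)
    have "(\<Sum>k\<le>N. \<bar>a (c, r) k\<bar>) \<le> (\<Sum>k\<le>N. A * (1 / 2) ^ k)" by (rule sum_mono) (rule ab)
    also have "\<dots> \<le> A * 2" unfolding sum_distrib_left[symmetric] by (rule mult_left_mono[OF geometric_half A])
    finally have "(\<Sum>k\<le>N. \<bar>a (c, r) k\<bar>) * D \<le> A * 2 * D" using D0 by (rule mult_right_mono)
    then have "near (2 * A * D) ?g ?q" using near_mono[OF nr] by (simp add: mult_ac)
    then have 2: "\<bar>(?g ?s - ?q ?s) - (?g ?t - ?q ?t)\<bar> \<le> 2 * A * D * \<bar>?s - ?t\<bar>"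
      using st unfolding near_def by blast
    have "\<bar>?s - ?t\<bar> = \<bar>x - y\<bar> / r" using r by (simp add: diff_divide_distrib[symmetric])
    with 2 have 3: "\<bar>(?g ?s - ?q ?s) - (?g ?t - ?q ?t)\<bar> \<le> 2 * A * D / r * \<bar>x - y\<bar>" by simp
    have "local_sum m l es a x - local_sum m l es a y = ?g ?s - ?g ?t"
      unfolding N_def by (rule local_sum_diff[OF ch cr]) (use x y in auto)
    then have "\<bar>(V (c, r) x - local_sum m l es a x) - (V (c, r) y - local_sum m l es a y)\<bar> \<le>
      A * exp (- real N) / r * \<bar>x - y\<bar> + 2 * A * D / r * \<bar>x - y\<bar>"
      using T 3 unfolding abs_le_iff by linarith
    also have "\<dots> = (A * exp (- real N) + 2 * A * D) / r * \<bar>x - y\<bar>"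
      by (simp only: distrib_right add_divide_distrib)
    finally show "\<bar>(V (c, r) x - local_sum m l es a x) - (V (c, r) y - local_sum m l es a y)\<bar> \<le>
      (A * exp (- real N) + 2 * A * D) / r * \<bar>x - y\<bar>" .
  qed
  then show ?thesis unfolding D_def N_def by blast
qed

section \<open>Error estimates for a corrected local sum\<close>

lemma pw_affine_continuous:
  assumes "pw_affine F"
  shows "continuous_on UNIV F"
proof -
  obtain S where S: "finite S" "\<And>a b. a < b \<Longrightarrow> {a<..<b} \<inter> S = {} \<Longrightarrow> \<exists>s c. \<forall>x\<in>{a..b}. F x = s * x + c"
    using assms unfolding pw_affine_def by blast
  have "isCont F x" for x
  proof -
    have "open (- (S - {x}))" by (intro open_Compl finite_imp_closed finite_Diff S(1))
    then obtain e where e: "e > 0" "ball x e \<subseteq> - (S - {x})" using open_contains_ball by blast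
    then have e': "{x - e<..<x + e} \<inter> S \<subseteq> {x}" by (auto simp: ball_eq_greaterThanLessThan)
    have "{x - e<..<x} \<inter> S = {}" "{x<..<x + e} \<inter> S = {}" using e' e(1) by force+
    then obtain s c s' c' where l: "\<forall>y\<in>{x - e..x}. F y = s * y + c" and r: "\<forall>y\<in>{x..x + e}. F y = s' * y + c'"
      using S(2)[of "x - e" x] S(2)[of x "x + e"] e(1) by auto
    have "continuous_on {x - e..x} F"
      by (rule continuous_on_eq[of _ "\<lambda>y. s * y + c"]) (use l in \<open>auto intro!: continuous_intros\<close>)
    moreover have "continuous_on {x..x + e} F"
      by (rule continuous_on_eq[of _ "\<lambda>y. s' * y + c'"]) (use r in \<open>auto intro!: continuous_intros\<close>)
    ultimately have "continuous_on ({x - e..x} \<union> {x..x + e}) F"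
      by (intro continuous_on_closed_Un) auto
    moreover have "{x - e..x} \<union> {x..x + e} = {x - e..x + e}" using e(1) by auto
    ultimately have "continuous_on {x - e<..<x + e} F" by (auto intro: continuous_on_subset)
    then show ?thesis using e(1) by (simp add: continuous_on_eq_continuous_at)
  qed
  then show ?thesis by (simp add: continuous_on_eq_continuous_at)
qed

lemma derivative_le_lipschitz:
  fixes f :: "real \<Rightarrow> real"
  assumes d: "(f has_real_derivative D) (at x)" and x: "x \<in> {u<..<v}"
    and l: "\<And>y. y \<in> {u<..<v} \<Longrightarrow> \<bar>f y - f x\<bar> \<le> L * \<bar>y - x\<bar>"
  shows "\<bar>D\<bar> \<le> L"
proof -
  have "((\<lambda>y. (f y - f x) / (y - x)) \<longlongrightarrow> D) (at x)" using d by (simp add: has_field_derivative_iff)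
  then have "((\<lambda>y. \<bar>(f y - f x) / (y - x)\<bar>) \<longlongrightarrow> \<bar>D\<bar>) (at x)" by (rule tendsto_rabs)
  moreover have "\<forall>\<^sub>F y in at x. \<bar>(f y - f x) / (y - x)\<bar> \<le> L"
  proof -
    have "\<forall>\<^sub>F y in at x. y \<in> {u<..<v}" using x by (intro eventually_at_in_open') auto
    moreover have "\<forall>\<^sub>F y in at x. y \<noteq> x" by (simp add: eventually_at_filter)
    ultimately show ?thesis
    proof eventually_elim
      case (elim y)
      then show ?case using l[of y] by (simp add: abs_divide divide_le_eq)
    qed
  qed
  ultimately show ?thesis by (intro tendsto_upperbound) auto
qed

text \<open>\<open>Z\<close> is the part of U that is only bounded on an element and not
  approximated. The slope bound \<theta> / r over the diameter 2 r gives 2 \<theta>, whatever the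
  size of the element.\<close>

lemma elementwise_oscillation:
  assumes ch: "chain (-1) es 1" and E: "continuous_on {-1..1} U" "continuous_on UNIV F"
    and near: "elementwise_near es \<theta> (\<lambda>e x. U x - Z e x) F" and \<theta>: "0 \<le> \<theta>" and \<zeta>0: "0 \<le> \<zeta>"
    and Z: "\<And>c r x. (c, r) \<in> set es \<Longrightarrow> x \<in> {c - r<..<c + r} \<Longrightarrow> \<bar>Z (c, r) x\<bar> \<le> \<zeta>"
    and x: "x \<in> {-1..1}"
  shows "\<bar>(U x - F x) - (U (-1) - F (-1))\<bar> \<le> real (length es) * (2 * \<theta> + 2 * \<zeta>)"
proof (rule chain_oscillation[OF ch _ _ x])
  show "continuous_on {-1..1} (\<lambda>x. U x - F x)"
    by (intro continuous_intros E continuous_on_subset[OF E(2)]) auto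
  fix c r x y assume cr: "(c, r) \<in> set es" and xy: "x \<in> {c - r<..<c + r}" "y \<in> {c - r<..<c + r}"
  have r: "0 < r" by (rule chain_element(1)[OF ch cr])
  have "\<bar>(U x - Z (c, r) x - F x) - (U y - Z (c, r) y - F y)\<bar> \<le> \<theta> / r * \<bar>x - y\<bar>"
    using near cr xy unfolding elementwise_near_def by blast
  also have "\<dots> \<le> \<theta> / r * (2 * r)"
    using xy \<theta> r by (intro mult_left_mono) (auto simp: abs_le_iff)
  also have "\<dots> = 2 * \<theta>" using r by simp
  finally have "\<bar>(U x - Z (c, r) x - F x) - (U y - Z (c, r) y - F y)\<bar> \<le> 2 * \<theta>" .
  then show "\<bar>U x - F x - (U y - F y)\<bar> \<le> 2 * \<theta> + 2 * \<zeta>"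
    using Z[OF cr xy(1)] Z[OF cr xy(2)] by linarith
qed (use \<theta> \<zeta>0 in auto)

text \<open>The correction uses a function that the hidden layers already provide, the approximate
  linear monomial of one element. It rises by at least 2 - 2 D \<ge> 1 over the interval and has
  slope at most 2 / r, so cancelling F(1) - F(-1) costs at most twice its size.\<close>

lemma boundary_correction:
  assumes ch: "chain (-1) es 1" and near: "elementwise_near es \<theta> V F" and e0: "(c0, r0) \<in> set es"
    and small: "\<eta> m * 30 ^ (2 ^ l) \<le> 1 / 2"
  defines "g \<equiv> \<lambda>x. mono_approx m l 1 (lcoord c0 r0 x)"
  shows "\<exists>\<mu> k. let H = (\<lambda>x. F x + \<mu> * g x + k) in H (-1) = 0 \<and> H 1 = 0 \<and>
    elementwise_near es (\<theta> + 2 * \<bar>F 1 - F (-1)\<bar>) V H"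
proof -
  define D where "D = \<eta> m * 30 ^ (2 ^ l)"
  have D: "0 \<le> D" "D \<le> 1 / 2" using small \<eta>_pos[of m] by (auto simp: D_def)
  have nr: "near D (mono_approx m l 1) (\<lambda>t. t ^ 1)"
    unfolding D_def by (rule mono_approx_near) (use small in auto)
  have r0: "0 < r0" by (rule chain_element(1)[OF ch e0])
  have lip: "\<bar>mono_approx m l 1 s - mono_approx m l 1 t\<bar> \<le> 2 * \<bar>s - t\<bar>" if "s \<in> {-1..1}" "t \<in> {-1..1}" for s t
  proof -
    have "\<bar>(mono_approx m l 1 s - s) - (mono_approx m l 1 t - t)\<bar> \<le> D * \<bar>s - t\<bar>"
      using nr that unfolding near_def by simp
    also have "\<dots> \<le> 1 * \<bar>s - t\<bar>" using D by (intro mult_right_mono) auto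
    finally show ?thesis
      using abs_triangle_ineq[of "(mono_approx m l 1 s - s) - (mono_approx m l 1 t - t)" "s - t"] by simp
  qed
  have "lcoord c0 r0 (-1) = -1" "lcoord c0 r0 1 = 1"
    using chain_element(2,3)[OF ch e0] by (auto intro: lcoord_left[OF r0] lcoord_right[OF r0])
  then have g1: "g 1 = mono_approx m l 1 1" "g (-1) = mono_approx m l 1 (-1)" by (simp_all add: g_def)
  have nb: "\<bar>mono_approx m l 1 t - t ^ 1\<bar> \<le> D" if "t \<in> {-1..1}" for t
    using nr that unfolding near_def by blast
  have "\<bar>mono_approx m l 1 1 - 1\<bar> \<le> D" "\<bar>mono_approx m l 1 (-1) - (-1)\<bar> \<le> D"
    using nb[of 1] nb[of "-1"] by simp_all
  then have gg: "1 \<le> g 1 - g (-1)" using D unfolding g1 by linarith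
  define \<mu> where "\<mu> = - (F 1 - F (-1)) / (g 1 - g (-1))"
  have "\<bar>\<mu>\<bar> = \<bar>F 1 - F (-1)\<bar> / (g 1 - g (-1))" using gg by (simp add: \<mu>_def abs_divide)
  also have "\<dots> \<le> \<bar>F 1 - F (-1)\<bar> / 1" using gg by (intro divide_left_mono) auto
  finally have \<mu>: "\<bar>\<mu>\<bar> \<le> \<bar>F 1 - F (-1)\<bar>" by simp
  define k where "k = - F (-1) - \<mu> * g (-1)"
  define H where "H x = F x + \<mu> * g x + k" for x
  have "H (-1) = 0" by (simp add: H_def k_def)
  moreover have "H 1 = 0"
  proof -
    have "\<mu> * (g 1 - g (-1)) = - (F 1 - F (-1))" using gg by (simp add: \<mu>_def)
    then show ?thesis by (simp add: H_def k_def algebra_simps)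
  qed
  moreover have "elementwise_near es (\<theta> + 2 * \<bar>F 1 - F (-1)\<bar>) V H"
    unfolding elementwise_near_def
  proof (intro allI impI ballI)
    fix c r x y assume cr: "(c, r) \<in> set es" and xy: "x \<in> {c - r<..<c + r}" "y \<in> {c - r<..<c + r}"
    have r: "0 < r" by (rule chain_element(1)[OF ch cr])
    have "\<bar>g x - g y\<bar> \<le> 2 / r * \<bar>x - y\<bar>"
    proof (cases "(c, r) = (c0, r0)")
      case True
      have in1: "(x - c) / r \<in> {-1..1}" "(y - c) / r \<in> {-1..1}" using xy r by (auto simp: field_simps)
      have gx: "g x = mono_approx m l 1 ((x - c) / r)" "g y = mono_approx m l 1 ((y - c) / r)"
        using True xy lcoord_inside[OF r0, of x c0] lcoord_inside[OF r0, of y c0] by (auto simp: g_def)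
      have "\<bar>g x - g y\<bar> \<le> 2 * \<bar>(x - c) / r - (y - c) / r\<bar>" unfolding gx by (rule lip[OF in1])
      also have "\<bar>(x - c) / r - (y - c) / r\<bar> = \<bar>x - y\<bar> / r" using r by (simp add: diff_divide_distrib[symmetric])
      finally show ?thesis by simp
    next
      case False
      from chain_separated[OF ch cr e0 False]
      have "lcoord c0 r0 x = lcoord c0 r0 y"
      proof
        assume "c + r \<le> c0 - r0"
        then show ?thesis using xy by (simp add: lcoord_left[OF r0])
      next
        assume "c0 + r0 \<le> c - r"
        then show ?thesis using xy by (simp add: lcoord_right[OF r0])
      qed
      then have "g x = g y" by (simp add: g_def)
      then show ?thesis using r by simp
    qed
    then have "\<bar>\<mu>\<bar> * \<bar>g x - g y\<bar> \<le> \<bar>F 1 - F (-1)\<bar> * (2 / r * \<bar>x - y\<bar>)"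
      using \<mu> by (intro mult_mono) auto
    then have 1: "\<bar>\<mu> * g x - \<mu> * g y\<bar> \<le> 2 * \<bar>F 1 - F (-1)\<bar> / r * \<bar>x - y\<bar>"
      by (simp add: right_diff_distrib[symmetric] abs_mult mult_ac)
    have 2: "\<bar>(V (c, r) x - F x) - (V (c, r) y - F y)\<bar> \<le> \<theta> / r * \<bar>x - y\<bar>"
      using near cr xy unfolding elementwise_near_def by blast
    have "\<bar>(V (c, r) x - H x) - (V (c, r) y - H y)\<bar> \<le> \<theta> / r * \<bar>x - y\<bar> + 2 * \<bar>F 1 - F (-1)\<bar> / r * \<bar>x - y\<bar>"
      using 1 2 unfolding H_def abs_le_iff by linarith
    also have "\<dots> = (\<theta> + 2 * \<bar>F 1 - F (-1)\<bar>) / r * \<bar>x - y\<bar>"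
      by (simp only: distrib_right add_divide_distrib)
    finally show "\<bar>(V (c, r) x - H x) - (V (c, r) y - H y)\<bar> \<le> (\<theta> + 2 * \<bar>F 1 - F (-1)\<bar>) / r * \<bar>x - y\<bar>" .
  qed
  ultimately show ?thesis unfolding H_def[abs_def] Let_def by blast
qed

lemma AE_lebesgue_on_finite:
  assumes "finite S"
  shows "AE x in lebesgue_on {l<..<r::real}. x \<notin> S"
proof -
  have "S \<in> null_sets lebesgue"
    using assms by (intro null_sets_completionI finite_imp_null_set_lborel)
  then have "AE x in lebesgue. x \<notin> S" by (rule AE_not_in)
  then show ?thesis by (subst AE_restrict_space_iff) (auto elim: eventually_mono)
qed

lemma L2_norm_le_AE:
  assumes "AE x in lebesgue_on I. (h x)\<^sup>2 \<le> H x" "integrable (lebesgue_on I) H" "(LINT x|lebesgue_on I. H x) \<le> B\<^sup>2" "0 \<le> B"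
  shows "L2_norm I h \<le> B"
proof -
  have H0: "0 \<le> (LINT x|lebesgue_on I. H x)"
    by (rule integral_nonneg_AE) (use assms(1) in eventually_elim, meson order_trans zero_le_power2)
  have "(LINT x|lebesgue_on I. (h x)\<^sup>2) \<le> (LINT x|lebesgue_on I. H x)"
  proof (cases "integrable (lebesgue_on I) (\<lambda>x. (h x)\<^sup>2)")
    case True
    then show ?thesis by (rule integral_mono_AE[OF _ assms(2,1)])
  next
    \<comment> \<open>The integral of a function that is not integrable is 0 by convention.\<close>
    case False
    then show ?thesis using H0 by (simp add: not_integrable_integral_eq)
  qed
  then have "(LINT x|lebesgue_on I. (h x)\<^sup>2) \<le> B\<^sup>2" using assms(3) by linarith
  then show ?thesis unfolding L2_norm_def using assms(4) by (intro real_le_lsqrt) auto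
qed

lemma indicator_lebesgue_on:
  assumes "a \<le> b" "-1 \<le> a" "b \<le> 1"
  shows "integrable (lebesgue_on J) (indicator {a<..<b} :: real \<Rightarrow> real)"
    "(LINT x|lebesgue_on J. indicator {a<..<b} x) = b - a"
proof -
  have eq: "(\<lambda>x. indicator J x * indicator {a<..<b} x :: real) = indicator {a<..<b}"
    using assms by (auto simp: indicator_def fun_eq_iff)
  have "integrable lebesgue (indicator {a<..<b} :: real \<Rightarrow> real)"
    by (rule integrable_real_indicator) (use assms(1) in auto)
  then show "integrable (lebesgue_on J) (indicator {a<..<b} :: real \<Rightarrow> real)"
    by (simp add: integrable_lebesgue_on_iff eq)
  show "(LINT x|lebesgue_on J. indicator {a<..<b} x) = b - a"
  proof -
    have "(LINT x|lebesgue_on J. indicator {a<..<b} x :: real) = (LINT x|lebesgue. indicator J x * indicator {a<..<b} x)"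
      by (rule integral_lebesgue_on_eq) simp
    also have "\<dots> = b - a" unfolding eq using assms(1) by simp
    finally show ?thesis .
  qed
qed

text \<open>On an element the slope of the error is at most G + \<theta> / r. Its square is at most
  2 G^2 + 2 (\<theta> / r)^2, and the second term integrates to 4 \<theta>^2 / r. The function
  \<open>wu\<close> stands for any representative of the derivative of the solution.\<close>

theorem energy_error:
  assumes ch: "chain (-1) es 1" and r\<rho>: "\<And>c r. (c, r) \<in> set es \<Longrightarrow> \<rho> \<le> r" "0 < \<rho>"
    and F: "pw_affine F"
    and U: "\<And>x. x \<in> J \<Longrightarrow> (U has_real_derivative U' x) (at x)" "continuous_on J U'" "\<And>x. x \<in> J \<Longrightarrow> \<bar>U' x\<bar> \<le> B"
    and near: "elementwise_near es \<theta> (\<lambda>e x. U x - Z e x) F" and \<theta>: "0 \<le> \<theta>"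
    and Z: "\<And>c r x. (c, r) \<in> set es \<Longrightarrow> x \<in> {c - r<..<c + r} \<Longrightarrow> (Z (c, r) has_real_derivative Z' (c, r) x) (at x)"
      "\<And>c r x. (c, r) \<in> set es \<Longrightarrow> x \<in> {c - r<..<c + r} \<Longrightarrow> \<bar>Z' (c, r) x\<bar> \<le> G x"
    and G: "integrable (lebesgue_on J) (\<lambda>x. (G x)\<^sup>2)"
  shows "F \<in> H1_space J"
    and "AE x in lebesgue_on J. wu x = U' x \<Longrightarrow> L2_norm J (\<lambda>x. wu x - weak_deriv J F x)
      \<le> sqrt (2 * (LINT x|lebesgue_on J. (G x)\<^sup>2) + 4 * real (length es) * \<theta>\<^sup>2 / \<rho>)"
proof -
  let ?L = "lebesgue_on J"
  have Fc: "continuous_on UNIV F" by (rule pw_affine_continuous[OF F])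
  obtain S where S: "finite S" "\<And>x. x \<notin> S \<Longrightarrow> (F has_real_derivative deriv F x) (at x)"
    using pw_affine_derivative[OF F] by blast
  define H where "H x = 2 * (G x)\<^sup>2 + (\<Sum>(c, r)\<in>set es. 2 * (\<theta> / r)\<^sup>2 * indicator {c - r<..<c + r} x)" for x
  have el: "0 < r" "-1 \<le> c - r" "c + r \<le> 1" if "(c, r) \<in> set es" for c r
    using chain_element[OF ch that] by auto
  have intH: "integrable ?L (\<lambda>x. \<Sum>(c, r)\<in>set es. 2 * (\<theta> / r)\<^sup>2 * indicator {c - r<..<c + r} x)"
  proof (rule Bochner_Integration.integrable_sum)
    fix e assume "e \<in> set es"
    moreover obtain c r where "e = (c, r)" by (cases e)
    ultimately show "integrable ?L (\<lambda>x. case e of (c, r) \<Rightarrow> 2 * (\<theta> / r)\<^sup>2 * indicator {c - r<..<c + r} x)"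
      using el[of c r] indicator_lebesgue_on(1)[of "c - r" "c + r"] by simp
  qed
  have Hint: "integrable ?L H"
    unfolding H_def[abs_def] using G intH by auto
  have "(LINT x|?L. H x) = 2 * (LINT x|?L. (G x)\<^sup>2) + (LINT x|?L. (\<Sum>(c, r)\<in>set es. 2 * (\<theta> / r)\<^sup>2 * indicator {c - r<..<c + r} x))"
    unfolding H_def using G intH by (subst Bochner_Integration.integral_add) auto
  also have "(LINT x|?L. (\<Sum>(c, r)\<in>set es. 2 * (\<theta> / r)\<^sup>2 * indicator {c - r<..<c + r} x)) =
      (\<Sum>e\<in>set es. LINT x|?L. (case e of (c, r) \<Rightarrow> 2 * (\<theta> / r)\<^sup>2 * indicator {c - r<..<c + r} x))"
  proof (rule Bochner_Integration.integral_sum)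
    fix e assume "e \<in> set es"
    moreover obtain c r where "e = (c, r)" by (cases e)
    ultimately show "integrable ?L (\<lambda>x. case e of (c, r) \<Rightarrow> 2 * (\<theta> / r)\<^sup>2 * indicator {c - r<..<c + r} x)"
      using el[of c r] indicator_lebesgue_on(1)[of "c - r" "c + r"] by simp
  qed
  also have "\<dots> \<le> (\<Sum>e\<in>set es. 4 * \<theta>\<^sup>2 / \<rho>)"
  proof (rule sum_mono)
    fix e assume e: "e \<in> set es"
    obtain c r where cr: "e = (c, r)" by (cases e)
    then have r: "0 < r" "\<rho> \<le> r" "-1 \<le> c - r" "c + r \<le> 1" using e el r\<rho> by auto
    have "(LINT x|?L. (case e of (c, r) \<Rightarrow> 2 * (\<theta> / r)\<^sup>2 * indicator {c - r<..<c + r} x)) = 2 * (\<theta> / r)\<^sup>2 * (c + r - (c - r))"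
      using indicator_lebesgue_on(2)[of "c - r" "c + r"] r by (simp add: cr)
    also have "\<dots> = 4 * \<theta>\<^sup>2 / r" using r(1) by (simp add: power2_eq_square)
    also have "\<dots> \<le> 4 * \<theta>\<^sup>2 / \<rho>" using r r\<rho>(2) by (intro divide_left_mono) auto
    finally show "(LINT x|?L. (case e of (c, r) \<Rightarrow> 2 * (\<theta> / r)\<^sup>2 * indicator {c - r<..<c + r} x)) \<le> 4 * \<theta>\<^sup>2 / \<rho>" .
  qed
  also have "\<dots> = real (card (set es)) * (4 * \<theta>\<^sup>2 / \<rho>)" by simp
  also have "\<dots> \<le> real (length es) * (4 * \<theta>\<^sup>2 / \<rho>)"
    using r\<rho>(2) card_length[of es] by (intro mult_right_mono) auto
  finally have Hle: "(LINT x|?L. H x) \<le> 2 * (LINT x|?L. (G x)\<^sup>2) + 4 * real (length es) * \<theta>\<^sup>2 / \<rho>" by (simp add: mult_ac)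
  have H0: "0 \<le> H x" for x
    unfolding H_def by (intro add_nonneg_nonneg sum_nonneg) auto
  have pt: "(U' x - deriv F x)\<^sup>2 \<le> H x" if x: "x \<in> J" "x \<notin> S" "x \<notin> (\<lambda>(c, r). c - r) ` set es" "x \<notin> (\<lambda>(c, r). c + r) ` set es" for x
  proof -
    obtain c r where cr: "(c, r) \<in> set es" "x \<in> {c - r..c + r}" using chain_cover[OF ch x(1)] by blast
    have "x \<noteq> c - r" "x \<noteq> c + r" using x(3,4) cr(1) by (metis case_prod_conv image_eqI)+
    then have xi: "x \<in> {c - r<..<c + r}" using cr(2) by auto
    have r: "0 < r" using el[OF cr(1)] by simp
    have "\<bar>U' x - Z' (c, r) x - deriv F x\<bar> \<le> \<theta> / r"
    proof (rule derivative_le_lipschitz[OF _ xi, where f = "\<lambda>x. U x - Z (c, r) x - F x"])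
      show "((\<lambda>x. U x - Z (c, r) x - F x) has_real_derivative U' x - Z' (c, r) x - deriv F x) (at x)"
        by (intro DERIV_diff U(1) Z(1)[OF cr(1) xi] S(2) x)
      fix y assume "y \<in> {c - r<..<c + r}"
      then show "\<bar>U y - Z (c, r) y - F y - (U x - Z (c, r) x - F x)\<bar> \<le> \<theta> / r * \<bar>y - x\<bar>"
        using near cr(1) xi unfolding elementwise_near_def by blast
    qed
    then have "\<bar>U' x - deriv F x\<bar> \<le> G x + \<theta> / r" using Z(2)[OF cr(1) xi] by linarith
    then have "(U' x - deriv F x)\<^sup>2 \<le> (G x + \<theta> / r)\<^sup>2"
      using abs_le_square_iff[of "U' x - deriv F x" "G x + \<theta> / r"] by linarith
    also have "\<dots> \<le> 2 * (G x)\<^sup>2 + 2 * (\<theta> / r)\<^sup>2"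
      using zero_le_power2[of "G x - \<theta> / r"] by (simp add: power2_sum power2_diff)
    also have "2 * (\<theta> / r)\<^sup>2 \<le> (\<Sum>(c, r)\<in>set es. 2 * (\<theta> / r)\<^sup>2 * indicator {c - r<..<c + r} x)"
      using member_le_sum[OF cr(1), of "\<lambda>(c, r). 2 * (\<theta> / r)\<^sup>2 * indicator {c - r<..<c + r} x"] xi by auto
    finally show ?thesis by (simp add: H_def)
  qed
  have ae: "AE x in ?L. (U' x - deriv F x)\<^sup>2 \<le> H x"
  proof -
    have "AE x in ?L. x \<notin> S \<union> (\<lambda>(c, r). c - r) ` set es \<union> (\<lambda>(c, r). c + r) ` set es"
      by (rule AE_lebesgue_on_finite) (use S(1) in auto)
    moreover have "AE x in ?L. x \<in> J" using AE_space[of ?L] by simp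
    ultimately show ?thesis by eventually_elim (rule pt, auto)
  qed
  have bnd: "finite_measure ?L" by (rule finite_measure_lebesgue_on) simp
  \<comment> \<open>The integral is computed only to obtain measurability of
    \<open>deriv F\<close>.\<close>
  have "(deriv F has_integral (F 1 - F (-1))) {-1..1}"
    by (rule fundamental_theorem_of_calculus_interior_strong[OF S(1)])
      (use S(2) continuous_on_subset[OF Fc] in \<open>auto simp: has_real_derivative_iff_has_vector_derivative\<close>)
  then have "deriv F \<in> borel_measurable (lebesgue_on {-1..1})"
    by (intro integrable_imp_measurable has_integral_integrable)
  then have dm: "deriv F \<in> borel_measurable ?L" by (rule measurable_restrict_mono) auto
  have dL: "deriv F \<in> L2_space J"
  proof -
    have "integrable ?L (\<lambda>x. (deriv F x)\<^sup>2)"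
    proof (rule Bochner_Integration.integrable_bound[of _ "\<lambda>x. 2 * H x + 2 * B\<^sup>2"])
      show "integrable ?L (\<lambda>x. 2 * H x + 2 * B\<^sup>2)"
        using Hint finite_measure.integrable_const[OF bnd, of "2 * B\<^sup>2"] by auto
      show "(\<lambda>x. (deriv F x)\<^sup>2) \<in> borel_measurable ?L" using dm by (rule borel_measurable_power)
      have "AE x in ?L. x \<in> J" using AE_space[of ?L] by simp
      with ae show "AE x in ?L. norm ((deriv F x)\<^sup>2) \<le> norm (2 * H x + 2 * B\<^sup>2)"
      proof eventually_elim
        case (elim x)
        have "(deriv F x)\<^sup>2 \<le> 2 * (U' x - deriv F x)\<^sup>2 + 2 * (U' x)\<^sup>2"
          using zero_le_power2[of "2 * U' x - deriv F x"] by (simp add: power2_diff power_mult_distrib)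
        moreover have "(U' x)\<^sup>2 \<le> B\<^sup>2" using U(3)[OF elim(2)] by (simp add: abs_le_square_iff[symmetric])
        ultimately have "(deriv F x)\<^sup>2 \<le> 2 * H x + 2 * B\<^sup>2" using elim(1) by linarith
        then show ?case by simp
      qed
    qed
    then show ?thesis using dm by (simp add: L2_space_def)
  qed
  have wd: "has_weak_deriv J F (deriv F)"
    by (rule has_weak_deriv_piecewise[OF continuous_on_subset[OF Fc] S(1)])
      (use S(2) locally_integrable_on_integrable[OF L2_space_integrable[OF dL]] in auto)
  have "bounded (F ` {-1..1})"
    by (intro compact_imp_bounded compact_continuous_image continuous_on_subset[OF Fc]) auto
  then obtain BF where "\<forall>x\<in>{-1..1}. \<bar>F x\<bar> \<le> BF" by (auto simp: bounded_iff)
  then have FL: "F \<in> L2_space J"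
    by (intro L2_space_bounded[of _ _ _ BF] continuous_borel_measurable_lebesgue_on Fc) auto
  show "F \<in> H1_space J" using FL dL wd by (auto simp: H1_space_def)
  assume wu: "AE x in ?L. wu x = U' x"
  have wF: "AE x in ?L. weak_deriv J F x = deriv F x"
    by (rule has_weak_deriv_weak_deriv(2)[OF wd]) simp
  show "L2_norm J (\<lambda>x. wu x - weak_deriv J F x) \<le> sqrt (2 * (LINT x|?L. (G x)\<^sup>2) + 4 * real (length es) * \<theta>\<^sup>2 / \<rho>)"
  proof (rule L2_norm_le_AE[OF _ Hint])
    show "AE x in ?L. (wu x - weak_deriv J F x)\<^sup>2 \<le> H x"
      using wu wF ae by eventually_elim simp
    have "0 \<le> (LINT x|?L. H x)" by (rule Bochner_Integration.integral_nonneg) (rule H0)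
    then show "(LINT x|?L. H x) \<le> (sqrt (2 * (LINT x|?L. (G x)\<^sup>2) + 4 * real (length es) * \<theta>\<^sup>2 / \<rho>))\<^sup>2"
      using Hle by simp
    show "0 \<le> sqrt (2 * (LINT x|?L. (G x)\<^sup>2) + 4 * real (length es) * \<theta>\<^sup>2 / \<rho>)"
      using Hle \<open>0 \<le> (LINT x|?L. H x)\<close> by simp
  qed
qed

section \<open>The mesh and the approximation of the solution\<close>

text \<open>Elements are pairs of midpoint and radius. For \<open>q p \<epsilon> \<le> 1\<close> this is the spectral boundary layer mesh with two layer elements of width \<open>p \<epsilon>\<close>,
  whose middle element is subdivided so that Taylor polynomials suffice there.\<close>

definition middle_mesh :: "nat \<Rightarrow> nat \<Rightarrow> real \<Rightarrow> (real \<times> real) list" where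
  "middle_mesh q p \<epsilon> = uniform_mesh (-1 + real p * \<epsilon>) ((1 - real p * \<epsilon>) / real q) q"

definition mesh :: "nat \<Rightarrow> nat \<Rightarrow> real \<Rightarrow> (real \<times> real) list" where
  "mesh q p \<epsilon> = (if real q * (real p * \<epsilon>) \<le> 1
     then (-1 + real p * \<epsilon> / 2, real p * \<epsilon> / 2) # middle_mesh q p \<epsilon> @ [(1 - real p * \<epsilon> / 2, real p * \<epsilon> / 2)]
     else uniform_mesh (-1) (1 / real q) q)"

text \<open>The degree is a power of two, since each round of squaring doubles it; the least
  admissible one stays below 4 q p and keeps the size quadratic in p.\<close>

definition level :: "nat \<Rightarrow> nat \<Rightarrow> nat" where
  "level q p = (LEAST l. 2 * q * p \<le> 2 ^ l)"

lemma level_bounds: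
  assumes "1 \<le> q" "1 \<le> p"
  shows "2 * q * p \<le> 2 ^ level q p" "2 ^ level q p \<le> 4 * q * p"
proof -
  have "2 * q * p \<le> 2 ^ (2 * q * p)" using less_exp[of "2 * q * p"] by simp
  then show 1: "2 * q * p \<le> 2 ^ level q p" unfolding level_def by (rule LeastI)
  have "1 * 1 \<le> q * p" by (rule mult_le_mono[OF assms])
  then have two: "2 \<le> 2 * q * p" by simp
  have "level q p \<noteq> 0"
  proof
    assume "level q p = 0"
    then have "2 * q * p \<le> 1" using 1 by (metis power_0)
    then show False using two by linarith
  qed
  then obtain l where l: "level q p = Suc l" by (cases "level q p") auto
  have "\<not> 2 * q * p \<le> 2 ^ l"
    using not_less_Least[of l "\<lambda>l. 2 * q * p \<le> 2 ^ l"] l unfolding level_def by simp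
  then have "2 * 2 ^ l \<le> 2 * (2 * q * p)" by (intro mult_le_mono2) simp
  then show "2 ^ level q p \<le> 4 * q * p" unfolding l power_Suc by simp
qed

lemma middle_mesh_chain:
  assumes "1 \<le> q" "real p * \<epsilon> < 1"
  shows "chain (-1 + real p * \<epsilon>) (middle_mesh q p \<epsilon>) (1 - real p * \<epsilon>)"
proof -
  have "0 < (1 - real p * \<epsilon>) / real q" using assms by simp
  note c = chain_uniform_mesh[OF this, of "-1 + real p * \<epsilon>" q]
  have e1: "2 * real q * ((1 - real p * \<epsilon>) / real q) = 2 * (1 - real p * \<epsilon>)"
    using assms(1) by simp
  have e2: "-1 + real p * \<epsilon> + 2 * (1 - real p * \<epsilon>) = 1 - real p * \<epsilon>" by simp
  from c show ?thesis unfolding middle_mesh_def e1 e2 .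
qed

lemma mesh_layer_small:
  assumes "2 \<le> q" "real q * (real p * \<epsilon>) \<le> 1" "0 < \<epsilon>"
  shows "real p * \<epsilon> \<le> 1 / real q" "real p * \<epsilon> \<le> 1 / 2"
proof -
  show 1: "real p * \<epsilon> \<le> 1 / real q" using assms by (simp add: field_simps)
  have "1 / real q \<le> 1 / 2" using assms(1) by (intro divide_left_mono) auto
  then show "real p * \<epsilon> \<le> 1 / 2" using 1 by linarith
qed

lemma mesh_chain:
  assumes "2 \<le> q" "1 \<le> p" "0 < \<epsilon>"
  shows "chain (-1) (mesh q p \<epsilon>) 1"
proof (cases "real q * (real p * \<epsilon>) \<le> 1")
  case True
  define t where "t = real p * \<epsilon>"
  have t: "0 < t" "t \<le> 1 / 2" using assms mesh_layer_small[OF assms(1) True assms(3)] by (auto simp: t_def)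
  have "chain (-1 + t) (middle_mesh q p \<epsilon>) (1 - t)"
    using middle_mesh_chain[of q p \<epsilon>] assms t by (simp add: t_def)
  moreover have "chain (1 - t) [(1 - t / 2, t / 2)] 1" using t by simp
  ultimately have "chain (-1 + t) (middle_mesh q p \<epsilon> @ [(1 - t / 2, t / 2)]) 1" by (rule chain_append)
  then have "chain (-1) ((-1 + t / 2, t / 2) # middle_mesh q p \<epsilon> @ [(1 - t / 2, t / 2)]) 1" using t by simp
  then show ?thesis using True by (simp add: mesh_def t_def)
next
  case False
  then show ?thesis
    using chain_uniform_mesh[of "1 / real q" "-1" q] assms(1) by (simp add: mesh_def)
qed

lemma mesh_length: "length (mesh q p \<epsilon>) \<le> q + 2"
  by (simp add: mesh_def middle_mesh_def uniform_mesh_def)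

lemma mesh_nonempty: "1 \<le> q \<Longrightarrow> mesh q p \<epsilon> \<noteq> []"
  by (simp add: mesh_def uniform_mesh_def)

lemma middle_mesh_radius: "(c, r) \<in> set (middle_mesh q p \<epsilon>) \<Longrightarrow> r = (1 - real p * \<epsilon>) / real q"
  by (auto simp: middle_mesh_def uniform_mesh_def)

lemma mesh_cases:
  assumes "(c, r) \<in> set (mesh q p \<epsilon>)"
  obtains "real q * (real p * \<epsilon>) \<le> 1" "(c, r) \<in> set (middle_mesh q p \<epsilon>)" "r = (1 - real p * \<epsilon>) / real q"
  | "real q * (real p * \<epsilon>) \<le> 1" "(c, r) \<notin> set (middle_mesh q p \<epsilon>)" "r = real p * \<epsilon> / 2"
  | "1 < real q * (real p * \<epsilon>)" "r = 1 / real q"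
proof (cases "real q * (real p * \<epsilon>) \<le> 1")
  case True
  show ?thesis
  proof (cases "(c, r) \<in> set (middle_mesh q p \<epsilon>)")
    case mid: True
    show ?thesis by (rule that(1)[OF True mid middle_mesh_radius[OF mid]])
  next
    case False
    then show ?thesis using that(2)[OF True False] assms True by (auto simp: mesh_def)
  qed
next
  case False
  then show ?thesis using that(3) assms by (auto simp: mesh_def uniform_mesh_def)
qed

text \<open>The upper bound is the scale of analyticity of the data; the lower one keeps \<epsilon>
  \<theta>^2 / r bounded in the energy norm.\<close>

lemma mesh_radius:
  assumes "2 \<le> q" "1 \<le> p" "0 < \<epsilon>" "\<epsilon> \<le> 1" "(c, r) \<in> set (mesh q p \<epsilon>)"
  shows "r \<le> 1 / real q" "\<epsilon> / (2 * real q) \<le> r"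
proof -
  have q: "0 < real q" "1 \<le> real q" using assms(1) by auto
  have p: "1 \<le> real p" using assms(2) by simp
  have e1: "\<epsilon> / (2 * real q) \<le> 1 / (2 * real q)" using assms(4) q by (intro divide_right_mono) auto
  have "r \<le> 1 / real q \<and> \<epsilon> / (2 * real q) \<le> r"
    using assms(5)
  proof (cases rule: mesh_cases)
    case 1
    have t: "0 < real p * \<epsilon>" "real p * \<epsilon> \<le> 1 / 2" using mesh_layer_small[OF assms(1) 1(1) assms(3)] assms p by auto
    have "(1 / 2) / real q \<le> r" unfolding 1(3) using t q by (intro divide_right_mono) auto
    moreover have "r \<le> 1 / real q" unfolding 1(3) using t q by (intro divide_right_mono) auto
    moreover have "(1 / 2) / real q = 1 / (2 * real q)" by simp
    ultimately show ?thesis using e1 by (intro conjI) linarith+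
  next
    case 2
    have t: "0 < real p * \<epsilon>" "real p * \<epsilon> \<le> 1 / real q" using mesh_layer_small[OF assms(1) 2(1) assms(3)] assms p by auto
    have "\<epsilon> / (2 * real q) \<le> \<epsilon> / 2" using q assms(3) by (intro divide_left_mono) auto
    also have "\<dots> \<le> r" unfolding 2(3) using p assms(3) by simp
    finally show ?thesis using t 2(3) by linarith
  next
    case 3
    have "1 / (2 * real q) \<le> 1 / real q" using q by (intro divide_left_mono) auto
    then show ?thesis using e1 3(2) by linarith
  qed
  then show "r \<le> 1 / real q" "\<epsilon> / (2 * real q) \<le> r" by simp_all
qed

text \<open>A single term of the exponential series.\<close>

lemma power_le_fact_exp:
  fixes x :: real
  assumes "0 \<le> x"
  shows "x ^ k \<le> fact k * exp x"
proof -
  have "(\<Sum>n\<in>{k}. x ^ n /\<^sub>R fact n) \<le> (\<Sum>n. x ^ n /\<^sub>R fact n)"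
    by (rule sum_le_suminf[OF summable_exp_generic]) (use assms in auto)
  then have "x ^ k / fact k \<le> exp x" by (simp add: exp_def divide_inverse mult.commute)
  then show ?thesis by (simp add: field_simps)
qed

lemma two_le_exp_1: "(2::real) \<le> exp 1"
  using exp_ge_add_one_self[of 1] by simp

text \<open>With 9 N sawtooth steps per square, 30 / 2^9 = 30 / 512 is below 1 / 16, so the growth
  30^N of \<open>mono_approx_near\<close> is beaten with a margin 16^N to spare.\<close>

lemma square_accuracy:
  assumes "2 \<le> N"
  shows "\<eta> (9 * N) * 30 ^ N \<le> 16 * exp (- real N)" "\<eta> (9 * N) * 30 ^ N \<le> 1 / 2"
proof -
  have "\<eta> (9 * N) * 30 ^ N = 16 * (((1 / 2) ^ 9) ^ N * 30 ^ N)"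
    by (simp only: \<eta>_def power_mult mult.assoc)
  also have "\<dots> = 16 * ((1 / 2) ^ 9 * 30) ^ N" by (simp only: power_mult_distrib)
  also have "\<dots> \<le> 16 * (1 / 16) ^ N" by (intro mult_left_mono power_mono) (auto simp: power_divide)
  finally have 1: "\<eta> (9 * N) * 30 ^ N \<le> 16 * (1 / 16) ^ N" .
  have "(1 / 16 :: real) ^ N \<le> exp (-1) ^ N"
    using exp_le by (intro power_mono) (auto simp: exp_minus field_simps)
  also have "exp (-1 :: real) ^ N = exp (- real N)" by (simp add: exp_of_nat_mult[symmetric])
  finally show "\<eta> (9 * N) * 30 ^ N \<le> 16 * exp (- real N)" using 1 by linarith
  have "(1 / 16 :: real) ^ N \<le> (1 / 16) ^ 2" using assms by (intro power_decreasing) auto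
  then show "\<eta> (9 * N) * 30 ^ N \<le> 1 / 2" using 1 by (simp add: power2_eq_square)
qed

section \<open>Derivative bounds on the elements of the mesh\<close>

context classical_solution begin

text \<open>With X = K (k + 1 / \<epsilon>) r the assumptions give exp(3) X \<le> k + q p, hence X^k
  = exp(-3 k) (exp(3) X)^k \<le> exp(-3 k) k! exp(k + q p). This is the decay exp(-2 k) that
  \<open>taylor_element\<close> requires, at the price exp(q p), which the degree N \<ge> 2 q p
  repays.\<close>

lemma U_element_bound:
  assumes q: "exp 3 * K \<le> q" and r: "0 < r" "q * r \<le> 1" "r \<le> real p * \<epsilon>" and x: "x \<in> J"
  shows "\<bar>(deriv ^^ k) U x\<bar> * r ^ k \<le> A * exp (q * real p) * exp (- 2 * real k) * fact k"
proof -
  have K0: "0 < K" using K(1) by simp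
  have "0 < exp 3 * K" using K0 by simp
  then have q0: "0 \<le> q" using q by linarith
  define X where "X = K * (real k + 1 / \<epsilon>) * r"
  have X0: "0 \<le> X" using K0 eps r by (simp add: X_def)
  have "\<bar>(deriv ^^ k) U x\<bar> * r ^ k \<le> A * K ^ k * (real k + 1 / \<epsilon>) ^ k * r ^ k"
    using r by (intro mult_right_mono deriv_n_U_bound x) auto
  also have "\<dots> = A * X ^ k" by (simp add: X_def power_mult_distrib mult.assoc)
  also have "\<dots> \<le> A * (exp (q * real p) * exp (- 2 * real k) * fact k)"
  proof (rule mult_left_mono)
    have "exp 3 * X = (exp 3 * K) * (real k * r) + (exp 3 * K) * (r / \<epsilon>)"
      by (simp add: X_def field_simps)
    also have "\<dots> \<le> q * (real k * r) + q * real p"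
    proof (rule add_mono)
      show "exp 3 * K * (real k * r) \<le> q * (real k * r)" by (rule mult_right_mono[OF q]) (use r in simp)
      have "r / \<epsilon> \<le> real p" using r(3) eps by (simp add: field_simps)
      then show "exp 3 * K * (r / \<epsilon>) \<le> q * real p"
        by (rule mult_mono[OF q]) (use q0 r eps in auto)
    qed
    also have "q * (real k * r) = real k * (q * r)" by simp
    also have "\<dots> \<le> real k * 1" using r(2) by (intro mult_left_mono) auto
    finally have sX: "exp 3 * X \<le> real k + q * real p" by simp
    have "(exp 3 * X) ^ k \<le> fact k * exp (exp 3 * X)" by (rule power_le_fact_exp) (use X0 in simp)
    also have "\<dots> \<le> fact k * exp (real k + q * real p)" using sX by (intro mult_left_mono) auto
    finally have "exp (3 * real k) * X ^ k \<le> fact k * exp (real k + q * real p)"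
      by (simp add: power_mult_distrib exp_of_nat_mult[symmetric] mult.commute)
    then have "exp (- 3 * real k) * (exp (3 * real k) * X ^ k) \<le> exp (- 3 * real k) * (fact k * exp (real k + q * real p))"
      by (rule mult_left_mono) simp
    moreover have "exp (- 3 * real k) * (exp (3 * real k) * X ^ k) = X ^ k"
      by (simp add: exp_minus)
    moreover have "exp (- 3 * real k) * (fact k * exp (real k + q * real p)) = exp (q * real p + - 2 * real k) * fact k"
    proof -
      have "- 3 * real k + (real k + q * real p) = q * real p + - 2 * real k" by simp
      then have "exp (- 3 * real k) * exp (real k + q * real p) = exp (q * real p + - 2 * real k)"
        by (simp only: exp_add[symmetric])
      then show ?thesis by (simp only: mult.left_commute[of _ "fact k"]) (simp only: mult.commute)
    qed
    ultimately have "X ^ k \<le> exp (q * real p + - 2 * real k) * fact k" by (simp only:)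
    then show "X ^ k \<le> exp (q * real p) * exp (- 2 * real k) * fact k" by (simp only: exp_add)
  qed (use A in simp)
  finally show ?thesis by (simp add: mult.assoc)
qed

text \<open>The outer expansion is analytic at the rate 2 K independently of \<epsilon>, hence no
  factor exp(q p) and no comparison of r with p \<epsilon>.\<close>

lemma outer_element_bound:
  assumes q: "exp 3 * K \<le> q" and r: "0 < r" "q * r \<le> 1" and x: "x \<in> J"
    and small: "128 * \<Gamma> * (\<epsilon> * real p)\<^sup>2 \<le> 1"
  shows "\<bar>(deriv ^^ k) (outer_sum \<epsilon> p) x\<bar> * r ^ k \<le> 2 * A0 * exp (- 2 * real k) * fact k"
proof -
  have K0: "0 < K" using K(1) by simp
  have "\<bar>(deriv ^^ k) (outer_sum \<epsilon> p) x\<bar> * r ^ k \<le> (2 * A0 * (2 * K) ^ k * fact (k + 0)) * r ^ k"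
    using r eps by (intro mult_right_mono deriv_boundD(2)[OF deriv_bound_outer_sum[OF _ small] x]) auto
  also have "\<dots> = 2 * A0 * fact k * (2 * K * r) ^ k" by (simp add: power_mult_distrib)
  also have "\<dots> \<le> 2 * A0 * fact k * exp (- 2) ^ k"
  proof (intro mult_left_mono power_mono)
    have "exp 2 * 2 * (K * r) \<le> exp 2 * exp 1 * (K * r)"
      using two_le_exp_1 K0 r by (intro mult_right_mono mult_left_mono) auto
    also have "\<dots> = exp 3 * K * r" by (simp add: exp_add[symmetric])
    also have "\<dots> \<le> q * r" using q r by (intro mult_right_mono) auto
    also have "\<dots> \<le> 1" by (rule r(2))
    finally have "exp 2 * (2 * K * r) \<le> 1" by (simp add: mult_ac)
    then have "exp (- 2) * (exp 2 * (2 * K * r)) \<le> exp (- 2) * 1" by (intro mult_left_mono) auto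
    then show "2 * K * r \<le> exp (- 2)" by (simp add: mult.assoc[symmetric] exp_add[symmetric] del: mult.assoc)
  qed (use A0_pos K0 r in auto)
  also have "exp (- 2 :: real) ^ k = exp (- 2 * real k)" by (simp add: exp_of_nat_mult[symmetric] mult.commute)
  finally show ?thesis by (simp add: mult_ac)
qed

end

section \<open>Choice of the mesh parameter and collection of the constants\<close>

context reaction_diffusion begin

text \<open>The second condition feeds the Taylor bounds. The third gives 128
  \<open>\<Gamma>\<close> (\<epsilon> p)^2 \<le> 1 from p \<epsilon> \<le> 1 / q. The last makes 1 /
  q at most half of \<open>rate\<close>, the other half being lost to the square root in the energy
  norm.\<close>

definition admissible :: "nat \<Rightarrow> bool" where
  "admissible q \<longleftrightarrow> 2 \<le> q \<and> exp 3 * K \<le> real q \<and> 128 * \<Gamma> \<le> real q \<and> 2 / rate \<le> real q"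

lemma admissible_exists: "\<exists>q. admissible q"
proof -
  obtain q :: nat where "max (max 2 (exp 3 * K)) (max (128 * \<Gamma>) (2 / rate)) \<le> real q"
    using real_arch_simple by blast
  then show ?thesis by (intro exI[of _ q]) (simp add: admissible_def)
qed

text \<open>33 = 1 + 2 * 16: the Taylor error and twice the constant of
  \<open>square_accuracy\<close>. \<open>T2\<close> adds the boundary correction;
  \<open>Csup\<close> and \<open>Cen\<close> are the resulting constants for the maximum norm and
  the squared energy norm.\<close>

definition T1 :: real where "T1 = 33 * (A + 2 * A0)"

definition T2 :: "nat \<Rightarrow> real" where "T2 q = T1 + 2 * (real (q + 2) * (2 * T1 + 2 * Cz))"

definition Csup :: "nat \<Rightarrow> real" where "Csup q = real (q + 2) * (2 * T2 q + 2 * Cz)"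

definition Cen :: "nat \<Rightarrow> real" where "Cen q = 2 * CE + 8 * real q * real (q + 2) * (T2 q)\<^sup>2"

lemma T_pos: "0 < T1" "0 < T2 q" "0 < Csup q" "0 < Cen q"
proof -
  show 1: "0 < T1" using A A0_pos by (simp add: T1_def)
  show 2: "0 < T2 q" unfolding T2_def using 1 consts_pos by (intro add_pos_nonneg mult_nonneg_nonneg) auto
  show "0 < Csup q" unfolding Csup_def using 2 consts_pos by (intro mult_pos_pos add_pos_pos) auto
  show "0 < Cen q" unfolding Cen_def using consts_pos by (intro add_pos_nonneg mult_nonneg_nonneg) auto
qed

end

context classical_solution begin

text \<open>On every element U is split into a part for Taylor approximation and a part Z that is
  already exponentially small: the remainder of the outer expansion on the middle elements of the
  layer mesh, and 0 on all others. G dominates |Z'| and carries the energy estimate.\<close>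

lemma mesh_decomposition:
  assumes q: "admissible q" and p: "1 \<le> p"
  defines "es \<equiv> mesh q p \<epsilon>"
  shows "\<exists>Z Z' G. (\<forall>e\<in>set es. \<forall>n. ndiff J n (\<lambda>x. U x - Z e x)) \<and>
    (\<forall>c r k x. (c, r) \<in> set es \<longrightarrow> x \<in> {c - r<..<c + r} \<longrightarrow>
      \<bar>(deriv ^^ k) (\<lambda>x. U x - Z (c, r) x) x\<bar> * r ^ k \<le> (A + 2 * A0) * exp (real q * real p) * exp (- 2 * real k) * fact k) \<and>
    (\<forall>c r x. (c, r) \<in> set es \<longrightarrow> x \<in> {c - r<..<c + r} \<longrightarrow>
      \<bar>Z (c, r) x\<bar> \<le> Cz * exp (- rate * real p) \<and> (Z (c, r) has_real_derivative Z' (c, r) x) (at x) \<and> \<bar>Z' (c, r) x\<bar> \<le> G x) \<and>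
    integrable (lebesgue_on J) (\<lambda>x. (G x)\<^sup>2) \<and> \<epsilon> * (LINT x|lebesgue_on J. (G x)\<^sup>2) \<le> CE * exp (- rate * real p)"
proof -
  have Q: "2 \<le> q" "exp 3 * K \<le> real q" "128 * \<Gamma> \<le> real q" using q by (auto simp: admissible_def)
  have qp: "0 < real q" "1 \<le> real q" using Q(1) by auto
  have ch: "chain (-1) es 1" unfolding es_def by (rule mesh_chain[OF Q(1) p eps(1)])
  have rad: "0 < r" "real q * r \<le> 1" "{c - r<..<c + r} \<subseteq> J" if "(c, r) \<in> set es" for c r
  proof -
    show "0 < r" by (rule chain_element(1)[OF ch that])
    show "real q * r \<le> 1"
      using mesh_radius(1)[OF Q(1) p eps that[unfolded es_def]] qp by (simp add: field_simps)
    show "{c - r<..<c + r} \<subseteq> J" using chain_element(2,3)[OF ch that] by auto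
  qed
  have Ubd: "\<bar>(deriv ^^ k) U x\<bar> * r ^ k \<le> (A + 2 * A0) * exp (real q * real p) * exp (- 2 * real k) * fact k"
    if "(c, r) \<in> set es" "x \<in> {c - r<..<c + r}" "r \<le> real p * \<epsilon>" for c r k x
  proof -
    have "x \<in> J" using rad(3)[OF that(1)] that(2) by blast
    from U_element_bound[OF Q(2) rad(1,2)[OF that(1)] that(3) this]
    have "\<bar>(deriv ^^ k) U x\<bar> * r ^ k \<le> A * exp (real q * real p) * exp (- 2 * real k) * fact k" .
    also have "\<dots> \<le> (A + 2 * A0) * exp (real q * real p) * exp (- 2 * real k) * fact k"
      using A0_pos by (intro mult_right_mono) auto
    finally show ?thesis .
  qed
  show ?thesis
  proof (cases "real q * (real p * \<epsilon>) \<le> 1")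
    case False
    \<comment> \<open>In this regime r = 1 / q < p \<epsilon>, so U itself is resolved
      everywhere.\<close>
    have "r \<le> real p * \<epsilon>" if "(c, r) \<in> set es" for c r
      using that unfolding es_def
    proof (cases rule: mesh_cases)
      case 3
      have "1 \<le> real p * \<epsilon> * real q" using 3(1) by (simp add: mult_ac)
      then show ?thesis unfolding 3(2) using qp(1) by (simp add: pos_divide_le_eq)
    qed (use False in auto)
    then show ?thesis
      using Ubd consts_pos
      by (intro exI[of _ "\<lambda>_ _. 0"] exI[of _ "\<lambda>_. 0"]) (auto simp: ndiff_U)
  next
    case True
    have small: "real p * \<epsilon> \<le> 1 / real q" "real p * \<epsilon> \<le> 1 / 2" using mesh_layer_small[OF Q(1) True eps(1)] by auto
    have "(\<epsilon> * real p)\<^sup>2 \<le> (1 / real q)\<^sup>2"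
      using small(1) eps by (intro power_mono) (auto simp: mult.commute)
    then have "128 * \<Gamma> * (\<epsilon> * real p)\<^sup>2 \<le> real q * (1 / real q)\<^sup>2"
      using Q(3) \<Gamma>_pos by (intro mult_mono) auto
    also have "\<dots> \<le> 1" using qp by (simp add: power2_eq_square)
    finally have small2: "128 * \<Gamma> * (\<epsilon> * real p)\<^sup>2 \<le> 1" .
    have p0: "0 < p" using p by simp
    note R = p0 small(2) small2
    define a c where "a = -1 + real p * \<epsilon>" and "c = 1 - real p * \<epsilon>"
    have chm: "chain a (middle_mesh q p \<epsilon>) c"
      unfolding a_def c_def by (rule middle_mesh_chain) (use Q small in auto)
    define Z where "Z e = (if e \<in> set (middle_mesh q p \<epsilon>) then rem p else (\<lambda>_. 0))" for e
    define Z' where "Z' e = (if e \<in> set (middle_mesh q p \<epsilon>) then rem' p else (\<lambda>_. 0))" for e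
    define G where "G x = indicator {a..c} x * \<bar>rem' p x\<bar>" for x
    have pe: "0 < real p * \<epsilon>" using p0 eps by simp
    then have acJ: "{a..c} \<subseteq> J" by (auto simp: a_def c_def)
    have VU: "(\<lambda>x. U x - Z e x) = (if e \<in> set (middle_mesh q p \<epsilon>) then outer_sum \<epsilon> p else U)" for e
      by (auto simp: Z_def rem_def[OF R])
    have mid: "x \<in> {a..c}" if "(c', r) \<in> set (middle_mesh q p \<epsilon>)" "x \<in> {c' - r<..<c' + r}" for c' r x
      using chain_element(2,3)[OF chm that(1)] that(2) by auto
    have G2: "(\<lambda>x. (G x)\<^sup>2) = (\<lambda>x. indicator {a..c} x * (rem' p x)\<^sup>2)"
      by (auto simp: G_def indicator_def fun_eq_iff)
    have rc: "continuous_on {a..c} (\<lambda>x. (rem' p x)\<^sup>2)"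
      by (intro continuous_intros continuous_at_imp_continuous_on ballI DERIV_isCont[OF rem'_deriv[OF R]]) (use acJ in auto)
    have ri: "integrable (lebesgue_on {a..c}) (\<lambda>x. (rem' p x)\<^sup>2)"
      using locally_integrable_on_continuous[OF rc] by (auto simp: locally_integrable_on_def)
    have JG: "(\<lambda>x. indicator J x * (indicator {a..c} x * (rem' p x)\<^sup>2)) = (\<lambda>x. indicator {a..c} x * (rem' p x)\<^sup>2)"
      using acJ by (auto simp: indicator_def fun_eq_iff)
    have Gi: "integrable (lebesgue_on J) (\<lambda>x. (G x)\<^sup>2)"
      using ri unfolding G2 by (simp add: integrable_lebesgue_on_iff JG)
    have "(LINT x|lebesgue_on J. (G x)\<^sup>2) = (LINT x|lebesgue_on {a..c}. (rem' p x)\<^sup>2)"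
      unfolding G2 by (simp add: integral_lebesgue_on_eq JG)
    also have "\<dots> = integral {a..c} (\<lambda>x. (rem' p x)\<^sup>2)"
      by (rule lebesgue_integral_eq_integral[OF ri]) simp
    finally have GI: "\<epsilon> * (LINT x|lebesgue_on J. (G x)\<^sup>2) \<le> CE * exp (- rate * real p)"
      using rem'_energy(2)[OF R] by (simp add: a_def c_def)
    have 1: "ndiff J n (\<lambda>x. U x - Z e x)" for e n
      unfolding VU by (simp add: ndiff_U ndiff_outer_sum)
    have 2: "\<bar>(deriv ^^ k) (\<lambda>x. U x - Z (c', r) x) x\<bar> * r ^ k \<le> (A + 2 * A0) * exp (real q * real p) * exp (- 2 * real k) * fact k"
      if e: "(c', r) \<in> set es" and x: "x \<in> {c' - r<..<c' + r}" for c' r k x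
      using e unfolding es_def
    proof (cases rule: mesh_cases)
      case 1
      have "x \<in> J" using rad(3)[OF e] x by blast
      from outer_element_bound[OF Q(2) rad(1,2)[OF e] this small2]
      have "\<bar>(deriv ^^ k) (outer_sum \<epsilon> p) x\<bar> * r ^ k \<le> 2 * A0 * exp (- 2 * real k) * fact k" .
      also have "\<dots> \<le> ((A + 2 * A0) * exp (real q * real p)) * exp (- 2 * real k) * fact k"
      proof (intro mult_right_mono)
        have "2 * A0 * 1 \<le> (A + 2 * A0) * exp (real q * real p)"
          using A A0_pos by (intro mult_mono) auto
        then show "2 * A0 \<le> (A + 2 * A0) * exp (real q * real p)" by simp
      qed auto
      finally show ?thesis unfolding VU using 1(2) by simp
    next
      case 2
      have "r \<le> real p * \<epsilon>" using 2(3) pe by simp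
      from Ubd[OF e x this] show ?thesis unfolding VU using 2(2) by simp
    next
      case 3
      then show ?thesis using True by simp
    qed
    have 3: "\<bar>Z (c', r) x\<bar> \<le> Cz * exp (- rate * real p) \<and> (Z (c', r) has_real_derivative Z' (c', r) x) (at x) \<and> \<bar>Z' (c', r) x\<bar> \<le> G x"
      if e: "(c', r) \<in> set es" and x: "x \<in> {c' - r<..<c' + r}" for c' r x
    proof (cases "(c', r) \<in> set (middle_mesh q p \<epsilon>)")
      case True
      have xac: "x \<in> {a..c}" by (rule mid[OF True x])
      then have xJ: "x \<in> J" using acJ by blast
      show ?thesis
        using True rem_bound[OF R, of x] rem_deriv[OF R xJ] xac by (simp add: Z_def Z'_def G_def a_def c_def)
    next
      case False
      then show ?thesis using consts_pos by (simp add: Z_def Z'_def G_def)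
    qed
    show ?thesis
      by (intro exI[of _ Z] exI[of _ Z'] exI[of _ G] conjI ballI allI impI) (use 1 2 3 Gi GI in auto)
  qed
qed

end

section \<open>Assembly of the network and its error\<close>

context classical_solution begin

lemma network_error:
  assumes q: "admissible q" and p: "1 \<le> p" and \<Phi>: "realizes \<Phi> gs"
    and gs: "\<And>c r k. (c, r) \<in> set (mesh q p \<epsilon>) \<Longrightarrow> k \<le> 2 ^ level q p \<Longrightarrow>
      sparse_comb 3 gs (\<lambda>x. mono_approx (9 * 2 ^ level q p) (level q p) k (lcoord c r x))"
    and wu: "AE x in lebesgue_on J. wu x = U' x"
  obtains l where "neural_network 1 1 (\<Phi> @ [l])" "network_size (\<Phi> @ [l]) \<le> network_size \<Phi> + (length gs + 1)"
    "relu_fun (\<Phi> @ [l]) \<in> H1_space J" "continuous_on UNIV (relu_fun (\<Phi> @ [l]))"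
    "relu_fun (\<Phi> @ [l]) (-1) = 0" "relu_fun (\<Phi> @ [l]) 1 = 0"
    "\<And>x. x \<in> {-1..1} \<Longrightarrow> \<bar>U x - relu_fun (\<Phi> @ [l]) x\<bar> \<le> Csup q * exp (- rate * real p)"
    "sqrt \<epsilon> * L2_norm J (\<lambda>x. wu x - weak_deriv J (relu_fun (\<Phi> @ [l])) x) \<le> sqrt (Cen q * exp (- rate * real p))"
proof -
  define es l m where "es = mesh q p \<epsilon>" and "l = level q p" and "m = 9 * (2::nat) ^ l"
  define E where "E = exp (- rate * real p)"
  define \<zeta> where "\<zeta> = Cz * E"
  define A' where "A' = (A + 2 * A0) * exp (real q * real p)"
  have Q: "2 \<le> q" using q by (simp add: admissible_def)
  have E0: "0 < E" by (simp add: E_def)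
  have \<zeta>0: "0 \<le> \<zeta>" using consts_pos E0 by (simp add: \<zeta>_def)
  have ch: "chain (-1) es 1" unfolding es_def by (rule mesh_chain[OF Q p eps(1)])
  have len: "real (length es) \<le> real (q + 2)" unfolding es_def using mesh_length[of q p \<epsilon>] by (simp only: of_nat_le_iff)
  have len0: "0 \<le> real (length es)" by simp
  have A'0: "0 \<le> A'" using A A0_pos by (simp add: A'_def)
  have "es \<noteq> []" unfolding es_def by (rule mesh_nonempty) (use Q in simp)
  then have e0: "hd es \<in> set es" by simp
  obtain c0 r0 where "hd es = (c0, r0)" by (rule prod.exhaust)
  then have cr0: "(c0, r0) \<in> set es" using e0 by simp
  have N2: "2 * q * p \<le> 2 ^ l" unfolding l_def by (rule level_bounds(1)) (use Q p in auto)
  have "2 * 1 * 1 \<le> 2 * q * p" by (intro mult_le_mono) (use Q p in auto)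
  then have "2 \<le> (2::nat) ^ l" using N2 by linarith
  note acc = square_accuracy[OF this, folded m_def]
  from mesh_decomposition[OF q p, folded es_def A'_def]
  obtain Z Z' G where nd: "\<forall>e\<in>set es. \<forall>n. ndiff J n (\<lambda>x. U x - Z e x)"
    and bd: "\<forall>c r k x. (c, r) \<in> set es \<longrightarrow> x \<in> {c - r<..<c + r} \<longrightarrow>
      \<bar>(deriv ^^ k) (\<lambda>x. U x - Z (c, r) x) x\<bar> * r ^ k \<le> A' * exp (- 2 * real k) * fact k"
    and Z: "\<forall>c r x. (c, r) \<in> set es \<longrightarrow> x \<in> {c - r<..<c + r} \<longrightarrow>
      \<bar>Z (c, r) x\<bar> \<le> Cz * exp (- rate * real p) \<and> (Z (c, r) has_real_derivative Z' (c, r) x) (at x) \<and> \<bar>Z' (c, r) x\<bar> \<le> G x"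
    and G: "integrable (lebesgue_on J) (\<lambda>x. (G x)\<^sup>2)" "\<epsilon> * (LINT x|lebesgue_on J. (G x)\<^sup>2) \<le> CE * exp (- rate * real p)"
    by (elim exE conjE)
  define V where "V e x = U x - Z e x" for e x
  define \<theta>0 where "\<theta>0 = A' * exp (- real (2 ^ l)) + 2 * A' * (\<eta> m * 30 ^ (2 ^ l))"
  have "\<exists>a. elementwise_near es (A' * exp (- real (2 ^ l)) + 2 * A' * (\<eta> m * 30 ^ (2 ^ l))) V (local_sum m l es a)"
  proof (rule local_sum_near[OF ch A'0])
    show "ndiff J n (V e)" if "e \<in> set es" for e n using nd that unfolding V_def[abs_def] by blast
    show "\<bar>(deriv ^^ k) (V (c, r)) x\<bar> * r ^ k \<le> A' * exp (- 2 * real k) * fact k"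
      if "(c, r) \<in> set es" "x \<in> {c - r<..<c + r}" for c r k x
      using bd that unfolding V_def[abs_def] by blast
  qed (use acc in linarith)
  then obtain a where near0: "elementwise_near es \<theta>0 V (local_sum m l es a)" unfolding \<theta>0_def ..
  define F where "F = local_sum m l es a"
  have \<theta>0: "0 \<le> \<theta>0" "\<theta>0 \<le> T1 * E"
  proof -
    show "0 \<le> \<theta>0" using A'0 \<eta>_pos[of m] by (simp add: \<theta>0_def)
    have "\<theta>0 = A' * (exp (- real (2 ^ l)) + 2 * (\<eta> m * 30 ^ (2 ^ l)))" by (simp add: \<theta>0_def algebra_simps)
    also have "\<dots> \<le> A' * (33 * exp (- real (2 ^ l)))"
      using acc(1) A'0 by (intro mult_left_mono) linarith+
    \<comment> \<open>Half of the degree N \<ge> 2 q p cancels the factor exp(q p) in A'; the other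
      half yields E, since \<open>rate\<close> \<le> 1 \<le> q.\<close>
    also have "\<dots> \<le> A' * (33 * (exp (- (real q * real p)) * E))"
    proof (intro mult_left_mono A'0)
      have "real (2 * q * p) \<le> real (2 ^ l)" using N2 by (simp only: of_nat_le_iff)
      moreover have "rate * real p \<le> real q * real p"
        using Q by (intro mult_right_mono) (auto simp: rate_def)
      ultimately have "- real (2 ^ l) \<le> - (real q * real p) + - rate * real p" by simp
      then show "exp (- real (2 ^ l)) \<le> exp (- (real q * real p)) * E"
        unfolding E_def exp_add[symmetric] by (simp only: exp_le_cancel_iff)
    qed simp
    also have "\<dots> = T1 * E * (exp (real q * real p) * exp (- (real q * real p)))"
      by (simp add: A'_def T1_def)
    also have "\<dots> = T1 * E" by (simp add: exp_add[symmetric])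
    finally show "\<theta>0 \<le> T1 * E" .
  qed
  have Fs: "sparse_comb (length gs) gs F"
  proof -
    have F: "F = (\<lambda>x. \<Sum>e\<in>set es. \<Sum>k\<le>2 ^ l. a e k * mono_approx m l k (lcoord (fst e) (snd e) x))"
      by (simp add: F_def local_sum_def[abs_def] case_prod_unfold)
    show ?thesis
      unfolding F
    proof (intro sparse_comb_sum sparse_comb_cmult)
      fix e k assume "e \<in> set es" "k \<in> {..(2::nat) ^ l}"
      then show "sparse_comb (length gs) gs (\<lambda>x. mono_approx m l k (lcoord (fst e) (snd e) x))"
        unfolding m_def l_def es_def
        by (intro sparse_comb_length[OF gs]) auto
    qed
  qed
  have near1: "elementwise_near es \<theta>0 (\<lambda>e x. U x - Z e x) F" using near0 by (simp add: F_def V_def[abs_def])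
  have Fpw: "pw_affine F" by (rule realizes_output[OF \<Phi> Fs])
  have Zb: "\<bar>Z (c, r) x\<bar> \<le> \<zeta>" "(Z (c, r) has_real_derivative Z' (c, r) x) (at x)" "\<bar>Z' (c, r) x\<bar> \<le> G x"
    if "(c, r) \<in> set es" "x \<in> {c - r<..<c + r}" for c r x
    using Z[rule_format, OF that] by (simp_all add: \<zeta>_def E_def)
  have "\<bar>(U 1 - F 1) - (U (-1) - F (-1))\<bar> \<le> real (length es) * (2 * \<theta>0 + 2 * \<zeta>)"
    by (rule elementwise_oscillation[OF ch U_cont pw_affine_continuous[OF Fpw] near1 \<theta>0(1) \<zeta>0 Zb(1)]) simp_all
  also have "\<dots> \<le> real (q + 2) * (2 * (T1 * E) + 2 * \<zeta>)"
    using len \<theta>0 \<zeta>0 by (intro mult_mono) auto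
  finally have "\<bar>(U 1 - F 1) - (U (-1) - F (-1))\<bar> \<le> real (q + 2) * (2 * (T1 * E) + 2 * \<zeta>)" .
  \<comment> \<open>Both boundary values of U are 0, so the accumulated error is exactly the
    increment of F that has to be corrected.\<close>
  moreover have "\<bar>(U 1 - F 1) - (U (-1) - F (-1))\<bar> = \<bar>F 1 - F (-1)\<bar>" unfolding U_bc by linarith
  ultimately have \<Lambda>: "\<bar>F 1 - F (-1)\<bar> \<le> real (q + 2) * (2 * (T1 * E) + 2 * \<zeta>)" by (simp only:)
  have sm: "\<eta> m * 30 ^ (2 ^ l) \<le> 1 / 2" by (rule acc(2))
  obtain \<mu> k where Hk: "let H = (\<lambda>x. F x + \<mu> * mono_approx m l 1 (lcoord c0 r0 x) + k) in H (-1) = 0 \<and> H 1 = 0 \<and>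
      elementwise_near es (\<theta>0 + 2 * \<bar>F 1 - F (-1)\<bar>) (\<lambda>e x. U x - Z e x) H"
    using boundary_correction[OF ch near1 cr0 sm] by (elim exE)
  define H where "H = (\<lambda>x. F x + \<mu> * mono_approx m l 1 (lcoord c0 r0 x) + k)"
  define \<theta> where "\<theta> = \<theta>0 + 2 * \<bar>F 1 - F (-1)\<bar>"
  have H: "H (-1) = 0" "H 1 = 0" "elementwise_near es \<theta> (\<lambda>e x. U x - Z e x) H"
    using Hk unfolding Let_def H_def \<theta>_def by blast+
  have \<theta>: "0 \<le> \<theta>" "\<theta> \<le> T2 q * E"
  proof -
    show "0 \<le> \<theta>" using \<theta>0 by (simp add: \<theta>_def)
    have "\<theta> \<le> T1 * E + 2 * (real (q + 2) * (2 * (T1 * E) + 2 * \<zeta>))"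
      unfolding \<theta>_def by (intro add_mono mult_left_mono \<theta>0(2) \<Lambda>) simp
    also have "\<dots> = T2 q * E" unfolding T2_def \<zeta>_def by (simp add: algebra_simps)
    finally show "\<theta> \<le> T2 q * E" .
  qed
  have "sparse_comb (length gs) gs (\<lambda>x. mono_approx m l 1 (lcoord c0 r0 x))"
    unfolding m_def l_def by (rule sparse_comb_length, rule gs) (use cr0 in \<open>auto simp: es_def\<close>)
  note lin = this
  have Hs: "sparse_comb (length gs) gs H"
    unfolding H_def
    by (rule sparse_comb_length[OF sparse_comb_add[OF sparse_comb_add[OF Fs sparse_comb_cmult[OF lin]] sparse_comb_const[of 0]]])
  obtain ll where ll: "neural_network 1 1 (\<Phi> @ [ll])" "relu_fun (\<Phi> @ [ll]) = H"
    "network_size (\<Phi> @ [ll]) \<le> network_size \<Phi> + (length gs + 1)" "pw_affine H"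
    by (rule realizes_output[OF \<Phi> Hs])
  have Hc: "continuous_on UNIV H" by (rule pw_affine_continuous[OF ll(4)])
  have sup: "\<bar>U x - H x\<bar> \<le> Csup q * exp (- rate * real p)" if x: "x \<in> {-1..1}" for x
  proof -
    have "\<bar>(U x - H x) - (U (-1) - H (-1))\<bar> \<le> real (length es) * (2 * \<theta> + 2 * \<zeta>)"
      by (rule elementwise_oscillation[OF ch U_cont Hc H(3) \<theta>(1) \<zeta>0 Zb(1) x])
    also have "\<dots> \<le> real (q + 2) * (2 * (T2 q * E) + 2 * \<zeta>)"
      using len \<theta> \<zeta>0 by (intro mult_mono) auto
    also have "\<dots> = Csup q * E" unfolding Csup_def \<zeta>_def by (simp add: algebra_simps)
    finally show ?thesis by (simp add: U_bc H E_def)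
  qed
  \<comment> \<open>A lower bound for all radii; its factor \<epsilon> cancels the weight of the
    energy norm.\<close>
  define \<rho> where "\<rho> = \<epsilon> / (2 * real q)"
  have \<rho>0: "0 < \<rho>" using eps Q by (simp add: \<rho>_def)
  have r\<rho>: "\<rho> \<le> r" if "(c, r) \<in> set es" for c r
    unfolding \<rho>_def by (rule mesh_radius(2)[OF Q p eps that[unfolded es_def]])
  have U'c: "continuous_on J U'"
    by (intro continuous_at_imp_continuous_on ballI DERIV_isCont[OF U'_deriv])
  have HH: "H \<in> H1_space J"
    by (rule energy_error(1)[where \<rho> = \<rho> and G = G, OF ch _ \<rho>0 ll(4) _ U'c _ H(3) \<theta>(1) _ _ G(1)])
      (fact r\<rho> U_deriv U'_bound Zb(2) Zb(3))+
  have en: "L2_norm J (\<lambda>x. wu x - weak_deriv J H x)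
      \<le> sqrt (2 * (LINT x|lebesgue_on J. (G x)\<^sup>2) + 4 * real (length es) * \<theta>\<^sup>2 / \<rho>)"
    by (rule energy_error(2)[where \<rho> = \<rho> and G = G, OF ch _ \<rho>0 ll(4) _ U'c _ H(3) \<theta>(1) _ _ G(1) wu])
      (fact r\<rho> U_deriv U'_bound Zb(2) Zb(3))+
  have "sqrt \<epsilon> * L2_norm J (\<lambda>x. wu x - weak_deriv J H x)
      \<le> sqrt \<epsilon> * sqrt (2 * (LINT x|lebesgue_on J. (G x)\<^sup>2) + 4 * real (length es) * \<theta>\<^sup>2 / \<rho>)"
    by (rule mult_left_mono[OF en]) (use eps in auto)
  also have "\<dots> = sqrt (\<epsilon> * (2 * (LINT x|lebesgue_on J. (G x)\<^sup>2) + 4 * real (length es) * \<theta>\<^sup>2 / \<rho>))"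
    by (simp add: real_sqrt_mult)
  also have "\<dots> \<le> sqrt (Cen q * E)"
  proof (rule real_sqrt_le_mono)
    have "\<epsilon> * (2 * (LINT x|lebesgue_on J. (G x)\<^sup>2) + 4 * real (length es) * \<theta>\<^sup>2 / \<rho>)
      = 2 * (\<epsilon> * (LINT x|lebesgue_on J. (G x)\<^sup>2)) + 8 * real q * (real (length es) * \<theta>\<^sup>2)"
      using eps Q by (simp add: \<rho>_def field_simps)
    also have "\<dots> \<le> 2 * (CE * E) + 8 * real q * (real (q + 2) * ((T2 q)\<^sup>2 * E))"
    proof (intro add_mono mult_left_mono)
      show "\<epsilon> * (LINT x|lebesgue_on J. (G x)\<^sup>2) \<le> CE * E" using G(2) by (simp add: E_def)
      \<comment> \<open>The squared approximation error of order E^2 is weakened to E, the rate of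
        the energy of the remainder.\<close>
      have E1: "E \<le> 1" using consts_pos \<sigma> by (simp add: E_def rate_def)
      have "\<theta>\<^sup>2 \<le> (T2 q * E)\<^sup>2" by (rule power_mono[OF \<theta>(2,1)])
      also have "\<dots> = (T2 q)\<^sup>2 * (E * E)" by (simp add: power2_eq_square)
      also have "\<dots> \<le> (T2 q)\<^sup>2 * (1 * E)" using E0 E1 by (intro mult_left_mono mult_right_mono) auto
      finally have t: "\<theta>\<^sup>2 \<le> (T2 q)\<^sup>2 * E" by simp
      show "real (length es) * \<theta>\<^sup>2 \<le> real (q + 2) * ((T2 q)\<^sup>2 * E)"
        by (rule mult_mono[OF len t]) auto
    qed auto
    also have "\<dots> = Cen q * E" unfolding Cen_def by (simp add: algebra_simps)
    finally show "\<epsilon> * (2 * (LINT x|lebesgue_on J. (G x)\<^sup>2) + 4 * real (length es) * \<theta>\<^sup>2 / \<rho>) \<le> Cen q * E" .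
  qed
  finally have energy: "sqrt \<epsilon> * L2_norm J (\<lambda>x. wu x - weak_deriv J H x) \<le> sqrt (Cen q * exp (- rate * real p))"
    by (simp add: E_def)
  show ?thesis
    by (rule that[of ll]) (simp_all only: ll(2), (use ll(1,3) HH Hc H(1,2) sup energy in simp_all))
qed

end

section \<open>Hidden layers determined by q, p and \<epsilon>\<close>

definition hidden_basis :: "nat \<Rightarrow> nat \<Rightarrow> real \<Rightarrow> network \<Rightarrow> (real \<Rightarrow> real) list \<Rightarrow> bool" where
  "hidden_basis q p \<epsilon> \<Phi> gs \<longleftrightarrow> (let N = 2 ^ level q p; es = mesh q p \<epsilon> in
     realizes \<Phi> gs \<and> length \<Phi> = 1 + level q p * Suc (9 * N) \<and>
     network_size \<Phi> \<le> 67 * length es * Suc (9 * N) * N \<and> length gs \<le> 9 * length es * N \<and>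
     (\<forall>c r k. (c, r) \<in> set es \<longrightarrow> k \<le> N \<longrightarrow> sparse_comb 3 gs (\<lambda>x. mono_approx (9 * N) (level q p) k (lcoord c r x))))"

text \<open>The choice is made from a predicate in which neither the solution nor the coefficients
  occur. This is how the independence of the hidden layers from the solution is realised.\<close>

definition hidden_net :: "nat \<Rightarrow> nat \<Rightarrow> real \<Rightarrow> network" where
  "hidden_net q p \<epsilon> = (SOME \<Phi>. \<exists>gs. hidden_basis q p \<epsilon> \<Phi> gs)"

lemma hidden_net_basis:
  assumes q: "2 \<le> q" and p: "1 \<le> p" and e: "0 < \<epsilon>"
  shows "\<exists>gs. hidden_basis q p \<epsilon> (hidden_net q p \<epsilon>) gs"
proof -
  have "2 * 1 * 1 \<le> 2 * q * p" by (intro mult_le_mono) (use q p in auto)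
  moreover have "2 * q * p \<le> 2 ^ level q p" by (rule level_bounds(1)) (use q p in auto)
  ultimately have "2 \<le> (2::nat) ^ level q p" by linarith
  then have "\<eta> (9 * 2 ^ level q p) * 30 ^ (2 ^ level q p) \<le> 1 / 2" by (rule square_accuracy(2))
  then have small: "\<eta> (9 * 2 ^ level q p) * 30 ^ (2 ^ level q p) \<le> 1" by linarith
  have "mesh q p \<epsilon> \<noteq> []" by (rule mesh_nonempty) (use q in simp)
  have "\<exists>gs. net (1 + level q p * Suc (9 * 2 ^ level q p)) (67 * length (mesh q p \<epsilon>) * Suc (9 * 2 ^ level q p) * 2 ^ level q p) gs \<and>
    length gs \<le> 9 * length (mesh q p \<epsilon>) * 2 ^ level q p \<and> (\<forall>c r k. (c, r) \<in> set (mesh q p \<epsilon>) \<longrightarrow> k \<le> 2 ^ level q p \<longrightarrow>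
      sparse_comb 3 gs (\<lambda>x. mono_approx (9 * 2 ^ level q p) (level q p) k (lcoord c r x)))"
  proof (rule net_monomials[OF \<open>mesh q p \<epsilon> \<noteq> []\<close> _ small])
    show "0 < r" if "(c, r) \<in> set (mesh q p \<epsilon>)" for c r
      by (rule chain_element(1)[OF mesh_chain[OF q p e] that])
  qed
  then have "\<exists>\<Phi> gs. hidden_basis q p \<epsilon> \<Phi> gs"
    unfolding hidden_basis_def Let_def net_def by blast
  then show ?thesis unfolding hidden_net_def by (rule someI_ex)
qed

text \<open>The 40 bounds 9 N + 1 against q p for N \<le> 4 q p, the logarithm counts the rounds of
  squaring, and 2 stands for the layer of local coordinates and the output layer.\<close>

definition depth_const :: "nat \<Rightarrow> real" where
  "depth_const q = 2 + 40 * real q * (log 2 (4 * real q) + 1)"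

text \<open>10880 = 16 * 680: here 680 = 67 * 9 + 67 + 9 + 1 collects the hidden and output layers,
  and 16 comes from N^2 \<le> (4 q p)^2.\<close>

definition size_const :: "nat \<Rightarrow> real" where
  "size_const q = 10880 * real (q + 2) * (real q)\<^sup>2"

lemma depth_bound:
  assumes q: "1 \<le> q" and p: "1 \<le> p"
  shows "real (2 + level q p * Suc (9 * 2 ^ level q p)) \<le> depth_const q * real p * (1 + log 2 (real p))"
proof -
  define l where "l = level q p"
  define N :: nat where "N = 2 ^ l"
  define P where "P = 1 + log 2 (real p)"
  have N: "N \<le> 4 * q * p" "1 \<le> N" unfolding N_def l_def using level_bounds(2)[OF q p] by simp_all
  have P: "1 \<le> P" using p by (simp add: P_def)
  have q4: "0 \<le> log 2 (4 * real q)" using q by simp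
  have "real l = log 2 (real N)" by (simp add: N_def log_nat_power)
  also have "\<dots> \<le> log 2 ((4 * real q) * real p)"
  proof (subst log_le_cancel_iff)
    have "real N \<le> real (4 * q * p)" using N(1) by (simp only: of_nat_le_iff)
    then show "real N \<le> (4 * real q) * real p" by simp
  qed (use N q p in auto)
  also have "\<dots> = log 2 (4 * real q) + log 2 (real p)" using q p by (subst log_mult) auto
  also have "\<dots> = log 2 (4 * real q) * 1 + (P - 1)" by (simp add: P_def)
  also have "\<dots> \<le> log 2 (4 * real q) * P + P" using P q4 by (intro add_mono mult_left_mono) auto
  also have "\<dots> = (log 2 (4 * real q) + 1) * P" by (simp add: algebra_simps)
  finally have l: "real l \<le> (log 2 (4 * real q) + 1) * P" .
  have "Suc (9 * N) \<le> 40 * (q * p)" using N by simp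
  then have "real (Suc (9 * N)) \<le> real (40 * (q * p))" by (simp only: of_nat_le_iff)
  then have s: "real (Suc (9 * N)) \<le> 40 * (real q * real p)" by simp
  have "1 * 1 \<le> real p * P" using P p by (intro mult_mono) auto
  moreover have "real (2 + l * Suc (9 * N)) = 2 + real l * real (Suc (9 * N))" by (simp only: of_nat_add of_nat_mult of_nat_numeral)
  ultimately have "real (2 + l * Suc (9 * N)) \<le> 2 * (real p * P) + real l * real (Suc (9 * N))" by linarith
  also have "\<dots> \<le> 2 * (real p * P) + ((log 2 (4 * real q) + 1) * P) * (40 * (real q * real p))"
    using q4 P by (intro add_left_mono mult_mono l s) auto
  also have "\<dots> = depth_const q * real p * P" by (simp add: depth_const_def algebra_simps)
  finally show ?thesis by (simp add: l_def N_def P_def)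
qed

lemma size_bound:
  assumes q: "1 \<le> q" and p: "1 \<le> p" and es: "1 \<le> n" "n \<le> q + 2"
  defines "N \<equiv> 2 ^ level q p"
  shows "real (67 * n * Suc (9 * N) * N + (9 * n * N + 1)) \<le> size_const q * (real p)\<^sup>2"
proof -
  have N: "N \<le> 4 * q * p" "1 \<le> N" unfolding N_def using level_bounds(2)[OF q p] by simp_all
  have nN: "1 \<le> n * N" "n * N \<le> n * N * N" using es N by simp_all
  have "67 * n * Suc (9 * N) * N = 603 * (n * N * N) + 67 * (n * N)" by (simp add: algebra_simps)
  then have "67 * n * Suc (9 * N) * N + (9 * n * N + 1) \<le> 680 * (n * N * N)" using nN by linarith
  also have "\<dots> \<le> 680 * ((q + 2) * (4 * q * p) * (4 * q * p))"
    by (intro mult_le_mono order_refl es N)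
  finally have "real (67 * n * Suc (9 * N) * N + (9 * n * N + 1)) \<le> real (680 * ((q + 2) * (4 * q * p) * (4 * q * p)))"
    by (simp only: of_nat_le_iff)
  also have "\<dots> = size_const q * (real p)\<^sup>2" by (simp add: size_const_def power2_eq_square algebra_simps)
  finally show ?thesis .
qed

section \<open>Norms of the error and bounds on the data\<close>

lemma L2_norm_le_const:
  assumes "AE x in lebesgue_on J. \<bar>h x\<bar> \<le> s" "0 \<le> s"
  shows "L2_norm J h \<le> 2 * s"
proof (rule L2_norm_le_AE[where H = "\<lambda>_. s\<^sup>2"])
  have f: "finite_measure (lebesgue_on J)" by (rule finite_measure_lebesgue_on) simp
  show "AE x in lebesgue_on J. (h x)\<^sup>2 \<le> s\<^sup>2"
    using assms(1) by eventually_elim (use assms(2) in \<open>simp add: abs_le_square_iff[symmetric]\<close>)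
  show "integrable (lebesgue_on J) (\<lambda>_. s\<^sup>2)" by (rule finite_measure.integrable_const[OF f])
  have "measure (lebesgue_on J) J = measure lebesgue J" by (rule measure_restrict_space) simp_all
  then have "(LINT x|lebesgue_on J. s\<^sup>2) = 2 * s\<^sup>2" by simp
  then show "(LINT x|lebesgue_on J. s\<^sup>2) \<le> (2 * s)\<^sup>2" by (simp only: power_mult_distrib) simp
qed (use assms in auto)

lemma Linf_norm_le_AE:
  assumes "h \<in> borel_measurable (lebesgue_on I)" "AE x in lebesgue_on I. \<bar>h x\<bar> \<le> s"
  shows "Linf_norm I h \<le> ereal s"
  unfolding Linf_norm_def using assms by (intro esssup_I) auto

lemma deriv_bound_of_analytic:
  assumes an: "real_analytic_on g {-1..1}" and C: "0 < C" and K: "0 < K"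
    and b: "\<And>n. Linf_norm J ((deriv ^^ n) g) \<le> ereal (C * K ^ n * fact n)"
  shows "deriv_bound g C K 0"
  unfolding deriv_bound_def
proof (intro conjI allI ballI)
  show nd: "ndiff J n g" for n by (rule real_analytic_on_ndiff[OF an])
  show "\<bar>(deriv ^^ n) g x\<bar> \<le> C * K ^ n * fact (n + 0)" if "x \<in> J" for n x
    using Linf_norm_le_pointwise[OF ndiff_continuous_on[OF nd order_refl] b that] by simp
qed

context reaction_diffusion begin

lemma network_approximation:
  assumes q: "admissible q" and p: "1 \<le> p" and e: "0 < \<epsilon>" "\<epsilon> \<le> 1" and ws: "weak_solution \<epsilon> b f u"
  defines "err \<equiv> (sqrt (Cen q) + 2 * Csup q) * exp (- (1 / real q) * real p)"
  shows "\<exists>\<Phi>. neural_network 1 1 \<Phi> \<and> relu_fun \<Phi> \<in> H1_space J \<and>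
    \<epsilon> powr (1/2) * L2_norm J (\<lambda>x. weak_deriv J u x - weak_deriv J (relu_fun \<Phi>) x)
      + L2_norm J (\<lambda>x. u x - relu_fun \<Phi> x) \<le> err \<and>
    Linf_norm J (\<lambda>x. u x - relu_fun \<Phi> x) \<le> ereal err \<and>
    relu_fun \<Phi> (-1) = 0 \<and> relu_fun \<Phi> 1 = 0 \<and>
    real (depth \<Phi>) \<le> depth_const q * real p * (1 + log 2 (real p)) \<and>
    real (network_size \<Phi>) \<le> size_const q * (real p)\<^sup>2 \<and>
    butlast \<Phi> = hidden_net q p \<epsilon>"
proof -
  have Q: "2 \<le> q" "2 / rate \<le> real q" using q by (auto simp: admissible_def)
  have bc: "continuous_on J b" "continuous_on J f"
    using ndiff_continuous_on[OF deriv_boundD(1)[OF bC], of 0 0] ndiff_continuous_on[OF deriv_boundD(1)[OF fC], of 0 0]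
    by simp_all
  have bb: "\<bar>b x\<bar> \<le> C" "\<bar>f x\<bar> \<le> C" if "x \<in> J" for x
    using deriv_boundD(2)[OF bC that, of 0] deriv_boundD(2)[OF fC that, of 0] by simp_all
  obtain U U' where U: "continuous_on {-1..1} U" "U (-1) = 0" "U 1 = 0"
    "\<And>x. x \<in> J \<Longrightarrow> (U has_real_derivative U' x) (at x)"
    "\<And>x. x \<in> J \<Longrightarrow> (U' has_real_derivative (b x * U x - f x) / \<epsilon>\<^sup>2) (at x)"
    and ae: "AE x in lebesgue_on J. u x = U x" "AE x in lebesgue_on J. weak_deriv J u x = U' x"
    and um: "u \<in> borel_measurable (lebesgue_on J)"
    by (rule weak_solution_classical[OF ws e(1) bc(1) bb(1) bc(2) bb(2)]) auto
  interpret classical_solution b f b0 C L \<epsilon> U U'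
    by unfold_locales (fact e U)+
  define \<Phi>0 where "\<Phi>0 = hidden_net q p \<epsilon>"
  define E where "E = exp (- (1 / real q) * real p)"
  obtain gs where gs: "hidden_basis q p \<epsilon> \<Phi>0 gs"
    unfolding \<Phi>0_def using hidden_net_basis[OF Q(1) p e(1)] ..
  have gs1: "realizes \<Phi>0 gs" and len: "length \<Phi>0 = 1 + level q p * Suc (9 * 2 ^ level q p)"
    and sz: "network_size \<Phi>0 \<le> 67 * length (mesh q p \<epsilon>) * Suc (9 * 2 ^ level q p) * 2 ^ level q p"
    and lgs: "length gs \<le> 9 * length (mesh q p \<epsilon>) * 2 ^ level q p"
    and gs2: "\<And>c r k. (c, r) \<in> set (mesh q p \<epsilon>) \<Longrightarrow> k \<le> 2 ^ level q p \<Longrightarrow>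
      sparse_comb 3 gs (\<lambda>x. mono_approx (9 * 2 ^ level q p) (level q p) k (lcoord c r x))"
    using gs unfolding hidden_basis_def Let_def by blast+
  obtain l where l: "neural_network 1 1 (\<Phi>0 @ [l])" "network_size (\<Phi>0 @ [l]) \<le> network_size \<Phi>0 + (length gs + 1)"
    "relu_fun (\<Phi>0 @ [l]) \<in> H1_space J" "continuous_on UNIV (relu_fun (\<Phi>0 @ [l]))"
    "relu_fun (\<Phi>0 @ [l]) (-1) = 0" "relu_fun (\<Phi>0 @ [l]) 1 = 0"
    and sup: "\<And>x. x \<in> {-1..1} \<Longrightarrow> \<bar>U x - relu_fun (\<Phi>0 @ [l]) x\<bar> \<le> Csup q * exp (- rate * real p)"
    and en: "sqrt \<epsilon> * L2_norm J (\<lambda>x. weak_deriv J u x - weak_deriv J (relu_fun (\<Phi>0 @ [l])) x) \<le> sqrt (Cen q * exp (- rate * real p))"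
    using network_error[OF q p gs1 gs2 ae(2)] by blast
  define H where "H = relu_fun (\<Phi>0 @ [l])"
  have rate: "0 < rate" using \<sigma> by (simp add: rate_def)
  \<comment> \<open>The maximum norm decays at \<open>rate\<close>, but the energy norm, being a
    square root, only at half of it.\<close>
  have "1 / real q \<le> rate / 2" using Q rate by (simp add: field_simps)
  then have "1 / real q * real p \<le> rate / 2 * real p" by (rule mult_right_mono) simp
  then have E2: "exp (- rate * real p / 2) \<le> E" by (simp add: E_def)
  have E1: "exp (- rate * real p) \<le> E"
  proof -
    have "- rate * real p \<le> - rate * real p / 2" using rate by simp
    then have "exp (- rate * real p) \<le> exp (- rate * real p / 2)" by (simp only: exp_le_cancel_iff)
    then show ?thesis using E2 by linarith
  qed
  have "sqrt (exp (- rate * real p)) = exp (- rate * real p / 2)"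
    by (rule real_sqrt_unique) (simp_all add: power2_eq_square exp_add[symmetric])
  then have "sqrt (Cen q * exp (- rate * real p)) \<le> sqrt (Cen q) * E"
    using E2 T_pos(4)[of q] by (simp add: real_sqrt_mult)
  with en have en': "\<epsilon> powr (1/2) * L2_norm J (\<lambda>x. weak_deriv J u x - weak_deriv J H x) \<le> sqrt (Cen q) * E"
    using e(1) by (simp add: H_def powr_half_sqrt)
  have "Csup q * exp (- rate * real p) \<le> Csup q * E" using E1 T_pos(3)[of q] by simp
  then have sup': "\<bar>U x - H x\<bar> \<le> Csup q * E" if "x \<in> J" for x
    using sup[of x] that unfolding H_def by fastforce
  have "AE x in lebesgue_on J. x \<in> J" using AE_space[of "lebesgue_on J"] by simp
  with ae(1) have aeH: "AE x in lebesgue_on J. \<bar>u x - H x\<bar> \<le> Csup q * E"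
    by eventually_elim (use sup' in auto)
  have CE0: "0 \<le> Csup q * E" "0 \<le> sqrt (Cen q) * E"
    using T_pos(3,4)[of q] by (simp_all add: E_def)
  have err: "err = sqrt (Cen q) * E + 2 * (Csup q * E)" by (simp add: err_def E_def algebra_simps)
  have "L2_norm J (\<lambda>x. u x - H x) \<le> 2 * (Csup q * E)" by (rule L2_norm_le_const[OF aeH CE0(1)])
  with en' have 1: "\<epsilon> powr (1/2) * L2_norm J (\<lambda>x. weak_deriv J u x - weak_deriv J H x)
      + L2_norm J (\<lambda>x. u x - H x) \<le> err" unfolding err by linarith
  have "Linf_norm J (\<lambda>x. u x - H x) \<le> ereal (Csup q * E)"
    by (rule Linf_norm_le_AE[OF _ aeH])
      (intro borel_measurable_diff um continuous_borel_measurable_lebesgue_on l(4)[folded H_def])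
  moreover have "Csup q * E \<le> err" unfolding err using CE0 by linarith
  ultimately have 2: "Linf_norm J (\<lambda>x. u x - H x) \<le> ereal err" by (meson ereal_less_eq(3) order_trans)
  have q1: "1 \<le> q" using Q by simp
  have "depth (\<Phi>0 @ [l]) = 2 + level q p * Suc (9 * 2 ^ level q p)" using len by (simp add: depth_def)
  then have 3: "real (depth (\<Phi>0 @ [l])) \<le> depth_const q * real p * (1 + log 2 (real p))"
    using depth_bound[OF q1 p] by (simp only:)
  have "1 \<le> length (mesh q p \<epsilon>)" using mesh_nonempty[OF q1] by (simp add: Suc_le_eq)
  note sb = size_bound[OF q1 p this mesh_length]
  have "network_size (\<Phi>0 @ [l]) \<le> 67 * length (mesh q p \<epsilon>) * Suc (9 * 2 ^ level q p) * 2 ^ level q p + (9 * length (mesh q p \<epsilon>) * 2 ^ level q p + 1)"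
    using l(2) sz lgs by linarith
  then have "real (network_size (\<Phi>0 @ [l])) \<le> real (67 * length (mesh q p \<epsilon>) * Suc (9 * 2 ^ level q p) * 2 ^ level q p + (9 * length (mesh q p \<epsilon>) * 2 ^ level q p + 1))"
    by (simp only: of_nat_le_iff)
  also note sb
  finally have 4: "real (network_size (\<Phi>0 @ [l])) \<le> size_const q * (real p)\<^sup>2" .
  show ?thesis
    by (intro exI[of _ "\<Phi>0 @ [l]"] conjI l 1[unfolded H_def] 2[unfolded H_def] 3 4) (simp add: \<Phi>0_def)
qed

end

theorem proposition5p2:
  fixes I :: "real set"
  defines "I \<equiv> {-1<..<1}"
  shows
    "\<exists>(Ct :: real \<Rightarrow> real) (hidden :: real \<Rightarrow> nat \<Rightarrow> real \<Rightarrow> real \<Rightarrow> network).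
       (\<forall>\<beta>>0. Ct \<beta> > 0) \<and>
       (\<forall>(b :: real \<Rightarrow> real) (f :: real \<Rightarrow> real).
          real_analytic_on b {-1..1} \<longrightarrow>
          real_analytic_on f {-1..1} \<longrightarrow>
          (\<exists>b0>0. \<forall>x\<in>{-1..1}. b0 \<le> b x) \<longrightarrow>
          (\<exists>Cf>0. \<exists>Kf>0. \<forall>n. Linf_norm I ((deriv ^^ n) f) \<le> ereal (Cf * Kf ^ n * fact n)) \<longrightarrow>
          (\<exists>Cb>0. \<exists>Kb>0. \<forall>n. Linf_norm I ((deriv ^^ n) b) \<le> ereal (Cb * Kb ^ n * fact n)) \<longrightarrow>
          (\<exists>\<kappa>0>0. \<forall>\<kappa>. 0 < \<kappa> \<and> \<kappa> < \<kappa>0 \<longrightarrow>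
             (\<exists>C>0. \<exists>\<beta>>0. \<forall>(p :: nat) (\<epsilon> :: real) u.
                1 \<le> p \<longrightarrow> 0 < \<epsilon> \<longrightarrow> \<epsilon> \<le> 1 \<longrightarrow> weak_solution \<epsilon> b f u \<longrightarrow>
                (\<exists>\<Phi>. neural_network 1 1 \<Phi> \<and>
                   relu_fun \<Phi> \<in> H1_space I \<and>
                   \<epsilon> powr (1/2) * L2_norm I (\<lambda>x. weak_deriv I u x - weak_deriv I (relu_fun \<Phi>) x)
                     + L2_norm I (\<lambda>x. u x - relu_fun \<Phi> x) \<le> C * exp (- \<beta> * real p) \<and>
                   Linf_norm I (\<lambda>x. u x - relu_fun \<Phi> x) \<le> ereal (C * exp (- \<beta> * real p)) \<and>
                   relu_fun \<Phi> (-1) = 0 \<and> relu_fun \<Phi> 1 = 0 \<and>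
                   real (depth \<Phi>) \<le> Ct \<beta> * real p * (1 + log 2 (real p)) \<and>
                   real (network_size \<Phi>) \<le> Ct \<beta> * (real p)\<^sup>2 \<and>
                   butlast \<Phi> = hidden \<kappa> p \<epsilon> \<beta>))))"
proof -
  \<comment> \<open>This inverts \<beta> = 1 / q; at such values the floor is exact.\<close>
  define qq where "qq \<beta> = nat \<lfloor>1 / \<beta>\<rfloor>" for \<beta> :: real
  \<comment> \<open>The constant is fixed before the data are known. The summand 1 and the absolute
    values make it positive for every \<beta>, also for those that are not of the form 1 /
    q.\<close>
  define Ct where "Ct \<beta> = 1 + \<bar>depth_const (qq \<beta>)\<bar> + \<bar>size_const (qq \<beta>)\<bar>" for \<beta>
  let ?good = "\<lambda>C \<beta> p \<epsilon> u. \<exists>\<Phi>. neural_network 1 1 \<Phi> \<and> relu_fun \<Phi> \<in> H1_space J \<and>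
      \<epsilon> powr (1/2) * L2_norm J (\<lambda>x. weak_deriv J u x - weak_deriv J (relu_fun \<Phi>) x)
        + L2_norm J (\<lambda>x. u x - relu_fun \<Phi> x) \<le> C * exp (- \<beta> * real p) \<and>
      Linf_norm J (\<lambda>x. u x - relu_fun \<Phi> x) \<le> ereal (C * exp (- \<beta> * real p)) \<and>
      relu_fun \<Phi> (-1) = 0 \<and> relu_fun \<Phi> 1 = 0 \<and>
      real (depth \<Phi>) \<le> Ct \<beta> * real p * (1 + log 2 (real p)) \<and>
      real (network_size \<Phi>) \<le> Ct \<beta> * (real p)\<^sup>2 \<and> butlast \<Phi> = hidden_net (qq \<beta>) p \<epsilon>"
  show ?thesis
    unfolding I_def
  proof (rule exI[of _ Ct], rule exI[of _ "\<lambda>_ p \<epsilon> \<beta>. hidden_net (qq \<beta>) p \<epsilon>"], intro conjI allI impI)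
    show "0 < Ct \<beta>" if "0 < \<beta>" for \<beta> unfolding Ct_def by linarith
    fix b f
    assume an: "real_analytic_on b {-1..1}" "real_analytic_on f {-1..1}"
      and "\<exists>b0>0. \<forall>x\<in>{-1..1}. b0 \<le> b x"
      and "\<exists>Cf>0. \<exists>Kf>0. \<forall>n. Linf_norm J ((deriv ^^ n) f) \<le> ereal (Cf * Kf ^ n * fact n)"
      and "\<exists>Cb>0. \<exists>Kb>0. \<forall>n. Linf_norm J ((deriv ^^ n) b) \<le> ereal (Cb * Kb ^ n * fact n)"
    then obtain b0 Cf Kf Cb Kb where c: "0 < b0" "\<And>x. x \<in> {-1..1} \<Longrightarrow> b0 \<le> b x" "0 < Cf" "0 < Kf" "0 < Cb" "0 < Kb"
      and bds: "\<And>n. Linf_norm J ((deriv ^^ n) f) \<le> ereal (Cf * Kf ^ n * fact n)"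
        "\<And>n. Linf_norm J ((deriv ^^ n) b) \<le> ereal (Cb * Kb ^ n * fact n)"
      by auto
    note db = deriv_bound_of_analytic[OF an(2) c(3,4) bds(1)] deriv_bound_of_analytic[OF an(1) c(5,6) bds(2)]
    \<comment> \<open>Common constants for both coefficients; 1 is added to meet the lower bounds
      that the locale demands.\<close>
    interpret reaction_diffusion b f b0 "1 + Cf + Cb" "1 + Kf + Kb"
    proof
      show "deriv_bound b (1 + Cf + Cb) (1 + Kf + Kb) 0" by (rule deriv_bound_mono[OF db(2)]) (use c in auto)
      show "deriv_bound f (1 + Cf + Cb) (1 + Kf + Kb) 0" by (rule deriv_bound_mono[OF db(1)]) (use c in auto)
    qed (use c in auto)
    obtain q where q: "admissible q" using admissible_exists by blast
    then have q2: "2 \<le> q" by (simp add: admissible_def)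
    have qq: "qq (1 / real q) = q" by (simp add: qq_def)
    have Cpos: "0 < sqrt (Cen q) + 2 * Csup q"
      using T_pos(3,4)[of q] by (intro add_pos_pos) auto
    have good: "?good (sqrt (Cen q) + 2 * Csup q) (1 / real q) p \<epsilon> u"
      if p: "1 \<le> p" and e: "0 < \<epsilon>" "\<epsilon> \<le> 1" and ws: "weak_solution \<epsilon> b f u" for p \<epsilon> u
    proof -
      have D: "depth_const q * real p * (1 + log 2 (real p)) \<le> Ct (1 / real q) * real p * (1 + log 2 (real p))"
        unfolding Ct_def qq using p by (intro mult_right_mono) auto
      have S: "size_const q * (real p)\<^sup>2 \<le> Ct (1 / real q) * (real p)\<^sup>2"
        unfolding Ct_def qq by (intro mult_right_mono) auto
      from network_approximation[OF q p e ws] show ?thesis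
        unfolding qq by (elim exE conjE, intro exI conjI) (assumption | erule order_trans[OF _ D] order_trans[OF _ S])+
    qed
    show "\<exists>\<kappa>0>0. \<forall>\<kappa>::real. 0 < \<kappa> \<and> \<kappa> < \<kappa>0 \<longrightarrow> (\<exists>C>0. \<exists>\<beta>>0. \<forall>(p :: nat) (\<epsilon> :: real) u.
        1 \<le> p \<longrightarrow> 0 < \<epsilon> \<longrightarrow> \<epsilon> \<le> 1 \<longrightarrow> weak_solution \<epsilon> b f u \<longrightarrow> ?good C \<beta> p \<epsilon> u)"
    proof (rule exI[where x = "1::real"], rule conjI, simp, rule allI, rule impI,
        rule exI[where x = "sqrt (Cen q) + 2 * Csup q"], rule conjI, rule Cpos,
        rule exI[where x = "1 / real q"], rule conjI)
      show "0 < 1 / real q" using q2 by simp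
      show "\<forall>p \<epsilon> u. 1 \<le> p \<longrightarrow> 0 < \<epsilon> \<longrightarrow> \<epsilon> \<le> 1 \<longrightarrow> weak_solution \<epsilon> b f u \<longrightarrow> ?good (sqrt (Cen q) + 2 * Csup q) (1 / real q) p \<epsilon> u"
        by (intro allI impI) (rule good)
    qed
  qed
qed

end
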